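(* Let $n\ge 1$, $0<s<1$, $1<p<\infty$, and let $\beta\in\mathbb{R}$ satisfy $\beta>-s$ and $\delta:=p(s+\beta)<n$. Let $\{\psi_{k,\lambda}\}_{k\in\mathbb{N},\lambda\in\Lambda_k}$ be a wavelet basis on $\mathbb{T}^n$ as described in the context, and assume that it satisfies the following separation property for some fixed constant $C>0$: (S) for every pair of distinct points $x,x'\in\mathbb{T}^n$ there are $k\in\mathbb{N}$ and $\lambda\in\Lambda_k$ such that $$C^{-1}2^{-k}\leq d(x,x')\leq C2^{-k},\qquad |\psi_{k,\lambda}(x)|\geq C^{-1},\qquad \psi_{k,\lambda}(x')=0 .$$ Consider the random series $$f=\sum_{k\in\mathbb{N}}\sum_{\lambda\in\Lambda_k}c_{k,\lambda}\psi_{k,\lambda},\qquad c_{k,\lambda}=W_{k,\lambda}\bigl(2^{-ks}(1-B_{k,\lambda})+2^{k\beta}B_{k,\lambda}\bigr),$$ where the $W_{k,\lambda}$ are independent identically distributed Gaussian random variables with mean zero and variance $1$, the $B_{k,\lambda}$ are independent Bernoulli random variables taking the value $1$ with probability $2^{-\delta k}$ and the value $0$ with probability $1-2^{-\delta k}$, and the families $\{W_{k,\lambda}\}$ and $\{B_{k,\lambda}\}$ are independent of each other. Let $\mathbb{P}$ be the law of $f$, regarded as a probability measure on $L^1(\mathbb{T}^n)$. Then: (i) for $\mathbb{P}$-a.e. $f$ there is a set $Y(f)\subset\mathbb{R}$ of positive Lebesgue measure such that $$\dim_H\bigl(Z(f)\cap\{f=y\}\bigr)=n-s\qquad\text{for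 every } y\in Y(f);$$ (ii) for a.e. $y\in\mathbb{R}$ there is a set $F(y)\subset L^1(\mathbb{T}^n)$ with $\mathbb{P}(F(y))>0$ such that $$\dim_H\bigl(Z(f)\cap\{f=y\}\bigr)=n-s\qquad\text{for every } f\in F(y).$$
   Context: $\mathbb{T}^n=\mathbb{R}^n/\mathbb{Z}^n$ is the periodic torus with distance $d$ induced by the Euclidean one, $\mathbb{N}=\{0,1,2,\dots\}$, and $\dim_H$ is the Hausdorff dimension. For $f\in L^1(\mathbb{T}^n)$, $Z(f)$ is the set of Lebesgue points of $f$, i.e. of points $x$ for which there is a real number $\bar f(x)$ with $\lim_{r\downarrow0}r^{-n}\int_{B_r(x)}|f(y)-\bar f(x)|\,dy=0$. The level set $\{f=y\}$ is the set of points $x$ such that $\liminf_{r\downarrow 0}\frac{1}{|B_r(x)|}\int_{B_r(x)}f\leq y\leq\limsup_{r\downarrow 0}\frac{1}{|B_r(x)|}\int_{B_r(x)}f$; in particular $Z(f)\cap\{f=y\}=\{x\in Z(f):\bar f(x)=y\}$. Wavelet basis: $\{\psi_{k,\lambda}\}$ is an orthogonal, $L^\infty$-normalized basis of the space of mean-zero elements of $L^2(\mathbb{T}^n)$, where $k\in\mathbb{N}$ is the scale and $\Lambda_k$ indexes the wavelets of scale $k$. It is constructed as the standard periodization of a basis of compactly supported wavelets on $\mathbb{R}^n$ whose mother wavelets are $C^1$. That is, there is a finite family of compactly supported $C^1$ functions $\Psi^e:\mathbb{R}^n\to\mathbb{R}$ (the mother wavelets; $2^n-1$ of them) such that $\{2^{kn/2}\Psi^e(2^kx-m)\}_{e,\,k\in\mathbb{Z},\,m\in\mathbb{Z}^n}$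 is an orthonormal basis of $L^2(\mathbb{R}^n)$; $\Lambda_k$ is the set of pairs $\lambda=(e,m)$ with $m\in\{0,\dots,2^k-1\}^n$; and $\psi_{k,\lambda}(x)=\sum_{\ell\in\mathbb{Z}^n}\Psi^e(2^k(x-\ell)-m)$. For every choice of the parameters as in the claim the series belongs to $L^1(\mathbb{T}^n)$ almost surely, so that $\mathbb{P}$ is well defined. *)

theory Defs
  imports "HOL-Probability.Probability"
begin

section \<open>Hausdorff dimension\<close>

text \<open>The separate value at \<^term>\<open>t = 0\<close> makes the case \<^term>\<open>t = 0\<close> the counting measure
  (in Isabelle/HOL, \<^term>\<open>0 powr 0 = (0::real)\<close>).  Covering sets are required to be bounded
  because \<^const>\<open>diameter\<close> is a junk value on unbounded sets.\<close>

definition hausdorff_gauge :: "real \<Rightarrow> 'a::metric_space set \<Rightarrow> ennreal" where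
  "hausdorff_gauge t U =
     (if U = {} then 0 else if t = 0 then 1 else ennreal (diameter U powr t))"

definition hausdorff_content :: "real \<Rightarrow> real \<Rightarrow> 'a::metric_space set \<Rightarrow> ennreal" where
  "hausdorff_content t \<epsilon> A =
     (INF U \<in> {U :: nat \<Rightarrow> 'a set. A \<subseteq> (\<Union>i. U i) \<and> (\<forall>i. bounded (U i) \<and> diameter (U i) \<le> \<epsilon>)}.
        \<Sum>i. hausdorff_gauge t (U i))"

definition hausdorff_measure :: "real \<Rightarrow> 'a::metric_space set \<Rightarrow> ennreal" where
  "hausdorff_measure t A = (SUP \<epsilon> \<in> {0<..}. hausdorff_content t \<epsilon> A)"

definition hausdorff_dim :: "'a::metric_space set \<Rightarrow> ereal" where
  "hausdorff_dim A = (INF t \<in> {t. 0 \<le> t \<and> hausdorff_measure t A = 0}. ereal t)"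


section \<open>The flat torus\<close>

definition int_vec :: "int ^ 'n \<Rightarrow> real ^ 'n" where
  "int_vec l = (\<chi> i. of_int (l $ i))"

lemma int_vec_simps [simp]:
  "int_vec 0 = 0" "int_vec (a + b) = int_vec a + int_vec b"
  "int_vec (- a) = - int_vec a" "int_vec (a - b) = int_vec a - int_vec b"
  by (simp_all add: int_vec_def vec_eq_iff)

lemma norm_int_vec_ge_1:
  assumes "a \<noteq> (0 :: int ^ 'n::finite)"
  shows "norm (int_vec a) \<ge> 1"
proof -
  from assms obtain i where i: "a $ i \<noteq> 0" by (auto simp: vec_eq_iff)
  have "1 \<le> \<bar>of_int (a $ i) :: real\<bar>" using i by linarith
  also have "\<dots> = norm (int_vec a $ i)" by (simp add: int_vec_def)
  also have "\<dots> \<le> norm (int_vec a)" by (rule Finite_Cartesian_Product.norm_nth_le)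
  finally show ?thesis .
qed

definition torus_rel :: "real ^ 'n \<Rightarrow> real ^ 'n \<Rightarrow> bool" where
  "torus_rel x y \<longleftrightarrow> (\<exists>l. x = y + int_vec l)"

lemma equivp_torus_rel: "equivp (torus_rel :: real ^ 'n::finite \<Rightarrow> _)"
proof (rule equivpI)
  show "reflp (torus_rel :: real ^ 'n::finite \<Rightarrow> _)"
    by (auto simp: reflp_def torus_rel_def intro!: exI[of _ 0])
  show "symp (torus_rel :: real ^ 'n::finite \<Rightarrow> _)"
  proof (rule sympI)
    fix x y :: "real ^ 'n" assume "torus_rel x y"
    then obtain l where "x = y + int_vec l" by (auto simp: torus_rel_def)
    then have "y = x + int_vec (- l)" by simp
    then show "torus_rel y x" unfolding torus_rel_def by blast
  qed
  show "transp (torus_rel :: real ^ 'n::finite \<Rightarrow> _)"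
  proof (rule transpI)
    fix x y z :: "real ^ 'n" assume "torus_rel x y" "torus_rel y z"
    then obtain l m where "x = y + int_vec l" "y = z + int_vec m" by (auto simp: torus_rel_def)
    then have "x = z + int_vec (m + l)" by simp
    then show "torus_rel x z" unfolding torus_rel_def by blast
  qed
qed

quotient_type 'n torus = "real ^ 'n::finite" / torus_rel
  morphisms rep_torus to_torus
  by (rule equivp_torus_rel)

definition lattice_dist :: "real ^ 'n::finite \<Rightarrow> real ^ 'n \<Rightarrow> real" where
  "lattice_dist x y = (INF l. norm (x - y - int_vec l))"

lemma lattice_dist_bdd: "bdd_below (range (\<lambda>l. norm (x - int_vec l)))"
  by (rule bdd_belowI[of _ 0]) auto

lemma lattice_dist_le: "lattice_dist x y \<le> norm (x - y - int_vec l)"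
  unfolding lattice_dist_def by (rule cINF_lower[OF lattice_dist_bdd]) simp

lemma lattice_dist_ge: "(\<And>l. c \<le> norm (x - y - int_vec l)) \<Longrightarrow> c \<le> lattice_dist x y"
  unfolding lattice_dist_def by (rule cINF_greatest) auto

lemma lattice_dist_less:
  assumes "lattice_dist x y < c"
  obtains l where "norm (x - y - int_vec l) < c"
  using assms lattice_dist_ge[of c x y] by (meson not_le)

lemma lattice_dist_nonneg: "0 \<le> lattice_dist x y"
  by (rule lattice_dist_ge) simp

lemma lattice_dist_shift: "lattice_dist (x + int_vec a) (y + int_vec b) \<le> lattice_dist x y"
proof (rule lattice_dist_ge)
  fix l
  show "lattice_dist (x + int_vec a) (y + int_vec b) \<le> norm (x - y - int_vec l)"
    using lattice_dist_le[of "x + int_vec a" "y + int_vec b" "l + a - b"]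
    by (simp add: algebra_simps)
qed

lemma lattice_dist_shift_eq: "lattice_dist (x + int_vec a) (y + int_vec b) = lattice_dist x y"
  using lattice_dist_shift[of x a y b]
    lattice_dist_shift[of "x + int_vec a" "- a" "y + int_vec b" "- b"] by simp

lemma lattice_dist_commute: "lattice_dist x y = lattice_dist y x"
proof -
  have "lattice_dist x y \<le> lattice_dist y x" for x y :: "real ^ 'b::finite"
  proof (rule lattice_dist_ge)
    fix l
    have "x - y - int_vec (- l) = - (y - x - int_vec l)" by simp
    then have "norm (x - y - int_vec (- l)) = norm (y - x - int_vec l)"
      by (metis norm_minus_cancel)
    then show "lattice_dist x y \<le> norm (y - x - int_vec l)"
      using lattice_dist_le[of x y "- l"] by simp
  qed
  from this[of x y] this[of y x] show ?thesis by simp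
qed

lemma lattice_dist_triangle: "lattice_dist x z \<le> lattice_dist x y + lattice_dist y z"
proof (rule field_le_epsilon)
  fix e :: real assume "0 < e"
  obtain l where l: "norm (x - y - int_vec l) < lattice_dist x y + e / 2"
    using lattice_dist_less[of x y "lattice_dist x y + e / 2"] \<open>0 < e\<close> by auto
  obtain m where m: "norm (y - z - int_vec m) < lattice_dist y z + e / 2"
    using lattice_dist_less[of y z "lattice_dist y z + e / 2"] \<open>0 < e\<close> by auto
  have "lattice_dist x z \<le> norm ((x - y - int_vec l) + (y - z - int_vec m))"
    using lattice_dist_le[of x z "l + m"] by (simp add: algebra_simps)
  also have "\<dots> \<le> norm (x - y - int_vec l) + norm (y - z - int_vec m)"
    by (rule norm_triangle_ineq)
  finally show "lattice_dist x z \<le> lattice_dist x y + lattice_dist y z + e" using l m by simp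
qed

lemma lattice_dist_eq_0: "lattice_dist x y = 0 \<longleftrightarrow> torus_rel x y"
proof
  assume "torus_rel x y"
  then obtain l where "x = y + int_vec l" by (auto simp: torus_rel_def)
  then have "lattice_dist x y \<le> 0" using lattice_dist_le[of x y l] by simp
  then show "lattice_dist x y = 0" using lattice_dist_nonneg[of x y] by simp
next
  assume 0: "lattice_dist x y = 0"
  obtain l where l: "norm (x - y - int_vec l) < 1 / 2"
    using lattice_dist_less[of x y "1/2"] 0 by auto
  show "torus_rel x y"
  proof (rule ccontr)
    assume "\<not> torus_rel x y"
    then have "x - y - int_vec l \<noteq> 0" unfolding torus_rel_def by (metis add.commute diff_add_cancel diff_0 diff_eq_eq add_0)
    then have "0 < min (1/2) (norm (x - y - int_vec l))" by simp
    then obtain m where m: "norm (x - y - int_vec m) < min (1/2) (norm (x - y - int_vec l))"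
      using lattice_dist_less[of x y] 0 by metis
    then have "l - m \<noteq> 0" by auto
    then have "1 \<le> norm (int_vec (l - m))" by (rule norm_int_vec_ge_1)
    also have "int_vec (l - m) = (x - y - int_vec m) - (x - y - int_vec l)" by simp
    also have "norm \<dots> \<le> norm (x - y - int_vec m) + norm (x - y - int_vec l)"
      by (rule norm_triangle_ineq4)
    finally show False using l m by simp
  qed
qed

instantiation torus :: (finite) metric_space
begin

lift_definition dist_torus :: "'a torus \<Rightarrow> 'a torus \<Rightarrow> real" is lattice_dist
  by (auto simp: torus_rel_def lattice_dist_shift_eq)

definition uniformity_torus :: "('a torus \<times> 'a torus) filter" where
  "uniformity_torus = (INF e\<in>{0 <..}. principal {(x, y). dist x y < e})"

definition open_torus :: "'a torus set \<Rightarrow> bool" where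
  "open_torus U \<longleftrightarrow> (\<forall>x\<in>U. eventually (\<lambda>(x', y). x' = x \<longrightarrow> y \<in> U) uniformity)"

instance
proof
  fix x y z :: "'a torus"
  show "dist x y = 0 \<longleftrightarrow> x = y"
    by transfer (rule lattice_dist_eq_0)
  show "dist x y \<le> dist x z + dist y z"
    by transfer (metis lattice_dist_triangle lattice_dist_commute)
qed (auto simp: uniformity_torus_def open_torus_def)

end

definition unit_cube :: "(real ^ 'n) set" where
  "unit_cube = {x. \<forall>i. 0 \<le> x $ i \<and> x $ i < 1}"

definition torus_measure :: "'n::finite torus measure" where
  "torus_measure = distr (restrict_space lborel unit_cube) borel to_torus"

lemma sets_torus_measure [measurable_cong, simp]: "sets torus_measure = sets borel"
  by (simp add: torus_measure_def)

lemma dist_to_torus_le: "dist (to_torus x) (to_torus y) \<le> dist x y"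
  using lattice_dist_le[of x y 0] by (simp add: dist_torus.abs_eq dist_norm)

lemma borel_measurable_to_torus [measurable]: "to_torus \<in> borel_measurable borel"
proof (rule borel_measurable_continuous_onI)
  show "continuous_on UNIV (to_torus :: real ^ 'n::finite \<Rightarrow> _)"
    unfolding continuous_on_iff by (meson dist_to_torus_le le_less_trans)
qed

lemma unit_cube_borel [measurable]: "unit_cube \<in> sets (borel :: (real ^ 'n::finite) measure)"
  unfolding unit_cube_def by measurable

lemma emeasure_unit_cube: "emeasure lborel (unit_cube :: (real ^ 'n::finite) set) = 1"
proof -
  have box: "emeasure lborel (box 0 (1 :: real ^ 'n)) = 1"
    by (subst emeasure_lborel_box)
       (auto simp: Basis_vec_def inner_axis prod_eq_1_iff intro!: prod.neutral)
  have cbox: "emeasure lborel (cbox 0 (1 :: real ^ 'n)) = 1"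
    by (subst emeasure_lborel_cbox)
       (auto simp: Basis_vec_def inner_axis prod_eq_1_iff intro!: prod.neutral)
  have "box 0 (1 :: real ^ 'n) \<subseteq> unit_cube" "unit_cube \<subseteq> cbox 0 (1 :: real ^ 'n)"
    by (auto simp: unit_cube_def mem_box_cart less_imp_le)
  then have "emeasure lborel (box 0 (1 :: real ^ 'n)) \<le> emeasure lborel (unit_cube :: (real ^ 'n) set)"
    "emeasure lborel (unit_cube :: (real ^ 'n) set) \<le> emeasure lborel (cbox 0 (1 :: real ^ 'n))"
    by (auto intro!: emeasure_mono)
  then show ?thesis using box cbox by (simp add: antisym)
qed

lemma prob_space_torus_measure: "prob_space torus_measure"
  unfolding torus_measure_def
proof (rule prob_space.prob_space_distr)
  show "prob_space (restrict_space lborel (unit_cube :: (real ^ 'n::finite) set))"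
    by (rule prob_spaceI) (simp add: emeasure_restrict_space space_restrict_space emeasure_unit_cube)
  show "to_torus \<in> borel_measurable (restrict_space lborel unit_cube)"
    by (rule measurable_restrict_space1) simp
qed


section \<open>The space of integrable functions on the torus, modulo equality almost everywhere\<close>

definition l1_rel :: "('n::finite torus \<Rightarrow> real) \<Rightarrow> ('n torus \<Rightarrow> real) \<Rightarrow> bool" where
  "l1_rel f g \<longleftrightarrow> integrable torus_measure f \<and> integrable torus_measure g
     \<and> (AE x in torus_measure. f x = g x)"

lemma part_equivp_l1_rel: "part_equivp (l1_rel :: ('n::finite torus \<Rightarrow> real) \<Rightarrow> _)"
proof (rule part_equivpI)
  show "\<exists>f :: 'n torus \<Rightarrow> real. l1_rel f f"
    by (rule exI[of _ "\<lambda>_. 0"]) (simp add: l1_rel_def)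
  show "symp (l1_rel :: ('n torus \<Rightarrow> real) \<Rightarrow> _)"
    by (rule sympI) (auto simp: l1_rel_def)
  show "transp (l1_rel :: ('n torus \<Rightarrow> real) \<Rightarrow> _)"
    by (rule transpI) (auto simp: l1_rel_def)
qed

quotient_type 'n l1 = "'n::finite torus \<Rightarrow> real" / partial: l1_rel
  morphisms rep_l1 to_l1
  by (rule part_equivp_l1_rel)

instantiation l1 :: (finite) real_normed_vector
begin

lift_definition zero_l1 :: "'a l1" is "\<lambda>_. 0"
  by (simp add: l1_rel_def)

lift_definition plus_l1 :: "'a l1 \<Rightarrow> 'a l1 \<Rightarrow> 'a l1" is "\<lambda>f g x. f x + g x"
  by (auto simp: l1_rel_def)

lift_definition minus_l1 :: "'a l1 \<Rightarrow> 'a l1 \<Rightarrow> 'a l1" is "\<lambda>f g x. f x - g x"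
  by (auto simp: l1_rel_def)

lift_definition uminus_l1 :: "'a l1 \<Rightarrow> 'a l1" is "\<lambda>f x. - f x"
  by (auto simp: l1_rel_def)

lift_definition scaleR_l1 :: "real \<Rightarrow> 'a l1 \<Rightarrow> 'a l1" is "\<lambda>c f x. c * f x"
  by (auto simp: l1_rel_def)

lift_definition norm_l1 :: "'a l1 \<Rightarrow> real" is "\<lambda>f. LINT x|torus_measure. \<bar>f x\<bar>"
  unfolding l1_rel_def by (rule integral_cong_AE) auto

definition dist_l1 :: "'a l1 \<Rightarrow> 'a l1 \<Rightarrow> real" where
  "dist_l1 f g = norm (f - g)"

definition sgn_l1 :: "'a l1 \<Rightarrow> 'a l1" where
  "sgn_l1 f = inverse (norm f) *\<^sub>R f"

definition uniformity_l1 :: "('a l1 \<times> 'a l1) filter" where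
  "uniformity_l1 = (INF e\<in>{0 <..}. principal {(x, y). dist x y < e})"

definition open_l1 :: "'a l1 set \<Rightarrow> bool" where
  "open_l1 U \<longleftrightarrow> (\<forall>x\<in>U. eventually (\<lambda>(x', y). x' = x \<longrightarrow> y \<in> U) uniformity)"

instance
proof
  fix f g h :: "'a l1" and a b :: real
  show "f + g + h = f + (g + h)"
    by transfer (auto simp: l1_rel_def algebra_simps)
  show "f + g = g + f"
    by transfer (auto simp: l1_rel_def algebra_simps)
  show "0 + f = f"
    by transfer (auto simp: l1_rel_def)
  show "- f + f = 0"
    by transfer (auto simp: l1_rel_def)
  show "f - g = f + - g"
    by transfer (auto simp: l1_rel_def)
  show "a *\<^sub>R (f + g) = a *\<^sub>R f + a *\<^sub>R g"
    by transfer (auto simp: l1_rel_def algebra_simps)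
  show "(a + b) *\<^sub>R f = a *\<^sub>R f + b *\<^sub>R f"
    by transfer (auto simp: l1_rel_def algebra_simps)
  show "a *\<^sub>R b *\<^sub>R f = (a * b) *\<^sub>R f"
    by transfer (auto simp: l1_rel_def algebra_simps)
  show "1 *\<^sub>R f = f"
    by transfer (auto simp: l1_rel_def)
  show "norm f = 0 \<longleftrightarrow> f = 0"
    by transfer (auto simp: l1_rel_def integral_nonneg_eq_0_iff_AE)
  show "norm (f + g) \<le> norm f + norm g"
  proof transfer
    fix f g :: "'a torus \<Rightarrow> real"
    assume "l1_rel f f" "l1_rel g g"
    then have [simp]: "integrable torus_measure f" "integrable torus_measure g"
      by (auto simp: l1_rel_def)
    have "(LINT x|torus_measure. \<bar>f x + g x\<bar>) \<le> (LINT x|torus_measure. \<bar>f x\<bar> + \<bar>g x\<bar>)"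
      by (rule integral_mono) auto
    then show "(LINT x|torus_measure. \<bar>f x + g x\<bar>)
        \<le> (LINT x|torus_measure. \<bar>f x\<bar>) + (LINT x|torus_measure. \<bar>g x\<bar>)"
      by simp
  qed
  show "norm (a *\<^sub>R f) = \<bar>a\<bar> * norm f"
    by transfer (simp add: abs_mult)
qed (auto simp: dist_l1_def sgn_l1_def uniformity_l1_def open_l1_def)

end

definition ball_average :: "('n::finite torus \<Rightarrow> real) \<Rightarrow> 'n torus \<Rightarrow> real \<Rightarrow> real" where
  "ball_average f x r = (LINT z:ball x r|torus_measure. f z) / measure torus_measure (ball x r)"

lemma set_integral_cong_l1_rel:
  assumes "l1_rel f g"
  shows "(LINT z:ball x r|torus_measure. \<bar>f z - a\<bar>) = (LINT z:ball x r|torus_measure. \<bar>g z - a\<bar>)"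
    and "(LINT z:ball x r|torus_measure. f z) = (LINT z:ball x r|torus_measure. g z)"
proof -
  have [measurable]: "f \<in> borel_measurable torus_measure" "g \<in> borel_measurable torus_measure"
    using assms by (auto simp: l1_rel_def)
  have [measurable]: "ball x r \<in> sets torus_measure" by simp
  have ae: "AE x in torus_measure. f x = g x" using assms by (simp add: l1_rel_def)
  show "(LINT z:ball x r|torus_measure. \<bar>f z - a\<bar>) = (LINT z:ball x r|torus_measure. \<bar>g z - a\<bar>)"
    unfolding set_lebesgue_integral_def using ae by (intro integral_cong_AE) auto
  show "(LINT z:ball x r|torus_measure. f z) = (LINT z:ball x r|torus_measure. g z)"
    unfolding set_lebesgue_integral_def using ae by (intro integral_cong_AE) auto
qed

lift_definition lebesgue_points :: "'n::finite l1 \<Rightarrow> 'n torus set" is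
  "\<lambda>f. {x. \<exists>a. ((\<lambda>r. (LINT z:ball x r|torus_measure. \<bar>f z - a\<bar>) / r ^ CARD('n)) \<longlongrightarrow> 0) (at_right 0)}"
  by (simp add: set_integral_cong_l1_rel(1))

lift_definition level_set :: "'n::finite l1 \<Rightarrow> real \<Rightarrow> 'n torus set" is
  "\<lambda>f y. {x. Liminf (at_right 0) (\<lambda>r. ereal (ball_average f x r)) \<le> ereal y
           \<and> ereal y \<le> Limsup (at_right 0) (\<lambda>r. ereal (ball_average f x r))}"
  by (simp add: ball_average_def set_integral_cong_l1_rel(2))


section \<open>Wavelet bases\<close>

definition L2_functions :: "'a measure \<Rightarrow> ('a \<Rightarrow> real) set" where
  "L2_functions M = {f \<in> borel_measurable M. integrable M (\<lambda>x. (f x)\<^sup>2)}"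

text \<open>\<^term>\<open>V\<close> is a space of square integrable functions.  The last clause says that the linear
  span of the family is dense in \<^term>\<open>V\<close> for the \<open>L\<^sup>2\<close> norm.\<close>

definition orthogonal_basis_L2 ::
  "'a measure \<Rightarrow> ('a \<Rightarrow> real) set \<Rightarrow> 'i set \<Rightarrow> ('i \<Rightarrow> 'a \<Rightarrow> real) \<Rightarrow> bool" where
  "orthogonal_basis_L2 M V I \<phi> \<longleftrightarrow>
     (\<forall>i\<in>I. \<phi> i \<in> V \<and> (LINT x|M. (\<phi> i x)\<^sup>2) \<noteq> 0)
   \<and> (\<forall>i\<in>I. \<forall>j\<in>I. i \<noteq> j \<longrightarrow> (LINT x|M. \<phi> i x * \<phi> j x) = 0)
   \<and> (\<forall>f\<in>V. \<forall>\<epsilon>>0. \<exists>J a. finite J \<and> J \<subseteq> I \<and> (LINT x|M. (f x - (\<Sum>i\<in>J. a i * \<phi> i x))\<^sup>2) < \<epsilon>)"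

definition orthonormal_basis_L2 ::
  "'a measure \<Rightarrow> ('a \<Rightarrow> real) set \<Rightarrow> 'i set \<Rightarrow> ('i \<Rightarrow> 'a \<Rightarrow> real) \<Rightarrow> bool" where
  "orthonormal_basis_L2 M V I \<phi> \<longleftrightarrow>
     orthogonal_basis_L2 M V I \<phi> \<and> (\<forall>i\<in>I. (LINT x|M. (\<phi> i x)\<^sup>2) = 1)"

definition C1_function :: "('a::real_normed_vector \<Rightarrow> real) \<Rightarrow> bool" where
  "C1_function f \<longleftrightarrow>
     (\<exists>f' :: 'a \<Rightarrow> 'a \<Rightarrow>\<^sub>L real. (\<forall>x. (f has_derivative blinfun_apply (f' x)) (at x))
        \<and> continuous_on UNIV f')"

definition euclidean_wavelet ::
  "(nat \<Rightarrow> real ^ 'n \<Rightarrow> real) \<Rightarrow> nat \<times> int \<times> (int ^ 'n) \<Rightarrow> real ^ 'n \<Rightarrow> real" where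
  "euclidean_wavelet \<Psi> = (\<lambda>(e, k, m) x.
     2 powr (of_int k * real CARD('n) / 2) * \<Psi> e ((2 powr of_int k) *\<^sub>R x - int_vec m))"

text \<open>The mother wavelets are indexed by the \<open>2\<^sup>n - 1\<close> numbers
  \<^term>\<open>e < 2 ^ CARD('n) - (1::nat)\<close>; values of \<^term>\<open>\<Psi>\<close> at other indices play no role.\<close>

definition mother_wavelets :: "(nat \<Rightarrow> real ^ 'n::finite \<Rightarrow> real) \<Rightarrow> bool" where
  "mother_wavelets \<Psi> \<longleftrightarrow>
     (\<forall>e < 2 ^ CARD('n) - 1. C1_function (\<Psi> e) \<and> compact (closure {x. \<Psi> e x \<noteq> 0}))
   \<and> orthonormal_basis_L2 lborel (L2_functions lborel)
       ({..<2 ^ CARD('n) - 1} \<times> UNIV \<times> UNIV) (euclidean_wavelet \<Psi>)"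

definition wavelet_index :: "nat \<Rightarrow> (nat \<times> (int ^ 'n)) set" where
  "wavelet_index k = {..<2 ^ CARD('n) - 1} \<times> {m. \<forall>i. 0 \<le> m $ i \<and> m $ i < 2 ^ k}"

text \<open>For compactly supported mother wavelets only finitely many terms of the sum over the
  lattice are nonzero.\<close>

lift_definition wavelet ::
  "(nat \<Rightarrow> real ^ 'n::finite \<Rightarrow> real) \<Rightarrow> nat \<Rightarrow> nat \<times> (int ^ 'n) \<Rightarrow> 'n torus \<Rightarrow> real" is
  "\<lambda>\<Psi> k (e, m) x. \<Sum>\<^sub>\<infinity>l. \<Psi> e ((2 ^ k) *\<^sub>R (x - int_vec l) - int_vec m)"
proof -
  fix \<Psi> :: "nat \<Rightarrow> real ^ 'n \<Rightarrow> real" and k and p :: "nat \<times> (int ^ 'n)" and x y :: "real ^ 'n"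
  assume "torus_rel x y"
  then obtain a where a: "x = y + int_vec a" by (auto simp: torus_rel_def)
  obtain e m where p: "p = (e, m)" by (cases p)
  have "bij_betw (\<lambda>l. l - a) UNIV UNIV"
    by (rule bij_betwI[of _ _ _ "\<lambda>l. l + a"]) auto
  then have "(\<Sum>\<^sub>\<infinity>l. \<Psi> e ((2 ^ k) *\<^sub>R (y - int_vec (l - a)) - int_vec m))
      = (\<Sum>\<^sub>\<infinity>l. \<Psi> e ((2 ^ k) *\<^sub>R (y - int_vec l) - int_vec m))"
    by (rule infsum_reindex_bij_betw)
  then show "(case p of (e, m) \<Rightarrow> \<lambda>x. \<Sum>\<^sub>\<infinity>l. \<Psi> e ((2 ^ k) *\<^sub>R (x - int_vec l) - int_vec m)) x
      = (case p of (e, m) \<Rightarrow> \<lambda>x. \<Sum>\<^sub>\<infinity>l. \<Psi> e ((2 ^ k) *\<^sub>R (x - int_vec l) - int_vec m)) y"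
    by (simp add: p a algebra_simps)
qed

text \<open>The formula for \<^const>\<open>wavelet\<close> carries no factor depending on the scale; this is the
  \<open>L\<^sup>\<infinity>\<close> normalization, in the sense of upper and lower bounds for the sup norm that do not
  depend on the scale (the sup norm need not be exactly 1).\<close>

definition wavelet_basis :: "(nat \<Rightarrow> real ^ 'n::finite \<Rightarrow> real) \<Rightarrow> bool" where
  "wavelet_basis \<Psi> \<longleftrightarrow>
     mother_wavelets \<Psi>
   \<and> orthogonal_basis_L2 torus_measure
       {f \<in> L2_functions torus_measure. (LINT x|torus_measure. f x) = 0}
       (SIGMA k:UNIV. wavelet_index k) (\<lambda>(k, j). wavelet \<Psi> k j)"

definition separation_property :: "(nat \<Rightarrow> real ^ 'n::finite \<Rightarrow> real) \<Rightarrow> real \<Rightarrow> bool" where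
  "separation_property \<Psi> C \<longleftrightarrow>
     (\<forall>x x'. x \<noteq> x' \<longrightarrow>
       (\<exists>k. \<exists>j \<in> wavelet_index k.
          inverse C / 2 ^ k \<le> dist x x' \<and> dist x x' \<le> C / 2 ^ k
        \<and> inverse C \<le> \<bar>wavelet \<Psi> k j x\<bar> \<and> wavelet \<Psi> k j x' = 0))"


section \<open>The random wavelet series\<close>

definition random_weights ::
  "'w measure \<Rightarrow> real \<Rightarrow> (nat \<times> nat \<times> (int ^ 'n) \<Rightarrow> 'w \<Rightarrow> real)
     \<Rightarrow> (nat \<times> nat \<times> (int ^ 'n) \<Rightarrow> 'w \<Rightarrow> real) \<Rightarrow> bool" where
  "random_weights M \<delta> W B \<longleftrightarrow>
     (let I = (SIGMA k:UNIV. wavelet_index k) in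
       prob_space M
     \<and> prob_space.indep_vars M (\<lambda>_. borel) W I
     \<and> (\<forall>i\<in>I. distributed M lborel (W i) (\<lambda>x. ennreal (std_normal_density x)))
     \<and> prob_space.indep_vars M (\<lambda>_. borel) B I
     \<and> (\<forall>(k, j)\<in>I. measure M {\<omega> \<in> space M. B (k, j) \<omega> = 1} = 2 powr (- \<delta> * real k)
                   \<and> measure M {\<omega> \<in> space M. B (k, j) \<omega> = 0} = 1 - 2 powr (- \<delta> * real k))
     \<and> prob_space.indep_var M (Pi\<^sub>M I (\<lambda>_. borel)) (\<lambda>\<omega>. \<lambda>i\<in>I. W i \<omega>)
                              (Pi\<^sub>M I (\<lambda>_. borel)) (\<lambda>\<omega>. \<lambda>i\<in>I. B i \<omega>))"

definition random_coefficient ::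
  "real \<Rightarrow> real \<Rightarrow> (nat \<times> nat \<times> (int ^ 'n) \<Rightarrow> 'w \<Rightarrow> real)
     \<Rightarrow> (nat \<times> nat \<times> (int ^ 'n) \<Rightarrow> 'w \<Rightarrow> real) \<Rightarrow> nat \<times> nat \<times> (int ^ 'n) \<Rightarrow> 'w \<Rightarrow> real" where
  "random_coefficient s \<beta> W B = (\<lambda>(k, j) \<omega>.
     W (k, j) \<omega> * (2 powr (- real k * s) * (1 - B (k, j) \<omega>)
                    + 2 powr (real k * \<beta>) * B (k, j) \<omega>))"

text \<open>The sum over the scales converges in the norm of \<^typ>\<open>'n::finite l1\<close>.  It does so almost
  surely; where it does not, \<^const>\<open>suminf\<close> is a fixed element, which does not affect the law.\<close>

definition random_series ::
  "real \<Rightarrow> real \<Rightarrow> (nat \<Rightarrow> real ^ 'n::finite \<Rightarrow> real) \<Rightarrow> (nat \<times> nat \<times> (int ^ 'n) \<Rightarrow> 'w \<Rightarrow> real)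
     \<Rightarrow> (nat \<times> nat \<times> (int ^ 'n) \<Rightarrow> 'w \<Rightarrow> real) \<Rightarrow> 'w \<Rightarrow> 'n l1" where
  "random_series s \<beta> \<Psi> W B \<omega> =
     (\<Sum>k. \<Sum>j\<in>wavelet_index k. random_coefficient s \<beta> W B (k, j) \<omega> *\<^sub>R to_l1 (wavelet \<Psi> k j))"

definition series_law ::
  "'w measure \<Rightarrow> real \<Rightarrow> real \<Rightarrow> (nat \<Rightarrow> real ^ 'n::finite \<Rightarrow> real)
     \<Rightarrow> (nat \<times> nat \<times> (int ^ 'n) \<Rightarrow> 'w \<Rightarrow> real) \<Rightarrow> (nat \<times> nat \<times> (int ^ 'n) \<Rightarrow> 'w \<Rightarrow> real)
     \<Rightarrow> 'n l1 measure" where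
  "series_law M s \<beta> \<Psi> W B = distr M borel (random_series s \<beta> \<Psi> W B)"

end

theory Submission
  imports Defs
begin

text \<open>Because \<open>p > 1\<close>, the coefficients of scale \<open>k\<close> have mean absolute value \<open>O(2^(-ks))\<close>, so that on
  a ball of radius \<open>2^(-m)\<close> the series differs from its partial sum at the centre by \<open>O(2^(-ms))\<close> in the mean.

  Upper bound.  The averages of \<open>f\<close> over balls of radius \<open>2^(-m)\<close> around a point of the level set tend
  to \<open>y\<close>, hence infinitely often the next step is not much smaller than the remaining distance to \<open>y\<close>.
  At such scales \<open>y\<close> is close to the value of the partial sum at a nearby dyadic point, up to the local
  oscillation of \<open>f\<close>, and Fubini's theorem bounds the number of such dyadic points for almost every \<open>y\<close>.

  Lower bound.  By the separation property, given all random variables but one Gaussian, \<open>f(x) - f(x')\<close>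
  has a density bounded by \<open>O(d(x,x')^(-s))\<close>.  Therefore the measures \<open>(1/2e) 1[|f - y| < e] dx\<close> have
  bounded mean energy for a kernel that is \<open>d(x,x')^(s-n)\<close> up to logarithms.  A second moment argument
  shows that for some pairs \<open>(f,y)\<close> their masses do not degenerate as \<open>e\<close> tends to 0 along a sequence; on
  a closed set of points where \<open>f\<close> is continuous, this bounds every covering of the level set from
  below.  These pairs charge every set \<open>F \<times> [-R,R]\<close> and every set \<open>L\<^sup>1 \<times> Y\<close> of positive measure, which gives (i) and (ii).\<close>

section \<open>Geometry of the torus\<close>

text \<open>The law lives on L1, whose elements are classes without point values, and
  representatives are picked without any measurability in \<open>f\<close>. Hence every quantity
  that enters Fubini's theorem is a function of the wavelet coefficients, recovered from
  \<open>f\<close> by continuous functionals; representatives of \<open>f\<close> appear only in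
  estimates for a single \<open>f\<close>.

  The dimension itself is never treated as a measurable function. It is replaced by the measurable
  condition \<open>full_level\<close> on pairs \<open>(f, y)\<close>, which forces it, so that (i)
  and (ii) become statements about sections of one set in a product space. Both follow by
  contradiction from positive mean mass, but the source of that mass differs. Over a set of
  functions, the integral over \<open>y\<close> of a slice is exactly \<open>2\<epsilon>\<close> at
  every point of \<open>K A f\<close>. Over a set of levels, a lower bound for the density of a
  single value \<open>f(x)\<close> is needed; it comes from a separating wavelet for two points at
  distance 1/2, whose scale is bounded.

  No limit measure is constructed. For one small \<epsilon>, compactness turns a cover of the level
  set into a finite cover of the slice, and the energy bound is applied to that slice.\<close>

lemma dist_to_torus_less_iff:
  "dist (to_torus u) (to_torus v) < c \<longleftrightarrow> (\<exists>l. norm (u - v - int_vec l) < c)"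
  unfolding dist_torus.abs_eq by (meson lattice_dist_le lattice_dist_less le_less_trans)

lemma to_torus_cases:
  fixes x :: "'n::finite torus"
  obtains u where "x = to_torus u" "u \<in> unit_cube"
proof -
  obtain v where v: "x = to_torus v" by (metis Quotient3_abs_rep Quotient3_torus)
  define l :: "int ^ 'n" where "l = (\<chi> i. \<lfloor>v $ i\<rfloor>)"
  have "torus_rel v (v - int_vec l)" unfolding torus_rel_def by (intro exI[of _ l]) simp
  then have "x = to_torus (v - int_vec l)" using v by (simp add: torus.abs_eq_iff)
  moreover have "v - int_vec l \<in> unit_cube"
    unfolding unit_cube_def
  proof safe
    fix i
    have "of_int \<lfloor>v $ i\<rfloor> \<le> v $ i" "v $ i < of_int \<lfloor>v $ i\<rfloor> + 1" by linarith+
    then show "0 \<le> (v - int_vec l) $ i" "(v - int_vec l) $ i < 1"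
      unfolding l_def int_vec_def vector_minus_component vec_lambda_beta by linarith+
  qed
  ultimately show ?thesis using that by blast
qed

lemma norm_le_CARD:
  fixes u :: "real ^ 'n::finite"
  assumes "\<And>i. \<bar>u $ i\<bar> \<le> c"
  shows "norm u \<le> real CARD('n) * c"
proof -
  have "norm u \<le> (\<Sum>i\<in>UNIV. \<bar>u $ i\<bar>)" by (rule norm_le_l1_cart)
  also have "\<dots> \<le> real CARD('n) * c" using sum_mono[of UNIV "\<lambda>i. \<bar>u $ i\<bar>" "\<lambda>_. c"] assms by simp
  finally show ?thesis .
qed

lemma finite_card_int_box:
  fixes A :: "'n::finite \<Rightarrow> int set"
  assumes A: "\<And>i. finite (A i)"
  shows "finite {m :: int ^ 'n. \<forall>i. m $ i \<in> A i}" (is "finite ?S")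
    and "card {m :: int ^ 'n. \<forall>i. m $ i \<in> A i} = (\<Prod>i\<in>UNIV. card (A i))"
proof -
  have bij: "bij_betw vec_nth ?S (PiE UNIV A)"
    by (rule bij_betwI[of _ _ _ vec_lambda]) (auto simp: PiE_def)
  have "finite (PiE UNIV A)" by (rule finite_PiE) (use A in auto)
  then show "finite ?S" using bij_betw_finite[OF bij] by simp
  show "card ?S = (\<Prod>i\<in>UNIV. card (A i))"
    using bij_betw_same_card[OF bij] by (simp add: card_PiE)
qed

definition dyadic_index :: "nat \<Rightarrow> (int ^ 'n::finite) set" where
  "dyadic_index k = {m. \<forall>i. 0 \<le> m $ i \<and> m $ i < 2 ^ k}"

lemma dyadic_index_eq: "dyadic_index k = {m. \<forall>i. m $ i \<in> {0..<2 ^ k}}"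
  by (auto simp: dyadic_index_def)

lemma finite_dyadic_index [simp]: "finite (dyadic_index k)"
  unfolding dyadic_index_eq by (rule finite_card_int_box) simp

lemma card_dyadic_index: "card (dyadic_index k :: (int ^ 'n::finite) set) = 2 ^ (k * CARD('n))"
  unfolding dyadic_index_eq by (subst finite_card_int_box) (auto simp: power_mult nat_power_eq)

lemma finite_wavelet_index [simp]: "finite (wavelet_index k)"
  using finite_dyadic_index[of k] unfolding wavelet_index_def dyadic_index_def by auto

text \<open>Each coordinate of \<open>l\<close> is confined to an interval of length
  \<open>2 * r\<close>, which holds at most \<open>2 * r + 1\<close> integers.\<close>

lemma card_near_ints:
  fixes v :: "real ^ 'n::finite"
  assumes "0 \<le> r"
  shows "finite {l :: int ^ 'n. norm (int_vec l - v) < r}" (is "finite ?S")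
    and "real (card {l :: int ^ 'n. norm (int_vec l - v) < r}) \<le> (2 * r + 1) ^ CARD('n)"
proof -
  define A where "A i = {\<lceil>v $ i - r\<rceil>..\<lfloor>v $ i + r\<rfloor>}" for i
  have sub: "?S \<subseteq> {l. \<forall>i. l $ i \<in> A i}"
  proof safe
    fix l :: "int ^ 'n" and i assume "norm (int_vec l - v) < r"
    then have "\<bar>of_int (l $ i) - v $ i\<bar> < r"
      using component_le_norm_cart[of "int_vec l - v" i] by (simp add: int_vec_def)
    then have "v $ i - r \<le> of_int (l $ i)" "of_int (l $ i) \<le> v $ i + r" by linarith+
    then show "l $ i \<in> A i" by (simp add: A_def ceiling_le le_floor_iff)
  qed
  have fin: "finite {l :: int ^ 'n. \<forall>i. l $ i \<in> A i}"
    by (rule finite_card_int_box) (simp add: A_def)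
  then show "finite ?S" using sub finite_subset by blast
  have "card ?S \<le> (\<Prod>i\<in>UNIV. card (A i))"
    using card_mono[OF fin sub] finite_card_int_box(2)[of A] by (simp add: A_def)
  then have "real (card ?S) \<le> (\<Prod>i\<in>UNIV. real (card (A i)))"
    by (metis of_nat_mono of_nat_prod)
  also have "\<dots> \<le> (\<Prod>i\<in>(UNIV::'n set). 2 * r + 1)"
  proof (rule prod_mono)
    fix i
    have "real (card (A i)) = real (nat (\<lfloor>v $ i + r\<rfloor> - \<lceil>v $ i - r\<rceil> + 1))" by (simp add: A_def)
    also have "\<dots> \<le> 2 * r + 1"
    proof -
      have "real_of_int (\<lfloor>v $ i + r\<rfloor> - \<lceil>v $ i - r\<rceil> + 1) \<le> 2 * r + 1" by linarith
      then show ?thesis using assms by (cases "\<lfloor>v $ i + r\<rfloor> - \<lceil>v $ i - r\<rceil> + 1 \<ge> 0") auto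
    qed
    finally show "0 \<le> real (card (A i)) \<and> real (card (A i)) \<le> 2 * r + 1" by simp
  qed
  finally show "real (card ?S) \<le> (2 * r + 1) ^ CARD('n)" by simp
qed

definition dyadic_point :: "nat \<Rightarrow> int ^ 'n::finite \<Rightarrow> 'n torus" where
  "dyadic_point k m = to_torus ((1 / 2 ^ k) *\<^sub>R int_vec m)"

lemma dyadic_net:
  fixes x :: "'n::finite torus"
  obtains m where "m \<in> dyadic_index k" "dist x (dyadic_point k m) \<le> real CARD('n) / 2 ^ k"
proof -
  obtain u where u: "x = to_torus u" "u \<in> unit_cube" by (rule to_torus_cases)
  define m :: "int ^ 'n" where "m = (\<chi> i. \<lfloor>2 ^ k * u $ i\<rfloor>)"
  have "m \<in> dyadic_index k"
    unfolding dyadic_index_def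
  proof safe
    fix i
    have "0 \<le> u $ i" "u $ i < 1" using u by (auto simp: unit_cube_def)
    then show "0 \<le> m $ i" "m $ i < 2 ^ k" by (auto simp: m_def floor_less_iff)
  qed
  moreover have "norm (u - (1 / 2 ^ k) *\<^sub>R int_vec m) \<le> real CARD('n) * (1 / 2 ^ k)"
  proof (rule norm_le_CARD)
    fix i
    have "\<bar>2 ^ k * u $ i - of_int \<lfloor>2 ^ k * u $ i\<rfloor>\<bar> \<le> 1" by linarith
    moreover have "(u - (1 / 2 ^ k) *\<^sub>R int_vec m) $ i
        = (2 ^ k * u $ i - of_int \<lfloor>2 ^ k * u $ i\<rfloor>) / 2 ^ k"
      by (simp add: m_def int_vec_def field_simps)
    ultimately show "\<bar>(u - (1 / 2 ^ k) *\<^sub>R int_vec m) $ i\<bar> \<le> 1 / 2 ^ k"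
      by (simp add: divide_right_mono abs_divide)
  qed
  then have "dist x (dyadic_point k m) \<le> real CARD('n) / 2 ^ k"
    using dist_to_torus_le[of u "(1 / 2 ^ k) *\<^sub>R int_vec m"]
    by (simp add: u dyadic_point_def dist_norm)
  ultimately show ?thesis using that by blast
qed

text \<open>The dyadic net of scale 0 is a single point, and every point lies within
  \<open>CARD('n)\<close> of it. This crude diameter is the radius of the coarsest layer of the
  kernel \<open>kap\<close>.\<close>

lemma dist_torus_le:
  fixes x y :: "'n::finite torus"
  shows "dist x y \<le> 2 * real CARD('n)"
proof -
  have 0: "dyadic_index 0 = {0 :: int ^ 'n}"
  proof -
    have "m = 0" if "\<forall>i. 0 \<le> m $ i \<and> m $ i < 1" for m :: "int ^ 'n"
      using that by (simp add: vec_eq_iff) (metis antisym_conv zless_imp_add1_zle add_0 int_one_le_iff_zero_less not_le)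
    then show ?thesis by (auto simp: dyadic_index_def)
  qed
  have "dist x (dyadic_point 0 0) \<le> real CARD('n)" for x :: "'n torus"
    using dyadic_net[of 0 x] unfolding 0 by auto
  from this[of x] this[of y] show ?thesis
    using dist_triangle2[of x y "dyadic_point 0 0"] by linarith
qed

section \<open>Volume of balls, compactness and a countable base of the torus\<close>

lemma emeasure_torus_measure:
  "A \<in> sets borel \<Longrightarrow> emeasure torus_measure A = emeasure lborel (unit_cube \<inter> to_torus -` A)"
  unfolding torus_measure_def
  by (subst emeasure_distr)
     (auto simp: space_restrict_space emeasure_restrict_space measurable_restrict_space1 Int_commute
       intro!: arg_cong[where f = "emeasure lborel"])

lemma space_torus_measure [simp]: "space torus_measure = UNIV"
  by (simp add: torus_measure_def)

lemma emeasure_lborel_cube: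
  fixes a :: "real ^ 'n::finite"
  assumes "0 \<le> h"
  shows "emeasure lborel (cbox a (a + (\<chi> i. h))) = ennreal (h ^ CARD('n))"
    and "emeasure lborel (box a (a + (\<chi> i. h))) = ennreal (h ^ CARD('n))"
proof -
  have [simp]: "(\<chi> i. h) \<bullet> axis j (1::real) = h" for j :: 'n by (simp add: inner_axis)
  have "(\<Prod>b\<in>(Basis :: (real ^ 'n) set). (\<chi> i. h) \<bullet> b) = (\<Prod>b\<in>(Basis :: (real ^ 'n) set). h)"
    by (rule prod.cong) (auto simp: Basis_vec_def)
  then have "(\<Prod>b\<in>(Basis :: (real ^ 'n) set). (\<chi> i. h) \<bullet> b) = h ^ CARD('n)"
    by simp
  then show "emeasure lborel (cbox a (a + (\<chi> i. h))) = ennreal (h ^ CARD('n))"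
    "emeasure lborel (box a (a + (\<chi> i. h))) = ennreal (h ^ CARD('n))"
    using assms
    by (subst emeasure_lborel_cbox emeasure_lborel_box; auto simp: Basis_vec_def inner_simps)+
qed

lemma emeasure_lborel_ball_le:
  fixes v :: "real ^ 'n::finite"
  assumes "0 \<le> r"
  shows "emeasure lborel (ball v r) \<le> ennreal ((2 * r) ^ CARD('n))"
proof -
  have "ball v r \<subseteq> cbox (v - (\<chi> i. r)) (v - (\<chi> i. r) + (\<chi> i. 2 * r))"
  proof
    fix u assume "u \<in> ball v r"
    then have "\<bar>(v - u) $ i\<bar> \<le> r" for i
      using component_le_norm_cart[of "v - u" i] by (simp add: dist_norm)
    then show "u \<in> cbox (v - (\<chi> i. r)) (v - (\<chi> i. r) + (\<chi> i. 2 * r))"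
      unfolding mem_box_cart by (force simp: abs_le_iff algebra_simps)
  qed
  then have "emeasure lborel (ball v r) \<le> emeasure lborel (cbox (v - (\<chi> i. r)) (v - (\<chi> i. r) + (\<chi> i. 2 * r)))"
    by (intro emeasure_mono) auto
  then show ?thesis using emeasure_lborel_cube(1)[of "2 * r" "v - (\<chi> i. r)"] assms by simp
qed

text \<open>For \<open>r \<le> 1\<close> only translates by vectors with entries in
  \<open>{-2..2}\<close> of a Euclidean ball can meet the unit cube. There are
  \<open>5 ^ CARD('n)\<close> of them, each inside a cube of side \<open>2 * r\<close>, whence the
  base 10. For larger \<open>r\<close> the right-hand side exceeds the total mass 1.\<close>

lemma emeasure_torus_ball_le:
  fixes x :: "'n::finite torus"
  assumes "0 < r"
  shows "emeasure torus_measure (ball x r) \<le> ennreal (10 ^ CARD('n) * r ^ CARD('n))"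
proof (cases "r \<le> 1")
  case True
  obtain v where v: "x = to_torus v" "v \<in> unit_cube" by (rule to_torus_cases)
  define L :: "(int ^ 'n) set" where "L = {l. \<forall>i. l $ i \<in> {-2..2}}"
  have L: "finite L" "card L = 5 ^ CARD('n)"
    unfolding L_def using finite_card_int_box[of "\<lambda>_::'n. {-2..2}"] by simp_all
  have "unit_cube \<inter> to_torus -` ball x r \<subseteq> (\<Union>l\<in>L. ball (v + int_vec l) r)"
  proof
    fix u assume u: "u \<in> unit_cube \<inter> to_torus -` ball x r"
    then obtain l where l: "norm (u - v - int_vec l) < r"
      by (auto simp: v(1) dist_commute dist_to_torus_less_iff)
    have "l $ i \<in> {-2..2}" for i
    proof -
      have "\<bar>(u - v - int_vec l) $ i\<bar> < 1"
        using component_le_norm_cart[of "u - v - int_vec l" i] l True by linarith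
      moreover have "0 \<le> u $ i" "u $ i < 1" "0 \<le> v $ i" "v $ i < 1"
        using u v by (auto simp: unit_cube_def)
      ultimately have "\<bar>of_int (l $ i) :: real\<bar> < 2" by (simp add: int_vec_def abs_less_iff)
      then show ?thesis by (auto simp: abs_less_iff)
    qed
    then have "l \<in> L" by (simp add: L_def)
    moreover have "u \<in> ball (v + int_vec l) r"
      using l by (simp add: dist_norm norm_minus_commute diff_diff_eq)
    ultimately show "u \<in> (\<Union>l\<in>L. ball (v + int_vec l) r)" by blast
  qed
  then have "emeasure torus_measure (ball x r) \<le> emeasure lborel (\<Union>l\<in>L. ball (v + int_vec l) r)"
    by (subst emeasure_torus_measure) (auto intro!: emeasure_mono sets.finite_UN L)
  also have "\<dots> \<le> (\<Sum>l\<in>L. emeasure lborel (ball (v + int_vec l) r))"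
    by (rule emeasure_subadditive_finite) (auto simp: L)
  also have "\<dots> \<le> (\<Sum>l\<in>L. ennreal ((2 * r) ^ CARD('n)))"
    using assms by (intro sum_mono emeasure_lborel_ball_le) auto
  also have "\<dots> = ennreal (real (card L) * (2 * r) ^ CARD('n))"
    by (simp only: sum_constant ennreal_mult' of_nat_0_le_iff ennreal_of_nat_eq_real_of_nat)
  also have "real (card L) * (2 * r) ^ CARD('n) = 10 ^ CARD('n) * r ^ CARD('n)"
  proof -
    have "(10::real) ^ CARD('n) = 5 ^ CARD('n) * 2 ^ CARD('n)"
      by (subst power_mult_distrib[symmetric]) simp
    then show ?thesis by (simp add: L power_mult_distrib)
  qed
  finally show ?thesis .
next
  case False
  then have "1 \<le> (10 * r) ^ CARD('n)" by (intro one_le_power) auto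
  then have "1 \<le> ennreal (10 ^ CARD('n) * r ^ CARD('n))"
    by (metis ennreal_1 ennreal_leI power_mult_distrib)
  then show ?thesis
    using prob_space.emeasure_le_1[OF prob_space_torus_measure] order_trans by blast
qed

text \<open>The ball contains a cube of side \<open>h\<close> with one corner at the centre. As
  \<open>h \<le> 1 / 2\<close>, the cube can be turned towards the interior of the unit cube in each
  coordinate separately, so that it does not leave the fundamental domain.\<close>

lemma emeasure_torus_ball_ge:
  fixes x :: "'n::finite torus"
  assumes "0 < r" "r \<le> 1"
  shows "ennreal ((r / (2 * real CARD('n))) ^ CARD('n)) \<le> emeasure torus_measure (ball x r)"
proof -
  obtain v where v: "x = to_torus v" "v \<in> unit_cube" by (rule to_torus_cases)
  define h where "h = r / (2 * real CARD('n))"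
  have h: "0 < h" "h \<le> 1 / 2" "h * real CARD('n) < r"
  proof -
    have n: "1 \<le> real CARD('n)" by (simp add: Suc_leI)
    then show "0 < h" "h * real CARD('n) < r" using assms by (auto simp: h_def)
    have "r / (2 * real CARD('n)) \<le> 1 / (2 * 1)"
      using n assms by (intro frac_le) auto
    then show "h \<le> 1 / 2" by (simp add: h_def)
  qed
  define a :: "real ^ 'n" where "a = (\<chi> i. if v $ i < 1 / 2 then v $ i else v $ i - h)"
  have "box a (a + (\<chi> i. h)) \<subseteq> unit_cube \<inter> to_torus -` ball x r"
  proof
    fix u assume "u \<in> box a (a + (\<chi> i. h))"
    then have u: "a $ i < u $ i" "u $ i < a $ i + h" for i by (auto simp: mem_box_cart)
    have vi: "0 \<le> v $ i" "v $ i < 1" for i using v by (auto simp: unit_cube_def)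
    have "0 \<le> u $ i" "u $ i < 1" "\<bar>(v - u) $ i\<bar> \<le> h" for i
      using u[of i] vi[of i] h by (auto simp: a_def split: if_splits)
    then have "u \<in> unit_cube" "norm (v - u) \<le> real CARD('n) * h"
      by (auto simp: unit_cube_def intro!: norm_le_CARD)
    then show "u \<in> unit_cube \<inter> to_torus -` ball x r"
      using dist_to_torus_le[of v u] h by (auto simp: v(1) dist_norm mult.commute)
  qed
  then have "emeasure lborel (box a (a + (\<chi> i. h))) \<le> emeasure torus_measure (ball x r)"
    using measurable_sets[OF borel_measurable_to_torus, of "ball x r"]
    by (subst emeasure_torus_measure) (auto intro!: emeasure_mono)
  then show ?thesis using emeasure_lborel_cube(2)[of h a] h by (simp add: h_def)
qed

lemma continuous_on_to_torus: "continuous_on S (to_torus :: real ^ 'n::finite \<Rightarrow> _)"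
  unfolding continuous_on_iff by (meson dist_to_torus_le le_less_trans)

lemma compact_UNIV_torus: "compact (UNIV :: 'n::finite torus set)"
proof -
  have "to_torus ` cbox 0 (1 :: real ^ 'n) = UNIV"
  proof safe
    fix x :: "'n torus"
    obtain u where "x = to_torus u" "u \<in> unit_cube" by (rule to_torus_cases)
    then show "x \<in> to_torus ` cbox 0 1"
      by (auto simp: unit_cube_def mem_box_cart less_imp_le intro!: image_eqI)
  qed auto
  then show ?thesis
    using compact_continuous_image[OF continuous_on_to_torus compact_cbox, of 0 "1 :: real ^ 'n"]
    by simp
qed

text \<open>Makes \<open>dist\<close> jointly measurable in both points. The kernel
  \<open>kap\<close> and the integrals over balls with variable centre depend on this.\<close>

instance torus :: (finite) second_countable_topology
proof
  obtain D :: "(real ^ 'a) set" where D: "countable D"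
    "\<And>X. open X \<Longrightarrow> X \<noteq> {} \<Longrightarrow> \<exists>d\<in>D. d \<in> X" using countable_dense_setE by metis
  define B where "B = (\<lambda>(d, q). ball (to_torus d) (real_of_rat q) :: 'a torus set) ` (D \<times> UNIV)"
  have "topological_basis B"
  proof (rule topological_basisI)
    show "open U" if "U \<in> B" for U using that by (auto simp: B_def)
    fix U :: "'a torus set" and x assume U: "open U" "x \<in> U"
    then obtain e where e: "e > 0" "ball x e \<subseteq> U" by (meson open_contains_ball)
    obtain v where v: "x = to_torus v" by (rule to_torus_cases)
    obtain d where d: "d \<in> D" "d \<in> ball v (e / 4)" using D(2)[of "ball v (e / 4)"] e by auto
    obtain q where q: "e / 4 < real_of_rat q" "real_of_rat q < e / 2"
      using of_rat_dense[of "e / 4" "e / 2"] e by auto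
    have dx: "dist (to_torus d) x < e / 4"
      using d dist_to_torus_le[of d v] by (auto simp: v dist_commute)
    have "ball (to_torus d) (real_of_rat q) \<subseteq> U"
    proof
      fix z assume "z \<in> ball (to_torus d) (real_of_rat q)"
      then have "dist x z < e" using dx q dist_triangle3[of x z "to_torus d"] by simp
      then show "z \<in> U" using e by auto
    qed
    moreover have "x \<in> ball (to_torus d) (real_of_rat q)" using dx q by simp
    ultimately show "\<exists>B'\<in>B. x \<in> B' \<and> B' \<subseteq> U"
      using d by (auto simp: B_def intro!: bexI[of _ "ball (to_torus d) (real_of_rat q)"])
  qed
  moreover have "countable B" using D by (simp add: B_def)
  ultimately show "\<exists>B::'a torus set set. countable B \<and> open = generate_topology B"
    using topological_basis_imp_subbasis by blast
qed

text \<open>A shift by 1/2 along one axis works, since no integer is closer to 1/2 than 1/2.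
  Applying the separation property to such a pair yields, at any given point, a wavelet of bounded
  scale that is not small there.\<close>

lemma torus_half_distance:
  fixes x :: "'n::finite torus"
  obtains x' where "dist x x' = 1 / 2"
proof -
  obtain v where v: "x = to_torus v" by (rule to_torus_cases)

  fix i :: 'n
  define e :: "real ^ 'n" where "e = axis i (1 / 2)"
  have "dist (to_torus v) (to_torus (v - e)) = 1 / 2"
    unfolding dist_torus.abs_eq
  proof (rule antisym)
    show "lattice_dist v (v - e) \<le> 1 / 2"
    proof -
      have "e = (1 / 2) *\<^sub>R axis i 1" by (simp add: e_def vec_eq_iff axis_def)
      then have "norm e = 1 / 2" by simp
      then show ?thesis using lattice_dist_le[of v "v - e" 0] by simp
    qed
    show "1 / 2 \<le> lattice_dist v (v - e)"
    proof (rule lattice_dist_ge)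
      fix l
      have "1 / 2 \<le> \<bar>1 / 2 - of_int (l $ i) :: real\<bar>"
        by (cases "l $ i \<le> 0") auto
      also have "\<dots> = \<bar>(v - (v - e) - int_vec l) $ i\<bar>"
        by (simp add: e_def int_vec_def)
      also have "\<dots> \<le> norm (v - (v - e) - int_vec l)" by (rule component_le_norm_cart)
      finally show "1 / 2 \<le> norm (v - (v - e) - int_vec l)" .
    qed
  qed
  then show ?thesis using that v by blast
qed

section \<open>The space of integrable functions\<close>

lemma l1_rel_rep_l1: "l1_rel (rep_l1 f) (rep_l1 f)"
  using Quotient3_rep_reflp[OF Quotient3_l1] .

lemma integrable_rep_l1 [simp, intro]: "integrable torus_measure (rep_l1 f)"
  using l1_rel_rep_l1[of f] by (simp add: l1_rel_def)

lemma borel_measurable_rep_l1 [measurable]: "rep_l1 f \<in> borel_measurable borel"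
  using borel_measurable_integrable[OF integrable_rep_l1[of f]]
    measurable_cong_sets[OF sets_torus_measure refl] by blast

lemma to_l1_rep_l1 [simp]: "to_l1 (rep_l1 f) = f"
  using Quotient3_abs_rep[OF Quotient3_l1] .

lemma l1_rel_refl_iff [simp]: "l1_rel g g \<longleftrightarrow> integrable torus_measure g"
  by (simp add: l1_rel_def)

lemma AE_rep_to_l1:
  "integrable torus_measure g \<Longrightarrow> AE x in torus_measure. rep_l1 (to_l1 g) x = g x"
  using rep_abs_rsp[OF Quotient3_l1, of g g] Quotient3_rel_rep
  by (metis Quotient3_l1 Quotient3_rep_abs l1_rel_def l1_rel_refl_iff)

lemma norm_to_l1: "integrable torus_measure g \<Longrightarrow> norm (to_l1 g) = (LINT x|torus_measure. \<bar>g x\<bar>)"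
  by (subst norm_l1.abs_eq) auto

lemma norm_l1_rep: "norm f = (LINT x|torus_measure. \<bar>rep_l1 f x\<bar>)"
  using norm_to_l1[of "rep_l1 f"] by simp

lemma norm_l1_diff:
  "integrable torus_measure g \<Longrightarrow>
    norm (f - to_l1 g) = (LINT x|torus_measure. \<bar>rep_l1 f x - g x\<bar>)"
  using minus_l1.abs_eq[of "rep_l1 f" g] norm_to_l1[of "\<lambda>x. rep_l1 f x - g x"] by simp

lemma scaleR_to_l1:
  "integrable torus_measure g \<Longrightarrow> c *\<^sub>R to_l1 g = to_l1 (\<lambda>x. c * g x)"
  by (rule scaleR_l1.abs_eq) simp

lemma zero_l1_eq: "0 = to_l1 (\<lambda>_. 0)"
  by (simp add: zero_l1_def)

lemma sum_to_l1:
  assumes "\<And>i. i \<in> I \<Longrightarrow> integrable torus_measure (g i)"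
  shows "(\<Sum>i\<in>I. to_l1 (g i)) = to_l1 (\<lambda>x. \<Sum>i\<in>I. g i x)"
  using assms
proof (induction I rule: infinite_finite_induct)
  case (insert i I)
  then show ?case
    using plus_l1.abs_eq[of "g i" "\<lambda>x. \<Sum>i\<in>I. g i x"] by simp
qed (simp_all add: zero_l1_eq)

lemma lebesgue_points_iff:
  "x \<in> lebesgue_points f \<longleftrightarrow>
    (\<exists>a. ((\<lambda>r. (LINT z:ball x r|torus_measure. \<bar>rep_l1 f z - a\<bar>) / r ^ CARD('n)) \<longlongrightarrow> 0) (at_right 0))"
  for f :: "'n::finite l1"
  using lebesgue_points.abs_eq[of "rep_l1 f"] by simp

lemma level_set_iff:
  "x \<in> level_set f y \<longleftrightarrow>
     Liminf (at_right 0) (\<lambda>r. ereal (ball_average (rep_l1 f) x r)) \<le> ereal y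
   \<and> ereal y \<le> Limsup (at_right 0) (\<lambda>r. ereal (ball_average (rep_l1 f) x r))"
  using level_set.abs_eq[of "rep_l1 f"] by simp

text \<open>The Riesz-Fischer argument: the sum of the norms bounds the integral of the sum of
  absolute values, so the series converges absolutely almost everywhere, and dominated convergence
  turns this into convergence in norm.\<close>

lemma summable_l1:
  fixes v :: "nat \<Rightarrow> 'n::finite l1"
  assumes v: "summable (\<lambda>k. norm (v k))"
  shows "summable v"
proof -
  let ?g = "\<lambda>k. rep_l1 (v k)" and ?T = "torus_measure :: 'n torus measure"
  have sN: "summable (\<lambda>k. LINT x|?T. norm (?g k x))"
    using v by (simp add: norm_l1_rep)
  have "(\<integral>\<^sup>+x. (\<Sum>k. ennreal (norm (?g k x))) \<partial>?T) = (\<Sum>k. \<integral>\<^sup>+x. ennreal (norm (?g k x)) \<partial>?T)"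
    by (rule nn_integral_suminf) measurable
  also have "\<dots> = (\<Sum>k. ennreal (LINT x|?T. norm (?g k x)))"
    by (intro suminf_cong nn_integral_eq_integral) auto
  also have "\<dots> = ennreal (\<Sum>k. LINT x|?T. norm (?g k x))"
    by (rule suminf_ennreal2[OF _ sN]) simp
  also have "\<dots> \<noteq> \<infinity>" by simp
  finally have fin: "(\<integral>\<^sup>+x. (\<Sum>k. ennreal (norm (?g k x))) \<partial>?T) \<noteq> \<infinity>" .
  have "AE x in ?T. (\<Sum>k. ennreal (norm (?g k x))) \<noteq> \<infinity>"
    by (rule nn_integral_PInf_AE[OF _ fin]) measurable
  then have aes: "AE x in ?T. summable (\<lambda>k. norm (?g k x))"
  proof eventually_elim
    case (elim x)
    then show ?case by (intro summable_suminf_not_top) (auto simp: top_unique)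
  qed
  define h where "h x = (\<Sum>k. ?g k x)" for x
  define w where "w x = (\<Sum>k. norm (?g k x))" for x
  have h: "integrable ?T h" unfolding h_def by (rule integrable_suminf) (use aes sN in auto)
  have w: "integrable ?T w" unfolding w_def by (rule integrable_suminf) (use aes sN in auto)
  have "(\<lambda>m. LINT x|?T. \<bar>(\<Sum>k<m. ?g k x) - h x\<bar>) \<longlonglongrightarrow> (LINT x|?T. 0)"
  proof (rule integral_dominated_convergence)
    show "integrable ?T (\<lambda>x. 2 * w x)" using w by simp
    show "AE x in ?T. (\<lambda>m. \<bar>(\<Sum>k<m. ?g k x) - h x\<bar>) \<longlonglongrightarrow> 0"
      using aes
    proof eventually_elim
      case (elim x)
      have "(\<lambda>m. \<Sum>k<m. ?g k x) \<longlonglongrightarrow> h x"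
        unfolding h_def by (rule summable_LIMSEQ[OF summable_norm_cancel[OF elim]])
      from tendsto_rabs_zero[OF LIM_zero[OF this]] show ?case .
    qed
    show "AE x in ?T. norm \<bar>(\<Sum>k<m. ?g k x) - h x\<bar> \<le> 2 * w x" for m
      using aes
    proof eventually_elim
      case (elim x)
      have "norm (\<Sum>k<m. ?g k x) \<le> (\<Sum>k<m. norm (?g k x))" by (rule norm_sum)
      also have "\<dots> \<le> w x" unfolding w_def by (rule sum_le_suminf[OF elim]) auto
      finally have "norm (\<Sum>k<m. ?g k x) \<le> w x" .
      moreover have "norm (h x) \<le> w x" unfolding h_def w_def by (rule summable_norm[OF elim])
      ultimately show ?case unfolding real_norm_def by linarith
    qed
    show "(\<lambda>x. \<bar>(\<Sum>k<m. ?g k x) - h x\<bar>) \<in> borel_measurable ?T" for m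
      using borel_measurable_integrable[OF h] by measurable
  qed simp
  moreover have "norm ((\<Sum>k<m. v k) - to_l1 h) = (LINT x|?T. \<bar>(\<Sum>k<m. ?g k x) - h x\<bar>)" for m
  proof -
    have "(\<Sum>k<m. v k) - to_l1 h = to_l1 (\<lambda>x. (\<Sum>k<m. ?g k x) - h x)"
      using sum_to_l1[of "{..<m}" ?g] h by (simp add: minus_l1.abs_eq)
    then show ?thesis using h by (simp add: norm_to_l1)
  qed
  ultimately have "(\<lambda>m. norm ((\<Sum>k<m. v k) - to_l1 h)) \<longlonglongrightarrow> 0" by simp
  then have "(\<lambda>m. \<Sum>k<m. v k) \<longlonglongrightarrow> to_l1 h"
    using LIM_zero_iff tendsto_norm_zero_iff by blast
  then show ?thesis unfolding summable_iff_convergent convergent_def by blast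
qed

text \<open>Completeness is what makes convergence of the random series a measurable event, through
  the Cauchy criterion.\<close>

instance l1 :: (finite) banach
proof
  fix X :: "nat \<Rightarrow> 'a l1" assume X: "Cauchy X"
  have "\<exists>N. \<forall>n\<ge>N. \<forall>m\<ge>N. norm (X n - X m) < (1 / 2) ^ k" for k
    using X unfolding Cauchy_def dist_norm by (meson half_gt_zero zero_less_one zero_less_power)
  then obtain N where N: "\<And>k n m. n \<ge> N k \<Longrightarrow> m \<ge> N k \<Longrightarrow> norm (X n - X m) < (1 / 2) ^ k"
    by metis
  \<comment> \<open>Adding up all thresholds makes the subsequence strictly increasing and keeps it
    above \<open>N k\<close>, so that consecutive differences are summable.\<close>
  define r where "r k = k + (\<Sum>i\<le>k. N i)" for k
  have r: "strict_mono r" by (rule strict_monoI_Suc) (simp add: r_def)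
  have rN: "N k \<le> r k" for k
    using member_le_sum[of k "{..k}" N] by (simp add: r_def)
  define v where "v k = X (r (Suc k)) - X (r k)" for k
  have "norm (v k) \<le> (1 / 2) ^ k" for k
    unfolding v_def using N[of k "r (Suc k)" "r k"] rN[of k] strict_monoD[OF r, of k "Suc k"] by simp
  then have "summable (\<lambda>k. norm (v k))"
    by (intro summable_comparison_test[OF _ summable_geometric[of "1 / 2 :: real"]]) auto
  then have "convergent (\<lambda>m. \<Sum>k<m. v k)" using summable_l1 summable_iff_convergent by blast
  moreover have "(\<Sum>k<m. v k) = X (r m) - X (r 0)" for m
    unfolding v_def by (rule sum_lessThan_telescope)
  ultimately have "convergent (\<lambda>m. X (r m) - X (r 0) + X (r 0))"
    by (intro convergent_add convergent_const) simp
  then obtain l where "(X \<circ> r) \<longlonglongrightarrow> l" by (auto simp: convergent_def comp_def)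
  then show "convergent X"
    using Cauchy_converges_subseq[OF X r] by (auto simp: convergent_def)
qed

definition l1_pairing :: "('n::finite torus \<Rightarrow> real) \<Rightarrow> 'n l1 \<Rightarrow> real" where
  "l1_pairing g f = (LINT x|torus_measure. rep_l1 f x * g x)"

lemma integrable_mult_bounded:
  fixes g :: "'n::finite torus \<Rightarrow> real"
  assumes "integrable torus_measure f" "g \<in> borel_measurable borel" "\<And>x. \<bar>g x\<bar> \<le> b"
  shows "integrable torus_measure (\<lambda>x. f x * g x)"
proof (rule Bochner_Integration.integrable_bound)
  show "integrable torus_measure (\<lambda>x. b * f x)" using assms by simp
  show "(\<lambda>x. f x * g x) \<in> borel_measurable torus_measure"
    using assms borel_measurable_integrable[OF assms(1)] by auto
  show "AE x in torus_measure. norm (f x * g x) \<le> norm (b * f x)"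
  proof (intro always_eventually allI)
    fix x
    have "\<bar>g x\<bar> \<le> \<bar>b\<bar>" using assms(3)[of x] by linarith
    then show "norm (f x * g x) \<le> norm (b * f x)"
      by (simp add: abs_mult mult.commute[of "\<bar>f x\<bar>"] mult_right_mono)
  qed
qed

lemma l1_pairing_to_l1:
  assumes "integrable torus_measure f" "g \<in> borel_measurable borel"
  shows "l1_pairing g (to_l1 f) = (LINT x|torus_measure. f x * g x)"
  unfolding l1_pairing_def
  using AE_rep_to_l1[OF assms(1)] assms borel_measurable_integrable[OF assms(1)]
  by (intro integral_cong_AE) auto

lemma bounded_linear_l1_pairing:
  fixes g :: "'n::finite torus \<Rightarrow> real"
  assumes g: "g \<in> borel_measurable borel" "\<And>x. \<bar>g x\<bar> \<le> b"
  shows "bounded_linear (l1_pairing g)"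
proof (rule bounded_linear_intro[where K = b])
  fix f h :: "'n l1" and c :: real
  have f: "integrable torus_measure (\<lambda>x. rep_l1 f x * g x)" for f :: "'n l1"
    by (rule integrable_mult_bounded) (use g in auto)
  have "f + h = to_l1 (\<lambda>x. rep_l1 f x + rep_l1 h x)"
    using plus_l1.abs_eq[of "rep_l1 f" "rep_l1 h"] by simp
  then show "l1_pairing g (f + h) = l1_pairing g f + l1_pairing g h"
    using f[of f] f[of h] g by (simp add: l1_pairing_to_l1 distrib_right) (simp add: l1_pairing_def)
  have "c *\<^sub>R f = to_l1 (\<lambda>x. c * rep_l1 f x)"
    using scaleR_to_l1[of "rep_l1 f" c] by simp
  then show "l1_pairing g (c *\<^sub>R f) = c *\<^sub>R l1_pairing g f"
    using g by (simp add: l1_pairing_to_l1 mult.assoc) (simp add: l1_pairing_def)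
  have "norm (l1_pairing g f) \<le> (LINT x|torus_measure. norm (rep_l1 f x * g x))"
    unfolding l1_pairing_def by (rule integral_norm_bound)
  also have "\<dots> \<le> (LINT x|torus_measure. b * \<bar>rep_l1 f x\<bar>)"
    using f[of f] g(2)
    by (intro integral_mono integrable_norm) (auto simp: abs_mult mult.commute[of _ "\<bar>rep_l1 f _\<bar>"] mult_left_mono)
  finally show "norm (l1_pairing g f) \<le> norm f * b" by (simp add: norm_l1_rep mult.commute)
qed

section \<open>Periodized wavelets\<close>

text \<open>A single constant bounds the size, the Lipschitz constant and the support. The form with
  all larger \<open>R\<close> allows a finite family of functions to share one constant.\<close>

lemma C1_compact_support_bounds:
  fixes \<psi> :: "real ^ 'n::finite \<Rightarrow> real"
  assumes C1: "C1_function \<psi>" and cs: "compact (closure {x. \<psi> x \<noteq> 0})"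
  shows "\<exists>r. \<forall>R\<ge>r. (\<forall>x. \<bar>\<psi> x\<bar> \<le> R) \<and> (\<forall>x y. \<bar>\<psi> x - \<psi> y\<bar> \<le> R * norm (x - y)) \<and> (\<forall>x. R \<le> norm x \<longrightarrow> \<psi> x = 0)"
proof -
  obtain D where D: "\<And>x. (\<psi> has_derivative blinfun_apply (D x)) (at x)" "continuous_on UNIV D"
    using C1 unfolding C1_function_def by auto
  let ?K = "closure {x. \<psi> x \<noteq> 0}"
  have cont: "continuous_on UNIV \<psi>"
    by (rule continuous_at_imp_continuous_on) (use D(1) has_derivative_continuous in blast)
  have "bounded (\<psi> ` ?K)" "bounded (D ` ?K)" "bounded ?K"
    using cs D(2) cont by (auto intro!: compact_imp_bounded compact_continuous_image intro: continuous_on_subset)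
  then have "\<exists>b0. \<forall>x\<in>?K. norm (\<psi> x) \<le> b0" "\<exists>b1. \<forall>x\<in>?K. norm (D x) \<le> b1"
    "\<exists>b2. \<forall>x\<in>?K. norm x \<le> b2"
    unfolding bounded_iff by simp_all
  then obtain b0 b1 b2 where b0: "\<forall>x\<in>?K. norm (\<psi> x) \<le> b0"
    and b1: "\<forall>x\<in>?K. norm (D x) \<le> b1" and b2: "\<forall>x\<in>?K. norm x \<le> b2"
    by (elim exE)
  define r where "r = \<bar>b0\<bar> + \<bar>b1\<bar> + \<bar>b2\<bar> + 1"
  have K: "x \<in> ?K" if "\<psi> x \<noteq> 0" for x using that closure_subset[of "{x. \<psi> x \<noteq> 0}"] by blast
  \<comment> \<open>Off the closed support the function vanishes in a neighbourhood, so its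
    derivative is zero; a bound for the derivative on the compact support is then a global
    bound.\<close>
  have D0: "D x = 0" if "x \<notin> ?K" for x
  proof -
    have o: "open (- ?K)" "x \<in> - ?K" using that by auto
    have z: "0 = \<psi> y" if "y \<in> - ?K" for y using K[of y] that by auto
    have "((\<lambda>_. 0 :: real) has_derivative (\<lambda>h. 0)) (at x)" by (rule has_derivative_const)
    from has_derivative_transform_within_open[OF this o z]
    have "(\<psi> has_derivative (\<lambda>h. 0)) (at x)" .
    from has_derivative_unique[OF D(1) this] have "blinfun_apply (D x) = (\<lambda>h. 0)" .
    then show ?thesis by (intro blinfun_eqI) simp
  qed
  have Dr: "norm (D x) \<le> r" for x
    using bspec[OF b1, of x] D0[of x] by (cases "x \<in> ?K") (auto simp: r_def)
  have "\<bar>\<psi> x\<bar> \<le> r" for x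
    using bspec[OF b0, of x] K[of x] by (cases "\<psi> x = 0") (auto simp: r_def)
  moreover have "\<psi> x = 0" if "r \<le> norm x" for x
    using bspec[OF b2, of x] K[of x] that by (cases "\<psi> x = 0") (auto simp: r_def)
  moreover have "\<bar>\<psi> x - \<psi> y\<bar> \<le> r * norm (x - y)" for x y
    using differentiable_bound[of UNIV \<psi> "\<lambda>x. blinfun_apply (D x)" r x y] D(1) Dr
    by (simp add: norm_blinfun.rep_eq)
  ultimately show ?thesis
    by (intro exI[of _ r] allI impI conjI)
      (meson order_trans mult_right_mono norm_ge_zero)+
qed

lemma mother_wavelets_bounds:
  fixes \<Psi> :: "nat \<Rightarrow> real ^ 'n::finite \<Rightarrow> real"
  assumes "mother_wavelets \<Psi>"
  obtains R where "R \<ge> 1" "\<And>e x. e < 2 ^ CARD('n) - 1 \<Longrightarrow> \<bar>\<Psi> e x\<bar> \<le> R"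
    "\<And>e x y. e < 2 ^ CARD('n) - 1 \<Longrightarrow> \<bar>\<Psi> e x - \<Psi> e y\<bar> \<le> R * norm (x - y)"
    "\<And>e x. e < 2 ^ CARD('n) - 1 \<Longrightarrow> R \<le> norm x \<Longrightarrow> \<Psi> e x = 0"
proof -
  have "\<forall>e. \<exists>r. e < 2 ^ CARD('n) - 1 \<longrightarrow> (\<forall>R\<ge>r. (\<forall>x. \<bar>\<Psi> e x\<bar> \<le> R)
     \<and> (\<forall>x y. \<bar>\<Psi> e x - \<Psi> e y\<bar> \<le> R * norm (x - y)) \<and> (\<forall>x. R \<le> norm x \<longrightarrow> \<Psi> e x = 0))"
    using assms C1_compact_support_bounds unfolding mother_wavelets_def by metis
  then obtain r where r: "\<And>e R. e < 2 ^ CARD('n) - 1 \<Longrightarrow> r e \<le> R \<Longrightarrow> (\<forall>x. \<bar>\<Psi> e x\<bar> \<le> R)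
     \<and> (\<forall>x y. \<bar>\<Psi> e x - \<Psi> e y\<bar> \<le> R * norm (x - y)) \<and> (\<forall>x. R \<le> norm x \<longrightarrow> \<Psi> e x = 0)"
    by metis
  define R where "R = 1 + (\<Sum>e<2 ^ CARD('n) - 1. \<bar>r e\<bar>)"
  have "r e \<le> R" if "e < 2 ^ CARD('n) - 1" for e
    using member_le_sum[of e "{..<2 ^ CARD('n) - 1}" "\<lambda>e. \<bar>r e\<bar>"] that by (simp add: R_def)
  moreover have "R \<ge> 1" by (simp add: R_def sum_nonneg)
  ultimately show ?thesis using r by (intro that[of R]) blast+
qed

lemma wavelet_to_torus:
  "wavelet \<Psi> k (e, m) (to_torus u) = (\<Sum>\<^sub>\<infinity>l. \<Psi> e ((2 ^ k) *\<^sub>R (u - int_vec l) - int_vec m))"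
  by (simp add: wavelet.abs_eq)

text \<open>Since \<open>2 ^ k \<ge> 1\<close>, the condition at scale \<open>k\<close> is stronger
  than the one at scale 0. The number of relevant periods is therefore bounded independently of
  \<open>k\<close>.\<close>

lemma near_lattice_terms:
  fixes u :: "real ^ 'n::finite"
  assumes R: "0 \<le> R"
  shows "finite {l. norm ((2 ^ k) *\<^sub>R (u - int_vec l) - int_vec m) < R}" (is "finite ?L")
    and "real (card {l. norm ((2 ^ k) *\<^sub>R (u - int_vec l) - int_vec m) < R}) \<le> (2 * R + 1) ^ CARD('n)"
proof -
  define v where "v = u - (1 / 2 ^ k) *\<^sub>R int_vec m"
  have sub: "?L \<subseteq> {l. norm (int_vec l - v) < R}"
  proof safe
    fix l assume "norm ((2 ^ k) *\<^sub>R (u - int_vec l) - int_vec m) < R"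
    moreover have "(2 ^ k) *\<^sub>R (u - int_vec l) - int_vec m = (2 ^ k) *\<^sub>R (v - int_vec l)"
      by (simp add: v_def algebra_simps)
    ultimately have "2 ^ k * norm (v - int_vec l) < R" by simp
    moreover have "1 * norm (v - int_vec l) \<le> 2 ^ k * norm (v - int_vec l)"
      by (intro mult_right_mono) auto
    ultimately show "norm (int_vec l - v) < R" by (simp add: norm_minus_commute)
  qed
  show "finite ?L" using sub card_near_ints(1)[OF R, of v] finite_subset by blast
  have "real (card ?L) \<le> real (card {l. norm (int_vec l - v) < R})"
    using card_mono[OF card_near_ints(1)[OF R, of v] sub] by simp
  then show "real (card ?L) \<le> (2 * R + 1) ^ CARD('n)"
    using card_near_ints(2)[OF R, of v] by linarith
qed

context
  fixes \<Psi> :: "nat \<Rightarrow> real ^ 'n::finite \<Rightarrow> real" and R :: real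
  assumes R: "R \<ge> 1"
    and \<Psi>_le: "\<And>e x. e < 2 ^ CARD('n) - 1 \<Longrightarrow> \<bar>\<Psi> e x\<bar> \<le> R"
    and \<Psi>_Lipschitz: "\<And>e x y. e < 2 ^ CARD('n) - 1 \<Longrightarrow> \<bar>\<Psi> e x - \<Psi> e y\<bar> \<le> R * norm (x - y)"
    and \<Psi>_support: "\<And>e x. e < 2 ^ CARD('n) - 1 \<Longrightarrow> R \<le> norm x \<Longrightarrow> \<Psi> e x = 0"
begin

text \<open>The index set may be larger than necessary, so that the values at two points can be
  written over one common set and subtracted termwise.\<close>

lemma wavelet_finite_sum:
  assumes e: "e < 2 ^ CARD('n) - 1" and L: "finite L"
    and sub: "{l. norm ((2 ^ k) *\<^sub>R (u - int_vec l) - int_vec m) < R} \<subseteq> L"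
  shows "wavelet \<Psi> k (e, m) (to_torus u) = (\<Sum>l\<in>L. \<Psi> e ((2 ^ k) *\<^sub>R (u - int_vec l) - int_vec m))"
proof -
  have "(\<Sum>\<^sub>\<infinity>l. \<Psi> e ((2 ^ k) *\<^sub>R (u - int_vec l) - int_vec m))
      = (\<Sum>\<^sub>\<infinity>l\<in>L. \<Psi> e ((2 ^ k) *\<^sub>R (u - int_vec l) - int_vec m))"
  proof (rule infsum_cong_neutral)
    fix l assume "l \<in> UNIV - L"
    then show "\<Psi> e ((2 ^ k) *\<^sub>R (u - int_vec l) - int_vec m) = 0"
      using sub by (intro \<Psi>_support[OF e]) (auto simp flip: not_less)
  qed auto
  then show ?thesis using L by (simp add: wavelet_to_torus)
qed

lemma wavelet_abs_le:
  assumes j: "j \<in> wavelet_index k"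
  shows "\<bar>wavelet \<Psi> k j x\<bar> \<le> (2 * R + 1) ^ CARD('n) * R"
proof -
  obtain e m where em: "j = (e, m)" "e < 2 ^ CARD('n) - 1"
    using j by (auto simp: wavelet_index_def)
  obtain u where u: "x = to_torus u" by (rule to_torus_cases)
  let ?L = "{l. norm ((2 ^ k) *\<^sub>R (u - int_vec l) - int_vec m) < R}"
  have L: "finite ?L" "real (card ?L) \<le> (2 * R + 1) ^ CARD('n)"
    using near_lattice_terms[of R k u m] R by auto
  have "\<bar>wavelet \<Psi> k j x\<bar> \<le> (\<Sum>l\<in>?L. \<bar>\<Psi> e ((2 ^ k) *\<^sub>R (u - int_vec l) - int_vec m)\<bar>)"
    unfolding u em(1) wavelet_finite_sum[OF em(2) L(1) subset_refl] by (rule sum_abs)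
  also have "\<dots> \<le> (\<Sum>l\<in>?L. R)" by (intro sum_mono \<Psi>_le em)
  also have "\<dots> = real (card ?L) * R" by simp
  also have "\<dots> \<le> (2 * R + 1) ^ CARD('n) * R" using L R by (intro mult_right_mono) auto
  finally show ?thesis .
qed

text \<open>Representatives of the two points are chosen almost as close as the torus distance; the
  slack \<open>\<epsilon>\<close> is there because the infimum over the lattice is not known to be
  attained. Then each of the boundedly many terms changes by at most \<open>R * 2 ^ k\<close> times
  that distance.\<close>

lemma wavelet_Lipschitz:
  assumes j: "j \<in> wavelet_index k"
  shows "\<bar>wavelet \<Psi> k j x - wavelet \<Psi> k j y\<bar> \<le> 2 * (2 * R + 1) ^ CARD('n) * R * 2 ^ k * dist x y"
proof (rule field_le_epsilon)
  fix \<epsilon> :: real assume \<epsilon>: "0 < \<epsilon>"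
  define c where "c = 2 * (2 * R + 1) ^ CARD('n) * R * 2 ^ k"
  have c: "c > 0" using R by (simp add: c_def)
  obtain e m where em: "j = (e, m)" "e < 2 ^ CARD('n) - 1"
    using j by (auto simp: wavelet_index_def)
  obtain u where u: "x = to_torus u" by (rule to_torus_cases)
  obtain v0 where v0: "y = to_torus v0" by (rule to_torus_cases)
  have "dist (to_torus u) (to_torus v0) < dist x y + \<epsilon> / c" using \<epsilon> c by (simp add: u v0)
  then obtain l0 where l0: "norm (u - v0 - int_vec l0) < dist x y + \<epsilon> / c"
    unfolding dist_to_torus_less_iff by blast
  define v where "v = v0 + int_vec l0"
  have v: "y = to_torus v" unfolding v0 v_def torus.abs_eq_iff torus_rel_def
    by (rule exI[of _ "- l0"]) simp
  let ?L = "\<lambda>u. {l. norm ((2 ^ k) *\<^sub>R (u - int_vec l) - int_vec m) < R}"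
  let ?t = "\<lambda>u l. (2 ^ k) *\<^sub>R (u - int_vec l) - int_vec m"
  have L: "finite (?L u)" "real (card (?L u)) \<le> (2 * R + 1) ^ CARD('n)" for u
    using near_lattice_terms[of R k u m] R by auto
  let ?K = "?L u \<union> ?L v"
  have fK: "finite ?K" using L by blast
  have cK: "real (card ?K) \<le> 2 * (2 * R + 1) ^ CARD('n)"
    using card_Un_le[of "?L u" "?L v"] L(2)[of u] L(2)[of v] by linarith
  have "wavelet \<Psi> k j x - wavelet \<Psi> k j y = (\<Sum>l\<in>?K. \<Psi> e (?t u l) - \<Psi> e (?t v l))"
    unfolding u v em(1) sum_subtractf
    by (subst (1 2) wavelet_finite_sum[OF em(2) fK]) auto
  then have "\<bar>wavelet \<Psi> k j x - wavelet \<Psi> k j y\<bar> \<le> (\<Sum>l\<in>?K. \<bar>\<Psi> e (?t u l) - \<Psi> e (?t v l)\<bar>)"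
    by (simp only: sum_abs)
  also have "\<dots> \<le> (\<Sum>l\<in>?K. R * (2 ^ k * norm (u - v)))"
  proof (rule sum_mono)
    fix l
    have "?t u l - ?t v l = (2 ^ k) *\<^sub>R (u - v)" by (simp add: algebra_simps)
    then have "norm (?t u l - ?t v l) = 2 ^ k * norm (u - v)" by simp
    then show "\<bar>\<Psi> e (?t u l) - \<Psi> e (?t v l)\<bar> \<le> R * (2 ^ k * norm (u - v))"
      using \<Psi>_Lipschitz[OF em(2), of "?t u l" "?t v l"] by simp
  qed
  also have "\<dots> = real (card ?K) * (R * (2 ^ k * norm (u - v)))" by simp
  also have "\<dots> \<le> 2 * (2 * R + 1) ^ CARD('n) * (R * (2 ^ k * norm (u - v)))"
    using cK R by (intro mult_right_mono) auto
  also have "\<dots> = c * norm (u - v)" by (simp add: c_def)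
  also have "\<dots> \<le> c * (dist x y + \<epsilon> / c)"
    using l0 c by (intro mult_left_mono) (auto simp: v_def diff_diff_eq)
  also have "\<dots> = c * dist x y + \<epsilon>" using c by (simp add: field_simps)
  finally show "\<bar>wavelet \<Psi> k j x - wavelet \<Psi> k j y\<bar>
      \<le> 2 * (2 * R + 1) ^ CARD('n) * R * 2 ^ k * dist x y + \<epsilon>" by (simp add: c_def)
qed

lemma wavelet_nonzero_near:
  assumes "e < 2 ^ CARD('n) - 1" "wavelet \<Psi> k (e, m) (to_torus u) \<noteq> 0"
  obtains l where "norm (int_vec (m + (2 ^ k) *s l) - (2 ^ k) *\<^sub>R u) < R"
proof -
  let ?L = "{l. norm ((2 ^ k) *\<^sub>R (u - int_vec l) - int_vec m) < R}"
  have "finite ?L" using near_lattice_terms[of R k u m] R by auto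
  from wavelet_finite_sum[OF assms(1) this subset_refl] assms(2)
  have "?L \<noteq> {}" by (metis sum.empty)
  then obtain l where l: "norm ((2 ^ k) *\<^sub>R (u - int_vec l) - int_vec m) < R" by blast
  have "int_vec (m + (2 ^ k) *s l) - (2 ^ k) *\<^sub>R u = - ((2 ^ k) *\<^sub>R (u - int_vec l) - int_vec m)"
    by (simp add: vec_eq_iff int_vec_def algebra_simps)
  then have "norm (int_vec (m + (2 ^ k) *s l) - (2 ^ k) *\<^sub>R u) < R" using l by (simp only: norm_minus_cancel)
  then show ?thesis by (rule that)
qed

text \<open>A wavelet that is nonzero at \<open>x\<close> has a period \<open>m + 2 ^ k * l\<close>
  within \<open>R\<close> of \<open>2 ^ k * u\<close>. This assignment is injective because
  \<open>m\<close> is the residue modulo \<open>2 ^ k\<close>, and the number of integer vectors in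
  that ball does not depend on \<open>k\<close>.\<close>

lemma card_wavelets_at_point:
  "real (card {j \<in> wavelet_index k. wavelet \<Psi> k j x \<noteq> 0}) \<le> 2 ^ CARD('n) * (2 * R + 1) ^ CARD('n)"
proof -
  obtain u where u: "x = to_torus u" by (rule to_torus_cases)
  let ?J = "{j \<in> wavelet_index k. wavelet \<Psi> k j x \<noteq> 0}"
  let ?N = "{l :: int ^ 'n. norm (int_vec l - (2 ^ k) *\<^sub>R u) < R}"
  have "\<forall>j\<in>?J. \<exists>l. norm (int_vec (snd j + (2 ^ k) *s l) - (2 ^ k) *\<^sub>R u) < R"
  proof
    fix j assume "j \<in> ?J"
    then have "fst j < 2 ^ CARD('n) - 1" "wavelet \<Psi> k (fst j, snd j) (to_torus u) \<noteq> 0"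
      by (auto simp: wavelet_index_def u)
    then show "\<exists>l. norm (int_vec (snd j + (2 ^ k) *s l) - (2 ^ k) *\<^sub>R u) < R"
      by (rule wavelet_nonzero_near[of "fst j" k "snd j" u]) (rule exI)
  qed
  from bchoice[OF this] obtain l
    where l: "\<And>j. j \<in> ?J \<Longrightarrow> norm (int_vec (snd j + (2 ^ k) *s l j) - (2 ^ k) *\<^sub>R u) < R"
    by blast
  define F where "F j = (fst j, snd j + (2 ^ k) *s l j)" for j
  have "inj_on F ?J"
  proof (rule inj_onI)
    fix j j' assume j: "j \<in> ?J" "j' \<in> ?J" "F j = F j'"
    have "snd j $ i = snd j' $ i" for i
    proof -
      have "snd j $ i + 2 ^ k * l j $ i = snd j' $ i + 2 ^ k * l j' $ i"
        using j(3) by (simp add: F_def vec_eq_iff)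
      then have "(snd j $ i + 2 ^ k * l j $ i) mod 2 ^ k = (snd j' $ i + 2 ^ k * l j' $ i) mod 2 ^ k"
        by simp
      then have "snd j $ i mod 2 ^ k = snd j' $ i mod 2 ^ k" by simp
      moreover have "0 \<le> snd j $ i" "snd j $ i < 2 ^ k" "0 \<le> snd j' $ i" "snd j' $ i < 2 ^ k"
        using j by (auto simp: wavelet_index_def)
      ultimately show ?thesis by (simp add: mod_pos_pos_trivial)
    qed
    then show "j = j'" using j(3) by (simp add: F_def prod_eq_iff vec_eq_iff)
  qed
  moreover have "F ` ?J \<subseteq> {..<2 ^ CARD('n) - 1} \<times> ?N"
    using l by (force simp: F_def wavelet_index_def)
  moreover have fN: "finite ?N" using card_near_ints(1)[of R] R by auto
  ultimately have "card ?J \<le> card ({..<2 ^ CARD('n) - 1 :: nat} \<times> ?N)"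
    by (intro card_inj_on_le[of F]) auto
  also have "\<dots> = (2 ^ CARD('n) - 1) * card ?N" by (simp add: card_cartesian_product)
  finally have "real (card ?J) \<le> real ((2 ^ CARD('n) - 1) * card ?N)" by (rule of_nat_mono)
  also have "\<dots> = real (2 ^ CARD('n) - 1) * real (card ?N)" by simp
  also have "\<dots> \<le> 2 ^ CARD('n) * (2 * R + 1) ^ CARD('n)"
    using card_near_ints(2)[of R "(2 ^ k) *\<^sub>R u"] R by (intro mult_mono) (auto simp: of_nat_diff)
  finally show ?thesis .
qed

end

lemma wavelet_bounds:
  fixes \<Psi> :: "nat \<Rightarrow> real ^ 'n::finite \<Rightarrow> real"
  assumes "mother_wavelets \<Psi>"
  obtains b where "b \<ge> 1" "\<And>k j x. j \<in> wavelet_index k \<Longrightarrow> \<bar>wavelet \<Psi> k j x\<bar> \<le> b"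
    "\<And>k j x y. j \<in> wavelet_index k \<Longrightarrow> \<bar>wavelet \<Psi> k j x - wavelet \<Psi> k j y\<bar> \<le> b * 2 ^ k * dist x y"
    "\<And>k x. real (card {j \<in> wavelet_index k. wavelet \<Psi> k j x \<noteq> 0}) \<le> b"
proof -
  obtain R where R: "R \<ge> 1" "\<And>e x. e < 2 ^ CARD('n) - 1 \<Longrightarrow> \<bar>\<Psi> e x\<bar> \<le> R"
    "\<And>e x y. e < 2 ^ CARD('n) - 1 \<Longrightarrow> \<bar>\<Psi> e x - \<Psi> e y\<bar> \<le> R * norm (x - y)"
    "\<And>e x. e < 2 ^ CARD('n) - 1 \<Longrightarrow> R \<le> norm x \<Longrightarrow> \<Psi> e x = 0"
    using mother_wavelets_bounds[OF assms] by metis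
  define b where "b = 2 * 2 ^ CARD('n) * (2 * R + 1) ^ CARD('n) * R"
  have p: "1 \<le> (2::real) ^ CARD('n)" "1 \<le> (2 * R + 1) ^ CARD('n)"
    using R(1) by (auto intro!: one_le_power)
  define q where "q = (2 * R + 1) ^ CARD('n)"
  have q: "1 \<le> q * R" "q \<le> q * R" "q > 0" using p R(1) mult_mono[of 1 q 1 R] mult_left_mono[of 1 R q] by (auto simp: q_def)
  have b_eq: "b = 2 * 2 ^ CARD('n) * (q * R)" by (simp add: b_def q_def)
  have 1: "2 * (q * R) \<le> b" unfolding b_eq using p q by (intro mult_right_mono) auto
  have 2: "2 ^ CARD('n) * q \<le> b"
  proof -
    have "2 ^ CARD('n) * q \<le> 2 ^ CARD('n) * (q * R)" using q p by (intro mult_left_mono) auto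
    also have "\<dots> \<le> b" unfolding b_eq using q p by simp
    finally show ?thesis .
  qed
  show ?thesis
  proof (rule that)
    show "b \<ge> 1" using 1 q by linarith
    show "\<bar>wavelet \<Psi> k j x\<bar> \<le> b" if "j \<in> wavelet_index k" for k j x
      using wavelet_abs_le[of R \<Psi> j k x, OF R that] 1 q by (simp add: q_def)
    show "\<bar>wavelet \<Psi> k j x - wavelet \<Psi> k j y\<bar> \<le> b * 2 ^ k * dist x y" if "j \<in> wavelet_index k" for k j x y
    proof -
      have "2 * (q * R) * (2 ^ k * dist x y) \<le> b * (2 ^ k * dist x y)"
        using 1 by (intro mult_right_mono) auto
      then show ?thesis using wavelet_Lipschitz[of R \<Psi> j k x y, OF R that]
        unfolding q_def mult.assoc by (rule order_trans[rotated])
    qed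
    show "real (card {j \<in> wavelet_index k. wavelet \<Psi> k j x \<noteq> 0}) \<le> b" for k x
      using card_wavelets_at_point[of R \<Psi> k x, OF R] 2 by (simp add: q_def)
  qed
qed

section \<open>Independence and Gaussian estimates\<close>

context prob_space
begin

text \<open>The constant \<^const>\<open>indep_var\<close> requires both variables to take values in the same type.\<close>

definition indep_pair :: "'b measure \<Rightarrow> ('a \<Rightarrow> 'b) \<Rightarrow> 'c measure \<Rightarrow> ('a \<Rightarrow> 'c) \<Rightarrow> bool" where
  "indep_pair S X T Y \<longleftrightarrow> X \<in> measurable M S \<and> Y \<in> measurable M T
     \<and> distr M S X \<Otimes>\<^sub>M distr M T Y = distr M (S \<Otimes>\<^sub>M T) (\<lambda>\<omega>. (X \<omega>, Y \<omega>))"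

lemma indep_pairI: "indep_var S X T Y \<Longrightarrow> indep_pair S X T Y"
  by (simp add: indep_pair_def indep_var_distribution_eq)

lemma indep_pair_compose:
  assumes XY: "indep_pair S X T Y" and f: "f \<in> measurable S S'" and g: "g \<in> measurable T T'"
  shows "indep_pair S' (\<lambda>\<omega>. f (X \<omega>)) T' (\<lambda>\<omega>. g (Y \<omega>))"
proof -
  have [measurable]: "X \<in> measurable M S" "Y \<in> measurable M T"
    using XY by (auto simp: indep_pair_def)
  note [measurable] = f g
  interpret Y: prob_space "distr M T Y" by (rule prob_space_distr) measurable
  interpret Y': prob_space "distr (distr M T Y) T' g" by (rule Y.prob_space_distr) measurable
  have "distr M S' (\<lambda>\<omega>. f (X \<omega>)) \<Otimes>\<^sub>M distr M T' (\<lambda>\<omega>. g (Y \<omega>))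
      = distr (distr M S X) S' f \<Otimes>\<^sub>M distr (distr M T Y) T' g"
    by (simp add: distr_distr comp_def)
  also have "\<dots> = distr (distr M S X \<Otimes>\<^sub>M distr M T Y) (S' \<Otimes>\<^sub>M T') (\<lambda>(x, y). (f x, g y))"
    by (rule pair_measure_distr) (simp_all add: Y'.sigma_finite_measure_axioms)
  also have "\<dots> = distr (distr M (S \<Otimes>\<^sub>M T) (\<lambda>\<omega>. (X \<omega>, Y \<omega>))) (S' \<Otimes>\<^sub>M T') (\<lambda>(x, y). (f x, g y))"
    using XY by (simp add: indep_pair_def)
  also have "\<dots> = distr M (S' \<Otimes>\<^sub>M T') (\<lambda>\<omega>. (f (X \<omega>), g (Y \<omega>)))"
    by (subst distr_distr) (auto simp: comp_def)
  finally show ?thesis by (simp add: indep_pair_def)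
qed

text \<open>Fubini's theorem as conditioning: \<open>Y\<close> is frozen and \<open>X\<close> is
  integrated out with its own law.\<close>

lemma indep_pair_nn_integral:
  assumes ind: "indep_pair S X T Y" and h: "h \<in> borel_measurable (S \<Otimes>\<^sub>M T)"
  shows "(\<integral>\<^sup>+\<omega>. h (X \<omega>, Y \<omega>) \<partial>M) = (\<integral>\<^sup>+\<omega>. (\<integral>\<^sup>+x. h (x, Y \<omega>) \<partial>distr M S X) \<partial>M)"
proof -
  have X: "X \<in> measurable M S" and Y: "Y \<in> measurable M T"
    using ind by (auto simp: indep_pair_def)
  interpret X: prob_space "distr M S X" by (rule prob_space_distr) fact
  interpret Y: prob_space "distr M T Y" by (rule prob_space_distr) fact
  interpret XY: pair_sigma_finite "distr M S X" "distr M T Y" ..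
  have eq: "distr M S X \<Otimes>\<^sub>M distr M T Y = distr M (S \<Otimes>\<^sub>M T) (\<lambda>x. (X x, Y x))"
    using ind by (simp add: indep_pair_def)
  have s: "sets (distr M S X \<Otimes>\<^sub>M distr M T Y) = sets (S \<Otimes>\<^sub>M T)"
    by (intro sets_pair_measure_cong) auto
  have h': "h \<in> borel_measurable (distr M S X \<Otimes>\<^sub>M distr M T Y)"
    using h measurable_cong_sets[OF s refl] by blast
  have "(\<integral>\<^sup>+\<omega>. h (X \<omega>, Y \<omega>) \<partial>M) = (\<integral>\<^sup>+z. h z \<partial>(distr M S X \<Otimes>\<^sub>M distr M T Y))"
    unfolding eq using X Y h by (subst nn_integral_distr) auto
  also have "\<dots> = (\<integral>\<^sup>+y. (\<integral>\<^sup>+x. h (x, y) \<partial>distr M S X) \<partial>distr M T Y)"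
    by (rule XY.nn_integral_snd[symmetric]) (use h' in simp)
  also have "\<dots> = (\<integral>\<^sup>+\<omega>. (\<integral>\<^sup>+x. h (x, Y \<omega>) \<partial>distr M S X) \<partial>M)"
  proof -
    have "(\<lambda>y. \<integral>\<^sup>+x. h (x, y) \<partial>distr M S X) \<in> borel_measurable (distr M T Y)"
      using X.borel_measurable_nn_integral[of "\<lambda>y x. h (x, y)" "distr M T Y"] measurable_pair_swap[OF h']
      by (simp add: case_prod_beta')
    then show ?thesis by (intro nn_integral_distr[OF Y])
  qed
  finally show ?thesis .
qed

text \<open>On a measurable set \<open>A\<close> both measures are computed by integrating out
  \<open>X\<close> first, which leaves the function \<open>g\<close> of \<open>(Y, Z)\<close>.
  Independence of \<open>Y\<close> and \<open>Z\<close>, then of \<open>X\<close> and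
  \<open>Y\<close> with \<open>Z\<close> frozen, then of \<open>(X, Y)\<close> and \<open>Z\<close>
  puts the variables back.\<close>

lemma indep_pair_assoc:
  assumes XY: "indep_pair S X T Y" and XYZ: "indep_pair (S \<Otimes>\<^sub>M T) (\<lambda>\<omega>. (X \<omega>, Y \<omega>)) U Z"
  shows "indep_pair S X (T \<Otimes>\<^sub>M U) (\<lambda>\<omega>. (Y \<omega>, Z \<omega>))"
proof -
  have [measurable]: "X \<in> measurable M S" "Y \<in> measurable M T" "Z \<in> measurable M U"
    using XY XYZ by (auto simp: indep_pair_def)
  have YZ: "indep_pair T Y U Z"
    using indep_pair_compose[OF XYZ measurable_snd measurable_ident] by simp
  interpret X: prob_space "distr M S X" by (rule prob_space_distr) measurable
  interpret YZ: prob_space "distr M (T \<Otimes>\<^sub>M U) (\<lambda>\<omega>. (Y \<omega>, Z \<omega>))" by (rule prob_space_distr) measurable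
  interpret P: pair_sigma_finite "distr M S X" "distr M (T \<Otimes>\<^sub>M U) (\<lambda>\<omega>. (Y \<omega>, Z \<omega>))" ..
  have s: "sets (distr M S X \<Otimes>\<^sub>M distr M (T \<Otimes>\<^sub>M U) (\<lambda>\<omega>. (Y \<omega>, Z \<omega>))) = sets (S \<Otimes>\<^sub>M (T \<Otimes>\<^sub>M U))"
    by (intro sets_pair_measure_cong) auto
  have "distr M S X \<Otimes>\<^sub>M distr M (T \<Otimes>\<^sub>M U) (\<lambda>\<omega>. (Y \<omega>, Z \<omega>))
      = distr M (S \<Otimes>\<^sub>M (T \<Otimes>\<^sub>M U)) (\<lambda>\<omega>. (X \<omega>, (Y \<omega>, Z \<omega>)))" (is "?L = ?R")
  proof (rule measure_eqI)
    fix A assume "A \<in> sets ?L"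
    then have A[measurable]: "A \<in> sets (S \<Otimes>\<^sub>M (T \<Otimes>\<^sub>M U))" using s by simp
    define g where "g = (\<lambda>(y, z). \<integral>\<^sup>+x. indicator A (x, (y, z)) \<partial>distr M S X)"
    have g[measurable]: "g \<in> borel_measurable (T \<Otimes>\<^sub>M U)"
      unfolding g_def by measurable
    have "emeasure ?L A = (\<integral>\<^sup>+z. indicator A z \<partial>?L)"
      using \<open>A \<in> sets ?L\<close> by (simp del: sets_distr sets_pair_measure)
    also have "\<dots> = (\<integral>\<^sup>+y. (\<integral>\<^sup>+x. indicator A (x, y) \<partial>distr M S X) \<partial>distr M (T \<Otimes>\<^sub>M U) (\<lambda>\<omega>. (Y \<omega>, Z \<omega>)))"
      using \<open>A \<in> sets ?L\<close> by (intro P.nn_integral_snd[symmetric]) (simp del: sets_distr sets_pair_measure)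
    also have "\<dots> = (\<integral>\<^sup>+y. g y \<partial>distr M (T \<Otimes>\<^sub>M U) (\<lambda>\<omega>. (Y \<omega>, Z \<omega>)))"
      by (simp add: g_def case_prod_beta)
    also have "\<dots> = (\<integral>\<^sup>+\<omega>. g (Y \<omega>, Z \<omega>) \<partial>M)" by (subst nn_integral_distr) auto
    also have "\<dots> = (\<integral>\<^sup>+\<omega>. (\<integral>\<^sup>+y. g (y, Z \<omega>) \<partial>distr M T Y) \<partial>M)"
      by (rule indep_pair_nn_integral[OF YZ g])
    also have "\<dots> = (\<integral>\<^sup>+\<omega>. (\<integral>\<^sup>+\<omega>'. g (Y \<omega>', Z \<omega>) \<partial>M) \<partial>M)"
    proof (rule nn_integral_cong)
      fix \<omega> assume "\<omega> \<in> space M"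
      then have [simp]: "Z \<omega> \<in> space U" by (meson \<open>Z \<in> measurable M U\<close> measurable_space)
      show "(\<integral>\<^sup>+y. g (y, Z \<omega>) \<partial>distr M T Y) = (\<integral>\<^sup>+\<omega>'. g (Y \<omega>', Z \<omega>) \<partial>M)"
        by (subst nn_integral_distr) auto
    qed
    also have "\<dots> = (\<integral>\<^sup>+\<omega>. (\<integral>\<^sup>+xy. indicator A (fst xy, (snd xy, Z \<omega>)) \<partial>distr M (S \<Otimes>\<^sub>M T) (\<lambda>\<omega>. (X \<omega>, Y \<omega>))) \<partial>M)"
    proof (rule nn_integral_cong)
      fix \<omega> assume "\<omega> \<in> space M"
      then have Z[simp]: "Z \<omega> \<in> space U" by (meson \<open>Z \<in> measurable M U\<close> measurable_space)
      have "(\<lambda>xy. indicator A (fst xy, (snd xy, Z \<omega>))) \<in> borel_measurable (S \<Otimes>\<^sub>M T)"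
        by measurable
      from indep_pair_nn_integral[OF XY this]
      show "(\<integral>\<^sup>+\<omega>'. g (Y \<omega>', Z \<omega>) \<partial>M) = (\<integral>\<^sup>+xy. indicator A (fst xy, (snd xy, Z \<omega>)) \<partial>distr M (S \<Otimes>\<^sub>M T) (\<lambda>\<omega>. (X \<omega>, Y \<omega>)))"
        by (subst nn_integral_distr) (auto simp: g_def)
    qed
    also have "\<dots> = (\<integral>\<^sup>+\<omega>. indicator A (X \<omega>, (Y \<omega>, Z \<omega>)) \<partial>M)"
      using indep_pair_nn_integral[OF XYZ, of "\<lambda>z. indicator A (fst (fst z), (snd (fst z), snd z))"]
      by simp
    also have "\<dots> = (\<integral>\<^sup>+z. indicator A z \<partial>?R)" by (subst nn_integral_distr) auto
    also have "\<dots> = emeasure ?R A" by simp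
    finally show "emeasure ?L A = emeasure ?R A" .
  qed (simp only: s sets_distr)
  then show ?thesis by (simp add: indep_pair_def)
qed

end

section \<open>Interval probabilities of the standard Gaussian\<close>

definition std_normal :: "real measure" where
  "std_normal = density lborel (\<lambda>x. ennreal (std_normal_density x))"

lemma sets_std_normal [simp, measurable_cong]: "sets std_normal = sets borel"
  by (simp add: std_normal_def)

lemma nn_integral_abs_std_normal: "(\<integral>\<^sup>+x. ennreal \<bar>x\<bar> \<partial>std_normal) \<le> 1"
proof -
  have hb: "has_bochner_integral lborel (\<lambda>x. std_normal_density x * \<bar>x\<bar>) (sqrt (2 / pi))"
    using std_normal_moment_abs_odd[of 0] by simp
  have "(\<integral>\<^sup>+x. ennreal \<bar>x\<bar> \<partial>std_normal) = (\<integral>\<^sup>+x. ennreal (std_normal_density x * \<bar>x\<bar>) \<partial>lborel)"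
    unfolding std_normal_def by (subst nn_integral_density) (auto simp: ennreal_mult)
  also have "\<dots> = ennreal (sqrt (2 / pi))"
    using nn_integral_eq_integral[of lborel "\<lambda>x. std_normal_density x * \<bar>x\<bar>"] hb
    by (auto simp: has_bochner_integral_iff)
  also have "\<dots> \<le> ennreal 1" using pi_gt3 by (intro ennreal_leI) (simp add: real_le_lsqrt)
  finally show ?thesis by simp
qed

text \<open>The set is an interval of length \<open>2 * \<epsilon> / \<bar>a\<bar>\<close>. Above,
  the density is at most 1; below, it is decreasing in \<open>\<bar>w\<bar>\<close>, and
  \<open>D\<close> bounds \<open>\<bar>w\<bar>\<close> on the interval.\<close>

lemma std_normal_interval:
  assumes "a \<noteq> 0" "0 \<le> \<epsilon>"
  shows "emeasure std_normal {w. \<bar>a * w + t\<bar> \<le> \<epsilon>} \<le> ennreal (2 * \<epsilon> / \<bar>a\<bar>)"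
    and "(\<bar>t\<bar> + \<epsilon>) / \<bar>a\<bar> \<le> D \<Longrightarrow>
      ennreal (std_normal_density D * (2 * \<epsilon> / \<bar>a\<bar>)) \<le> emeasure std_normal {w. \<bar>a * w + t\<bar> \<le> \<epsilon>}"
proof -
  let ?S = "{w. \<bar>a * w + t\<bar> \<le> \<epsilon>}"
  have S: "?S = {- t / a - \<epsilon> / \<bar>a\<bar> .. - t / a + \<epsilon> / \<bar>a\<bar>}"
  proof safe
    fix w assume "\<bar>a * w + t\<bar> \<le> \<epsilon>"
    moreover have "\<bar>a * w + t\<bar> = \<bar>a\<bar> * \<bar>w + t / a\<bar>"
      using assms by (simp add: abs_mult[symmetric] distrib_left)
    ultimately have "\<bar>w + t / a\<bar> \<le> \<epsilon> / \<bar>a\<bar>" using assms by (simp add: field_simps)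
    then show "w \<in> {- t / a - \<epsilon> / \<bar>a\<bar> .. - t / a + \<epsilon> / \<bar>a\<bar>}" by (auto simp: abs_le_iff)
  next
    fix w assume "w \<in> {- t / a - \<epsilon> / \<bar>a\<bar> .. - t / a + \<epsilon> / \<bar>a\<bar>}"
    then have "\<bar>w + t / a\<bar> \<le> \<epsilon> / \<bar>a\<bar>" by (auto simp: abs_le_iff)
    then have "\<bar>a\<bar> * \<bar>w + t / a\<bar> \<le> \<epsilon>" using assms by (simp add: field_simps)
    moreover have "\<bar>a * w + t\<bar> = \<bar>a\<bar> * \<bar>w + t / a\<bar>"
      using assms by (simp add: abs_mult[symmetric] distrib_left)
    ultimately show "\<bar>a * w + t\<bar> \<le> \<epsilon>" by simp
  qed
  have Sb: "?S \<in> sets borel" unfolding S by simp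
  have len: "emeasure lborel ?S = ennreal (2 * \<epsilon> / \<bar>a\<bar>)"
    unfolding S using assms by (subst emeasure_lborel_Icc) (auto simp: divide_nonneg_pos)
  have em: "emeasure std_normal ?S = (\<integral>\<^sup>+x. ennreal (std_normal_density x) * indicator ?S x \<partial>lborel)"
    unfolding std_normal_def using Sb by (subst emeasure_density) auto
  have "std_normal_density x \<le> 1" for x
  proof -
    have "1 \<le> sqrt (2 * pi)" using pi_gt3 by simp
    then have "1 / sqrt (2 * pi) * exp (- x\<^sup>2 / 2) \<le> 1 * 1"
      by (intro mult_mono) auto
    then show ?thesis by (simp add: std_normal_density_def)
  qed
  then have "emeasure std_normal ?S \<le> (\<integral>\<^sup>+x. 1 * indicator ?S x \<partial>lborel)"
    unfolding em by (intro nn_integral_mono mult_right_mono) (auto simp: ennreal_le_1)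
  also have "\<dots> = ennreal (2 * \<epsilon> / \<bar>a\<bar>)" using Sb len by simp
  finally show "emeasure std_normal ?S \<le> ennreal (2 * \<epsilon> / \<bar>a\<bar>)" .
  assume D: "(\<bar>t\<bar> + \<epsilon>) / \<bar>a\<bar> \<le> D"
  have low: "std_normal_density D \<le> std_normal_density w" if "w \<in> ?S" for w
  proof -
    have "\<bar>a\<bar> * \<bar>w\<bar> \<le> \<bar>t\<bar> + \<epsilon>" using that by (simp add: abs_mult[symmetric])
    then have "\<bar>w\<bar> \<le> (\<bar>t\<bar> + \<epsilon>) / \<bar>a\<bar>" using assms by (simp add: field_simps)
    then have "\<bar>w\<bar> \<le> D" using D by linarith
    then have "w\<^sup>2 \<le> D\<^sup>2" by (metis abs_ge_zero abs_le_square_iff abs_of_nonneg order_trans)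
    then show ?thesis by (simp add: std_normal_density_def divide_right_mono)
  qed
  have "ennreal (std_normal_density D * (2 * \<epsilon> / \<bar>a\<bar>)) = ennreal (std_normal_density D) * emeasure lborel ?S"
    unfolding len using assms by (subst ennreal_mult) auto
  also have "\<dots> = (\<integral>\<^sup>+x. ennreal (std_normal_density D) * indicator ?S x \<partial>lborel)"
    using Sb by (simp add: nn_integral_cmult_indicator)
  also have "\<dots> \<le> emeasure std_normal ?S"
    unfolding em using low by (intro nn_integral_mono) (auto simp: indicator_def intro!: ennreal_leI)
  finally show "ennreal (std_normal_density D * (2 * \<epsilon> / \<bar>a\<bar>)) \<le> emeasure std_normal ?S" .
qed

text \<open>The constant \<open>b\<close> merges the size, Lipschitz and overlap bounds of the
  wavelets. These follow from \<open>wavelet_basis\<close> by \<open>wavelet_bounds\<close> and are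
  listed only to fix \<open>b\<close> throughout.\<close>

locale random_wavelet_series =
  fixes \<Psi> :: "nat \<Rightarrow> real ^ 'n::finite \<Rightarrow> real"
    and M :: "'w measure"
    and W B :: "nat \<times> nat \<times> (int ^ 'n) \<Rightarrow> 'w \<Rightarrow> real"
    and s p \<beta> \<delta> C b :: real
  assumes s: "0 < s" "s < 1" and p: "1 < p" and \<beta>: "\<beta> > - s"
    and \<delta>: "\<delta> = p * (s + \<beta>)"
    and basis: "wavelet_basis \<Psi>"
    and C: "C > 0" and sep: "separation_property \<Psi> C"
    and weights: "random_weights M \<delta> W B"
    and b: "b \<ge> 1"
    and wavelet_le: "\<And>k j x. j \<in> wavelet_index k \<Longrightarrow> \<bar>wavelet \<Psi> k j x\<bar> \<le> b"
    and wavelet_diff_le: "\<And>k j x y. j \<in> wavelet_index k \<Longrightarrow>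
      \<bar>wavelet \<Psi> k j x - wavelet \<Psi> k j y\<bar> \<le> b * 2 ^ k * dist x y"
    and wavelet_card: "\<And>k x. real (card {j \<in> wavelet_index k. wavelet \<Psi> k j x \<noteq> 0}) \<le> b"
begin

definition I :: "(nat \<times> nat \<times> (int ^ 'n)) set" where
  "I = (SIGMA k:UNIV. wavelet_index k)"

lemma I_iff [simp]: "(k, j) \<in> I \<longleftrightarrow> j \<in> wavelet_index k"
  by (simp add: I_def)

abbreviation c :: "nat \<times> nat \<times> (int ^ 'n) \<Rightarrow> 'w \<Rightarrow> real" where
  "c \<equiv> random_coefficient s \<beta> W B"

definition amp :: "nat \<Rightarrow> real \<Rightarrow> real" where
  "amp k z = 2 powr (- real k * s) * (1 - z) + 2 powr (real k * \<beta>) * z"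

lemma amp_measurable [measurable]: "amp k \<in> borel_measurable borel"
  unfolding amp_def by measurable

lemma c_eq: "c (k, j) \<omega> = W (k, j) \<omega> * amp k (B (k, j) \<omega>)"
  by (simp add: random_coefficient_def amp_def)

text \<open>Because \<open>\<beta> > - s\<close>, the exceptional amplitude is at least the ordinary
  one. So \<open>2 powr (- real k * s)\<close> is a lower bound whatever the Bernoulli variable
  does, and conditioning on it costs nothing in density bounds.\<close>

lemma amp_01:
  assumes "z \<in> {0, 1}"
  shows "2 powr (- real k * s) \<le> amp k z" "amp k z \<le> max 1 (2 powr (real k * \<beta>))"
    "amp k z \<le> 2 powr (- real k * s) + 2 powr (real k * \<beta>) * indicator {1} z"
proof -
  have "- real k * s \<le> real k * \<beta>" using \<beta> mult_left_mono[of "-s" \<beta> "real k"] by simp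
  then have 1: "2 powr (- real k * s) \<le> 2 powr (real k * \<beta>)" by simp
  have 2: "2 powr (- real k * s) \<le> 2 powr 0" using s by (intro powr_mono) auto
  show "2 powr (- real k * s) \<le> amp k z" "amp k z \<le> max 1 (2 powr (real k * \<beta>))"
    "amp k z \<le> 2 powr (- real k * s) + 2 powr (real k * \<beta>) * indicator {1} z"
    using assms 1 2 by (auto simp: amp_def)
qed

sublocale prob_space M
  using weights by (simp add: random_weights_def Let_def)

lemma W_indep: "indep_vars (\<lambda>_. borel) W I"
  and W_distributed: "i \<in> I \<Longrightarrow> distributed M lborel (W i) (\<lambda>x. ennreal (std_normal_density x))"
  and B_indep: "indep_vars (\<lambda>_. borel) B I"
  and B_1: "(k, j) \<in> I \<Longrightarrow> measure M {\<omega> \<in> space M. B (k, j) \<omega> = 1} = 2 powr (- \<delta> * real k)"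
  and B_0: "(k, j) \<in> I \<Longrightarrow> measure M {\<omega> \<in> space M. B (k, j) \<omega> = 0} = 1 - 2 powr (- \<delta> * real k)"
  and WB_indep: "indep_var (Pi\<^sub>M I (\<lambda>_. borel)) (\<lambda>\<omega>. \<lambda>i\<in>I. W i \<omega>) (Pi\<^sub>M I (\<lambda>_. borel)) (\<lambda>\<omega>. \<lambda>i\<in>I. B i \<omega>)"
  using weights unfolding random_weights_def Let_def I_def by auto

lemma W_measurable [measurable]: "i \<in> I \<Longrightarrow> W i \<in> borel_measurable M"
  and B_measurable [measurable]: "i \<in> I \<Longrightarrow> B i \<in> borel_measurable M"
  using W_indep B_indep by (auto simp: indep_vars_def)

lemma distr_W: "i \<in> I \<Longrightarrow> distr M borel (W i) = std_normal"
  using distributed_distr_eq_density[OF W_distributed, of i]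
  unfolding std_normal_def by (metis distr_cong sets_lborel)

lemma c_measurable [measurable]: "i \<in> I \<Longrightarrow> c i \<in> borel_measurable M"
  by (cases i) (simp add: c_eq[abs_def])

lemma AE_B_01:
  assumes "i \<in> I" shows "AE \<omega> in M. B i \<omega> \<in> {0, 1}"
proof -
  obtain k j where i: "i = (k, j)" by (cases i)
  note [measurable] = B_measurable[OF assms]
  have "prob ({\<omega> \<in> space M. B i \<omega> = 1} \<union> {\<omega> \<in> space M. B i \<omega> = 0})
      = prob {\<omega> \<in> space M. B i \<omega> = 1} + prob {\<omega> \<in> space M. B i \<omega> = 0}"
    by (rule finite_measure_Union) auto
  also have "\<dots> = 1" using B_0[of k j] B_1[of k j] assms i by simp
  finally have "prob ({\<omega> \<in> space M. B i \<omega> = 1} \<union> {\<omega> \<in> space M. B i \<omega> = 0}) = 1" .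
  then have "AE \<omega> in M. \<omega> \<in> {\<omega> \<in> space M. B i \<omega> = 1} \<union> {\<omega> \<in> space M. B i \<omega> = 0}"
    by (subst (asm) prob_eq_1) auto
  then show ?thesis by eventually_elim auto
qed

lemma W_B_indep: "i \<in> I \<Longrightarrow> indep_pair borel (W i) borel (B i)"
  using indep_pair_compose[OF indep_pairI[OF WB_indep], of "\<lambda>f. f i" borel "\<lambda>f. f i" borel]
  by (simp add: measurable_component_singleton)

lemma nn_integral_c_le:
  assumes "(k, j) \<in> I"
  shows "(\<integral>\<^sup>+\<omega>. ennreal \<bar>c (k, j) \<omega>\<bar> \<partial>M) \<le> ennreal (2 * 2 powr (- real k * s))"
proof -
  let ?i = "(k, j)"
  note [measurable] = W_measurable[OF assms] B_measurable[OF assms]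
  have "(\<integral>\<^sup>+\<omega>. ennreal \<bar>c ?i \<omega>\<bar> \<partial>M) = (\<integral>\<^sup>+\<omega>. (\<lambda>(x, y). ennreal \<bar>x\<bar> * ennreal \<bar>amp k y\<bar>) (W ?i \<omega>, B ?i \<omega>) \<partial>M)"
    by (simp add: c_eq abs_mult ennreal_mult)
  also have "\<dots> = (\<integral>\<^sup>+\<omega>. (\<integral>\<^sup>+x. ennreal \<bar>x\<bar> * ennreal \<bar>amp k (B ?i \<omega>)\<bar> \<partial>std_normal) \<partial>M)"
    using indep_pair_nn_integral[OF W_B_indep[OF assms], of "\<lambda>(x, y). ennreal \<bar>x\<bar> * ennreal \<bar>amp k y\<bar>"]
    by (simp add: distr_W[OF assms])
  also have "\<dots> \<le> (\<integral>\<^sup>+\<omega>. ennreal (2 powr (- real k * s)) + ennreal (2 powr (real k * \<beta>)) * indicator {\<omega>\<in>space M. B ?i \<omega> = 1} \<omega> \<partial>M)"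
  proof (rule nn_integral_mono_AE)
    show "AE \<omega> in M. (\<integral>\<^sup>+x. ennreal \<bar>x\<bar> * ennreal \<bar>amp k (B ?i \<omega>)\<bar> \<partial>std_normal)
        \<le> ennreal (2 powr (- real k * s)) + ennreal (2 powr (real k * \<beta>)) * indicator {\<omega>\<in>space M. B ?i \<omega> = 1} \<omega>"
      using AE_B_01[OF assms] AE_space
    proof eventually_elim
      case (elim \<omega>)
      have "(\<integral>\<^sup>+x. ennreal \<bar>x\<bar> * ennreal \<bar>amp k (B ?i \<omega>)\<bar> \<partial>std_normal)
          = (\<integral>\<^sup>+x. ennreal \<bar>x\<bar> \<partial>std_normal) * ennreal \<bar>amp k (B ?i \<omega>)\<bar>"
        by (rule nn_integral_multc) auto
      also have "\<dots> \<le> 1 * ennreal \<bar>amp k (B ?i \<omega>)\<bar>"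
        by (intro mult_right_mono nn_integral_abs_std_normal) auto
      also have "\<dots> \<le> ennreal (2 powr (- real k * s) + 2 powr (real k * \<beta>) * indicator {1} (B ?i \<omega>))"
        using amp_01(1,3)[OF elim(1), of k] order_trans[OF powr_ge_zero amp_01(1)[OF elim(1), of k]]
        by (simp add: ennreal_leI del: ennreal_plus)
      also have "\<dots> = ennreal (2 powr (- real k * s)) + ennreal (2 powr (real k * \<beta>)) * indicator {\<omega>\<in>space M. B ?i \<omega> = 1} \<omega>"
        using elim by (auto simp: indicator_def simp flip: ennreal_plus)
      finally show ?case .
    qed
  qed
  also have "\<dots> = ennreal (2 powr (- real k * s)) + ennreal (2 powr (real k * \<beta>)) * emeasure M {\<omega>\<in>space M. B ?i \<omega> = 1}"
    by (subst nn_integral_add) (auto simp: nn_integral_cmult_indicator emeasure_space_1)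
  also have "\<dots> = ennreal (2 powr (- real k * s) + 2 powr (real k * \<beta>) * 2 powr (- \<delta> * real k))"
    using B_1[OF assms] by (simp add: emeasure_eq_measure ennreal_mult)
  also have "\<dots> \<le> ennreal (2 * 2 powr (- real k * s))"
  proof (rule ennreal_leI)
    \<comment> \<open>Here \<open>1 < p\<close> enters: a large coefficient contributes
      \<open>2^(k*(\<beta> - \<delta>))\<close> to the mean, and
      \<open>\<beta> - \<delta> + s = - (p - 1) * (s + \<beta>)\<close>, so this is at most the
      ordinary contribution.\<close>
    have "0 \<le> (p - 1) * (s + \<beta>)" using p \<beta> by simp
    then have "\<beta> - \<delta> \<le> - s" by (simp add: \<delta> algebra_simps)
    then have "real k * (\<beta> - \<delta>) \<le> real k * (- s)" by (intro mult_left_mono) auto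
    then have "2 powr (real k * \<beta> + - \<delta> * real k) \<le> 2 powr (- real k * s)"
      by (intro powr_mono) (auto simp: algebra_simps)
    then show "2 powr (- real k * s) + 2 powr (real k * \<beta>) * 2 powr (- \<delta> * real k) \<le> 2 * 2 powr (- real k * s)"
      by (simp only: powr_add)
  qed
  finally show ?thesis .
qed

text \<open>Isolates one Gaussian: the first component is its amplitude, the second the remaining terms.\<close>

lemma linear_combination_indep:
  assumes i: "(k, j) \<in> J" and J: "finite J" "J \<subseteq> I"
  shows "indep_pair borel (W (k, j)) (borel \<Otimes>\<^sub>M borel)
    (\<lambda>\<omega>. (a (k, j) * amp k (B (k, j) \<omega>), \<Sum>i\<in>J - {(k, j)}. a i * c i \<omega>))"
proof -
  let ?i = "(k, j)"
  let ?P = "\<lambda>A. Pi\<^sub>M A (\<lambda>_. borel :: real measure)"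
  have iI: "?i \<in> I" using i J by auto
  have W2: "indep_var (?P {?i}) (\<lambda>\<omega>. \<lambda>l\<in>{?i}. W l \<omega>) (?P (I - {?i})) (\<lambda>\<omega>. \<lambda>l\<in>I - {?i}. W l \<omega>)"
    by (rule indep_var_restrict[OF W_indep]) (use iI in auto)
  have "indep_pair borel (\<lambda>\<omega>. (\<lambda>l\<in>{?i}. W l \<omega>) ?i) (?P (I - {?i})) (\<lambda>\<omega>. \<lambda>l\<in>I - {?i}. W l \<omega>)"
    by (rule indep_pair_compose[OF indep_pairI[OF W2] _ measurable_ident, unfolded id_apply])
      (simp add: measurable_component_singleton)
  then have XY: "indep_pair borel (W ?i) (?P (I - {?i})) (\<lambda>\<omega>. \<lambda>l\<in>I - {?i}. W l \<omega>)"
    by (simp cong: restrict_cong)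
  have XYZ: "indep_pair (borel \<Otimes>\<^sub>M ?P (I - {?i})) (\<lambda>\<omega>. (W ?i \<omega>, \<lambda>l\<in>I - {?i}. W l \<omega>)) (?P I) (\<lambda>\<omega>. \<lambda>l\<in>I. B l \<omega>)"
  proof -
    have m: "(\<lambda>f. (f ?i, \<lambda>l\<in>I - {?i}. f l)) \<in> measurable (?P I) (borel \<Otimes>\<^sub>M ?P (I - {?i}))"
      using iI by (intro measurable_Pair measurable_component_singleton measurable_restrict) auto
    have "(\<lambda>l\<in>I - {?i}. (\<lambda>i\<in>I. W i \<omega>) l) = (\<lambda>l\<in>I - {?i}. W l \<omega>)" for \<omega>
      by (auto simp: restrict_def)
    then show ?thesis using indep_pair_compose[OF indep_pairI[OF WB_indep] m measurable_ident] iI by simp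
  qed
  \<comment> \<open>The chosen Gaussian is independent of the other Gaussians, and all Gaussians
    together are independent of the Bernoulli family; associativity joins the two facts.\<close>
  have V: "indep_pair borel (W ?i) (?P (I - {?i}) \<Otimes>\<^sub>M ?P I) (\<lambda>\<omega>. (\<lambda>l\<in>I - {?i}. W l \<omega>, \<lambda>l\<in>I. B l \<omega>))"
    by (rule indep_pair_assoc[OF XY XYZ])
  define F where "F = (\<lambda>(f, g). (a ?i * amp k (g ?i), \<Sum>l\<in>J - {?i}. a l * (f l * amp (fst l) (g l :: real))))"
  have F: "F \<in> measurable (?P (I - {?i}) \<Otimes>\<^sub>M ?P I) (borel \<Otimes>\<^sub>M borel)"
    unfolding F_def case_prod_beta
  proof (intro measurable_Pair borel_measurable_times borel_measurable_sum borel_measurable_const)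
    have g: "(\<lambda>x. snd x l) \<in> borel_measurable (?P (I - {?i}) \<Otimes>\<^sub>M ?P I)" if "l \<in> I" for l
      by (rule measurable_compose[OF measurable_snd measurable_component_singleton[OF that]])
    show "(\<lambda>x. amp k (snd x ?i)) \<in> borel_measurable (?P (I - {?i}) \<Otimes>\<^sub>M ?P I)"
      using measurable_compose[OF g[OF iI] amp_measurable] by simp
    fix l assume l: "l \<in> J - {?i}"
    then have lI: "l \<in> I - {?i}" "l \<in> I" using J by auto
    show "(\<lambda>x. fst x l) \<in> borel_measurable (?P (I - {?i}) \<Otimes>\<^sub>M ?P I)"
      by (rule measurable_compose[OF measurable_fst measurable_component_singleton[OF lI(1)]])
    show "(\<lambda>x. amp (fst l) (snd x l)) \<in> borel_measurable (?P (I - {?i}) \<Otimes>\<^sub>M ?P I)"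
      using measurable_compose[OF g[OF lI(2)] amp_measurable] by simp
  qed
  have eq: "F (\<lambda>l\<in>I - {?i}. W l \<omega>, \<lambda>l\<in>I. B l \<omega>)
      = (a ?i * amp k (B ?i \<omega>), \<Sum>i\<in>J - {?i}. a i * c i \<omega>)" for \<omega>
  proof -
    have "(\<Sum>l\<in>J - {?i}. a l * ((\<lambda>l\<in>I - {?i}. W l \<omega>) l * amp (fst l) ((\<lambda>l\<in>I. B l \<omega>) l)))
        = (\<Sum>l\<in>J - {?i}. a l * c l \<omega>)"
    proof (rule sum.cong[OF refl])
      fix l assume l: "l \<in> J - {?i}"
      then have "l \<in> I" "l \<noteq> ?i" using J by auto
      then show "a l * ((\<lambda>l\<in>I - {?i}. W l \<omega>) l * amp (fst l) ((\<lambda>l\<in>I. B l \<omega>) l)) = a l * c l \<omega>"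
        using c_eq[of "fst l" "snd l" \<omega>] by simp
    qed
    then show ?thesis using iI by (simp add: F_def)
  qed
  have "indep_pair borel (\<lambda>\<omega>. W ?i \<omega>) (borel \<Otimes>\<^sub>M borel) (\<lambda>\<omega>. F (\<lambda>l\<in>I - {?i}. W l \<omega>, \<lambda>l\<in>I. B l \<omega>))"
    by (rule indep_pair_compose[OF V _ F]) simp
  then show ?thesis unfolding eq by simp
qed

text \<open>Conditioning on everything except one Gaussian turns the probability into a mean of
  Gaussian interval probabilities, for which both upper and lower bounds are at hand.\<close>

lemma emeasure_linear_combination:
  assumes i: "(k, j) \<in> J" and J: "finite J" "J \<subseteq> I"
  shows "emeasure M {\<omega> \<in> space M. \<bar>(\<Sum>i\<in>J. a i * c i \<omega>) - y\<bar> \<le> \<epsilon>}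
    = (\<integral>\<^sup>+\<omega>. emeasure std_normal {w. \<bar>a (k, j) * amp k (B (k, j) \<omega>) * w
        + ((\<Sum>i\<in>J - {(k, j)}. a i * c i \<omega>) - y)\<bar> \<le> \<epsilon>} \<partial>M)"
proof -
  let ?i = "(k, j)" and ?A = "\<lambda>\<omega>. a (k, j) * amp k (B (k, j) \<omega>)" and ?R = "\<lambda>\<omega>. \<Sum>i\<in>J - {(k, j)}. a i * c i \<omega>"
  have iI: "?i \<in> I" using i J by auto
  have [measurable]: "i \<in> J \<Longrightarrow> c i \<in> borel_measurable M" for i using J by auto
  define h :: "real \<times> real \<times> real \<Rightarrow> ennreal" where
    "h = (\<lambda>(w, A, r). indicator {w. \<bar>A * w + (r - y)\<bar> \<le> \<epsilon>} w)"
  have h: "h \<in> borel_measurable (borel \<Otimes>\<^sub>M (borel \<Otimes>\<^sub>M borel))"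
  proof -
    have "h = indicator {z. \<bar>fst (snd z) * fst z + (snd (snd z) - y)\<bar> \<le> \<epsilon>}"
      by (auto simp: h_def fun_eq_iff indicator_def)
    moreover have "{z \<in> space (borel \<Otimes>\<^sub>M (borel \<Otimes>\<^sub>M borel)). \<bar>fst (snd z) * fst z + (snd (snd z) - y)\<bar> \<le> \<epsilon>}
        \<in> sets (borel \<Otimes>\<^sub>M (borel \<Otimes>\<^sub>M borel) :: (real \<times> real \<times> real) measure)" by measurable
    ultimately show ?thesis by (simp add: space_pair_measure)
  qed
  have split: "(\<Sum>i\<in>J. a i * c i \<omega>) = ?A \<omega> * W ?i \<omega> + ?R \<omega>" for \<omega>
    using J i by (subst sum.remove[OF J(1) i]) (simp add: c_eq ac_simps)
  have "emeasure M {\<omega> \<in> space M. \<bar>(\<Sum>i\<in>J. a i * c i \<omega>) - y\<bar> \<le> \<epsilon>}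
      = (\<integral>\<^sup>+\<omega>. indicator {\<omega> \<in> space M. \<bar>(\<Sum>i\<in>J. a i * c i \<omega>) - y\<bar> \<le> \<epsilon>} \<omega> \<partial>M)"
    by (rule nn_integral_indicator[symmetric]) measurable
  also have "\<dots> = (\<integral>\<^sup>+\<omega>. h (W ?i \<omega>, (?A \<omega>, ?R \<omega>)) \<partial>M)"
    by (rule nn_integral_cong) (simp add: h_def split indicator_def add_diff_eq)
  also have "\<dots> = (\<integral>\<^sup>+\<omega>. (\<integral>\<^sup>+x. h (x, (?A \<omega>, ?R \<omega>)) \<partial>std_normal) \<partial>M)"
    using indep_pair_nn_integral[OF linear_combination_indep[OF i J, of a] h] by (simp add: distr_W[OF iI])
  also have "\<dots> = (\<integral>\<^sup>+\<omega>. emeasure std_normal {w. \<bar>?A \<omega> * w + (?R \<omega> - y)\<bar> \<le> \<epsilon>} \<partial>M)"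
    unfolding h_def by (rule nn_integral_cong) (simp add: nn_integral_indicator)
  finally show ?thesis .
qed

text \<open>One coefficient that is not small suffices: given the other variables, the sum is
  Gaussian with standard deviation at least \<open>\<eta> * 2 powr (- real k * s)\<close>, and its
  density is bounded accordingly, whatever the remaining terms are.\<close>

lemma anticoncentration:
  assumes i: "(k, j) \<in> J" and J: "finite J" "J \<subseteq> I" and a: "\<eta> \<le> \<bar>a (k, j)\<bar>" "0 < \<eta>" and \<epsilon>: "0 \<le> \<epsilon>"
  shows "emeasure M {\<omega> \<in> space M. \<bar>(\<Sum>i\<in>J. a i * c i \<omega>) - y\<bar> \<le> \<epsilon>} \<le> ennreal (2 * \<epsilon> * 2 powr (real k * s) / \<eta>)"
proof -
  have iI: "(k, j) \<in> I" using i J by auto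
  have "emeasure M {\<omega> \<in> space M. \<bar>(\<Sum>i\<in>J. a i * c i \<omega>) - y\<bar> \<le> \<epsilon>} \<le> (\<integral>\<^sup>+\<omega>. ennreal (2 * \<epsilon> * 2 powr (real k * s) / \<eta>) \<partial>M)"
    unfolding emeasure_linear_combination[OF i J]
  proof (rule nn_integral_mono_AE)
    show "AE \<omega> in M. emeasure std_normal {w. \<bar>a (k, j) * amp k (B (k, j) \<omega>) * w
        + ((\<Sum>i\<in>J - {(k, j)}. a i * c i \<omega>) - y)\<bar> \<le> \<epsilon>} \<le> ennreal (2 * \<epsilon> * 2 powr (real k * s) / \<eta>)"
      using AE_B_01[OF iI]
    proof eventually_elim
      case (elim \<omega>)
      let ?A = "a (k, j) * amp k (B (k, j) \<omega>)"
      have p: "0 < 2 powr (- real k * s)" by simp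
      have "\<eta> * 2 powr (- real k * s) \<le> \<bar>a (k, j)\<bar> * amp k (B (k, j) \<omega>)"
        using a amp_01(1)[OF elim, of k] by (intro mult_mono) auto
      also have "\<dots> = \<bar>?A\<bar>" using less_le_trans[OF p amp_01(1)[OF elim, of k]] by (simp add: abs_mult)
      finally have A: "\<eta> * 2 powr (- real k * s) \<le> \<bar>?A\<bar>" .
      moreover have "0 < \<eta> * 2 powr (- real k * s)" using a by simp
      ultimately have A0: "?A \<noteq> 0" by linarith
      have "2 * \<epsilon> / \<bar>?A\<bar> \<le> 2 * \<epsilon> / (\<eta> * 2 powr (- real k * s))"
        using A \<epsilon> a A0 p by (intro divide_left_mono mult_pos_pos) auto
      also have "\<dots> = 2 * \<epsilon> * 2 powr (real k * s) / \<eta>" by (simp add: powr_minus field_simps)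
      finally show ?case
        by (intro order_trans[OF std_normal_interval(1)[OF A0 \<epsilon>]] ennreal_leI)
    qed
  qed
  then show ?thesis by (simp add: emeasure_space_1)
qed

end

section \<open>The random series as an integrable function\<close>

lemma borel_measurable_torus_iff [simp]:
  "g \<in> borel_measurable torus_measure \<longleftrightarrow> g \<in> borel_measurable borel"
  using measurable_cong_sets[OF sets_torus_measure refl] by blast

lemma integrable_torus_bounded:
  fixes g :: "'n::finite torus \<Rightarrow> real"
  assumes "g \<in> borel_measurable borel" "\<And>x. \<bar>g x\<bar> \<le> K"
  shows "integrable torus_measure g"
proof -
  interpret prob_space "torus_measure :: 'n torus measure" by (rule prob_space_torus_measure)
  show ?thesis by (rule integrable_const_bound[of _ K]) (use assms in auto)
qed

lemma nn_integral_torus_const: "(\<integral>\<^sup>+x. a \<partial>(torus_measure :: 'n::finite torus measure)) = a"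
proof -
  interpret prob_space "torus_measure :: 'n torus measure" by (rule prob_space_torus_measure)
  show ?thesis by (simp add: emeasure_space_1[simplified])
qed

context random_wavelet_series
begin

text \<open>Markov's inequality keeps the sum of the other terms bounded with probability at least
  1/2. On that event the conditional Gaussian has its centre in a bounded range and a standard
  deviation between two positive bounds, so its density near \<open>y\<close> is bounded
  below.\<close>

lemma concentration_lower:
  fixes E0 R \<epsilon> y \<eta> :: real
  assumes i: "(k, j) \<in> J" and J: "finite J" "J \<subseteq> I"
    and a: "\<eta> \<le> \<bar>a (k, j)\<bar>" "0 < \<eta>" "\<bar>a (k, j)\<bar> \<le> b" and \<epsilon>: "0 \<le> \<epsilon>" "\<epsilon> \<le> 1" and y: "\<bar>y\<bar> \<le> R"
    and E0: "(\<integral>\<^sup>+\<omega>. ennreal \<bar>\<Sum>i\<in>J. a i * c i \<omega>\<bar> \<partial>M) \<le> ennreal E0" "0 \<le> E0"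
  defines "h \<equiv> std_normal_density ((2 * (E0 + 2 * b) + R + 1) / (\<eta> * 2 powr (- real k * s)))
                / (b * max 1 (2 powr (real k * \<beta>)))"
  shows "ennreal (h * \<epsilon>) \<le> emeasure M {\<omega> \<in> space M. \<bar>(\<Sum>i\<in>J. a i * c i \<omega>) - y\<bar> \<le> \<epsilon>}"
proof -
  let ?i = "(k, j)" and ?A = "\<lambda>\<omega>. a (k, j) * amp k (B (k, j) \<omega>)" and ?R = "\<lambda>\<omega>. \<Sum>i\<in>J - {(k, j)}. a i * c i \<omega>"
  \<comment> \<open>Twice the bound for the mean of the remainder: \<open>E0\<close> for the full
    sum and \<open>2 * b\<close> for the term removed from it.\<close>
  let ?r = "2 * (E0 + 2 * b)"
  let ?D = "(?r + R + 1) / (\<eta> * 2 powr (- real k * s))"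
  let ?m = "max 1 (2 powr (real k * \<beta>))"
  have iI: "?i \<in> I" using i J by auto
  have cm[measurable]: "i \<in> J \<Longrightarrow> c i \<in> borel_measurable M" for i using J by auto
  have r0: "0 < ?r" using b E0 by simp
  have ks: "2 powr (- real k * s) \<le> 2 powr 0" using s by (intro powr_mono) auto
  have "(\<integral>\<^sup>+\<omega>. ennreal \<bar>?R \<omega>\<bar> \<partial>M)
      \<le> (\<integral>\<^sup>+\<omega>. ennreal \<bar>\<Sum>i\<in>J. a i * c i \<omega>\<bar> + ennreal b * ennreal \<bar>c ?i \<omega>\<bar> \<partial>M)"
  proof (rule nn_integral_mono)
    fix \<omega>
    have "?R \<omega> = (\<Sum>i\<in>J. a i * c i \<omega>) - a ?i * c ?i \<omega>"
      using J i by (subst sum.remove[OF J(1) i]) simp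
    then have "\<bar>?R \<omega>\<bar> \<le> \<bar>\<Sum>i\<in>J. a i * c i \<omega>\<bar> + \<bar>a ?i\<bar> * \<bar>c ?i \<omega>\<bar>"
      using abs_triangle_ineq4[of "\<Sum>i\<in>J. a i * c i \<omega>" "a ?i * c ?i \<omega>"] by (simp add: abs_mult)
    also have "\<dots> \<le> \<bar>\<Sum>i\<in>J. a i * c i \<omega>\<bar> + b * \<bar>c ?i \<omega>\<bar>"
      using a by (intro add_left_mono mult_right_mono) auto
    finally have "ennreal \<bar>?R \<omega>\<bar> \<le> ennreal (\<bar>\<Sum>i\<in>J. a i * c i \<omega>\<bar> + b * \<bar>c ?i \<omega>\<bar>)"
      by (rule ennreal_leI)
    then show "ennreal \<bar>?R \<omega>\<bar> \<le> ennreal \<bar>\<Sum>i\<in>J. a i * c i \<omega>\<bar> + ennreal b * ennreal \<bar>c ?i \<omega>\<bar>"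
      using b by (simp add: ennreal_mult)
  qed
  also have "\<dots> = (\<integral>\<^sup>+\<omega>. ennreal \<bar>\<Sum>i\<in>J. a i * c i \<omega>\<bar> \<partial>M) + ennreal b * (\<integral>\<^sup>+\<omega>. ennreal \<bar>c ?i \<omega>\<bar> \<partial>M)"
    using i by (subst nn_integral_add) (auto simp: nn_integral_cmult)
  also have "\<dots> \<le> ennreal E0 + ennreal b * ennreal (2 * 1)"
    using nn_integral_c_le[OF iI] ks
    by (intro add_mono E0 mult_left_mono order_trans[OF nn_integral_c_le[OF iI]] ennreal_leI) auto
  also have "\<dots> = ennreal (E0 + 2 * b)"
    using b E0 by (subst ennreal_mult[symmetric]) (auto simp: mult.commute)
  finally have ER: "(\<integral>\<^sup>+\<omega>. ennreal \<bar>?R \<omega>\<bar> \<partial>M) \<le> ennreal (E0 + 2 * b)" .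
  have "ennreal ?r * emeasure M {\<omega>\<in>space M. ?r < \<bar>?R \<omega>\<bar>}
      = (\<integral>\<^sup>+\<omega>. ennreal ?r * indicator {\<omega>\<in>space M. ?r < \<bar>?R \<omega>\<bar>} \<omega> \<partial>M)"
    by (rule nn_integral_cmult_indicator[symmetric]) measurable
  also have "\<dots> \<le> (\<integral>\<^sup>+\<omega>. ennreal \<bar>?R \<omega>\<bar> \<partial>M)"
    by (rule nn_integral_mono) (auto simp: indicator_def intro!: ennreal_leI)
  finally have "ennreal (?r * prob {\<omega>\<in>space M. ?r < \<bar>?R \<omega>\<bar>}) \<le> ennreal (E0 + 2 * b)"
    using ER r0 by (simp add: emeasure_eq_measure ennreal_mult'')
  then have "?r * prob {\<omega>\<in>space M. ?r < \<bar>?R \<omega>\<bar>} \<le> E0 + 2 * b"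
    using b E0 by (subst (asm) ennreal_le_iff) auto
  then have "?r * prob {\<omega>\<in>space M. ?r < \<bar>?R \<omega>\<bar>} \<le> ?r * (1 / 2)" by simp
  then have "prob {\<omega>\<in>space M. ?r < \<bar>?R \<omega>\<bar>} \<le> 1 / 2" using r0 mult_le_cancel_left_pos by blast
  moreover have "prob {\<omega>\<in>space M. \<not> ?r < \<bar>?R \<omega>\<bar>} = 1 - prob {\<omega>\<in>space M. ?r < \<bar>?R \<omega>\<bar>}"
    by (rule prob_neg) measurable
  ultimately have half: "1 / 2 \<le> prob {\<omega>\<in>space M. \<not> ?r < \<bar>?R \<omega>\<bar>}" by simp
  have D: "0 \<le> std_normal_density ?D" by simp
  \<comment> \<open>The factor 2 in the length of the interval cancels the probability 1/2.\<close>
  have "ennreal (h * \<epsilon>) = ennreal (std_normal_density ?D * (2 * \<epsilon> / (b * ?m))) * ennreal (1 / 2)"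
    unfolding h_def using b \<epsilon> D by (subst ennreal_mult[symmetric]) (auto simp: field_simps intro!: divide_nonneg_pos mult_nonneg_nonneg)
  also have "\<dots> \<le> ennreal (std_normal_density ?D * (2 * \<epsilon> / (b * ?m))) * emeasure M {\<omega>\<in>space M. \<not> ?r < \<bar>?R \<omega>\<bar>}"
    unfolding emeasure_eq_measure using half by (intro mult_left_mono ennreal_leI) auto
  also have "\<dots> = (\<integral>\<^sup>+\<omega>. ennreal (std_normal_density ?D * (2 * \<epsilon> / (b * ?m))) * indicator {\<omega>\<in>space M. \<not> ?r < \<bar>?R \<omega>\<bar>} \<omega> \<partial>M)"
    by (rule nn_integral_cmult_indicator[symmetric]) measurable
  also have "\<dots> \<le> emeasure M {\<omega> \<in> space M. \<bar>(\<Sum>i\<in>J. a i * c i \<omega>) - y\<bar> \<le> \<epsilon>}"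
    unfolding emeasure_linear_combination[OF i J]
  proof (rule nn_integral_mono_AE)
    show "AE \<omega> in M. ennreal (std_normal_density ?D * (2 * \<epsilon> / (b * ?m))) * indicator {\<omega>\<in>space M. \<not> ?r < \<bar>?R \<omega>\<bar>} \<omega>
      \<le> emeasure std_normal {w. \<bar>a (k, j) * amp k (B (k, j) \<omega>) * w + (?R \<omega> - y)\<bar> \<le> \<epsilon>}"
      using AE_B_01[OF iI]
    proof eventually_elim
      case (elim \<omega>)
      show ?case
      proof (cases "\<omega> \<in> {\<omega>\<in>space M. \<not> ?r < \<bar>?R \<omega>\<bar>}")
        case True
        then have R: "\<bar>?R \<omega>\<bar> \<le> ?r" by simp
        have p: "0 < 2 powr (- real k * s)" by simp
        have "\<eta> * 2 powr (- real k * s) \<le> \<bar>a (k, j)\<bar> * amp k (B (k, j) \<omega>)"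
          using a amp_01(1)[OF elim, of k] by (intro mult_mono) auto
        also have *: "\<dots> = \<bar>?A \<omega>\<bar>" using less_le_trans[OF p amp_01(1)[OF elim, of k]] by (simp add: abs_mult)
        finally have A: "\<eta> * 2 powr (- real k * s) \<le> \<bar>?A \<omega>\<bar>" .
        have A': "0 < \<eta> * 2 powr (- real k * s)" using a by simp
        then have A0: "?A \<omega> \<noteq> 0" using A by linarith
        have A1: "\<bar>?A \<omega>\<bar> \<le> b * ?m"
          unfolding *[symmetric] using a b amp_01(2)[OF elim, of k] less_le_trans[OF p amp_01(1)[OF elim, of k]]
          by (intro mult_mono) auto
        have "(\<bar>?R \<omega> - y\<bar> + \<epsilon>) / \<bar>?A \<omega>\<bar> \<le> ?D"
          using R y \<epsilon> A A' by (intro frac_le) auto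
        from std_normal_interval(2)[OF A0 \<epsilon>(1) this]
        have "ennreal (std_normal_density ?D * (2 * \<epsilon> / \<bar>?A \<omega>\<bar>)) \<le> emeasure std_normal {w. \<bar>?A \<omega> * w + (?R \<omega> - y)\<bar> \<le> \<epsilon>}" .
        moreover have "std_normal_density ?D * (2 * \<epsilon> / (b * ?m)) \<le> std_normal_density ?D * (2 * \<epsilon> / \<bar>?A \<omega>\<bar>)"
          using A1 A0 \<epsilon> b by (intro mult_left_mono divide_left_mono mult_pos_pos) auto
        ultimately show ?thesis using True by (auto intro: order_trans[OF ennreal_leI])
      qed simp
    qed
  qed
  finally show ?thesis .
qed

section \<open>Wavelet coefficients and partial sums as functions of an element of L1\<close>

abbreviation \<psi> :: "nat \<times> nat \<times> (int ^ 'n) \<Rightarrow> 'n torus \<Rightarrow> real" where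
  "\<psi> i \<equiv> wavelet \<Psi> (fst i) (snd i)"

lemma continuous_on_wavelet: "j \<in> wavelet_index k \<Longrightarrow> continuous_on A (wavelet \<Psi> k j)"
proof (rule lipschitz_on_continuous_on[OF lipschitz_onI])
  fix x y assume "j \<in> wavelet_index k"
  then show "dist (wavelet \<Psi> k j x) (wavelet \<Psi> k j y) \<le> (b * 2 ^ k) * dist x y"
    using wavelet_diff_le by (simp add: dist_real_def)
qed (use b in simp)

lemma wavelet_measurable [measurable]: "j \<in> wavelet_index k \<Longrightarrow> wavelet \<Psi> k j \<in> borel_measurable borel"
  by (rule borel_measurable_continuous_onI[OF continuous_on_wavelet])

lemma integrable_wavelet: "j \<in> wavelet_index k \<Longrightarrow> integrable torus_measure (wavelet \<Psi> k j)"
  by (rule integrable_torus_bounded[OF wavelet_measurable wavelet_le])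

lemma wavelet_orthogonal:
  assumes "i \<in> I" "i' \<in> I"
  shows "(LINT x|torus_measure. \<psi> i x * \<psi> i' x) = (if i = i' then LINT x|torus_measure. (\<psi> i x)\<^sup>2 else 0)"
    and "(LINT x|torus_measure. (\<psi> i x)\<^sup>2) \<noteq> 0"
  using basis assms unfolding wavelet_basis_def orthogonal_basis_L2_def I_def[symmetric] case_prod_beta
  by (auto simp: power2_eq_square)

text \<open>Coefficient with respect to the orthogonal basis. As the wavelets are bounded, it is a
  continuous functional on all of L1, so that the partial sums depend on \<open>f\<close> alone and
  not on the outcome that produced it.\<close>

definition cf :: "nat \<times> nat \<times> (int ^ 'n) \<Rightarrow> 'n l1 \<Rightarrow> real" where
  "cf i f = l1_pairing (\<psi> i) f / (LINT x|torus_measure. (\<psi> i x)\<^sup>2)"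

lemma bounded_linear_cf: "i \<in> I \<Longrightarrow> bounded_linear (cf i)"
  unfolding cf_def[abs_def] divide_inverse
  by (rule bounded_linear_compose[OF bounded_linear_mult_left bounded_linear_l1_pairing[of _ b]])
     (cases i, simp add: wavelet_le)+

lemma cf_measurable [measurable]: "i \<in> I \<Longrightarrow> cf i \<in> borel_measurable borel"
  by (rule borel_measurable_continuous_onI) (rule linear_continuous_on[OF bounded_linear_cf])

lemma cf_wavelet: "i \<in> I \<Longrightarrow> i' \<in> I \<Longrightarrow> cf i (to_l1 (\<psi> i')) = (if i = i' then 1 else 0)"
  using wavelet_orthogonal[of i' i] integrable_wavelet wavelet_measurable
  by (cases i; cases i') (auto simp: cf_def l1_pairing_to_l1)

definition Del :: "nat \<Rightarrow> 'n l1 \<Rightarrow> 'n torus \<Rightarrow> real" where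
  "Del k f x = (\<Sum>j\<in>wavelet_index k. cf (k, j) f * wavelet \<Psi> k j x)"

definition S :: "nat \<Rightarrow> 'n l1 \<Rightarrow> 'n torus \<Rightarrow> real" where
  "S m f x = (\<Sum>k<m. Del k f x)"

text \<open>The class of the continuous function \<open>S m f\<close>. Point values are taken from
  \<open>S\<close>, norm convergence is stated for \<open>SL\<close>.\<close>

definition SL :: "nat \<Rightarrow> 'n l1 \<Rightarrow> 'n l1" where
  "SL m f = (\<Sum>k<m. \<Sum>j\<in>wavelet_index k. cf (k, j) f *\<^sub>R to_l1 (wavelet \<Psi> k j))"

lemma continuous_on_Del: "continuous_on A (Del k f)"
  unfolding Del_def by (intro continuous_intros continuous_on_wavelet)

lemma continuous_on_S: "continuous_on A (S m f)"
  unfolding S_def by (intro continuous_intros continuous_on_Del)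

lemma Del_measurable_pair [measurable]:
  "(\<lambda>z. Del k (fst z) (snd z)) \<in> borel_measurable (borel \<Otimes>\<^sub>M borel)"
  unfolding Del_def
proof (intro borel_measurable_sum borel_measurable_times)
  fix j :: "nat \<times> (int ^ 'n)" assume j: "j \<in> wavelet_index k"
  show "(\<lambda>z. cf (k, j) (fst z)) \<in> borel_measurable (borel \<Otimes>\<^sub>M borel)"
    using j by (intro measurable_compose[OF measurable_fst cf_measurable]) simp
  show "(\<lambda>z. wavelet \<Psi> k j (snd z)) \<in> borel_measurable (borel \<Otimes>\<^sub>M borel)"
    using j by (intro measurable_compose[OF measurable_snd wavelet_measurable])
qed

lemma Del_measurable [measurable (raw)]:
  assumes "f \<in> measurable N borel" "g \<in> measurable N borel"
  shows "(\<lambda>\<omega>. Del k (f \<omega>) (g \<omega>)) \<in> borel_measurable N"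
  using measurable_compose[OF measurable_Pair[OF assms] Del_measurable_pair] by simp

lemma S_measurable [measurable (raw)]:
  assumes "f \<in> measurable N borel" "g \<in> measurable N borel"
  shows "(\<lambda>\<omega>. S k (f \<omega>) (g \<omega>)) \<in> borel_measurable N"
  unfolding S_def using assms by measurable

lemma integrable_S: "integrable torus_measure (S m f)"
  unfolding S_def[abs_def] Del_def
  by (intro Bochner_Integration.integrable_sum integrable_mult_right integrable_wavelet)

lemma SL_eq: "SL m f = to_l1 (S m f)"
proof -
  have "(\<Sum>j\<in>wavelet_index k. cf (k, j) f *\<^sub>R to_l1 (wavelet \<Psi> k j)) = to_l1 (Del k f)" for k
    unfolding Del_def[abs_def]
    by (simp add: scaleR_to_l1 integrable_wavelet sum_to_l1)
  then have "SL m f = (\<Sum>k<m. to_l1 (Del k f))" by (simp add: SL_def)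
  also have "\<dots> = to_l1 (S m f)"
    unfolding S_def[abs_def]
    by (rule sum_to_l1) (auto simp: Del_def[abs_def] intro!: Bochner_Integration.integrable_sum integrable_mult_right integrable_wavelet)
  finally show ?thesis .
qed

lemma continuous_SL: "continuous_on UNIV (SL m)"
  unfolding SL_def
  by (intro continuous_intros linear_continuous_on[OF bounded_linear_cf]) simp

text \<open>The functions that are restored by their own wavelet coefficients; almost every
  \<open>f\<close> under the law is of this kind.\<close>

definition good :: "'n l1 set" where
  "good = {f. (\<lambda>m. norm (f - SL m f)) \<longlonglongrightarrow> 0}"

lemma good_measurable [measurable]: "good \<in> sets borel"
proof -
  have "(\<lambda>f. norm (f - SL m f)) \<in> borel_measurable borel" for m
    by (intro borel_measurable_continuous_onI continuous_intros continuous_SL)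
  then have "{f \<in> space borel. (\<lambda>m. norm (f - SL m f)) \<longlonglongrightarrow> 0} \<in> sets borel"
    by measurable
  then show ?thesis by (simp add: good_def)
qed

section \<open>Almost sure convergence and measurability of the random series\<close>

definition term_l1 :: "nat \<Rightarrow> 'w \<Rightarrow> 'n l1" where
  "term_l1 k \<omega> = (\<Sum>j\<in>wavelet_index k. c (k, j) \<omega> *\<^sub>R to_l1 (wavelet \<Psi> k j))"

abbreviation X :: "'w \<Rightarrow> 'n l1" where
  "X \<equiv> random_series s \<beta> \<Psi> W B"

lemma X_eq: "X \<omega> = (\<Sum>k. term_l1 k \<omega>)"
  by (simp add: random_series_def term_l1_def)

lemma nn_integral_combination_le:
  assumes a: "\<And>j. j \<in> wavelet_index k \<Longrightarrow> \<bar>a j\<bar> \<le> K" and N: "real (card {j \<in> wavelet_index k. a j \<noteq> 0}) \<le> N"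
    and K: "0 \<le> K"
  shows "(\<integral>\<^sup>+\<omega>. ennreal \<bar>\<Sum>j\<in>wavelet_index k. a j * c (k, j) \<omega>\<bar> \<partial>M) \<le> ennreal (2 * N * K * 2 powr (- real k * s))"
proof -
  let ?J = "{j \<in> wavelet_index k. a j \<noteq> 0}"
  have [measurable]: "j \<in> wavelet_index k \<Longrightarrow> c (k, j) \<in> borel_measurable M" for j by simp
  have "(\<integral>\<^sup>+\<omega>. ennreal \<bar>\<Sum>j\<in>wavelet_index k. a j * c (k, j) \<omega>\<bar> \<partial>M)
     \<le> (\<integral>\<^sup>+\<omega>. (\<Sum>j\<in>?J. ennreal K * ennreal \<bar>c (k, j) \<omega>\<bar>) \<partial>M)"
  proof (rule nn_integral_mono)
    fix \<omega>
    have "(\<Sum>j\<in>wavelet_index k. a j * c (k, j) \<omega>) = (\<Sum>j\<in>?J. a j * c (k, j) \<omega>)"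
      by (rule sum.mono_neutral_right) auto
    also have "\<bar>\<dots>\<bar> \<le> (\<Sum>j\<in>?J. \<bar>a j * c (k, j) \<omega>\<bar>)" by (rule sum_abs)
    also have "\<dots> \<le> (\<Sum>j\<in>?J. K * \<bar>c (k, j) \<omega>\<bar>)"
      using a by (intro sum_mono) (auto simp: abs_mult intro!: mult_right_mono)
    finally have "ennreal \<bar>\<Sum>j\<in>wavelet_index k. a j * c (k, j) \<omega>\<bar> \<le> ennreal (\<Sum>j\<in>?J. K * \<bar>c (k, j) \<omega>\<bar>)"
      by (rule ennreal_leI)
    also have "\<dots> = (\<Sum>j\<in>?J. ennreal K * ennreal \<bar>c (k, j) \<omega>\<bar>)"
      using K by (subst sum_ennreal[symmetric]) (auto simp: ennreal_mult)
    finally show "ennreal \<bar>\<Sum>j\<in>wavelet_index k. a j * c (k, j) \<omega>\<bar> \<le> (\<Sum>j\<in>?J. ennreal K * ennreal \<bar>c (k, j) \<omega>\<bar>)" .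
  qed
  also have "\<dots> = (\<Sum>j\<in>?J. ennreal K * (\<integral>\<^sup>+\<omega>. ennreal \<bar>c (k, j) \<omega>\<bar> \<partial>M))"
    by (subst nn_integral_sum) (auto simp: nn_integral_cmult)
  also have "\<dots> \<le> (\<Sum>j\<in>?J. ennreal K * ennreal (2 * 2 powr (- real k * s)))"
    by (intro sum_mono mult_left_mono nn_integral_c_le) auto
  also have "\<dots> = ennreal (real (card ?J) * (K * (2 * 2 powr (- real k * s))))"
    using K by (simp add: ennreal_mult' ennreal_of_nat_eq_real_of_nat)
  also have "\<dots> \<le> ennreal (N * (K * (2 * 2 powr (- real k * s))))"
    using K N by (intro ennreal_leI mult_right_mono) auto
  finally show ?thesis by (simp add: ac_simps)
qed

lemma nn_integral_scale_le:
  "(\<integral>\<^sup>+\<omega>. ennreal \<bar>\<Sum>j\<in>wavelet_index k. wavelet \<Psi> k j x * c (k, j) \<omega>\<bar> \<partial>M) \<le> ennreal (2 * b\<^sup>2 * 2 powr (- real k * s))"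
  using nn_integral_combination_le[of k "\<lambda>j. wavelet \<Psi> k j x" b b] wavelet_le wavelet_card b
  by (simp add: power2_eq_square mult.assoc)

text \<open>Only the at most \<open>2 * b\<close> wavelets that are nonzero at \<open>x\<close> or
  at \<open>z\<close> contribute, each with Lipschitz constant \<open>b * 2 ^ k\<close>.\<close>

lemma nn_integral_scale_diff_le:
  "(\<integral>\<^sup>+\<omega>. ennreal \<bar>\<Sum>j\<in>wavelet_index k. (wavelet \<Psi> k j x - wavelet \<Psi> k j z) * c (k, j) \<omega>\<bar> \<partial>M)
    \<le> ennreal (4 * b\<^sup>2 * 2 ^ k * 2 powr (- real k * s) * dist x z)"
proof -
  have "{j \<in> wavelet_index k. wavelet \<Psi> k j x - wavelet \<Psi> k j z \<noteq> 0}
      \<subseteq> {j \<in> wavelet_index k. wavelet \<Psi> k j x \<noteq> 0} \<union> {j \<in> wavelet_index k. wavelet \<Psi> k j z \<noteq> 0}" by auto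
  then have "card {j \<in> wavelet_index k. wavelet \<Psi> k j x - wavelet \<Psi> k j z \<noteq> 0}
      \<le> card ({j \<in> wavelet_index k. wavelet \<Psi> k j x \<noteq> 0} \<union> {j \<in> wavelet_index k. wavelet \<Psi> k j z \<noteq> 0})"
    by (rule card_mono[rotated]) simp
  also have "\<dots> \<le> card {j \<in> wavelet_index k. wavelet \<Psi> k j x \<noteq> 0} + card {j \<in> wavelet_index k. wavelet \<Psi> k j z \<noteq> 0}"
    by (rule card_Un_le)
  finally have "card {j \<in> wavelet_index k. wavelet \<Psi> k j x - wavelet \<Psi> k j z \<noteq> 0}
      \<le> card {j \<in> wavelet_index k. wavelet \<Psi> k j x \<noteq> 0} + card {j \<in> wavelet_index k. wavelet \<Psi> k j z \<noteq> 0}" .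
  then have "real (card {j \<in> wavelet_index k. wavelet \<Psi> k j x - wavelet \<Psi> k j z \<noteq> 0}) \<le> 2 * b"
    using wavelet_card[of k x] wavelet_card[of k z] by linarith
  from nn_integral_combination_le[OF wavelet_diff_le this] show ?thesis
    using b by (simp add: power2_eq_square ac_simps)
qed

text \<open>The combination is a continuous function of its vector of coefficients, placed in the
  countable product \<open>nat \<Rightarrow> real\<close>, where measurability can be checked by
  coordinates. No measurability of addition on L1 is required.\<close>

lemma combination_measurable:
  assumes J: "finite J" "J \<subseteq> I"
  shows "(\<lambda>\<omega>. \<Sum>i\<in>J. c i \<omega> *\<^sub>R (v i :: 'n l1)) \<in> borel_measurable M"
proof -
  obtain g where g: "bij_betw g {..<card J} J" using ex_bij_betw_nat_finite[OF J(1)] by (auto simp: atLeast0LessThan)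
  have eq: "(\<Sum>i\<in>J. c i \<omega> *\<^sub>R v i) = (\<Sum>l<card J. c (g l) \<omega> *\<^sub>R v (g l))" for \<omega>
    by (rule sum.reindex_bij_betw[OF g, symmetric])
  have gI: "g l \<in> I" if "l < card J" for l using g that J(2) by (auto simp: bij_betw_def)
  define F where "F = (\<lambda>w :: nat \<Rightarrow> real. \<Sum>l<card J. w l *\<^sub>R v (g l))"
  have "continuous_on UNIV F"
    unfolding F_def by (intro continuous_intros continuous_on_product_coordinates)
  then have F: "F \<in> borel_measurable borel" by (rule borel_measurable_continuous_onI)
  have "(\<lambda>\<omega>. \<lambda>l. if l < card J then c (g l) \<omega> else 0) \<in> borel_measurable M"
  proof (rule measurable_coordinatewise_then_product)
    show "(\<lambda>\<omega>. if l < card J then c (g l) \<omega> else 0) \<in> borel_measurable M" for l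
      using c_measurable[OF gI, of l] by (cases "l < card J") auto
  qed
  from measurable_compose[OF this F]
  have "(\<lambda>\<omega>. F (\<lambda>l. if l < card J then c (g l) \<omega> else 0)) \<in> borel_measurable M" .
  moreover have "F (\<lambda>l. if l < card J then c (g l) \<omega> else 0) = (\<Sum>l<card J. c (g l) \<omega> *\<^sub>R v (g l))" for \<omega>
    unfolding F_def by (intro sum.cong refl) simp
  ultimately show ?thesis unfolding eq by simp
qed

definition J :: "nat \<Rightarrow> (nat \<times> nat \<times> (int ^ 'n)) set" where
  "J m = (SIGMA k:{..<m}. wavelet_index k)"

lemma finite_J [simp]: "finite (J m)" and J_subset: "J m \<subseteq> I"
  and J_iff: "(k, j) \<in> J m \<longleftrightarrow> k < m \<and> j \<in> wavelet_index k"
  by (auto simp: J_def I_def)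

lemma sum_J: "(\<Sum>k<m. \<Sum>j\<in>wavelet_index k. g (k, j)) = (\<Sum>i\<in>J m. g i)"
  unfolding J_def by (subst sum.Sigma) auto

text \<open>Padding with zero vectors writes partial sums of different lengths over one index set.
  Their difference is then again a linear combination, hence measurable.\<close>

lemma sum_term_l1:
  assumes "m \<le> N"
  shows "(\<Sum>k<m. term_l1 k \<omega>) = (\<Sum>i\<in>J N. c i \<omega> *\<^sub>R (if fst i < m then to_l1 (\<psi> i) else 0))"
proof -
  have "(\<Sum>k<m. term_l1 k \<omega>) = (\<Sum>i\<in>J m. c i \<omega> *\<^sub>R to_l1 (\<psi> i))"
    unfolding term_l1_def sum_J[symmetric] by simp
  also have "\<dots> = (\<Sum>i\<in>J m. c i \<omega> *\<^sub>R (if fst i < m then to_l1 (\<psi> i) else 0))"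
    by (rule sum.cong) (auto simp: J_def)
  also have "\<dots> = (\<Sum>i\<in>J N. c i \<omega> *\<^sub>R (if fst i < m then to_l1 (\<psi> i) else 0))"
    using assms by (intro sum.mono_neutral_left) (auto simp: J_def)
  finally show ?thesis .
qed

lemma norm_term_l1: "norm (term_l1 k \<omega>) = (LINT x|torus_measure. \<bar>\<Sum>j\<in>wavelet_index k. wavelet \<Psi> k j x * c (k, j) \<omega>\<bar>)"
proof -
  have "term_l1 k \<omega> = to_l1 (\<lambda>x. \<Sum>j\<in>wavelet_index k. c (k, j) \<omega> * wavelet \<Psi> k j x)"
    unfolding term_l1_def by (simp add: scaleR_to_l1 integrable_wavelet sum_to_l1)
  then show ?thesis
    by (subst norm_to_l1[symmetric])
      (auto simp: mult.commute intro!: Bochner_Integration.integrable_sum integrable_mult_right integrable_wavelet)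
qed

lemma powr_neg_eq: "2 powr (- real k * t) = (2 powr (- t)) ^ k"
  by (simp add: powr_power mult.commute)

lemma summable_powr_neg: "0 < t \<Longrightarrow> summable (\<lambda>k. 2 powr (- real k * t))"
  unfolding powr_neg_eq using powr_less_mono[of "- t" 0 2] by (simp add: summable_geometric)

text \<open>By Fubini's theorem the mean norm of the block of scale \<open>k\<close> is at most a
  constant times \<open>2 powr (- real k * s)\<close>, which is summable.\<close>

lemma AE_summable_term: "AE \<omega> in M. summable (\<lambda>k. norm (term_l1 k \<omega>))"
proof -
  let ?d = "\<lambda>k \<omega> x. \<Sum>j\<in>wavelet_index k. wavelet \<Psi> k j x * c (k, j) \<omega>"
  interpret T: prob_space "torus_measure :: 'n torus measure" by (rule prob_space_torus_measure)
  interpret MT: pair_sigma_finite M "torus_measure :: 'n torus measure" ..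
  have m: "(\<lambda>z. ?d k (fst z) (snd z)) \<in> borel_measurable (M \<Otimes>\<^sub>M torus_measure)" for k
  proof (intro borel_measurable_sum borel_measurable_times)
    fix j :: "nat \<times> (int ^ 'n)" assume j: "j \<in> wavelet_index k"
    show "(\<lambda>z. c (k, j) (fst z)) \<in> borel_measurable (M \<Otimes>\<^sub>M torus_measure)"
      using j by (intro measurable_compose[OF measurable_fst c_measurable]) simp
    show "(\<lambda>z. wavelet \<Psi> k j (snd z)) \<in> borel_measurable (M \<Otimes>\<^sub>M torus_measure)"
      using j by (intro measurable_compose[OF measurable_snd]) simp
  qed
  have nm: "ennreal (norm (term_l1 k \<omega>)) = (\<integral>\<^sup>+x. ennreal \<bar>?d k \<omega> x\<bar> \<partial>torus_measure)" for k \<omega>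
    unfolding norm_term_l1
    by (rule nn_integral_eq_integral[symmetric])
      (auto intro!: integrable_abs Bochner_Integration.integrable_sum integrable_mult_left integrable_wavelet)
  have nmm: "(\<lambda>\<omega>. ennreal (norm (term_l1 k \<omega>))) \<in> borel_measurable M" for k
    unfolding nm using m[of k] by (intro T.borel_measurable_nn_integral) (simp add: case_prod_beta')
  have le: "(\<integral>\<^sup>+\<omega>. ennreal (norm (term_l1 k \<omega>)) \<partial>M) \<le> ennreal (2 * b\<^sup>2 * 2 powr (- real k * s))" for k
  proof -
    have "(\<integral>\<^sup>+\<omega>. ennreal (norm (term_l1 k \<omega>)) \<partial>M) = (\<integral>\<^sup>+x. (\<integral>\<^sup>+\<omega>. ennreal \<bar>?d k \<omega> x\<bar> \<partial>M) \<partial>torus_measure)"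
      unfolding nm using m[of k] by (intro MT.Fubini'[symmetric]) (simp add: case_prod_beta')
    also have "\<dots> \<le> (\<integral>\<^sup>+x. ennreal (2 * b\<^sup>2 * 2 powr (- real k * s)) \<partial>(torus_measure :: 'n torus measure))"
      by (intro nn_integral_mono nn_integral_scale_le)
    finally show ?thesis by (simp only: nn_integral_torus_const)
  qed
  have "(\<integral>\<^sup>+\<omega>. (\<Sum>k. ennreal (norm (term_l1 k \<omega>))) \<partial>M) = (\<Sum>k. \<integral>\<^sup>+\<omega>. ennreal (norm (term_l1 k \<omega>)) \<partial>M)"
    by (rule nn_integral_suminf[OF nmm])
  also have "\<dots> \<le> (\<Sum>k. ennreal (2 * b\<^sup>2 * 2 powr (- real k * s)))"
    by (intro suminf_le le) auto
  also have "\<dots> = ennreal (\<Sum>k. 2 * b\<^sup>2 * 2 powr (- real k * s))"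
    by (intro suminf_ennreal2 summable_mult summable_powr_neg s) auto
  also have "\<dots> < \<infinity>" by simp
  finally have "(\<integral>\<^sup>+\<omega>. (\<Sum>k. ennreal (norm (term_l1 k \<omega>))) \<partial>M) \<noteq> \<infinity>" by simp
  then have "AE \<omega> in M. (\<Sum>k. ennreal (norm (term_l1 k \<omega>))) \<noteq> \<infinity>"
    by (intro nn_integral_PInf_AE borel_measurable_suminf_order nmm)
  then show ?thesis
  proof eventually_elim
    case (elim \<omega>)
    then show ?case by (intro summable_suminf_not_top) (auto simp: top_unique)
  qed
qed

text \<open>Where the series diverges, \<^const>\<open>suminf\<close> is a fixed junk value; the set where it converges is
  measurable because the space is complete, so that convergence is the Cauchy property.\<close>

lemma X_measurable [measurable]: "X \<in> borel_measurable M"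
proof -
  let ?P = "\<lambda>m \<omega>. \<Sum>k<m. term_l1 k \<omega>"
  define A where "A = {\<omega> \<in> space M. Cauchy (\<lambda>m. ?P m \<omega>)}"
  have Pm[measurable]: "(\<lambda>\<omega>. ?P m \<omega>) \<in> borel_measurable M" for m
    unfolding sum_term_l1[OF order_refl] by (rule combination_measurable[OF finite_J J_subset])
  have dm[measurable]: "(\<lambda>\<omega>. dist (?P m \<omega>) (?P n \<omega>)) \<in> borel_measurable M" for m n
  proof -
    let ?N = "max m n"
    have "?P m \<omega> - ?P n \<omega> = (\<Sum>i\<in>J ?N. c i \<omega> *\<^sub>R ((if fst i < m then to_l1 (\<psi> i) else 0) - (if fst i < n then to_l1 (\<psi> i) else 0)))" for \<omega>
      by (simp only: sum_term_l1[of m ?N] sum_term_l1[of n ?N] max.cobounded1 max.cobounded2 scaleR_diff_right sum_subtractf)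
    then show ?thesis
      unfolding dist_norm
      by (simp only:) (intro measurable_compose[OF combination_measurable[OF finite_J J_subset]] borel_measurable_continuous_onI continuous_intros)
  qed
  have A[measurable]: "A \<in> sets M"
    unfolding A_def metric_Cauchy_iff2 by measurable
  define X' where "X' \<omega> = (if \<omega> \<in> A then X \<omega> else 0)" for \<omega>
  have "X' \<in> borel_measurable M"
  proof (rule borel_measurable_LIMSEQ_metric)
    fix \<omega> assume "\<omega> \<in> space M"
    show "(\<lambda>m. if \<omega> \<in> A then ?P m \<omega> else 0) \<longlonglongrightarrow> X' \<omega>"
    proof (cases "\<omega> \<in> A")
      case True
      then have "summable (\<lambda>k. term_l1 k \<omega>)"
        unfolding A_def summable_iff_convergent by (simp add: Cauchy_convergent_iff)
      then show ?thesis using True summable_LIMSEQ by (simp add: X'_def X_eq)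
    qed (simp add: X'_def)
  qed measurable
  moreover have "X \<omega> = (if \<omega> \<in> A then X' \<omega> else (THE x. False))" if "\<omega> \<in> space M" for \<omega>
  proof (cases "\<omega> \<in> A")
    case False
    then have "\<not> summable (\<lambda>k. term_l1 k \<omega>)"
      using that unfolding A_def summable_iff_convergent by (simp add: Cauchy_convergent_iff)
    \<comment> \<open>All divergent outcomes share this predicate, so \<open>suminf\<close> has the
      same value at each of them.\<close>
    then have "(\<lambda>x. (\<lambda>k. term_l1 k \<omega>) sums x) = (\<lambda>x. False)" by (auto simp: summable_def)
    then show ?thesis using False by (simp add: X_eq suminf_def)
  qed (simp add: X'_def)
  ultimately show ?thesis
    by (subst measurable_cong[of M X "\<lambda>\<omega>. if \<omega> \<in> A then X' \<omega> else (THE x. False)"]) auto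
qed

text \<open>A continuous functional may be applied to the series term by term, and from scale
  \<open>fst i\<close> on the partial sums have the constant coefficient
  \<open>c i \<omega>\<close>. This identifies the random coefficients as functions of the
  sum.\<close>

lemma AE_X: "AE \<omega> in M. X \<omega> \<in> good \<and> (\<forall>i\<in>I. cf i (X \<omega>) = c i \<omega>)"
  using AE_summable_term
proof eventually_elim
  case (elim \<omega>)
  have "summable (\<lambda>k. term_l1 k \<omega>)" using elim by (rule summable_l1)
  then have lim: "(\<lambda>m. \<Sum>k<m. term_l1 k \<omega>) \<longlonglongrightarrow> X \<omega>"
    unfolding X_eq by (rule summable_LIMSEQ)
  have cf: "cf i (X \<omega>) = c i \<omega>" if i: "i \<in> I" for i
  proof -
    interpret cf: bounded_linear "cf i" by (rule bounded_linear_cf[OF i])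
    have "(\<lambda>m. cf i (\<Sum>k<m. term_l1 k \<omega>)) \<longlonglongrightarrow> cf i (X \<omega>)"
      by (rule cf.tendsto[OF lim])
    moreover have "cf i (\<Sum>k<m. term_l1 k \<omega>) = c i \<omega>" if "fst i < m" for m
    proof -
      have "cf i (\<Sum>k<m. term_l1 k \<omega>) = (\<Sum>i'\<in>J m. c i' \<omega> * cf i (if fst i' < m then to_l1 (\<psi> i') else 0))"
        by (simp only: sum_term_l1[of m m] order_refl cf.sum cf.scaleR real_scaleR_def)
      also have "\<dots> = (\<Sum>i'\<in>J m. if i' = i then c i \<omega> else 0)"
      proof (rule sum.cong[OF refl])
        fix i' assume i': "i' \<in> J m"
        then have "i' \<in> I" "fst i' < m" using J_subset[of m] by (auto simp: J_def)
        then show "c i' \<omega> * cf i (if fst i' < m then to_l1 (\<psi> i') else 0) = (if i' = i then c i \<omega> else 0)"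
          by (simp add: cf_wavelet[OF i])
      qed
      also have "\<dots> = c i \<omega>"
      proof -
        have "i \<in> J m" using that i by (cases i) (simp add: J_iff)
        then show ?thesis by simp
      qed
      finally show ?thesis .
    qed
    then have "eventually (\<lambda>m. cf i (\<Sum>k<m. term_l1 k \<omega>) = c i \<omega>) sequentially"
      by (rule eventually_mono[OF eventually_gt_at_top[of "fst i"]])
    then have "(\<lambda>m. cf i (\<Sum>k<m. term_l1 k \<omega>)) \<longlonglongrightarrow> c i \<omega>" by (rule tendsto_eventually)
    ultimately show ?thesis by (rule LIMSEQ_unique)
  qed
  have "SL m (X \<omega>) = (\<Sum>k<m. term_l1 k \<omega>)" for m
    unfolding SL_def term_l1_def by (intro sum.cong refl) (simp add: cf)
  then have "X \<omega> \<in> good" using tendsto_norm_zero[OF LIM_zero[OF lim]]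
    by (simp add: good_def norm_minus_commute)
  then show ?case using cf by blast
qed

end

context random_wavelet_series
begin

subsection \<open>Estimates under the law of the series\<close>

definition Q :: "'n l1 measure" where
  "Q = series_law M s \<beta> \<Psi> W B"

lemma Q_eq: "Q = distr M borel X"
  by (simp add: Q_def series_law_def)

lemma sets_Q [simp, measurable_cong]: "sets Q = sets borel"
  by (simp add: Q_eq)

lemma space_Q [simp]: "space Q = UNIV"
  by (simp add: Q_eq)

lemma prob_space_Q: "prob_space Q"
  unfolding Q_eq by (rule prob_space_distr) measurable

lemma nn_integral_Q: "h \<in> borel_measurable borel \<Longrightarrow> (\<integral>\<^sup>+f. h f \<partial>Q) = (\<integral>\<^sup>+\<omega>. h (X \<omega>) \<partial>M)"
  unfolding Q_eq by (subst nn_integral_distr[OF X_measurable]) auto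

lemma AE_good: "AE f in Q. f \<in> good"
proof -
  have "AE \<omega> in M. X \<omega> \<in> good" using AE_X by eventually_elim simp
  then show ?thesis unfolding Q_eq by (subst AE_distr_iff) auto
qed

lemma AE_Del_X: "AE \<omega> in M. \<forall>k x. Del k (X \<omega>) x = (\<Sum>j\<in>wavelet_index k. wavelet \<Psi> k j x * c (k, j) \<omega>)"
  using AE_X by eventually_elim (auto simp: Del_def mult.commute intro!: sum.cong)

lemma AE_S_X: "AE \<omega> in M. \<forall>m x. S m (X \<omega>) x = (\<Sum>i\<in>J m. \<psi> i x * c i \<omega>)"
  using AE_Del_X
proof eventually_elim
  case (elim \<omega>)
  then show ?case by (auto simp: S_def sum_J[symmetric])
qed

lemma nn_integral_Del_le: "(\<integral>\<^sup>+f. ennreal \<bar>Del k f x\<bar> \<partial>Q) \<le> ennreal (2 * b\<^sup>2 * 2 powr (- real k * s))"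
proof -
  have "(\<integral>\<^sup>+f. ennreal \<bar>Del k f x\<bar> \<partial>Q) = (\<integral>\<^sup>+\<omega>. ennreal \<bar>Del k (X \<omega>) x\<bar> \<partial>M)"
    by (rule nn_integral_Q) measurable
  also have "\<dots> = (\<integral>\<^sup>+\<omega>. ennreal \<bar>\<Sum>j\<in>wavelet_index k. wavelet \<Psi> k j x * c (k, j) \<omega>\<bar> \<partial>M)"
    by (rule nn_integral_cong_AE) (use AE_Del_X in eventually_elim, simp)
  finally show ?thesis using nn_integral_scale_le by simp
qed

section \<open>Mean oscillation of partial sums and size of tails\<close>

lemma nn_integral_Del_diff_le:
  "(\<integral>\<^sup>+f. ennreal \<bar>Del k f x - Del k f z\<bar> \<partial>Q) \<le> ennreal (4 * b\<^sup>2 * 2 ^ k * 2 powr (- real k * s) * dist x z)"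
proof -
  have "(\<integral>\<^sup>+f. ennreal \<bar>Del k f x - Del k f z\<bar> \<partial>Q) = (\<integral>\<^sup>+\<omega>. ennreal \<bar>Del k (X \<omega>) x - Del k (X \<omega>) z\<bar> \<partial>M)"
    by (rule nn_integral_Q) measurable
  also have "\<dots> = (\<integral>\<^sup>+\<omega>. ennreal \<bar>\<Sum>j\<in>wavelet_index k. (wavelet \<Psi> k j x - wavelet \<Psi> k j z) * c (k, j) \<omega>\<bar> \<partial>M)"
    by (rule nn_integral_cong_AE) (use AE_Del_X in eventually_elim, simp add: left_diff_distrib sum_subtractf)
  finally show ?thesis using nn_integral_scale_diff_le by simp
qed

text \<open>In units of \<open>2^(-m)\<close>: \<open>CARD('n)\<close> for the distance to a dyadic
  point, plus 1 for the radius of the ball whose average is considered. The ball around the dyadic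
  point then contains the ball around the original point.\<close>

definition rad :: real where "rad = real CARD('n) + 1"

definition Cosc :: real where "Cosc = 4 * b\<^sup>2 * rad / (2 powr (1 - s) - 1)"

lemma rad_pos: "rad > 0" by (simp add: rad_def)

lemma two_powr_1_s: "2 powr (1 - s) > 1"
  using s powr_less_mono[of 0 "1 - s" 2] by simp

lemma Cosc_pos: "Cosc > 0"
  using b two_powr_1_s rad_pos by (simp add: Cosc_def)

text \<open>The block of scale \<open>k\<close> changes in the mean by about
  \<open>2^(k*(1-s)) * 2^(-m)\<close>. Since \<open>s < 1\<close>, these contributions grow
  geometrically and the finest scale dominates; \<open>Cosc\<close> is the sum of the geometric
  series.\<close>

lemma nn_integral_S_diff_le:
  assumes d: "dist x z \<le> rad / 2 ^ m"
  shows "(\<integral>\<^sup>+f. ennreal \<bar>S m f z - S m f x\<bar> \<partial>Q) \<le> ennreal (Cosc * 2 powr (- real m * s))"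
proof -
  let ?q = "2 powr (1 - s)"
  have q: "?q > 1" by (rule two_powr_1_s)
  have "(\<integral>\<^sup>+f. ennreal \<bar>S m f z - S m f x\<bar> \<partial>Q) \<le> (\<integral>\<^sup>+f. (\<Sum>k<m. ennreal \<bar>Del k f z - Del k f x\<bar>) \<partial>Q)"
  proof (rule nn_integral_mono)
    fix f
    have "\<bar>S m f z - S m f x\<bar> \<le> (\<Sum>k<m. \<bar>Del k f z - Del k f x\<bar>)"
      unfolding S_def sum_subtractf[symmetric] by (rule sum_abs)
    then have "ennreal \<bar>S m f z - S m f x\<bar> \<le> ennreal (\<Sum>k<m. \<bar>Del k f z - Del k f x\<bar>)"
      by (rule ennreal_leI)
    then show "ennreal \<bar>S m f z - S m f x\<bar> \<le> (\<Sum>k<m. ennreal \<bar>Del k f z - Del k f x\<bar>)"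
      by (simp add: sum_ennreal)
  qed
  also have "\<dots> = (\<Sum>k<m. \<integral>\<^sup>+f. ennreal \<bar>Del k f z - Del k f x\<bar> \<partial>Q)"
    by (rule nn_integral_sum) measurable
  also have "\<dots> \<le> (\<Sum>k<m. ennreal (4 * b\<^sup>2 * rad / 2 ^ m * ?q ^ k))"
  proof (rule sum_mono)
    fix k
    have "2 ^ k * 2 powr (- real k * s) = ?q ^ k"
      by (simp add: powr_realpow[symmetric] powr_powr powr_add[symmetric] powr_power algebra_simps)
    then have "4 * b\<^sup>2 * 2 ^ k * 2 powr (- real k * s) * dist z x = 4 * b\<^sup>2 * ?q ^ k * dist x z"
      by (simp add: dist_commute)
    also have "\<dots> \<le> 4 * b\<^sup>2 * ?q ^ k * (rad / 2 ^ m)"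
      using d by (intro mult_left_mono) auto
    finally show "(\<integral>\<^sup>+f. ennreal \<bar>Del k f z - Del k f x\<bar> \<partial>Q) \<le> ennreal (4 * b\<^sup>2 * rad / 2 ^ m * ?q ^ k)"
      by (intro order_trans[OF nn_integral_Del_diff_le] ennreal_leI) (simp add: ac_simps)
  qed
  also have "\<dots> = ennreal (\<Sum>k<m. 4 * b\<^sup>2 * rad / 2 ^ m * ?q ^ k)"
    using rad_pos by (intro sum_ennreal) (auto intro!: mult_nonneg_nonneg divide_nonneg_nonneg)
  also have "\<dots> \<le> ennreal (Cosc * 2 powr (- real m * s))"
  proof (rule ennreal_leI)
    have "(\<Sum>k<m. ?q ^ k) = (?q ^ m - 1) / (?q - 1)" by (rule geometric_sum) (use q in linarith)
    also have "\<dots> \<le> ?q ^ m / (?q - 1)" using q by (intro divide_right_mono) auto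
    finally have g: "(\<Sum>k<m. ?q ^ k) \<le> ?q ^ m / (?q - 1)" .
    have qm: "?q ^ m = 2 ^ m * 2 powr (- real m * s)"
      by (simp add: powr_realpow[symmetric] powr_powr powr_add[symmetric] powr_power algebra_simps)
    have "(\<Sum>k<m. 4 * b\<^sup>2 * rad / 2 ^ m * ?q ^ k) = 4 * b\<^sup>2 * rad / 2 ^ m * (\<Sum>k<m. ?q ^ k)"
      by (simp add: sum_distrib_left)
    also have "\<dots> \<le> 4 * b\<^sup>2 * rad / 2 ^ m * (?q ^ m / (?q - 1))"
      using rad_pos by (intro mult_left_mono g) auto
    also have "\<dots> = Cosc * 2 powr (- real m * s)" unfolding qm by (simp add: Cosc_def)
    finally show "(\<Sum>k<m. 4 * b\<^sup>2 * rad / 2 ^ m * ?q ^ k) \<le> Cosc * 2 powr (- real m * s)" .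
  qed
  finally show ?thesis .
qed

definition tail :: "nat \<Rightarrow> 'n l1 \<Rightarrow> 'n torus \<Rightarrow> ennreal" where
  "tail m f z = (\<Sum>k. ennreal \<bar>Del (m + k) f z\<bar>)"

text \<open>For almost all \<open>f\<close>, \<open>Theta m f x\<close> dominates the scaled integral of \<open>\<bar>f - S m f x\<bar>\<close> over a ball of
  radius comparable to \<open>2^(-m)\<close>; unlike that integral it is jointly measurable in \<open>f\<close> and \<open>x\<close>.\<close>

definition Theta :: "nat \<Rightarrow> 'n l1 \<Rightarrow> 'n torus \<Rightarrow> ennreal" where
  "Theta m f x = ennreal ((2 ^ m) ^ CARD('n)) *
     (\<integral>\<^sup>+z. (tail m f z + ennreal \<bar>S m f z - S m f x\<bar>) * indicator (ball x (rad / 2 ^ m)) z \<partial>torus_measure)"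

lemma tail_measurable [measurable (raw)]:
  assumes "f \<in> measurable N borel" "g \<in> measurable N borel"
  shows "(\<lambda>\<omega>. tail k (f \<omega>) (g \<omega>)) \<in> borel_measurable N"
  unfolding tail_def using assms by measurable

definition Ctail :: real where "Ctail = 2 * b\<^sup>2 * (\<Sum>k. 2 powr (- real k * s))"

lemma Ctail_nonneg: "Ctail \<ge> 0"
  unfolding Ctail_def by (intro mult_nonneg_nonneg suminf_nonneg summable_powr_neg s) auto

lemma nn_integral_tail_le: "(\<integral>\<^sup>+f. tail m f z \<partial>Q) \<le> ennreal (Ctail * 2 powr (- real m * s))"
proof -
  have "(\<integral>\<^sup>+f. tail m f z \<partial>Q) = (\<Sum>k. \<integral>\<^sup>+f. ennreal \<bar>Del (m + k) f z\<bar> \<partial>Q)"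
    unfolding tail_def by (rule nn_integral_suminf) measurable
  also have "\<dots> \<le> (\<Sum>k. ennreal (2 * b\<^sup>2 * 2 powr (- real (m + k) * s)))"
    by (intro suminf_le nn_integral_Del_le) auto
  also have "\<dots> = (\<Sum>k. ennreal (2 * b\<^sup>2 * 2 powr (- real m * s) * 2 powr (- real k * s)))"
    by (simp add: algebra_simps flip: powr_add)
  also have "\<dots> = ennreal (\<Sum>k. 2 * b\<^sup>2 * 2 powr (- real m * s) * 2 powr (- real k * s))"
    by (intro suminf_ennreal2 summable_mult summable_powr_neg s) auto
  also have "(\<Sum>k. 2 * b\<^sup>2 * 2 powr (- real m * s) * 2 powr (- real k * s)) = Ctail * 2 powr (- real m * s)"
    unfolding Ctail_def by (subst suminf_mult[OF summable_powr_neg[OF s(1)]]) simp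
  finally show ?thesis .
qed

definition CTheta :: real where
  "CTheta = (Ctail + Cosc) * (10 * rad) ^ CARD('n)"

lemma CTheta_pos: "CTheta > 0"
  using Ctail_nonneg Cosc_pos rad_pos by (simp add: CTheta_def)

lemma Theta_measurable [measurable (raw)]:
  assumes [measurable]: "f \<in> measurable N borel" "g \<in> measurable N borel"
  shows "(\<lambda>\<omega>. Theta k (f \<omega>) (g \<omega>)) \<in> borel_measurable N"
proof -
  interpret T: prob_space "torus_measure :: 'n torus measure" by (rule prob_space_torus_measure)
  show ?thesis
    \<comment> \<open>Written through \<open>dist\<close>, membership in the ball is measurable in
      the moving centre as well.\<close>
    unfolding Theta_def indicator_def mem_ball by measurable
qed

text \<open>Fubini's theorem reduces the claim to the mean bounds for tail and oscillation at a
  fixed \<open>z\<close>. The prefactor of \<open>Theta\<close> cancels the volume of the ball up to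
  \<open>(10 * rad) ^ CARD('n)\<close>.\<close>

lemma nn_integral_Theta_le: "(\<integral>\<^sup>+f. Theta m f x \<partial>Q) \<le> ennreal (CTheta * 2 powr (- real m * s))"
proof -
  interpret T: prob_space "torus_measure :: 'n torus measure" by (rule prob_space_torus_measure)
  interpret Q: prob_space Q by (rule prob_space_Q)
  interpret QT: pair_sigma_finite Q "torus_measure :: 'n torus measure" ..
  let ?B = "ball x (rad / 2 ^ m)"
  let ?g = "\<lambda>f z. (tail m f z + ennreal \<bar>S m f z - S m f x\<bar>) * indicator ?B z"
  have 1: "(\<integral>\<^sup>+f. Theta m f x \<partial>Q) = ennreal ((2 ^ m) ^ CARD('n)) * (\<integral>\<^sup>+f. (\<integral>\<^sup>+z. ?g f z \<partial>torus_measure) \<partial>Q)"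
    unfolding Theta_def indicator_def mem_ball by (rule nn_integral_cmult) measurable
  have "(\<integral>\<^sup>+f. (\<integral>\<^sup>+z. ?g f z \<partial>torus_measure) \<partial>Q) = (\<integral>\<^sup>+z. (\<integral>\<^sup>+f. ?g f z \<partial>Q) \<partial>torus_measure)"
    unfolding indicator_def mem_ball by (rule QT.Fubini'[symmetric]) measurable
  also have "\<dots> \<le> (\<integral>\<^sup>+z. ennreal ((Ctail + Cosc) * 2 powr (- real m * s)) * indicator ?B z \<partial>torus_measure)"
  proof (rule nn_integral_mono)
    fix z
    show "(\<integral>\<^sup>+f. ?g f z \<partial>Q) \<le> ennreal ((Ctail + Cosc) * 2 powr (- real m * s)) * indicator ?B z"
    proof (cases "z \<in> ?B")
      case True
      then have "(\<integral>\<^sup>+f. ?g f z \<partial>Q) = (\<integral>\<^sup>+f. tail m f z + ennreal \<bar>S m f z - S m f x\<bar> \<partial>Q)"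
        by simp
      moreover have "(\<integral>\<^sup>+f. tail m f z + ennreal \<bar>S m f z - S m f x\<bar> \<partial>Q)
          = (\<integral>\<^sup>+f. tail m f z \<partial>Q) + (\<integral>\<^sup>+f. ennreal \<bar>S m f z - S m f x\<bar> \<partial>Q)"
        by (rule nn_integral_add) measurable
      ultimately have "(\<integral>\<^sup>+f. ?g f z \<partial>Q) = (\<integral>\<^sup>+f. tail m f z \<partial>Q) + (\<integral>\<^sup>+f. ennreal \<bar>S m f z - S m f x\<bar> \<partial>Q)"
        by simp
      also have "\<dots> \<le> ennreal (Ctail * 2 powr (- real m * s)) + ennreal (Cosc * 2 powr (- real m * s))"
        using True by (intro add_mono nn_integral_tail_le nn_integral_S_diff_le) auto
      also have "\<dots> = ennreal ((Ctail + Cosc) * 2 powr (- real m * s))"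
        using Ctail_nonneg Cosc_pos by (subst ennreal_plus[symmetric]) (auto simp: distrib_right)
      finally show ?thesis using True by simp
    qed simp
  qed
  also have "\<dots> = ennreal ((Ctail + Cosc) * 2 powr (- real m * s)) * emeasure torus_measure ?B"
    by (rule nn_integral_cmult_indicator) simp
  also have "\<dots> \<le> ennreal ((Ctail + Cosc) * 2 powr (- real m * s)) * ennreal (10 ^ CARD('n) * (rad / 2 ^ m) ^ CARD('n))"
    using rad_pos by (intro mult_left_mono emeasure_torus_ball_le) auto
  finally have "(\<integral>\<^sup>+f. Theta m f x \<partial>Q) \<le> ennreal ((2 ^ m) ^ CARD('n)) *
      (ennreal ((Ctail + Cosc) * 2 powr (- real m * s)) * ennreal (10 ^ CARD('n) * (rad / 2 ^ m) ^ CARD('n)))"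
    unfolding 1 by (rule mult_left_mono) simp
  also have "\<dots> = ennreal ((2 ^ m) ^ CARD('n) * ((Ctail + Cosc) * 2 powr (- real m * s) * (10 ^ CARD('n) * (rad / 2 ^ m) ^ CARD('n))))"
    using Ctail_nonneg Cosc_pos rad_pos by (simp add: ennreal_mult)
  also have "(2 ^ m) ^ CARD('n) * ((Ctail + Cosc) * 2 powr (- real m * s) * (10 ^ CARD('n) * (rad / 2 ^ m) ^ CARD('n)))
      = CTheta * 2 powr (- real m * s)"
    by (simp add: CTheta_def power_mult_distrib power_divide)
  finally show ?thesis .
qed

text \<open>A set of Lebesgue points on which the series converges uniformly and which, unlike the set of all
  Lebesgue points, is closed.\<close>

definition K :: "real \<Rightarrow> 'n l1 \<Rightarrow> 'n torus set" where
  "K A f = {x. \<forall>m. Theta m f x \<le> ennreal (A * 2 powr (- real m * (s / 2)))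
                \<and> \<bar>Del m f x\<bar> \<le> A * 2 powr (- real m * (s / 2))}"

lemma K_measurable [measurable (raw)]:
  assumes [measurable]: "f \<in> measurable N borel" "g \<in> measurable N borel"
  shows "Measurable.pred N (\<lambda>\<omega>. g \<omega> \<in> K A (f \<omega>))"
  unfolding K_def mem_Collect_eq by measurable

definition CK :: real where
  "CK = (CTheta + 2 * b\<^sup>2) * (\<Sum>m. 2 powr (- real m * (s / 2)))"

text \<open>The means decay like \<open>2^(-m*s)\<close> while the thresholds in \<open>K\<close>
  decay only like \<open>2^(-m*s/2)\<close>. Markov's inequality therefore leaves a summable
  sequence, and the bound is uniform in \<open>x\<close>.\<close>

lemma prob_not_K_le:
  assumes A: "A > 0"
  shows "emeasure Q {f. x \<notin> K A f} \<le> ennreal (CK / A)"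
proof -
  let ?w = "\<lambda>m::nat. A * 2 powr (- real m * (s / 2))"
  have w: "?w m > 0" for m using A by simp
  let ?E = "\<lambda>m. {f. ennreal (?w m) \<le> Theta m f x}" and ?F = "\<lambda>m. {f. ennreal (?w m) \<le> ennreal \<bar>Del m f x\<bar>}"
  have EF [measurable]: "?E m \<in> sets Q" "?F m \<in> sets Q" for m by measurable
  have markov: "emeasure Q {f. ennreal (?w m) \<le> g f} \<le> ennreal (L / ?w m)"
    if g: "g \<in> borel_measurable borel" "(\<integral>\<^sup>+f. g f \<partial>Q) \<le> ennreal L" "0 \<le> L" for g m L
  proof -
    have [measurable]: "g \<in> borel_measurable borel" by (rule g)
    have "ennreal (?w m) * emeasure Q {f. ennreal (?w m) \<le> g f}
       = (\<integral>\<^sup>+f. ennreal (?w m) * indicator {f. ennreal (?w m) \<le> g f} f \<partial>Q)"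
      by (rule nn_integral_cmult_indicator[symmetric]) measurable
    also have "\<dots> \<le> (\<integral>\<^sup>+f. g f \<partial>Q)" by (rule nn_integral_mono) (auto simp: indicator_def)
    also have "\<dots> \<le> ennreal L" by (rule g)
    finally have "ennreal (1 / ?w m) * (ennreal (?w m) * emeasure Q {f. ennreal (?w m) \<le> g f}) \<le> ennreal (1 / ?w m) * ennreal L"
      by (rule mult_left_mono) simp
    moreover have "ennreal (1 / ?w m) * ennreal (?w m) = 1"
      using w[of m] A by (subst ennreal_mult[symmetric]) auto
    moreover have "ennreal (1 / ?w m) * ennreal L = ennreal (L / ?w m)"
      using w[of m] A g by (subst ennreal_mult[symmetric]) auto
    ultimately show ?thesis by (simp only: mult.assoc[symmetric] mult_1)
  qed
  have split: "CTheta * 2 powr (- real m * s) / ?w m + 2 * b\<^sup>2 * 2 powr (- real m * s) / ?w m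
      = (CTheta + 2 * b\<^sup>2) / A * 2 powr (- real m * (s / 2))" for m
  proof -
    have "2 powr (- real m * s) = 2 powr (- real m * (s / 2)) * 2 powr (- real m * (s / 2))"
      by (simp flip: powr_add) (simp add: mult.commute)
    then show ?thesis using A by (simp add: field_simps)
  qed
  have "{f. x \<notin> K A f} \<subseteq> (\<Union>m. ?E m \<union> ?F m)"
    by (auto simp: K_def not_le intro: less_imp_le ennreal_leI)
  then have "emeasure Q {f. x \<notin> K A f} \<le> emeasure Q (\<Union>m. ?E m \<union> ?F m)"
    by (intro emeasure_mono) auto
  also have "\<dots> \<le> (\<Sum>m. emeasure Q (?E m \<union> ?F m))"
    by (rule emeasure_subadditive_countably) auto
  also have "\<dots> \<le> (\<Sum>m. ennreal ((CTheta + 2 * b\<^sup>2) / A * 2 powr (- real m * (s / 2))))"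
  proof (intro suminf_le)
    fix m
    have "emeasure Q (?E m \<union> ?F m) \<le> emeasure Q (?E m) + emeasure Q (?F m)"
      by (rule emeasure_subadditive) auto
    also have "\<dots> \<le> ennreal (CTheta * 2 powr (- real m * s) / ?w m) + ennreal (2 * b\<^sup>2 * 2 powr (- real m * s) / ?w m)"
      using CTheta_pos by (intro add_mono markov nn_integral_Theta_le nn_integral_Del_le) auto
    also have "\<dots> = ennreal ((CTheta + 2 * b\<^sup>2) / A * 2 powr (- real m * (s / 2)))"
      unfolding split[symmetric] using CTheta_pos A by (intro ennreal_plus[symmetric]) auto
    finally show "emeasure Q (?E m \<union> ?F m) \<le> ennreal ((CTheta + 2 * b\<^sup>2) / A * 2 powr (- real m * (s / 2)))" .
  qed auto
  also have "\<dots> = ennreal (\<Sum>m. (CTheta + 2 * b\<^sup>2) / A * 2 powr (- real m * (s / 2)))"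
    using CTheta_pos A s by (intro suminf_ennreal2 summable_mult summable_powr_neg) auto
  also have "(\<Sum>m. (CTheta + 2 * b\<^sup>2) / A * 2 powr (- real m * (s / 2))) = CK / A"
    unfolding CK_def using s by (subst suminf_mult[OF summable_powr_neg]) auto
  finally show ?thesis .
qed

section \<open>The pointwise limit of the partial sums\<close>

definition Slim :: "'n l1 \<Rightarrow> 'n torus \<Rightarrow> real" where
  "Slim f x = lim (\<lambda>m. S m f x)"

lemma Slim_measurable [measurable (raw)]:
  assumes [measurable]: "f \<in> measurable N borel" "g \<in> measurable N borel"
  shows "(\<lambda>\<omega>. Slim (f \<omega>) (g \<omega>)) \<in> borel_measurable N"
  unfolding Slim_def by measurable

lemma Slim_LIMSEQ: "summable (\<lambda>k. Del k f x) \<Longrightarrow> (\<lambda>m. S m f x) \<longlonglongrightarrow> Slim f x"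
  unfolding Slim_def S_def[abs_def] using convergent_LIMSEQ_iff summable_iff_convergent by blast

definition Cgeo :: real where "Cgeo = (\<Sum>k. 2 powr (- real k * (s / 2)))"

text \<open>On \<open>K A f\<close> the blocks have a geometric majorant independent of the point,
  so convergence is uniform there, with the rate of the tail of that series.\<close>

lemma K_Slim:
  assumes x: "x \<in> K A f" and A: "0 \<le> A"
  shows "(\<lambda>m. S m f x) \<longlonglongrightarrow> Slim f x"
    and "\<bar>Slim f x - S m f x\<bar> \<le> A * Cgeo * 2 powr (- real m * (s / 2))"
proof -
  have le: "\<bar>Del k f x\<bar> \<le> A * 2 powr (- real k * (s / 2))" for k using x by (simp add: K_def)
  have s2: "summable (\<lambda>k. 2 powr (- real k * (s / 2)))" using s by (intro summable_powr_neg) simp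
  have sA: "summable (\<lambda>k. A * 2 powr (- real k * (s / 2)))" by (intro summable_mult s2)
  have sm: "summable (\<lambda>k. \<bar>Del k f x\<bar>)"
    by (rule summable_comparison_test'[OF sA, of 0]) (use le in auto)
  then have sD: "summable (\<lambda>k. Del k f x)" by (rule summable_rabs_cancel)
  then show lim: "(\<lambda>m. S m f x) \<longlonglongrightarrow> Slim f x" by (rule Slim_LIMSEQ)
  have "Slim f x = (\<Sum>k. Del k f x)"
    using LIMSEQ_unique[OF lim] summable_LIMSEQ[OF sD] by (simp add: S_def)
  also have "\<dots> = (\<Sum>k. Del (k + m) f x) + S m f x"
    unfolding S_def by (rule suminf_split_initial_segment[OF sD])
  finally have "\<bar>Slim f x - S m f x\<bar> = \<bar>\<Sum>k. Del (k + m) f x\<bar>" by simp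
  also have "\<dots> \<le> (\<Sum>k. \<bar>Del (k + m) f x\<bar>)"
    by (rule summable_rabs) (use sm in \<open>simp add: summable_iff_shift[of "\<lambda>k. \<bar>Del k f x\<bar>" m]\<close>)
  also have "\<dots> \<le> (\<Sum>k. A * 2 powr (- real m * (s / 2)) * 2 powr (- real k * (s / 2)))"
  proof (rule suminf_le)
    show "\<bar>Del (k + m) f x\<bar> \<le> A * 2 powr (- real m * (s / 2)) * 2 powr (- real k * (s / 2))" for k
    proof -
      have "2 powr (- real (k + m) * (s / 2)) = 2 powr (- real m * (s / 2)) * 2 powr (- real k * (s / 2))"
        by (simp add: algebra_simps flip: powr_add)
      then show ?thesis using le[of "k + m"] by simp
    qed
  qed (use sm s2 in \<open>auto simp: summable_iff_shift[of "\<lambda>k. \<bar>Del k f x\<bar>" m] intro!: summable_mult\<close>)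
  also have "\<dots> = A * Cgeo * 2 powr (- real m * (s / 2))"
    unfolding Cgeo_def by (subst suminf_mult[OF s2]) simp
  finally show "\<bar>Slim f x - S m f x\<bar> \<le> A * Cgeo * 2 powr (- real m * (s / 2))" .
qed

lemma K_Slim_le: "x \<in> K A f \<Longrightarrow> 0 \<le> A \<Longrightarrow> \<bar>Slim f x\<bar> \<le> A * Cgeo"
  using K_Slim(2)[of x A f 0] by (simp add: S_def)

section \<open>Density bounds for values and differences of values\<close>

lemma emeasure_Q:
  assumes "{f. P f} \<in> sets borel"
  shows "emeasure Q {f. P f} = emeasure M {\<omega> \<in> space M. P (X \<omega>)}"
  unfolding Q_eq using assms by (subst emeasure_distr) (auto intro!: arg_cong[where f = "emeasure M"])

definition Canti :: real where "Canti = 2 * C * C powr s"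

lemma Canti_pos: "Canti > 0" using C by (simp add: Canti_def)

text \<open>The separating wavelet vanishes at \<open>x'\<close>, so its coefficient in the
  difference is \<open>\<psi>(x)\<close>, of size at least \<open>1 / C\<close>. Its scale satisfies
  \<open>2^k \<le> C / d(x,x')\<close>, which turns \<open>2^(k*s)\<close> into the power of the
  distance. The partial sum must be long enough to contain this scale.\<close>

lemma S_anticoncentration:
  assumes "x \<noteq> x'"
  shows "\<exists>m0. \<forall>m\<ge>m0. \<forall>\<epsilon>\<ge>0. emeasure Q {f. \<bar>S m f x - S m f x'\<bar> \<le> \<epsilon>} \<le> ennreal (Canti * \<epsilon> * dist x x' powr (- s))"
proof -
  obtain k j where j: "j \<in> wavelet_index k" and d: "inverse C / 2 ^ k \<le> dist x x'" "dist x x' \<le> C / 2 ^ k"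
    and p: "inverse C \<le> \<bar>wavelet \<Psi> k j x\<bar>" "wavelet \<Psi> k j x' = 0"
    using sep assms unfolding separation_property_def by blast
  have "emeasure Q {f. \<bar>S m f x - S m f x'\<bar> \<le> \<epsilon>} \<le> ennreal (Canti * \<epsilon> * dist x x' powr (- s))"
    if m: "Suc k \<le> m" and \<epsilon>: "\<epsilon> \<ge> 0" for m \<epsilon>
  proof -
    let ?a = "\<lambda>i. \<psi> i x - \<psi> i x'"
    have "emeasure Q {f. \<bar>S m f x - S m f x'\<bar> \<le> \<epsilon>} = emeasure M {\<omega> \<in> space M. \<bar>S m (X \<omega>) x - S m (X \<omega>) x'\<bar> \<le> \<epsilon>}"
      by (rule emeasure_Q) measurable
    also have "\<dots> = emeasure M {\<omega> \<in> space M. \<bar>(\<Sum>i\<in>J m. ?a i * c i \<omega>) - 0\<bar> \<le> \<epsilon>}"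
    proof (rule emeasure_eq_AE)
      show "AE \<omega> in M. \<omega> \<in> {\<omega> \<in> space M. \<bar>S m (X \<omega>) x - S m (X \<omega>) x'\<bar> \<le> \<epsilon>}
        \<longleftrightarrow> \<omega> \<in> {\<omega> \<in> space M. \<bar>(\<Sum>i\<in>J m. ?a i * c i \<omega>) - 0\<bar> \<le> \<epsilon>}"
        using AE_S_X by eventually_elim (simp add: left_diff_distrib sum_subtractf)
      have [measurable]: "i \<in> J m \<Longrightarrow> c i \<in> borel_measurable M" for i using J_subset[of m] by auto
      show "{\<omega> \<in> space M. \<bar>(\<Sum>i\<in>J m. ?a i * c i \<omega>) - 0\<bar> \<le> \<epsilon>} \<in> sets M" by measurable
    qed measurable
    also have "\<dots> \<le> ennreal (2 * \<epsilon> * 2 powr (real k * s) / inverse C)"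
      by (rule anticoncentration[of k j]) (use J_subset m j p C \<epsilon> in \<open>auto simp: J_iff\<close>)
    also have "\<dots> \<le> ennreal (Canti * \<epsilon> * dist x x' powr (- s))"
    proof (rule ennreal_leI)
      have dpos: "0 < dist x x'" using assms by simp
      have "2 powr real k \<le> C / dist x x'" using d(2) dpos by (simp add: powr_realpow field_simps)
      then have "(2 powr real k) powr s \<le> (C / dist x x') powr s" using s by (intro powr_mono2) auto
      then have "2 powr (real k * s) \<le> C powr s * dist x x' powr (- s)"
        using C dpos by (simp add: powr_powr powr_divide powr_minus_divide)
      then have "2 * \<epsilon> * C * 2 powr (real k * s) \<le> 2 * \<epsilon> * C * (C powr s * dist x x' powr (- s))"
        using C \<epsilon> by (intro mult_left_mono) auto
      then show "2 * \<epsilon> * 2 powr (real k * s) / inverse C \<le> Canti * \<epsilon> * dist x x' powr (- s)"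
        by (simp add: Canti_def ac_simps divide_inverse)
    qed
    finally show ?thesis .
  qed
  then show ?thesis by (intro exI[of _ "Suc k"]) blast
qed

text \<open>A strict inequality for the limit holds eventually for the partial sums. The event lies
  in an increasing union of events, each inside a single event about one late partial sum, where the
  bound is uniform.\<close>

lemma Slim_anticoncentration:
  assumes x: "x \<noteq> x'" and A: "0 \<le> A" and \<epsilon>: "0 \<le> \<epsilon>"
  shows "emeasure Q {f. x \<in> K A f \<and> x' \<in> K A f \<and> \<bar>Slim f x - Slim f x'\<bar> < \<epsilon>} \<le> ennreal (Canti * \<epsilon> * dist x x' powr (- s))"
proof -
  obtain m0 where m0: "\<And>m. m \<ge> m0 \<Longrightarrow> emeasure Q {f. \<bar>S m f x - S m f x'\<bar> \<le> \<epsilon>} \<le> ennreal (Canti * \<epsilon> * dist x x' powr (- s))"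
    using S_anticoncentration[OF x] \<epsilon> by blast
  let ?E = "\<lambda>N. {f. \<forall>m\<ge>N. \<bar>S m f x - S m f x'\<bar> \<le> \<epsilon>}"
  have E [measurable]: "?E N \<in> sets Q" for N by measurable
  have sub: "{f. x \<in> K A f \<and> x' \<in> K A f \<and> \<bar>Slim f x - Slim f x'\<bar> < \<epsilon>} \<subseteq> (\<Union>N. ?E N)"
  proof safe
    fix f assume f: "x \<in> K A f" "x' \<in> K A f" "\<bar>Slim f x - Slim f x'\<bar> < \<epsilon>"
    have "(\<lambda>m. \<bar>S m f x - S m f x'\<bar>) \<longlonglongrightarrow> \<bar>Slim f x - Slim f x'\<bar>"
      by (intro tendsto_intros K_Slim[OF f(1) A] K_Slim[OF f(2) A])
    from order_tendstoD(2)[OF this f(3)] obtain N where "\<forall>m\<ge>N. \<bar>S m f x - S m f x'\<bar> < \<epsilon>"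
      by (auto simp: eventually_sequentially)
    then show "f \<in> (\<Union>N. ?E N)" by (auto intro!: exI[of _ N] less_imp_le)
  qed
  have "emeasure Q {f. x \<in> K A f \<and> x' \<in> K A f \<and> \<bar>Slim f x - Slim f x'\<bar> < \<epsilon>} \<le> emeasure Q (\<Union>N. ?E N)"
    by (rule emeasure_mono[OF sub]) measurable
  also have "\<dots> = (SUP N. emeasure Q (?E N))"
    by (rule SUP_emeasure_incseq[symmetric]) (auto simp: incseq_def)
  also have "\<dots> \<le> ennreal (Canti * \<epsilon> * dist x x' powr (- s))"
  proof (rule SUP_least)
    fix N
    have "emeasure Q (?E N) \<le> emeasure Q {f. \<bar>S (max m0 N) f x - S (max m0 N) f x'\<bar> \<le> \<epsilon>}"
      by (rule emeasure_mono) auto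
    also have "\<dots> \<le> ennreal (Canti * \<epsilon> * dist x x' powr (- s))" by (rule m0) simp
    finally show "emeasure Q (?E N) \<le> ennreal (Canti * \<epsilon> * dist x x' powr (- s))" .
  qed
  finally show ?thesis .
qed

lemma AE_summable_Del: "AE f in Q. summable (\<lambda>k. Del k f x)"
proof -
  have "(\<integral>\<^sup>+f. tail 0 f x \<partial>Q) < \<infinity>"
    using nn_integral_tail_le[of 0 x] by (rule le_less_trans) simp
  then have "AE f in Q. tail 0 f x \<noteq> \<infinity>"
    by (intro nn_integral_PInf_AE) auto
  then show ?thesis
  proof eventually_elim
    case (elim f)
    then have "summable (\<lambda>k. \<bar>Del k f x\<bar>)"
      by (intro summable_suminf_not_top) (auto simp: tail_def top_unique)
    then show ?case by (rule summable_rabs_cancel)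
  qed
qed

text \<open>At any \<open>x\<close> the separation property is applied to a point at distance 1/2.
  The separating scale is then bounded, so finitely many constants \<open>H k\<close> occur and
  their minimum works for all \<open>x\<close> and all late partial sums.\<close>

lemma S_concentration:
  assumes R: "0 \<le> R"
  obtains h m0 where "h > 0" "\<And>m x y \<epsilon>. m \<ge> m0 \<Longrightarrow> \<bar>y\<bar> \<le> R \<Longrightarrow> 0 \<le> \<epsilon> \<Longrightarrow> \<epsilon> \<le> 1 \<Longrightarrow>
    ennreal (h * \<epsilon>) \<le> emeasure Q {f. \<bar>S m f x - y\<bar> \<le> \<epsilon>}"
proof -
  \<comment> \<open>A scale separating points at distance 1/2 satisfies
    \<open>2 ^ k \<le> 2 * C\<close>, hence \<open>k < k1\<close>.\<close>
  obtain k1 :: nat where k1: "2 * C < 2 ^ k1" using real_arch_pow[of 2 "2 * C"] by auto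
  define H where "H k = std_normal_density ((2 * (Ctail + 2 * b) + R + 1) / (inverse C * 2 powr (- real k * s)))
                / (b * max 1 (2 powr (real k * \<beta>)))" for k :: nat
  have H: "H k > 0" for k
  proof -
    have "max 1 (2 powr (real k * \<beta>)) > 0" by simp
    then show ?thesis unfolding H_def using b by (intro divide_pos_pos mult_pos_pos) (auto simp: std_normal_density_def)
  qed
  define h where "h = Min (H ` {..k1})"
  have h: "h > 0" "\<And>k. k \<le> k1 \<Longrightarrow> h \<le> H k" using H by (auto simp: h_def)
  have "ennreal (h * \<epsilon>) \<le> emeasure Q {f. \<bar>S m f x - y\<bar> \<le> \<epsilon>}"
    if m: "m \<ge> Suc k1" and y: "\<bar>y\<bar> \<le> R" and \<epsilon>: "0 \<le> \<epsilon>" "\<epsilon> \<le> 1" for m x y \<epsilon>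
  proof -
    obtain x' where x': "dist x x' = 1 / 2" by (rule torus_half_distance)
    then have "x \<noteq> x'" by auto
    then obtain k j where j: "j \<in> wavelet_index k" and d: "dist x x' \<le> C / 2 ^ k"
      and p: "inverse C \<le> \<bar>wavelet \<Psi> k j x\<bar>"
      using sep unfolding separation_property_def by blast
    have "2 ^ k \<le> 2 * C" using d x' by (simp add: field_simps)
    then have "(2::real) ^ k < 2 ^ k1" using k1 by linarith
    then have k: "k < k1" by (simp add: power_strict_increasing_iff)
    have [measurable]: "i \<in> J m \<Longrightarrow> c i \<in> borel_measurable M" for i using J_subset[of m] by auto
    have E: "(\<integral>\<^sup>+\<omega>. ennreal \<bar>\<Sum>i\<in>J m. \<psi> i x * c i \<omega>\<bar> \<partial>M) \<le> ennreal Ctail"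
    proof -
      have "(\<integral>\<^sup>+\<omega>. ennreal \<bar>\<Sum>i\<in>J m. \<psi> i x * c i \<omega>\<bar> \<partial>M) = (\<integral>\<^sup>+\<omega>. ennreal \<bar>S m (X \<omega>) x\<bar> \<partial>M)"
        by (rule nn_integral_cong_AE) (use AE_S_X in eventually_elim, simp)
      also have "\<dots> = (\<integral>\<^sup>+f. ennreal \<bar>S m f x\<bar> \<partial>Q)"
        by (rule nn_integral_Q[symmetric]) measurable
      also have "\<dots> \<le> (\<integral>\<^sup>+f. tail 0 f x \<partial>Q)"
      proof (rule nn_integral_mono)
        fix f
        have "ennreal \<bar>S m f x\<bar> \<le> ennreal (\<Sum>k<m. \<bar>Del k f x\<bar>)"
          unfolding S_def by (intro ennreal_leI sum_abs)
        also have "\<dots> = (\<Sum>k<m. ennreal \<bar>Del k f x\<bar>)" by (simp add: sum_ennreal)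
        also have "\<dots> \<le> tail 0 f x" unfolding tail_def add_0 by (rule sum_le_suminf) auto
        finally show "ennreal \<bar>S m f x\<bar> \<le> tail 0 f x" .
      qed
      also have "\<dots> \<le> ennreal Ctail" using nn_integral_tail_le[of 0 x] by simp
      finally show ?thesis .
    qed
    have "ennreal (h * \<epsilon>) \<le> ennreal (H k * \<epsilon>)"
      using h(2)[of k] k \<epsilon> by (intro ennreal_leI mult_right_mono) auto
    also have "\<dots> \<le> emeasure M {\<omega> \<in> space M. \<bar>(\<Sum>i\<in>J m. \<psi> i x * c i \<omega>) - y\<bar> \<le> \<epsilon>}"
      unfolding H_def
      by (rule concentration_lower[where a = "\<lambda>i. \<psi> i x"])
         (use J_subset m k j p C \<epsilon> y E Ctail_nonneg wavelet_le[OF j] in \<open>auto simp: J_iff\<close>)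
    also have "\<dots> = emeasure M {\<omega> \<in> space M. \<bar>S m (X \<omega>) x - y\<bar> \<le> \<epsilon>}"
    proof (rule emeasure_eq_AE)
      show "AE \<omega> in M. \<omega> \<in> {\<omega> \<in> space M. \<bar>(\<Sum>i\<in>J m. \<psi> i x * c i \<omega>) - y\<bar> \<le> \<epsilon>}
        \<longleftrightarrow> \<omega> \<in> {\<omega> \<in> space M. \<bar>S m (X \<omega>) x - y\<bar> \<le> \<epsilon>}"
        using AE_S_X by eventually_elim simp
    qed measurable
    also have "\<dots> = emeasure Q {f. \<bar>S m f x - y\<bar> \<le> \<epsilon>}"
      by (rule emeasure_Q[symmetric]) measurable
    finally show ?thesis .
  qed
  with h(1) show ?thesis by (rule that)
qed

text \<open>With probability bounded below, infinitely many partial sums lie within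
  \<open>\<epsilon> / 2\<close> of \<open>y\<close>, by continuity from above. Where the series
  converges, the limit is then strictly within \<open>\<epsilon>\<close>; the price is a factor
  2.\<close>

lemma Slim_concentration:
  assumes R: "0 \<le> R"
  obtains h where "h > 0" "\<And>x y \<epsilon>. \<bar>y\<bar> \<le> R \<Longrightarrow> 0 < \<epsilon> \<Longrightarrow> \<epsilon> \<le> 1 \<Longrightarrow>
    ennreal (h * \<epsilon>) \<le> emeasure Q {f. \<bar>Slim f x - y\<bar> < \<epsilon>}"
proof -
  interpret Q: prob_space Q by (rule prob_space_Q)
  obtain h m0 where h: "h > 0" "\<And>m x y \<epsilon>. m \<ge> m0 \<Longrightarrow> \<bar>y\<bar> \<le> R \<Longrightarrow> 0 \<le> \<epsilon> \<Longrightarrow> \<epsilon> \<le> 1 \<Longrightarrow>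
    ennreal (h * \<epsilon>) \<le> emeasure Q {f. \<bar>S m f x - y\<bar> \<le> \<epsilon>}" using S_concentration[OF R] by metis
  have "ennreal (h / 2 * \<epsilon>) \<le> emeasure Q {f. \<bar>Slim f x - y\<bar> < \<epsilon>}"
    if y: "\<bar>y\<bar> \<le> R" and \<epsilon>: "0 < \<epsilon>" "\<epsilon> \<le> 1" for x y \<epsilon>
  proof -
    let ?E = "\<lambda>N. {f. \<exists>m\<ge>N. \<bar>S m f x - y\<bar> \<le> \<epsilon> / 2}"
    have E [measurable]: "?E N \<in> sets Q" for N by measurable
    have "ennreal (h / 2 * \<epsilon>) \<le> (INF N. emeasure Q (?E N))"
    proof (rule INF_greatest)
      fix N
      have "ennreal (h / 2 * \<epsilon>) \<le> emeasure Q {f. \<bar>S (max m0 N) f x - y\<bar> \<le> \<epsilon> / 2}"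
        using h(2)[of "max m0 N" y "\<epsilon> / 2" x] y \<epsilon> by simp
      also have "\<dots> \<le> emeasure Q (?E N)" by (rule emeasure_mono) (auto intro: exI[of _ "max m0 N"])
      finally show "ennreal (h / 2 * \<epsilon>) \<le> emeasure Q (?E N)" .
    qed
    also have "\<dots> = emeasure Q (\<Inter>N. ?E N)"
      by (rule INF_emeasure_decseq) (auto simp: decseq_def intro: order_trans)
    also have "\<dots> \<le> emeasure Q {f. \<bar>Slim f x - y\<bar> < \<epsilon>}"
    proof (rule emeasure_mono_AE)
      show "AE f in Q. f \<in> (\<Inter>N. ?E N) \<longrightarrow> f \<in> {f. \<bar>Slim f x - y\<bar> < \<epsilon>}"
        using AE_summable_Del[of x]
      proof eventually_elim
        case (elim f)
        have lim: "(\<lambda>m. \<bar>S m f x - y\<bar>) \<longlonglongrightarrow> \<bar>Slim f x - y\<bar>"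
          by (intro tendsto_intros Slim_LIMSEQ[OF elim])
        show ?case
        proof safe
          assume f: "f \<in> (\<Inter>N. ?E N)"
          show "\<bar>Slim f x - y\<bar> < \<epsilon>"
          proof (rule ccontr)
            assume "\<not> \<bar>Slim f x - y\<bar> < \<epsilon>"
            then have "\<epsilon> / 2 < \<bar>Slim f x - y\<bar>" using \<epsilon> by linarith
            from order_tendstoD(1)[OF lim this] obtain N where "\<forall>m\<ge>N. \<epsilon> / 2 < \<bar>S m f x - y\<bar>"
              by (auto simp: eventually_sequentially)
            then show False using f by (force simp: not_le[symmetric])
          qed
        qed
      qed
    qed measurable
    finally show ?thesis .
  qed
  with h(1) show ?thesis by (intro that[of "h / 2"]) auto
qed

end

section \<open>Lebesgue points and the upper bound\<close>

lemma set_integral_abs_eq: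
  fixes f :: "'n::finite l1"
  shows "ennreal (LINT z:ball x r|torus_measure. \<bar>rep_l1 f z - a\<bar>)
    = (\<integral>\<^sup>+z. ennreal \<bar>rep_l1 f z - a\<bar> * indicator (ball x r) z \<partial>torus_measure)"
    and "set_integrable torus_measure (ball x r) (\<lambda>z. rep_l1 f z - a)"
proof -
  interpret T: prob_space "torus_measure :: 'n torus measure" by (rule prob_space_torus_measure)
  have i: "integrable torus_measure (\<lambda>z. rep_l1 f z - a)" by auto
  show s: "set_integrable torus_measure (ball x r) (\<lambda>z. rep_l1 f z - a)"
    unfolding set_integrable_def using i by (intro integrable_mult_indicator) auto
  have "integrable torus_measure (\<lambda>z. indicator (ball x r) z *\<^sub>R \<bar>rep_l1 f z - a\<bar>)"
    using set_integrable_abs[OF s] by (simp add: set_integrable_def)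
  from nn_integral_eq_integral[OF this]
  have "ennreal (LINT z:ball x r|torus_measure. \<bar>rep_l1 f z - a\<bar>)
    = (\<integral>\<^sup>+z. ennreal (indicator (ball x r) z *\<^sub>R \<bar>rep_l1 f z - a\<bar>) \<partial>torus_measure)"
    by (simp add: set_lebesgue_integral_def)
  also have "\<dots> = (\<integral>\<^sup>+z. ennreal \<bar>rep_l1 f z - a\<bar> * indicator (ball x r) z \<partial>torus_measure)"
    by (rule nn_integral_cong) (simp add: indicator_def)
  finally show "ennreal (LINT z:ball x r|torus_measure. \<bar>rep_l1 f z - a\<bar>)
    = (\<integral>\<^sup>+z. ennreal \<bar>rep_l1 f z - a\<bar> * indicator (ball x r) z \<partial>torus_measure)" .
qed

lemma ball_average_diff_le:
  fixes f :: "'n::finite l1"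
  assumes r: "0 < r" "r \<le> 1"
  shows "\<bar>ball_average (rep_l1 f) x r - a\<bar>
    \<le> (2 * real CARD('n)) ^ CARD('n) * ((LINT z:ball x r|torus_measure. \<bar>rep_l1 f z - a\<bar>) / r ^ CARD('n))"
proof -
  interpret T: prob_space "torus_measure :: 'n torus measure" by (rule prob_space_torus_measure)
  let ?\<mu> = "measure torus_measure (ball x r)" and ?c = "(r / (2 * real CARD('n))) ^ CARD('n)"
  have c: "0 < ?c" using r by simp
  have \<mu>: "?c \<le> ?\<mu>"
    using emeasure_torus_ball_ge[OF r, of x] c by (simp add: T.emeasure_eq_measure)
  have s: "set_integrable torus_measure (ball x r) (\<lambda>z. rep_l1 f z)"
    unfolding set_integrable_def by (intro integrable_mult_indicator) auto
  have sa: "set_integrable torus_measure (ball x r) (\<lambda>z. a)"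
    unfolding set_integrable_def by (intro integrable_mult_indicator) auto
  have "(LINT z:ball x r|torus_measure. rep_l1 f z) - a * ?\<mu> = (LINT z:ball x r|torus_measure. rep_l1 f z - a)"
    by (subst set_integral_diff(2)[OF s sa]) (simp add: set_lebesgue_integral_def)
  then have "(LINT z:ball x r|torus_measure. rep_l1 f z - a) / ?\<mu> = ball_average (rep_l1 f) x r - a * ?\<mu> / ?\<mu>"
    by (simp add: ball_average_def diff_divide_distrib flip: \<open>_ = (LINT z:ball x r|torus_measure. rep_l1 f z - a)\<close>)
  then have "ball_average (rep_l1 f) x r - a = (LINT z:ball x r|torus_measure. rep_l1 f z - a) / ?\<mu>"
    using less_le_trans[OF c \<mu>] by simp
  moreover have "\<bar>LINT z:ball x r|torus_measure. rep_l1 f z - a\<bar> \<le> (LINT z:ball x r|torus_measure. \<bar>rep_l1 f z - a\<bar>)"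
    using set_integral_norm_bound[OF set_integral_abs_eq(2)[of x r f a]] by simp
  ultimately have "\<bar>ball_average (rep_l1 f) x r - a\<bar> \<le> (LINT z:ball x r|torus_measure. \<bar>rep_l1 f z - a\<bar>) / ?\<mu>"
    using \<mu> c by (simp add: abs_divide divide_right_mono)
  also have "\<dots> \<le> (LINT z:ball x r|torus_measure. \<bar>rep_l1 f z - a\<bar>) / ?c"
  proof (rule divide_left_mono[OF \<mu>])
    show "0 \<le> (LINT z:ball x r|torus_measure. \<bar>rep_l1 f z - a\<bar>)"
      unfolding set_lebesgue_integral_def by (rule integral_nonneg_AE) auto
  qed (use \<mu> c in auto)
  also have "\<dots> = (2 * real CARD('n)) ^ CARD('n) * ((LINT z:ball x r|torus_measure. \<bar>rep_l1 f z - a\<bar>) / r ^ CARD('n))"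
    using r by (simp add: power_divide field_simps)
  finally show ?thesis .
qed

lemma ball_average_tendsto:
  fixes f :: "'n::finite l1"
  assumes "((\<lambda>r. (LINT z:ball x r|torus_measure. \<bar>rep_l1 f z - a\<bar>) / r ^ CARD('n)) \<longlongrightarrow> 0) (at_right 0)"
  shows "((\<lambda>r. ball_average (rep_l1 f) x r) \<longlongrightarrow> a) (at_right 0)"
proof -
  have "((\<lambda>r. ball_average (rep_l1 f) x r - a) \<longlongrightarrow> 0) (at_right 0)"
  proof (rule Lim_null_comparison)
    show "eventually (\<lambda>r. norm (ball_average (rep_l1 f) x r - a)
      \<le> (2 * real CARD('n)) ^ CARD('n) * ((LINT z:ball x r|torus_measure. \<bar>rep_l1 f z - a\<bar>) / r ^ CARD('n))) (at_right 0)"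
      unfolding eventually_at_right_field real_norm_def
      by (rule exI[of _ 1]) (use ball_average_diff_le[of _ f x a] in auto)
    show "((\<lambda>r. (2 * real CARD('n)) ^ CARD('n) * ((LINT z:ball x r|torus_measure. \<bar>rep_l1 f z - a\<bar>) / r ^ CARD('n))) \<longlongrightarrow> 0) (at_right 0)"
      using tendsto_mult_left[OF assms] by simp
  qed
  then show ?thesis by (simp add: LIM_zero_iff)
qed

lemma level_set_iff_average:
  assumes "((\<lambda>r. ball_average (rep_l1 f) x r) \<longlongrightarrow> a) (at_right 0)"
  shows "x \<in> level_set f y \<longleftrightarrow> a = y"
proof -
  have l: "((\<lambda>r. ereal (ball_average (rep_l1 f) x r)) \<longlongrightarrow> ereal a) (at_right 0)"
    using assms by simp
  have nt: "\<not> trivial_limit (at_right (0::real))" by (rule trivial_limit_at_right_real)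
  show ?thesis
    unfolding level_set_iff lim_imp_Liminf[OF nt l] lim_imp_Limsup[OF nt l] by auto
qed

text \<open>At a Lebesgue point the averages converge, so liminf and limsup coincide and the level
  set condition identifies the limit as \<open>y\<close>.\<close>

lemma lebesgue_level_point_cases:
  assumes "x \<in> lebesgue_points f \<inter> level_set f y"
  shows "((\<lambda>r. ball_average (rep_l1 f) x r) \<longlongrightarrow> y) (at_right 0)"
  using assms lebesgue_points_iff[of x f] ball_average_tendsto[of x f] level_set_iff_average[of f x _ y] by blast

lemma dyadic_scale:
  assumes "0 < r" "r \<le> (\<rho>::real)"
  obtains m where "\<rho> / 2 ^ Suc m < r" "r \<le> \<rho> / 2 ^ m"
proof -
  have "\<exists>m. \<rho> / 2 ^ m < r"
  proof -
    obtain m where "\<rho> / r < 2 ^ m" using real_arch_pow[of 2 "\<rho> / r"] by auto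
    then show ?thesis using assms by (intro exI[of _ m]) (simp add: field_simps)
  qed
  define k where "k = (LEAST m. \<rho> / 2 ^ m < r)"
  have k: "\<rho> / 2 ^ k < r" unfolding k_def using \<open>\<exists>m. \<rho> / 2 ^ m < r\<close> by (rule LeastI_ex)
  have "k \<noteq> 0" using k assms by (intro notI) auto
  then obtain m where m: "k = Suc m" using not0_implies_Suc by blast
  have "\<not> \<rho> / 2 ^ m < r" using not_less_Least[of m "\<lambda>m. \<rho> / 2 ^ m < r"] m by (simp add: k_def)
  then show ?thesis using k m that[of m] by simp
qed

text \<open>Otherwise \<open>\<bar>y - a m\<bar> * (m / (m + 1))\<close> would eventually be nondecreasing and positive.\<close>

lemma infinitely_many_large_steps:
  fixes a :: "nat \<Rightarrow> real"
  assumes a: "a \<longlonglongrightarrow> y"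
  shows "\<exists>m\<ge>N. \<bar>y - a m\<bar> \<le> (real m + 1)\<^sup>2 * \<bar>a (Suc m) - a m\<bar>"
proof (rule ccontr)
  assume neg: "\<not> ?thesis"
  \<comment> \<open>Starting one step later makes the factor \<open>m / (m + 1)\<close>
    positive.\<close>
  let ?N = "Suc N"
  define D where "D m = \<bar>y - a m\<bar>" for m
  have step: "(real m + 1)\<^sup>2 * \<bar>a (Suc m) - a m\<bar> < D m" if "m \<ge> ?N" for m
    using neg that unfolding D_def by (meson Suc_leD not_le)
  have pos: "0 < D m" if "m \<ge> ?N" for m
    by (rule le_less_trans[OF _ step[OF that]]) simp
  have mono: "D m * (real m / (real m + 1)) \<le> D (Suc m) * (real (Suc m) / (real (Suc m) + 1))" if m: "m \<ge> ?N" for m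
  proof -
    have m1: "real m \<ge> 1" using m by simp
    have "\<bar>a (Suc m) - a m\<bar> \<le> D m / (real m + 1)\<^sup>2"
      using step[OF m] by (simp add: field_simps less_imp_le)
    then have "D m - D m / (real m + 1)\<^sup>2 \<le> D (Suc m)" unfolding D_def by linarith
    then have "(D m - D m / (real m + 1)\<^sup>2) * (real (Suc m) / (real (Suc m) + 1)) \<le> D (Suc m) * (real (Suc m) / (real (Suc m) + 1))"
      by (intro mult_right_mono) auto
    moreover have "(D m - D m / (real m + 1)\<^sup>2) * (real (Suc m) / (real (Suc m) + 1)) = D m * (real m / (real m + 1))"
    proof -
      \<comment> \<open>The factorization \<open>1 - 1/\<sigma>^2 = ((\<sigma> - 1)/\<sigma>) *
        ((\<sigma> + 1)/\<sigma>)\<close> makes the lower bounds telescope; this is why the steps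
        are weighted with a square.\<close>
      define \<sigma> where "\<sigma> = real m + 1"
      have \<sigma>: "real m = \<sigma> - 1" "real (Suc m) = \<sigma>" "\<sigma> \<noteq> 0" "\<sigma> + 1 \<noteq> 0" by (auto simp: \<sigma>_def)
      have "D m - D m / \<sigma>\<^sup>2 = D m * ((\<sigma> - 1) / \<sigma>) * ((\<sigma> + 1) / \<sigma>)"
        using \<sigma>(3) by (simp add: field_simps power2_eq_square)
      then have "(D m - D m / \<sigma>\<^sup>2) * (\<sigma> / (\<sigma> + 1)) = D m * ((\<sigma> - 1) / \<sigma>)"
        using \<sigma>(3,4) by simp
      then show ?thesis by (simp add: \<sigma>(1,2))
    qed
    ultimately show ?thesis by simp
  qed
  define e where "e = D ?N * (real ?N / (real ?N + 1))"
  have e: "e > 0" unfolding e_def using pos[of ?N] by (intro mult_pos_pos divide_pos_pos) auto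
  have ge: "e \<le> D m * (real m / (real m + 1))" if "m \<ge> ?N" for m
    using that by (induction m rule: dec_induct) (use mono in \<open>auto simp: e_def intro: order_trans\<close>)
  have "e \<le> D m" if "m \<ge> ?N" for m
  proof -
    have "D m * (real m / (real m + 1)) \<le> D m * 1" using pos[OF that] by (intro mult_left_mono) auto
    then show ?thesis using ge[OF that] by simp
  qed
  moreover have "D \<longlonglongrightarrow> 0"
    using tendsto_rabs_zero[OF LIM_zero[OF a]] unfolding D_def by (simp add: abs_minus_commute)
  then have "eventually (\<lambda>m. D m < e) sequentially" using e by (rule order_tendstoD)
  then obtain N' where "\<And>m. m \<ge> N' \<Longrightarrow> D m < e" by (auto simp: eventually_sequentially)
  ultimately show False using not_le[of e "D (max ?N N')"] by auto
qed

lemma bounded_poly_exp: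
  assumes "0 < \<tau>"
  obtains L :: real where "L > 0" "\<And>m::nat. (real m + 1) ^ k * 2 powr (- real m * \<tau>) \<le> L"
proof -
  have "(\<lambda>m::nat. (real m + 1) ^ k * 2 powr (- real m * \<tau>)) \<longlonglongrightarrow> 0"
    using assms by real_asymp
  then have "Bseq (\<lambda>m::nat. (real m + 1) ^ k * 2 powr (- real m * \<tau>))"
    using convergent_imp_Bseq convergentI by blast
  then obtain L where L: "L > 0" "\<And>m. norm ((real m + 1) ^ k * 2 powr (- real m * \<tau>)) \<le> L"
    by (auto simp: Bseq_def)
  have "(real m + 1) ^ k * 2 powr (- real m * \<tau>) \<le> L" for m
    using L(2)[of m] by simp
  then show ?thesis using that L(1) by blast
qed

section \<open>Hausdorff content and dimension\<close>

lemma hausdorff_content_le: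
  assumes "A \<subseteq> (\<Union>i. U i)" "\<And>i::nat. bounded (U i)" "\<And>i. diameter (U i) \<le> \<epsilon>"
  shows "hausdorff_content t \<epsilon> A \<le> (\<Sum>i. hausdorff_gauge t (U i))"
  unfolding hausdorff_content_def using assms by (intro INF_lower) auto

text \<open>The finite families are padded with empty sets, whose gauge is 0 for every exponent, and
  the resulting double sequence is enumerated by \<open>prod_decode\<close>.\<close>

lemma hausdorff_content_double_cover:
  assumes F: "\<And>m. finite (F m)" and A: "A \<subseteq> (\<Union>m. \<Union>q\<in>F m. U m q)"
    and U: "\<And>m q. q \<in> F m \<Longrightarrow> bounded (U m q)" "\<And>m q. q \<in> F m \<Longrightarrow> diameter (U m q) \<le> \<epsilon>" and \<epsilon>: "0 \<le> \<epsilon>"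
  shows "hausdorff_content t \<epsilon> A \<le> (\<Sum>m. \<Sum>q\<in>F m. hausdorff_gauge t (U m q))"
proof -
  have "\<exists>e. bij_betw e {..<card (F m)} (F m)" for m
    using ex_bij_betw_nat_finite[OF F[of m]] by (simp add: atLeast0LessThan)
  then obtain e where e: "\<And>m. bij_betw (e m) {..<card (F m)} (F m)" by metis
  define V where "V = (\<lambda>(m, l). if l < card (F m) then U m (e m l) else {})"
  have eF: "e m l \<in> F m" if "l < card (F m)" for m l using e[of m] that by (auto simp: bij_betw_def)
  have "hausdorff_content t \<epsilon> A \<le> (\<Sum>i. hausdorff_gauge t (V (prod_decode i)))"
  proof (rule hausdorff_content_le)
    show "A \<subseteq> (\<Union>i. V (prod_decode i))"
    proof
      fix x assume "x \<in> A"
      then obtain m q where q: "q \<in> F m" "x \<in> U m q" using A by blast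
      then obtain l where l: "l < card (F m)" "q = e m l" using e[of m] by (auto simp: bij_betw_def)
      then have "x \<in> V (prod_decode (prod_encode (m, l)))" using q by (simp add: V_def)
      then show "x \<in> (\<Union>i. V (prod_decode i))" by blast
    qed
    show "bounded (V (prod_decode i))" "diameter (V (prod_decode i)) \<le> \<epsilon>" for i
      using U[OF eF] \<epsilon> by (auto simp: V_def split: prod.splits)
  qed
  also have "\<dots> = (\<Sum>m. \<Sum>l. hausdorff_gauge t (V (m, l)))"
    by (rule suminf_ennreal_2dimen[of _ "\<lambda>z. hausdorff_gauge t (V z)"]) simp
  also have "\<dots> = (\<Sum>m. \<Sum>q\<in>F m. hausdorff_gauge t (U m q))"
  proof (rule suminf_cong)
    fix m
    have "(\<Sum>l. hausdorff_gauge t (V (m, l))) = (\<Sum>l\<in>{..<card (F m)}. hausdorff_gauge t (V (m, l)))"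
      by (rule suminf_finite) (auto simp: V_def hausdorff_gauge_def)
    also have "\<dots> = (\<Sum>l\<in>{..<card (F m)}. hausdorff_gauge t (U m (e m l)))"
      by (rule sum.cong) (auto simp: V_def)
    also have "\<dots> = (\<Sum>q\<in>F m. hausdorff_gauge t (U m q))"
      by (rule sum.reindex_bij_betw[OF e])
    finally show "(\<Sum>l. hausdorff_gauge t (V (m, l))) = (\<Sum>q\<in>F m. hausdorff_gauge t (U m q))" .
  qed
  finally show ?thesis .
qed

lemma hausdorff_dim_le:
  assumes "\<And>t. d < t \<Longrightarrow> hausdorff_measure t A = 0" "0 \<le> d"
  shows "hausdorff_dim A \<le> ereal d"
proof (rule ereal_le_epsilon2)
  fix e :: real assume "0 < e"
  then have "hausdorff_dim A \<le> ereal (d + e)"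
    unfolding hausdorff_dim_def using assms by (intro INF_lower) auto
  then show "hausdorff_dim A \<le> ereal d + ereal e" by simp
qed

lemma hausdorff_dim_ge:
  assumes "\<And>t. 0 \<le> t \<Longrightarrow> t < d \<Longrightarrow> hausdorff_measure t A \<noteq> 0"
  shows "ereal d \<le> hausdorff_dim A"
  unfolding hausdorff_dim_def using assms by (intro INF_greatest) (auto simp: not_less[symmetric])

text \<open>Covers must be made open for compactness and dyadic in size for the kernel, at the cost
  of a factor \<open>4 powr t\<close>. The additive \<open>\<tau>\<close> is needed for one-point
  sets, whose gauge vanishes when \<open>t > 0\<close>.\<close>

lemma open_thickening:
  fixes U :: "'a::metric_space set"
  assumes U: "bounded U" "U \<noteq> {}" "diameter U \<le> 1 / 4" and t: "0 \<le> t" and \<tau>: "0 < \<tau>"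
  shows "\<exists>q V. open V \<and> U \<subseteq> V \<and> (\<forall>x\<in>V. \<forall>x'\<in>V. dist x x' \<le> 1 / 2 ^ q)
     \<and> ennreal (2 powr (- real q * t)) \<le> ennreal (4 powr t) * hausdorff_gauge t U + ennreal \<tau>"
proof -
  let ?d = "diameter U"
  have thick: "\<exists>V. open V \<and> U \<subseteq> V \<and> (\<forall>x\<in>V. \<forall>x'\<in>V. dist x x' \<le> 1 / 2 ^ q)"
    if \<eta>: "0 < \<eta>" "?d + 2 * \<eta> \<le> 1 / 2 ^ q" for \<eta> :: real and q :: nat
  proof (intro exI[of _ "\<Union>u\<in>U. ball u \<eta>"] conjI ballI)
    fix x x' assume "x \<in> (\<Union>u\<in>U. ball u \<eta>)" "x' \<in> (\<Union>u\<in>U. ball u \<eta>)"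
    then obtain u u' where u: "u \<in> U" "u' \<in> U" "dist u x < \<eta>" "dist u' x' < \<eta>" by auto
    have "dist x x' \<le> dist u x + dist u u' + dist u' x'"
      using dist_triangle[of x x' u] dist_triangle[of u x' u'] by (simp add: dist_commute)
    also have "dist u u' \<le> ?d" using diameter_bounded_bound[OF U(1) u(1,2)] .
    finally show "dist x x' \<le> 1 / 2 ^ q" using u \<eta> by linarith
  qed (use \<eta> in auto)
  have d0: "0 \<le> ?d" by (rule diameter_ge_0[OF U(1)])
  show ?thesis
  proof (cases "?d = 0")
    case False
    then have d: "0 < ?d" using d0 by simp
    \<comment> \<open>Room for a neighbourhood of width \<open>?d / 2\<close> on each side, while
      \<open>1 / 2 ^ q\<close> stays below \<open>4 * ?d\<close>.\<close>
    obtain q where q: "1 / 2 ^ Suc q < 2 * ?d" "2 * ?d \<le> 1 / 2 ^ q"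
      using dyadic_scale[of "2 * ?d" 1] d U(3) by auto
    obtain V where V: "open V" "U \<subseteq> V" "\<forall>x\<in>V. \<forall>x'\<in>V. dist x x' \<le> 1 / 2 ^ q"
      using thick[of "?d / 2" q] d q by auto
    have "1 / 2 ^ q \<le> 4 * ?d" using q(1) by simp
    then have "(1 / 2 ^ q) powr t \<le> (4 * ?d) powr t" using t by (intro powr_mono2) auto
    moreover have "(1 / 2 ^ q) powr t = 2 powr (- real q * t)"
      by (simp add: powr_realpow[symmetric] powr_minus_divide[symmetric] powr_powr)
    ultimately have "2 powr (- real q * t) \<le> 4 powr t * ?d powr t" using d by (simp add: powr_mult)
    then have "ennreal (2 powr (- real q * t)) \<le> ennreal (4 powr t) * ennreal (?d powr t)"
      by (subst ennreal_mult[symmetric]) (auto intro!: ennreal_leI)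
    also have "ennreal (?d powr t) = hausdorff_gauge t U"
      using U d by (auto simp: hausdorff_gauge_def)
    finally have "ennreal (2 powr (- real q * t)) \<le> ennreal (4 powr t) * hausdorff_gauge t U + ennreal \<tau>"
      by (rule order_trans) simp
    then show ?thesis using V by blast
  next
    case True
    show ?thesis
    proof (cases "t = 0")
      case t0: True
      obtain V where V: "open V" "U \<subseteq> V" "\<forall>x\<in>V. \<forall>x'\<in>V. dist x x' \<le> 1 / 2 ^ 0"
        using thick[of "1 / 2" 0] True by auto
      have "ennreal (2 powr (- real 0 * t)) \<le> ennreal (4 powr t) * hausdorff_gauge t U + ennreal \<tau>"
        using U t0 by (simp add: hausdorff_gauge_def)
      then show ?thesis using V by blast
    next
      case False
      then have "2 powr (- t) < 2 powr 0" using t by (intro powr_less_mono) auto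
      then have "(\<lambda>q. (2 powr (- t)) ^ q) \<longlonglongrightarrow> 0" by (intro LIMSEQ_realpow_zero) auto
      from order_tendstoD(2)[OF this \<tau>] obtain q where q: "(2 powr (- t)) ^ q < \<tau>"
        by (auto simp: eventually_sequentially)
      obtain V where V: "open V" "U \<subseteq> V" "\<forall>x\<in>V. \<forall>x'\<in>V. dist x x' \<le> 1 / 2 ^ q"
        using thick[of "1 / 2 ^ q / 2" q] True by auto
      have "2 powr (- real q * t) \<le> \<tau>" using q by (simp add: powr_power mult.commute)
      then have "ennreal (2 powr (- real q * t)) \<le> ennreal \<tau>" by (rule ennreal_leI)
      then have "ennreal (2 powr (- real q * t)) \<le> ennreal (4 powr t) * hausdorff_gauge t U + ennreal \<tau>"
        by (rule order_trans) simp
      then show ?thesis using V by blast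
    qed
  qed
qed

section \<open>Oscillation of good functions and covers of their level sets\<close>

context random_wavelet_series
begin

text \<open>The function is compared with a later partial sum \<open>S M f\<close>. The blocks
  between \<open>m\<close> and \<open>M\<close> are absorbed by \<open>tail\<close>, and the error
  of \<open>S M f\<close> tends to 0 in norm, so that no pointwise convergence is required.\<close>

lemma local_oscillation_le_Theta:
  assumes f: "f \<in> good"
  shows "ennreal ((2 ^ m) ^ CARD('n)) *
    (\<integral>\<^sup>+z. ennreal \<bar>rep_l1 f z - S m f x\<bar> * indicator (ball x (rad / 2 ^ m)) z \<partial>torus_measure) \<le> Theta m f x"
  unfolding Theta_def
proof (rule mult_left_mono)
  let ?B = "ball x (rad / 2 ^ m)" and ?T = "torus_measure :: 'n torus measure"
  let ?a = "\<integral>\<^sup>+z. ennreal \<bar>rep_l1 f z - S m f x\<bar> * indicator ?B z \<partial>?T"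
  let ?b = "\<integral>\<^sup>+z. (tail m f z + ennreal \<bar>S m f z - S m f x\<bar>) * indicator ?B z \<partial>?T"
  have "?a \<le> ennreal (norm (f - SL M f)) + ?b" if M: "m \<le> M" for M
  proof -
    have "?a \<le> (\<integral>\<^sup>+z. ennreal \<bar>rep_l1 f z - S M f z\<bar> + (tail m f z + ennreal \<bar>S m f z - S m f x\<bar>) * indicator ?B z \<partial>?T)"
    proof (rule nn_integral_mono)
      fix z
      show "ennreal \<bar>rep_l1 f z - S m f x\<bar> * indicator ?B z
        \<le> ennreal \<bar>rep_l1 f z - S M f z\<bar> + (tail m f z + ennreal \<bar>S m f z - S m f x\<bar>) * indicator ?B z"
      proof (cases "z \<in> ?B")
        case True
        have "S M f z = S m f z + (\<Sum>k<M - m. Del (m + k) f z)"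
          using M sum.atLeastLessThan_concat[of 0 m M "\<lambda>k. Del k f z"]
            sum.shift_bounds_nat_ivl[of "\<lambda>k. Del k f z" 0 m "M - m"]
          by (simp add: S_def atLeast0LessThan[symmetric] add.commute)
        then have "\<bar>rep_l1 f z - S m f x\<bar> \<le> \<bar>rep_l1 f z - S M f z\<bar> + ((\<Sum>k<M - m. \<bar>Del (m + k) f z\<bar>) + \<bar>S m f z - S m f x\<bar>)"
          using sum_abs[of "\<lambda>k. Del (m + k) f z" "{..<M - m}"] by linarith
        then have "ennreal \<bar>rep_l1 f z - S m f x\<bar>
            \<le> ennreal (\<bar>rep_l1 f z - S M f z\<bar> + ((\<Sum>k<M - m. \<bar>Del (m + k) f z\<bar>) + \<bar>S m f z - S m f x\<bar>))"
          by (rule ennreal_leI)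
        also have "\<dots> = ennreal \<bar>rep_l1 f z - S M f z\<bar> + ((\<Sum>k<M - m. ennreal \<bar>Del (m + k) f z\<bar>) + ennreal \<bar>S m f z - S m f x\<bar>)"
          by (simp add: sum_nonneg sum_ennreal)
        also have "\<dots> \<le> ennreal \<bar>rep_l1 f z - S M f z\<bar> + (tail m f z + ennreal \<bar>S m f z - S m f x\<bar>)"
          unfolding tail_def by (intro add_left_mono add_right_mono sum_le_suminf) auto
        finally show ?thesis using True by simp
      qed simp
    qed
    also have "\<dots> = (\<integral>\<^sup>+z. ennreal \<bar>rep_l1 f z - S M f z\<bar> \<partial>?T) + ?b"
      unfolding indicator_def mem_ball by (rule nn_integral_add) measurable
    finally have "?a \<le> (\<integral>\<^sup>+z. ennreal \<bar>rep_l1 f z - S M f z\<bar> \<partial>?T) + ?b" .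
    moreover have "(\<integral>\<^sup>+z. ennreal \<bar>rep_l1 f z - S M f z\<bar> \<partial>?T) = ennreal (norm (f - SL M f))"
      unfolding SL_eq norm_l1_diff[OF integrable_S]
      by (rule nn_integral_eq_integral) (auto intro!: integrable_abs integrable_S)
    ultimately show ?thesis by simp
  qed
  moreover have "(\<lambda>M. ennreal (norm (f - SL M f)) + ?b) \<longlonglongrightarrow> ennreal 0 + ?b"
    using f by (intro tendsto_add tendsto_ennrealI tendsto_const) (simp add: good_def)
  ultimately show "?a \<le> ?b"
    by (intro LIMSEQ_le_const[of "\<lambda>M. ennreal (norm (f - SL M f)) + ?b" ?b ?a]) auto
qed simp

text \<open>A ball of radius \<open>r\<close> lies in one of radius \<open>rad / 2 ^ m\<close> of
  comparable size. There \<open>Theta\<close> controls the mean deviation from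
  \<open>S m f x\<close>, and the geometric tail controls the deviation of \<open>S m f x\<close>
  from the limit; both are of order \<open>r^(s/2)\<close>.\<close>

lemma K_lebesgue_point:
  assumes f: "f \<in> good" and x: "x \<in> K A f" and A: "0 \<le> A"
  shows "x \<in> lebesgue_points f \<inter> level_set f (Slim f x)"
proof -
  let ?T = "torus_measure :: 'n torus measure" and ?N = "CARD('n)"
  \<comment> \<open>The first summand comes from \<open>r > rad / 2 ^ Suc m\<close>; in the second,
    20 is 10 from the volume bound times the same factor 2.\<close>
  define C' where "C' = (2 / rad) ^ ?N * A + A * Cgeo * 20 ^ ?N"
  have Cg: "Cgeo \<ge> 0" unfolding Cgeo_def using s by (intro suminf_nonneg summable_powr_neg) auto
  have C': "C' \<ge> 0" using A Cg rad_pos by (simp add: C'_def)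
  have bound: "(LINT z:ball x r|?T. \<bar>rep_l1 f z - Slim f x\<bar>) / r ^ ?N \<le> C' * (2 * r / rad) powr (s / 2)"
    if r: "0 < r" "r \<le> rad" for r
  proof -
    obtain m where m: "rad / 2 ^ Suc m < r" "r \<le> rad / 2 ^ m" using dyadic_scale[OF r] by blast
    let ?B = "ball x (rad / 2 ^ m)" and ?w = "2 powr (- real m * (s / 2))"
    let ?I = "\<integral>\<^sup>+z. ennreal \<bar>rep_l1 f z - S m f x\<bar> * indicator ?B z \<partial>?T"
    have "ennreal ((2 ^ m) ^ ?N) * ?I \<le> ennreal (A * ?w)"
      using local_oscillation_le_Theta[OF f, of m x] x by (auto simp: K_def intro: order_trans)
    then have "ennreal (1 / (2 ^ m) ^ ?N) * (ennreal ((2 ^ m) ^ ?N) * ?I) \<le> ennreal (1 / (2 ^ m) ^ ?N) * ennreal (A * ?w)"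
      by (rule mult_left_mono) simp
    moreover have "ennreal (1 / (2 ^ m) ^ ?N) * (ennreal ((2 ^ m) ^ ?N) * ?I) = ?I"
      by (simp add: mult.assoc[symmetric] ennreal_mult[symmetric])
    ultimately have I: "?I \<le> ennreal (A * ?w / (2 ^ m) ^ ?N)"
      using A by (simp add: ennreal_mult[symmetric])
    have "ennreal (LINT z:ball x r|?T. \<bar>rep_l1 f z - Slim f x\<bar>)
       = (\<integral>\<^sup>+z. ennreal \<bar>rep_l1 f z - Slim f x\<bar> * indicator (ball x r) z \<partial>?T)"
      by (rule set_integral_abs_eq)
    also have "\<dots> \<le> (\<integral>\<^sup>+z. ennreal \<bar>rep_l1 f z - S m f x\<bar> * indicator ?B z + ennreal (A * Cgeo * ?w) * indicator ?B z \<partial>?T)"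
    proof (rule nn_integral_mono)
      fix z
      show "ennreal \<bar>rep_l1 f z - Slim f x\<bar> * indicator (ball x r) z
        \<le> ennreal \<bar>rep_l1 f z - S m f x\<bar> * indicator ?B z + ennreal (A * Cgeo * ?w) * indicator ?B z"
      proof (cases "z \<in> ball x r")
        case True
        then have "z \<in> ?B" using m by auto
        have "\<bar>rep_l1 f z - Slim f x\<bar> \<le> \<bar>rep_l1 f z - S m f x\<bar> + A * Cgeo * ?w"
          using K_Slim(2)[OF x A, of m] by linarith
        then have "ennreal \<bar>rep_l1 f z - Slim f x\<bar> \<le> ennreal (\<bar>rep_l1 f z - S m f x\<bar> + A * Cgeo * ?w)"
          by (rule ennreal_leI)
        then show ?thesis using \<open>z \<in> ?B\<close> True A Cg by simp
      qed simp
    qed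
    also have "\<dots> = ?I + ennreal (A * Cgeo * ?w) * emeasure ?T ?B"
    proof -
      have "(\<integral>\<^sup>+z. ennreal (A * Cgeo * ?w) * indicator ?B z \<partial>?T) = ennreal (A * Cgeo * ?w) * emeasure ?T ?B"
        by (rule nn_integral_cmult_indicator) simp
      moreover have "(\<integral>\<^sup>+z. ennreal \<bar>rep_l1 f z - S m f x\<bar> * indicator ?B z + ennreal (A * Cgeo * ?w) * indicator ?B z \<partial>?T)
          = ?I + (\<integral>\<^sup>+z. ennreal (A * Cgeo * ?w) * indicator ?B z \<partial>?T)"
        unfolding indicator_def mem_ball by (rule nn_integral_add) measurable
      ultimately show ?thesis by simp
    qed
    also have "\<dots> \<le> ennreal (A * ?w / (2 ^ m) ^ ?N) + ennreal (A * Cgeo * ?w) * ennreal (10 ^ ?N * (rad / 2 ^ m) ^ ?N)"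
      using rad_pos by (intro add_mono I mult_left_mono emeasure_torus_ball_le) auto
    also have "\<dots> = ennreal (A * ?w / (2 ^ m) ^ ?N + A * Cgeo * ?w * (10 ^ ?N * (rad / 2 ^ m) ^ ?N))"
      using A Cg rad_pos by (simp add: ennreal_mult)
    finally have "(LINT z:ball x r|?T. \<bar>rep_l1 f z - Slim f x\<bar>)
        \<le> A * ?w / (2 ^ m) ^ ?N + A * Cgeo * ?w * (10 ^ ?N * (rad / 2 ^ m) ^ ?N)"
      using A Cg rad_pos by (subst (asm) ennreal_le_iff) auto
    then have "(LINT z:ball x r|?T. \<bar>rep_l1 f z - Slim f x\<bar>) / r ^ ?N
        \<le> (A * ?w / (2 ^ m) ^ ?N + A * Cgeo * ?w * (10 ^ ?N * (rad / 2 ^ m) ^ ?N)) / r ^ ?N"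
      using r by (intro divide_right_mono) auto
    also have "\<dots> \<le> (A * ?w / (2 ^ m) ^ ?N + A * Cgeo * ?w * (10 ^ ?N * (rad / 2 ^ m) ^ ?N)) / (rad / 2 ^ Suc m) ^ ?N"
      using m r rad_pos A Cg by (intro divide_left_mono power_mono add_nonneg_nonneg mult_pos_pos zero_less_power) (auto intro!: divide_nonneg_nonneg mult_nonneg_nonneg)
    also have "\<dots> = C' * ?w"
    proof -
      define P :: real where "P = (2 ^ m) ^ ?N"
      define \<rho> where "\<rho> = rad ^ ?N"
      define two :: real where "two = 2 ^ ?N"
      define ten :: real where "ten = 10 ^ ?N"
      have nz: "P \<noteq> 0" "\<rho> \<noteq> 0" "two \<noteq> 0" using rad_pos by (auto simp: P_def \<rho>_def two_def)
      have e: "(rad / 2 ^ Suc m) ^ ?N = \<rho> / (two * P)" "(rad / 2 ^ m) ^ ?N = \<rho> / P" "(2 / rad) ^ ?N = two / \<rho>"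
        by (simp_all add: power_divide power_mult_distrib P_def \<rho>_def two_def)
      have "(20::real) ^ ?N = two * ten" unfolding two_def ten_def by (subst power_mult_distrib[symmetric]) simp
      then have C'_eq: "C' = two / \<rho> * A + A * Cgeo * (two * ten)" by (simp add: C'_def e)
      show ?thesis unfolding e C'_eq P_def[symmetric] ten_def[symmetric] using nz by (simp add: field_simps)
    qed
    also have "\<dots> \<le> C' * (2 * r / rad) powr (s / 2)"
    proof (rule mult_left_mono[OF _ C'])
      have "1 / 2 ^ m \<le> 2 * r / rad" using m(1) rad_pos by (simp add: field_simps)
      then have "(1 / 2 ^ m) powr (s / 2) \<le> (2 * r / rad) powr (s / 2)" using s by (intro powr_mono2) auto
      moreover have "(1 / 2 ^ m) powr (s / 2) = ?w"
        by (simp add: powr_realpow[symmetric] powr_minus_divide[symmetric] powr_powr)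
      ultimately show "?w \<le> (2 * r / rad) powr (s / 2)" by simp
    qed
    finally show ?thesis .
  qed
  have lim: "((\<lambda>r. (LINT z:ball x r|?T. \<bar>rep_l1 f z - Slim f x\<bar>) / r ^ ?N) \<longlongrightarrow> 0) (at_right 0)"
  proof (rule tendsto_sandwich[OF _ _ tendsto_const])
    show "eventually (\<lambda>r. (LINT z:ball x r|?T. \<bar>rep_l1 f z - Slim f x\<bar>) / r ^ ?N \<le> C' * (2 * r / rad) powr (s / 2)) (at_right 0)"
      unfolding eventually_at_right_field using rad_pos bound by (intro exI[of _ rad]) auto
    show "eventually (\<lambda>r. 0 \<le> (LINT z:ball x r|?T. \<bar>rep_l1 f z - Slim f x\<bar>) / r ^ ?N) (at_right 0)"
      unfolding eventually_at_right_field set_lebesgue_integral_def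
      by (intro exI[of _ 1]) (auto intro!: divide_nonneg_pos integral_nonneg_AE)
    show "((\<lambda>r. C' * (2 * r / rad) powr (s / 2)) \<longlongrightarrow> 0) (at_right 0)"
      using s rad_pos by real_asymp
  qed
  then have "x \<in> lebesgue_points f" unfolding lebesgue_points_iff by blast
  moreover have "x \<in> level_set f (Slim f x)"
    using level_set_iff_average[OF ball_average_tendsto[OF lim]] by blast
  ultimately show ?thesis by blast
qed

text \<open>Each of two consecutive averages is within
  \<open>(4 * real CARD('n)) ^ CARD('n) * Theta\<close> of the dyadic value. The difference of the
  averages uses this twice, the comparison with the dyadic value once more.\<close>

definition Cup :: real where "Cup = 3 * (4 * real CARD('n)) ^ CARD('n)"

definition near_level :: "nat \<Rightarrow> 'n l1 \<Rightarrow> real \<Rightarrow> int ^ 'n \<Rightarrow> bool" where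
  "near_level m f y q \<longleftrightarrow> ennreal \<bar>y - S m f (dyadic_point m q)\<bar>
      \<le> ennreal (Cup * (real m + 1)\<^sup>2) * Theta m f (dyadic_point m q)"

text \<open>The closed range of radii contains both \<open>1 / 2 ^ m\<close> and
  \<open>1 / 2 ^ Suc m\<close>, so that two consecutive averages are compared with the same partial
  sum at the same dyadic point.\<close>

lemma average_near_dyadic:
  assumes f: "f \<in> good" and d: "dist x q \<le> real CARD('n) / 2 ^ m" and r: "0 < r" "r \<le> 1 / 2 ^ m" "1 / 2 ^ Suc m \<le> r"
  shows "ennreal \<bar>ball_average (rep_l1 f) x r - S m f q\<bar> \<le> ennreal ((4 * real CARD('n)) ^ CARD('n)) * Theta m f q"
proof -
  let ?T = "torus_measure :: 'n torus measure" and ?N = "CARD('n)"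
  let ?L = "LINT z:ball x r|?T. \<bar>rep_l1 f z - S m f q\<bar>"
  have r1: "r \<le> 1" using r(2) by (rule order_trans) simp
  have L0: "0 \<le> ?L" unfolding set_lebesgue_integral_def by (rule integral_nonneg_AE) auto
  have "\<bar>ball_average (rep_l1 f) x r - S m f q\<bar> \<le> (2 * real ?N) ^ ?N * (?L / r ^ ?N)"
    by (rule ball_average_diff_le[OF r(1) r1])
  also have "\<dots> \<le> (2 * real ?N) ^ ?N * (?L / (1 / 2 ^ Suc m) ^ ?N)"
    using r L0 by (intro mult_left_mono divide_left_mono power_mono mult_pos_pos zero_less_power) auto
  also have "\<dots> = (4 * real ?N) ^ ?N * ((2 ^ m) ^ ?N * ?L)"
  proof -
    have "(4 * real ?N) ^ ?N = (2 * real ?N) ^ ?N * 2 ^ ?N"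
      by (subst power_mult_distrib[symmetric]) (simp add: mult.commute)
    then show ?thesis by (simp add: power_mult_distrib power_divide)
  qed
  finally have "ennreal \<bar>ball_average (rep_l1 f) x r - S m f q\<bar> \<le> ennreal ((4 * real ?N) ^ ?N * ((2 ^ m) ^ ?N * ?L))"
    by (rule ennreal_leI)
  also have "\<dots> = ennreal ((4 * real ?N) ^ ?N) * (ennreal ((2 ^ m) ^ ?N) * ennreal ?L)"
    using L0 by (simp add: ennreal_mult)
  also have "\<dots> \<le> ennreal ((4 * real ?N) ^ ?N) * Theta m f q"
  proof (rule mult_left_mono)
    have sub: "ball x r \<subseteq> ball q (rad / 2 ^ m)"
    proof
      fix z assume "z \<in> ball x r"
      then have "dist q z < real ?N / 2 ^ m + 1 / 2 ^ m"
        using d r(2) dist_triangle[of q z x] by (simp add: dist_commute)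
      then show "z \<in> ball q (rad / 2 ^ m)" by (simp add: rad_def add_divide_distrib)
    qed
    have "ennreal ?L = (\<integral>\<^sup>+z. ennreal \<bar>rep_l1 f z - S m f q\<bar> * indicator (ball x r) z \<partial>?T)"
      by (rule set_integral_abs_eq)
    also have "\<dots> \<le> (\<integral>\<^sup>+z. ennreal \<bar>rep_l1 f z - S m f q\<bar> * indicator (ball q (rad / 2 ^ m)) z \<partial>?T)"
      using sub by (intro nn_integral_mono mult_left_mono) (auto simp: indicator_def)
    finally have "ennreal ((2 ^ m) ^ ?N) * ennreal ?L \<le> ennreal ((2 ^ m) ^ ?N) *
       (\<integral>\<^sup>+z. ennreal \<bar>rep_l1 f z - S m f q\<bar> * indicator (ball q (rad / 2 ^ m)) z \<partial>?T)"
      by (rule mult_left_mono) simp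
    also have "\<dots> \<le> Theta m f q" by (rule local_oscillation_le_Theta[OF f])
    finally show "ennreal ((2 ^ m) ^ ?N) * ennreal ?L \<le> Theta m f q" .
  qed simp
  finally show ?thesis .
qed

text \<open>At infinitely many scales the remaining distance to \<open>y\<close> is at most
  \<open>(m + 1)^2\<close> times the next step. The step is bounded by the local oscillation, hence
  \<open>y\<close> is close to the dyadic value at such a scale.\<close>

lemma level_point_near_level:
  assumes f: "f \<in> good" and x: "x \<in> lebesgue_points f \<inter> level_set f y"
  shows "\<exists>m\<ge>N. \<exists>q\<in>dyadic_index m. dist x (dyadic_point m q) \<le> real CARD('n) / 2 ^ m \<and> near_level m f y q"
proof -
  define a where "a m = ball_average (rep_l1 f) x (1 / 2 ^ m)" for m
  have "filterlim (\<lambda>m::nat. 1 / 2 ^ m :: real) (at_right 0) sequentially"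
    by (rule tendsto_imp_filterlim_at_right) (auto intro!: LIMSEQ_divide_realpow_zero)
  then have a: "a \<longlonglongrightarrow> y"
    unfolding a_def using filterlim_compose[OF lebesgue_level_point_cases[OF x]] by blast
  obtain m where m: "m \<ge> N" "\<bar>y - a m\<bar> \<le> (real m + 1)\<^sup>2 * \<bar>a (Suc m) - a m\<bar>"
    using infinitely_many_large_steps[OF a] by blast
  obtain q where q: "q \<in> dyadic_index m" "dist x (dyadic_point m q) \<le> real CARD('n) / 2 ^ m"
    by (rule dyadic_net)
  let ?\<theta> = "Theta m f (dyadic_point m q)" and ?c = "(4 * real CARD('n)) ^ CARD('n)" and ?S = "S m f (dyadic_point m q)"
  have 1: "ennreal \<bar>a m - ?S\<bar> \<le> ennreal ?c * ?\<theta>" "ennreal \<bar>a (Suc m) - ?S\<bar> \<le> ennreal ?c * ?\<theta>"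
    unfolding a_def by (rule average_near_dyadic[OF f q(2)]; simp add: field_simps)+
  have "near_level m f y q"
  proof (cases "?\<theta> = \<top>")
    case True
    \<comment> \<open>Since \<open>0 * \<top> = 0\<close> in \<open>ennreal\<close>, the factor must
      be nonzero for the right-hand side to be infinite.\<close>
    have "Cup * (real m + 1)\<^sup>2 > 0" by (simp add: Cup_def)
    then have "ennreal (Cup * (real m + 1)\<^sup>2) \<noteq> 0" by (simp add: ennreal_eq_0_iff)
    then show ?thesis unfolding near_level_def True by (simp only: ennreal_mult_top if_False top_greatest)
  next
    case False
    then obtain t where t: "?\<theta> = ennreal t" "0 \<le> t" by (cases "?\<theta>") auto
    have c: "?c > 0" by simp
    have "\<bar>a m - ?S\<bar> \<le> ?c * t" "\<bar>a (Suc m) - ?S\<bar> \<le> ?c * t"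
      using 1 t c by (simp_all add: ennreal_mult[symmetric])
    then have d: "\<bar>a (Suc m) - a m\<bar> \<le> 2 * (?c * t)" "\<bar>a m - ?S\<bar> \<le> 1 * (?c * t)" by linarith+
    have p: "1 \<le> (real m + 1)\<^sup>2" by simp
    have "\<bar>y - ?S\<bar> \<le> \<bar>y - a m\<bar> + \<bar>a m - ?S\<bar>" by linarith
    also have "\<dots> \<le> (real m + 1)\<^sup>2 * (2 * (?c * t)) + (real m + 1)\<^sup>2 * (?c * t)"
      using m(2) d p t c
      by (intro add_mono order_trans[OF m(2)] order_trans[OF d(2)] mult_left_mono mult_right_mono) auto
    also have "\<dots> = Cup * (real m + 1)\<^sup>2 * t" by (simp add: Cup_def algebra_simps)
    finally show ?thesis
      unfolding near_level_def t by (subst ennreal_mult[symmetric]) (use t in \<open>auto simp: Cup_def intro!: ennreal_leI\<close>)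
  qed
  then show ?thesis using m q by blast
qed

text \<open>The factor \<open>(m + 1)^4\<close> makes the mean of \<open>cover_sum\<close> finite despite the factor \<open>(m + 1)\<^sup>2\<close> in
  \<open>near_level\<close>, and does not affect the dimension.\<close>

definition wt :: "nat \<Rightarrow> real" where
  "wt m = 2 powr (- real m * (real CARD('n) - s)) / (real m + 1) ^ 4"

definition cover_sum :: "'n l1 \<Rightarrow> real \<Rightarrow> ennreal" where
  "cover_sum f y = (\<Sum>m. \<Sum>q\<in>dyadic_index m. ennreal (wt m) * (if near_level m f y q then 1 else 0))"

text \<open>For \<open>t > n - s\<close> the gauge of a covering ball of scale \<open>m\<close> is
  at most a constant times \<open>wt m\<close>, the exponential gain absorbing the polynomial.
  Covers that start at scale \<open>N\<close> have total gauge bounded by the tail of the convergent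
  series \<open>cover_sum\<close>, which tends to 0.\<close>

lemma hausdorff_dim_level_le:
  assumes f: "f \<in> good" and fin: "cover_sum f y < \<infinity>"
  shows "hausdorff_dim (lebesgue_points f \<inter> level_set f y) \<le> ereal (real CARD('n) - s)"
proof (rule hausdorff_dim_le)
  let ?A = "lebesgue_points f \<inter> level_set f y" and ?n = "real CARD('n)"
  have n1: "?n \<ge> 1" by (simp add: Suc_leI)
  show "0 \<le> ?n - s" using n1 s by linarith
  fix t assume t: "?n - s < t"
  then have t0: "t > 0" using n1 s by linarith
  obtain L where L: "L > 0" "\<And>m::nat. (real m + 1) ^ 4 * 2 powr (- real m * (t - (?n - s))) \<le> L"
    using bounded_poly_exp[of "t - (?n - s)" 4] t by auto
  define D where "D = (2 * ?n) powr t * L"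
  have D: "D > 0" using n1 L by (simp add: D_def)
  define U where "U m q = cball (dyadic_point m q) (?n / 2 ^ m)" for m and q :: "int ^ 'n"
  have Ub: "bounded (U m q)" for m q by (simp add: U_def)
  have Ud: "diameter (U m q) \<le> 2 * ?n / 2 ^ m" for m q
  proof -
    have "dist x x' \<le> 2 * ?n / 2 ^ m" if "x \<in> U m q" "x' \<in> U m q" for x x'
    proof -
      have "dist (dyadic_point m q) x \<le> ?n / 2 ^ m" "dist (dyadic_point m q) x' \<le> ?n / 2 ^ m"
        using that by (auto simp: U_def)
      then show ?thesis using dist_triangle3[of x x' "dyadic_point m q"] by simp
    qed
    then show ?thesis by (auto simp: diameter_def intro!: cSUP_least)
  qed
  have gauge: "hausdorff_gauge t (U m q) \<le> ennreal D * ennreal (wt m)" for m q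
  proof -
    have "dyadic_point m q \<in> U m q" by (simp add: U_def)
    then have ne: "U m q \<noteq> {}" by blast
    have "diameter (U m q) powr t \<le> (2 * ?n / 2 ^ m) powr t"
      using Ud t0 diameter_ge_0[OF Ub] by (intro powr_mono2) auto
    also have "\<dots> = (2 * ?n) powr t * 2 powr (- real m * t)"
      using n1 by (simp add: powr_divide powr_realpow[symmetric] powr_powr powr_minus_divide)
    also have "2 powr (- real m * t) = ((real m + 1) ^ 4 * 2 powr (- real m * (t - (?n - s)))) * wt m"
      by (simp add: wt_def algebra_simps flip: powr_add)
    also have "(2 * ?n) powr t * (((real m + 1) ^ 4 * 2 powr (- real m * (t - (?n - s)))) * wt m)
        \<le> (2 * ?n) powr t * (L * wt m)"
      using L(2)[of m] by (intro mult_left_mono mult_right_mono) (auto simp: wt_def)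
    finally have "ennreal (diameter (U m q) powr t) \<le> ennreal (D * wt m)"
      by (intro ennreal_leI) (simp add: D_def mult.assoc)
    also have "ennreal (D * wt m) = ennreal D * ennreal (wt m)"
      using D by (intro ennreal_mult) (auto simp: wt_def)
    finally show ?thesis using ne t0 by (simp add: hausdorff_gauge_def)
  qed
  define h where "h m = (\<Sum>q\<in>dyadic_index m. ennreal (wt m) * (if near_level m f y q then 1 else 0))" for m
  have content: "hausdorff_content t \<epsilon> ?A \<le> ennreal D * (\<Sum>m. h (m + N))"
    if \<epsilon>: "\<epsilon> > 0" and N: "2 * ?n / 2 ^ N \<le> \<epsilon>" for \<epsilon> N
  proof -
    define F where "F m = {q \<in> dyadic_index (m + N). near_level (m + N) f y q}" for m
    have "hausdorff_content t \<epsilon> ?A \<le> (\<Sum>m. \<Sum>q\<in>F m. hausdorff_gauge t (U (m + N) q))"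
    proof (rule hausdorff_content_double_cover)
      show "finite (F m)" for m by (simp add: F_def)
      show "?A \<subseteq> (\<Union>m. \<Union>q\<in>F m. U (m + N) q)"
      proof
        fix x assume "x \<in> ?A"
        then obtain m q where m: "m \<ge> N" "q \<in> dyadic_index m" "dist x (dyadic_point m q) \<le> ?n / 2 ^ m" "near_level m f y q"
          using level_point_near_level[OF f] by blast
        then have "q \<in> F (m - N)" "x \<in> U (m - N + N) q" by (auto simp: F_def U_def dist_commute)
        then show "x \<in> (\<Union>m. \<Union>q\<in>F m. U (m + N) q)" by blast
      qed
      show "bounded (U (m + N) q)" for m q by (rule Ub)
      show "diameter (U (m + N) q) \<le> \<epsilon>" for m q
      proof -
        have "2 * ?n / 2 ^ (m + N) \<le> 2 * ?n / 2 ^ N" by (intro divide_left_mono) auto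
        then show ?thesis using Ud[of "m + N" q] N by linarith
      qed
    qed (use \<epsilon> in simp)
    also have "\<dots> \<le> (\<Sum>m. ennreal D * h (m + N))"
    proof (rule suminf_le)
      fix m
      have "(\<Sum>q\<in>F m. hausdorff_gauge t (U (m + N) q)) \<le> (\<Sum>q\<in>F m. ennreal D * ennreal (wt (m + N)))"
        by (intro sum_mono gauge)
      also have "\<dots> = ennreal D * h (m + N)"
        unfolding h_def F_def sum_distrib_left
        by (subst sum.inter_filter) (auto intro!: sum.cong)
      finally show "(\<Sum>q\<in>F m. hausdorff_gauge t (U (m + N) q)) \<le> ennreal D * h (m + N)" .
    qed auto
    also have "\<dots> = ennreal D * (\<Sum>m. h (m + N))" by simp
    finally show ?thesis .
  qed
  have tail0: "(\<lambda>N. \<Sum>m. h (m + N)) \<longlonglongrightarrow> 0"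
  proof -
    have hf: "h m < \<infinity>" for m
    proof -
      have "sum h {m} \<le> suminf h" by (rule sum_le_suminf) auto
      then show ?thesis using fin by (auto simp: cover_sum_def h_def[abs_def] intro: le_less_trans)
    qed
    define g where "g m = enn2real (h m)" for m
    have hg: "h m = ennreal (g m)" for m using hf[of m] by (simp add: g_def)
    have g0: "0 \<le> g m" for m by (simp add: g_def)
    have sg: "summable g"
      using fin by (intro summable_suminf_not_top g0) (simp add: cover_sum_def flip: hg, simp add: h_def top_unique less_top)
    have "(\<Sum>m. h (m + N)) = ennreal (\<Sum>m. g (m + N))" for N
      unfolding hg using g0 sg by (intro suminf_ennreal2) auto
    moreover have "(\<lambda>N. \<Sum>m. g (m + N)) \<longlonglongrightarrow> 0" by (rule suminf_exist_split2[OF sg])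
    ultimately show ?thesis using tendsto_ennrealI[of "\<lambda>N. \<Sum>m. g (m + N)" 0] by simp
  qed
  have "hausdorff_content t \<epsilon> ?A = 0" if \<epsilon>: "\<epsilon> > 0" for \<epsilon>
  proof -
    have "(\<lambda>N::nat. 2 * ?n / 2 ^ N) \<longlonglongrightarrow> 0" by (rule LIMSEQ_divide_realpow_zero) simp
    from order_tendstoD(2)[OF this \<epsilon>]
    have ev: "eventually (\<lambda>N. hausdorff_content t \<epsilon> ?A \<le> ennreal D * (\<Sum>m. h (m + N))) sequentially"
      by eventually_elim (rule content[OF \<epsilon>], simp)
    have "(\<lambda>N. ennreal D * (\<Sum>m. h (m + N))) \<longlonglongrightarrow> ennreal D * 0"
      by (intro ennreal_tendsto_cmult tail0) simp
    then have "hausdorff_content t \<epsilon> ?A \<le> ennreal D * 0"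
      using ev by (rule tendsto_lowerbound) simp
    then show ?thesis by simp
  qed
  then show "hausdorff_measure t ?A = 0"
    unfolding hausdorff_measure_def by (intro SUP_eq_const[THEN trans]) auto
qed

end

context random_wavelet_series
begin

subsection \<open>Energy and the lower bound\<close>

definition kweight :: "nat \<Rightarrow> real" where
  "kweight k = 2 powr (real k * (real CARD('n) - s)) / (real k + 1)\<^sup>2"

text \<open>Comparable to \<open>d(x,x')^(s-n)\<close> up to a logarithmic factor that makes it integrable against
  \<open>d(x,x')^(-s)\<close>; thus one kernel serves for all dimensions below \<open>n - s\<close>.\<close>

definition kap :: "'n torus \<Rightarrow> 'n torus \<Rightarrow> ennreal" where
  "kap x x' = (\<Sum>k. ennreal (kweight k) * indicator {z. dist x z \<le> 2 * real CARD('n) / 2 ^ k} x')"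

lemma kweight_nonneg: "0 \<le> kweight k"
  by (simp add: kweight_def)

lemma kap_ge:
  assumes "dist x x' \<le> 1 / 2 ^ q"
  shows "ennreal (kweight q) \<le> kap x x'"
proof -
  have "1 / 2 ^ q \<le> 2 * real CARD('n) / (2::real) ^ q" by (intro divide_right_mono order_trans[OF _ mult_left_mono[of 1 "real CARD('n)" 2]]) (auto simp: Suc_leI)
  then have "dist x x' \<le> 2 * real CARD('n) / 2 ^ q" using assms by linarith
  moreover have "(\<Sum>k\<in>{q}. ennreal (kweight k) * indicator {z. dist x z \<le> 2 * real CARD('n) / 2 ^ k} x') \<le> kap x x'"
    unfolding kap_def by (rule sum_le_suminf) auto
  ultimately show ?thesis by simp
qed

text \<open>The layer \<open>k = 0\<close> has weight 1 and covers the whole torus. This is what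
  makes the energy dominate the square of the mass.\<close>

lemma kap_ge_1: "1 \<le> kap x x'"
proof -
  have "(\<Sum>k\<in>{0}. ennreal (kweight k) * indicator {z. dist x z \<le> 2 * real CARD('n) / 2 ^ k} x') \<le> kap x x'"
    unfolding kap_def by (rule sum_le_suminf) auto
  then show ?thesis using dist_torus_le[of x x'] by (simp add: kweight_def)
qed

lemma kap_measurable [measurable (raw)]:
  assumes [measurable]: "f \<in> measurable N borel" "g \<in> measurable N borel"
  shows "(\<lambda>\<omega>. kap (f \<omega>) (g \<omega>)) \<in> borel_measurable N"
  unfolding kap_def indicator_def mem_Collect_eq by measurable

text \<open>Density, before normalization, of the measures that approximate the level set.
  \<open>Slim f x\<close> stands for the value of \<open>f\<close>, which keeps the function
  measurable in all arguments, and the restriction to \<open>K A f\<close> is built in.\<close>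

definition slice :: "real \<Rightarrow> real \<Rightarrow> 'n l1 \<Rightarrow> real \<Rightarrow> 'n torus \<Rightarrow> ennreal" where
  "slice A \<epsilon> f y x = (if x \<in> K A f \<and> \<bar>Slim f x - y\<bar> < \<epsilon> then 1 else 0)"

definition slice_mass :: "real \<Rightarrow> real \<Rightarrow> 'n l1 \<Rightarrow> real \<Rightarrow> ennreal" where
  "slice_mass A \<epsilon> f y = ennreal (1 / (2 * \<epsilon>)) * (\<integral>\<^sup>+x. slice A \<epsilon> f y x \<partial>torus_measure)"

definition slice_energy :: "real \<Rightarrow> real \<Rightarrow> 'n l1 \<Rightarrow> real \<Rightarrow> ennreal" where
  "slice_energy A \<epsilon> f y = ennreal (1 / (2 * \<epsilon>)\<^sup>2) *
     (\<integral>\<^sup>+x. (\<integral>\<^sup>+x'. kap x x' * (slice A \<epsilon> f y x * slice A \<epsilon> f y x') \<partial>torus_measure) \<partial>torus_measure)"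

text \<open>\<open>Theta\<close> is lower semicontinuous in \<open>x\<close>: the balls are open, so
  the integrand at the limit point is at most the liminf of the integrands, and Fatou's lemma
  applies.\<close>

lemma closed_K: "closed (K A f)"
proof -
  let ?T = "torus_measure :: 'n torus measure"
  have cT: "closed {x. Theta m f x \<le> ennreal a}" for m a
    unfolding closed_sequential_limits
  proof safe
    fix X and x :: "'n torus" assume X: "\<forall>n. X n \<in> {x. Theta m f x \<le> ennreal a}" and lim: "X \<longlonglongrightarrow> x"
    let ?r = "rad / 2 ^ m"
    let ?g = "\<lambda>x z. (tail m f z + ennreal \<bar>S m f z - S m f x\<bar>) * indicator (ball x ?r) z"
    have Slim: "(\<lambda>n. S m f (X n)) \<longlonglongrightarrow> S m f x"
      using continuous_on_S[of UNIV m f] lim by (auto simp: continuous_on_eq_continuous_at isCont_tendsto_compose)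
    have le: "?g x z \<le> liminf (\<lambda>n. ?g (X n) z)" for z
    proof (cases "z \<in> ball x ?r")
      case True
      have "(\<lambda>n. dist (X n) z) \<longlonglongrightarrow> dist x z" by (intro tendsto_intros lim)
      from order_tendstoD(2)[OF this, of ?r] True
      have ev: "eventually (\<lambda>n. ?g (X n) z = tail m f z + ennreal \<bar>S m f z - S m f (X n)\<bar>) sequentially"
        by (auto elim!: eventually_mono)
      have "(\<lambda>n. tail m f z + ennreal \<bar>S m f z - S m f (X n)\<bar>) \<longlonglongrightarrow> tail m f z + ennreal \<bar>S m f z - S m f x\<bar>"
        by (intro tendsto_add tendsto_ennrealI tendsto_intros Slim)
      then have "(\<lambda>n. ?g (X n) z) \<longlonglongrightarrow> tail m f z + ennreal \<bar>S m f z - S m f x\<bar>"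
        using tendsto_cong[OF ev] by blast
      then have "liminf (\<lambda>n. ?g (X n) z) = tail m f z + ennreal \<bar>S m f z - S m f x\<bar>"
        by (intro lim_imp_Liminf) auto
      then show ?thesis using True by simp
    qed simp
    have "(\<integral>\<^sup>+z. ?g x z \<partial>?T) \<le> (\<integral>\<^sup>+z. liminf (\<lambda>n. ?g (X n) z) \<partial>?T)"
      by (rule nn_integral_mono) (rule le)
    also have "\<dots> \<le> liminf (\<lambda>n. \<integral>\<^sup>+z. ?g (X n) z \<partial>?T)"
      unfolding indicator_def mem_ball by (rule nn_integral_liminf) measurable
    finally have 1: "(\<integral>\<^sup>+z. ?g x z \<partial>?T) \<le> liminf (\<lambda>n. \<integral>\<^sup>+z. ?g (X n) z \<partial>?T)" .
    let ?p = "(2 ^ m) ^ CARD('n) :: real"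
    have pp: "ennreal (1 / ?p) * (ennreal ?p * w) = w" for w
      by (simp add: mult.assoc[symmetric] ennreal_mult[symmetric])
    have pp': "ennreal ?p * (ennreal (1 / ?p) * w) = w" for w
      by (simp add: mult.assoc[symmetric] ennreal_mult[symmetric])
    have "(\<integral>\<^sup>+z. ?g (X n) z \<partial>?T) \<le> ennreal (1 / ?p) * ennreal a" for n
    proof -
      have "ennreal ?p * (\<integral>\<^sup>+z. ?g (X n) z \<partial>?T) \<le> ennreal a" using X by (simp add: Theta_def)
      then have "ennreal (1 / ?p) * (ennreal ?p * (\<integral>\<^sup>+z. ?g (X n) z \<partial>?T)) \<le> ennreal (1 / ?p) * ennreal a"
        by (rule mult_left_mono) simp
      then show ?thesis by (simp only: pp)
    qed
    then have "liminf (\<lambda>n. \<integral>\<^sup>+z. ?g (X n) z \<partial>?T) \<le> ennreal (1 / ?p) * ennreal a"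
      by (intro order_trans[OF Liminf_le_Limsup] Limsup_bounded always_eventually allI) auto
    with 1 have "(\<integral>\<^sup>+z. ?g x z \<partial>?T) \<le> ennreal (1 / ?p) * ennreal a" by (rule order_trans)
    then have "ennreal ?p * (\<integral>\<^sup>+z. ?g x z \<partial>?T) \<le> ennreal ?p * (ennreal (1 / ?p) * ennreal a)"
      by (rule mult_left_mono) simp
    then show "Theta m f x \<le> ennreal a" unfolding Theta_def by (simp only: pp')
  qed
  have cD: "closed {x. \<bar>Del m f x\<bar> \<le> a}" for m a
    by (intro closed_Collect_le continuous_intros continuous_on_Del)
  have "K A f = (\<Inter>m. {x. Theta m f x \<le> ennreal (A * 2 powr (- real m * (s / 2)))}
      \<inter> {x. \<bar>Del m f x\<bar> \<le> A * 2 powr (- real m * (s / 2))})"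
    by (auto simp: K_def)
  also have "closed \<dots>" by (intro closed_INT closed_Int cT cD ballI)
  finally show ?thesis .
qed

lemma continuous_on_Slim:
  assumes A: "0 \<le> A" shows "continuous_on (K A f) (Slim f)"
proof (rule uniform_limit_theorem[of _ "\<lambda>m. S m f" sequentially])
  show "\<forall>\<^sub>F m in sequentially. continuous_on (K A f) (S m f)" by (simp add: continuous_on_S)
  have "(\<lambda>m. 2 powr (- real m * (s / 2))) \<longlonglongrightarrow> 0"
    using s by (intro summable_LIMSEQ_zero summable_powr_neg) simp
  then have l0: "(\<lambda>m. A * Cgeo * 2 powr (- real m * (s / 2))) \<longlonglongrightarrow> 0" by (rule tendsto_mult_right_zero)
  show "uniform_limit (K A f) (\<lambda>m. S m f) (Slim f) sequentially"
  proof (rule uniform_limitI)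
    fix e :: real assume "0 < e"
    from order_tendstoD(2)[OF l0 this]
    show "\<forall>\<^sub>F m in sequentially. \<forall>x\<in>K A f. dist (S m f x) (Slim f x) < e"
    proof eventually_elim
      case (elim m)
      show ?case
      proof
        fix x assume "x \<in> K A f"
        from K_Slim(2)[OF this A, of m] elim show "dist (S m f x) (Slim f x) < e"
          by (simp add: dist_real_def abs_minus_commute)
      qed
    qed
  qed
qed simp

lemma slice_measurable [measurable (raw)]:
  assumes [measurable]: "f \<in> measurable N borel" "h \<in> borel_measurable N" "g \<in> measurable N borel"
  shows "(\<lambda>\<omega>. slice A \<epsilon> (f \<omega>) (h \<omega>) (g \<omega>)) \<in> borel_measurable N"
  unfolding slice_def by measurable

text \<open>Cauchy--Schwarz over the disjoint pieces of a covering bounds the mass of a slice by its energy.\<close>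

lemma mass_le_energy:
  assumes A: "0 \<le> A" and \<epsilon>: "0 < \<epsilon>" and D: "finite D"
    and V: "\<And>i. i \<in> D \<Longrightarrow> V i \<in> sets borel" "\<And>i x x'. i \<in> D \<Longrightarrow> x \<in> V i \<Longrightarrow> x' \<in> V i \<Longrightarrow> dist x x' \<le> 1 / 2 ^ q i"
    and disj: "disjoint_family_on V D"
    and cov: "\<And>x. x \<in> K A f \<Longrightarrow> \<bar>Slim f x - y\<bar> < \<epsilon> \<Longrightarrow> x \<in> (\<Union>i\<in>D. V i)"
    and a: "0 < a" "ennreal a < slice_mass A \<epsilon> f y" and vN: "slice_energy A \<epsilon> f y \<le> ennreal N" "0 < N"
  shows "a\<^sup>2 / N \<le> (\<Sum>i\<in>D. 1 / kweight (q i))"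
proof -
  let ?T = "torus_measure :: 'n torus measure"
  interpret T: prob_space ?T by (rule prob_space_torus_measure)
  let ?E = "{x. x \<in> K A f \<and> \<bar>Slim f x - y\<bar> < \<epsilon>}"
  have E[measurable]: "?E \<in> sets borel" by measurable
  have sl: "slice A \<epsilon> f y x = indicator ?E x" for x by (simp add: slice_def)
  define H where "H i = (if i \<in> D then ?E \<inter> V i else {})" for i
  have H[measurable]: "H i \<in> sets borel" for i using V(1)[of i] by (simp add: H_def)
  define e where "e i = measure ?T (H i)" for i
  have kw: "0 < kweight k" for k by (simp add: kweight_def)
  have "?E = (\<Union>i\<in>D. H i)" using cov by (auto simp: H_def)
  then have "measure ?T ?E = measure ?T (\<Union>i\<in>D. H i)" by simp
  also have "\<dots> = (\<Sum>i\<in>D. e i)"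
    unfolding e_def
  proof (rule T.finite_measure_finite_Union[OF D])
    show "disjoint_family_on H D"
      using disj by (auto simp: disjoint_family_on_def H_def)
  qed auto
  finally have mass: "measure ?T ?E = (\<Sum>i\<in>D. e i)" .
  have "ennreal a < ennreal (1 / (2 * \<epsilon>)) * ennreal (measure ?T ?E)"
    using a(2) by (simp add: slice_mass_def sl T.emeasure_eq_measure)
  then have "ennreal a < ennreal (1 / (2 * \<epsilon>) * measure ?T ?E)" using \<epsilon> by (subst ennreal_mult) auto
  then have "a < 1 / (2 * \<epsilon>) * measure ?T ?E" using a by (simp add: ennreal_less_iff)
  then have low: "2 * \<epsilon> * a < (\<Sum>i\<in>D. e i)" using \<epsilon> unfolding mass by (simp add: field_simps)
  have "ennreal (\<Sum>i\<in>D. kweight (q i) * (e i)\<^sup>2) = (\<Sum>i\<in>D. ennreal (kweight (q i)) * (ennreal (e i) * ennreal (e i)))"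
    using kweight_nonneg by (subst sum_ennreal[symmetric]) (auto simp: e_def ennreal_mult power2_eq_square)
  also have "\<dots> = (\<Sum>i\<in>D. \<integral>\<^sup>+x. (\<integral>\<^sup>+x'. ennreal (kweight (q i)) * (indicator (H i) x * indicator (H i) x') \<partial>?T) \<partial>?T)"
  proof (rule sum.cong[OF refl])
    fix i assume i: "i \<in> D"
    let ?c = "ennreal (kweight (q i))" and ?G = "H i"
    have G: "emeasure ?T ?G = ennreal (e i)" by (simp add: e_def T.emeasure_eq_measure)
    have "(\<integral>\<^sup>+x'. ?c * (indicator ?G x * indicator ?G x') \<partial>?T) = (?c * ennreal (e i)) * indicator ?G x" for x
    proof -
      have "(\<integral>\<^sup>+x'. ?c * (indicator ?G x * indicator ?G x') \<partial>?T) = (\<integral>\<^sup>+x'. (?c * indicator ?G x) * indicator ?G x' \<partial>?T)"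
        by (simp only: mult.assoc)
      also have "\<dots> = (?c * indicator ?G x) * ennreal (e i)"
        using nn_integral_cmult_indicator[of ?G ?T] G by simp
      finally show ?thesis by (simp only: ac_simps)
    qed
    then have "(\<integral>\<^sup>+x. (\<integral>\<^sup>+x'. ?c * (indicator ?G x * indicator ?G x') \<partial>?T) \<partial>?T) = (\<integral>\<^sup>+x. (?c * ennreal (e i)) * indicator ?G x \<partial>?T)"
      by (simp only:)
    also have "\<dots> = (?c * ennreal (e i)) * ennreal (e i)"
      using nn_integral_cmult_indicator[of ?G ?T] G by simp
    finally show "?c * (ennreal (e i) * ennreal (e i)) = (\<integral>\<^sup>+x. (\<integral>\<^sup>+x'. ?c * (indicator ?G x * indicator ?G x') \<partial>?T) \<partial>?T)"
      by (simp only: ac_simps)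
  qed
  also have "\<dots> = (\<integral>\<^sup>+x. (\<integral>\<^sup>+x'. (\<Sum>i\<in>D. ennreal (kweight (q i)) * (indicator (H i) x * indicator (H i) x')) \<partial>?T) \<partial>?T)"
  proof -
    have "(\<integral>\<^sup>+x. (\<integral>\<^sup>+x'. (\<Sum>i\<in>D. ennreal (kweight (q i)) * (indicator (H i) x * indicator (H i) x')) \<partial>?T) \<partial>?T)
        = (\<integral>\<^sup>+x. (\<Sum>i\<in>D. \<integral>\<^sup>+x'. ennreal (kweight (q i)) * (indicator (H i) x * indicator (H i) x') \<partial>?T) \<partial>?T)"
      by (intro nn_integral_cong nn_integral_sum) measurable
    also have "\<dots> = (\<Sum>i\<in>D. \<integral>\<^sup>+x. (\<integral>\<^sup>+x'. ennreal (kweight (q i)) * (indicator (H i) x * indicator (H i) x') \<partial>?T) \<partial>?T)"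
      by (rule nn_integral_sum) measurable
    finally show ?thesis by (rule sym)
  qed
  also have "\<dots> \<le> (\<integral>\<^sup>+x. (\<integral>\<^sup>+x'. kap x x' * (slice A \<epsilon> f y x * slice A \<epsilon> f y x') \<partial>?T) \<partial>?T)"
  proof (intro nn_integral_mono)
    fix x x'
    show "(\<Sum>i\<in>D. ennreal (kweight (q i)) * (indicator (H i) x * indicator (H i) x'))
       \<le> kap x x' * (slice A \<epsilon> f y x * slice A \<epsilon> f y x')"
    proof (cases "\<exists>i0\<in>D. x \<in> V i0 \<and> x' \<in> V i0 \<and> x \<in> ?E \<and> x' \<in> ?E")
      case True
      then obtain i0 where i0: "i0 \<in> D" "x \<in> V i0" "x' \<in> V i0" "x \<in> ?E" "x' \<in> ?E" by blast
      \<comment> \<open>By disjointness at most one term of the sum survives, and \<open>kap\<close>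
        dominates it because both points lie in one piece of diameter at most
        \<open>1 / 2 ^ q i0\<close>.\<close>
      have "x \<notin> V i" if "i \<in> D" "i \<noteq> i0" for i
        using disj that i0 by (auto simp: disjoint_family_on_def)
      then have "(\<Sum>i\<in>D. ennreal (kweight (q i)) * (indicator (H i) x * indicator (H i) x'))
         = (\<Sum>i\<in>D. if i = i0 then ennreal (kweight (q i0)) else 0)"
        using i0 by (intro sum.cong) (auto simp: indicator_def H_def)
      also have "\<dots> = ennreal (kweight (q i0))" using D i0 by simp
      also have "\<dots> \<le> kap x x'" using V(2)[OF i0(1-3)] by (rule kap_ge)
      finally show ?thesis using i0 by (simp add: sl)
    next
      case False
      then have "(\<Sum>i\<in>D. ennreal (kweight (q i)) * (indicator (H i) x * indicator (H i) x')) = 0"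
        by (intro sum.neutral) (auto simp: indicator_def H_def)
      then show ?thesis by simp
    qed
  qed
  finally have "ennreal (\<Sum>i\<in>D. kweight (q i) * (e i)\<^sup>2)
     \<le> (\<integral>\<^sup>+x. (\<integral>\<^sup>+x'. kap x x' * (slice A \<epsilon> f y x * slice A \<epsilon> f y x') \<partial>?T) \<partial>?T)" .
  then have "ennreal (1 / (2 * \<epsilon>)\<^sup>2) * ennreal (\<Sum>i\<in>D. kweight (q i) * (e i)\<^sup>2) \<le> slice_energy A \<epsilon> f y"
    unfolding slice_energy_def by (rule mult_left_mono) simp
  also have "\<dots> \<le> ennreal N" by (rule vN)
  finally have "1 / (2 * \<epsilon>)\<^sup>2 * (\<Sum>i\<in>D. kweight (q i) * (e i)\<^sup>2) \<le> N"
    using vN(2) kweight_nonneg by (simp add: ennreal_mult[symmetric] sum_nonneg)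
  then have energy: "(\<Sum>i\<in>D. kweight (q i) * (e i)\<^sup>2) \<le> (2 * \<epsilon>)\<^sup>2 * N"
    using \<epsilon> by (simp add: field_simps)
  \<comment> \<open>Splitting off the square root of the weight makes the first Cauchy--Schwarz
    factor the energy of the pieces and the second the sum to be bounded below.\<close>
  have "(\<Sum>i\<in>D. e i) = (\<Sum>i\<in>D. (sqrt (kweight (q i)) * e i) * (1 / sqrt (kweight (q i))))"
    using kw by (intro sum.cong) (auto simp: less_imp_neq[symmetric] dest: less_imp_neq)
  then have "(\<Sum>i\<in>D. e i)\<^sup>2 \<le> (\<Sum>i\<in>D. (sqrt (kweight (q i)) * e i)\<^sup>2) * (\<Sum>i\<in>D. (1 / sqrt (kweight (q i)))\<^sup>2)"
    using Cauchy_Schwarz_ineq_sum[of "\<lambda>i. sqrt (kweight (q i)) * e i" "\<lambda>i. 1 / sqrt (kweight (q i))" D] by simp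
  also have "\<dots> = (\<Sum>i\<in>D. kweight (q i) * (e i)\<^sup>2) * (\<Sum>i\<in>D. 1 / kweight (q i))"
    using kweight_nonneg by (simp add: power_mult_distrib power_divide)
  also have "\<dots> \<le> (2 * \<epsilon>)\<^sup>2 * N * (\<Sum>i\<in>D. 1 / kweight (q i))"
    using kweight_nonneg by (intro mult_right_mono energy sum_nonneg) auto
  finally have "(\<Sum>i\<in>D. e i)\<^sup>2 \<le> (2 * \<epsilon>)\<^sup>2 * N * (\<Sum>i\<in>D. 1 / kweight (q i))" .
  moreover have "(2 * \<epsilon> * a)\<^sup>2 \<le> (\<Sum>i\<in>D. e i)\<^sup>2" using low a \<epsilon> by (intro power_mono) auto
  ultimately have "(2 * \<epsilon>)\<^sup>2 * a\<^sup>2 \<le> (2 * \<epsilon>)\<^sup>2 * (N * (\<Sum>i\<in>D. 1 / kweight (q i)))"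
    by (simp add: power_mult_distrib mult.assoc)
  then have "a\<^sup>2 \<le> N * (\<Sum>i\<in>D. 1 / kweight (q i))"
    using \<epsilon> by (subst (asm) mult_le_cancel_left_pos) auto
  then show ?thesis using vN(2) by (simp add: field_simps)
qed

text \<open>A cover of small total gauge is made open. On the compact part of \<open>K A f\<close>
  that it misses, the continuous function \<open>\<bar>Slim f x - y\<bar>\<close> stays away from 0,
  so for large \<open>j\<close> the cover contains the whole slice. Mass and energy of that slice
  then contradict the small total gauge.\<close>

lemma hausdorff_measure_level_pos:
  assumes f: "f \<in> good" and A: "0 \<le> A" and a: "0 < a" and N: "0 < N"
    and io: "\<And>j0. \<exists>j\<ge>j0. ennreal a < slice_mass A (1 / 2 ^ j) f y \<and> slice_energy A (1 / 2 ^ j) f y \<le> ennreal N"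
    and t: "0 \<le> t" "t < real CARD('n) - s"
  shows "hausdorff_measure t (lebesgue_points f \<inter> level_set f y) \<noteq> 0"
proof
  let ?Z = "lebesgue_points f \<inter> level_set f y" and ?n = "real CARD('n)"
  assume z: "hausdorff_measure t ?Z = 0"
  obtain L where L: "L > 0" "\<And>m::nat. (real m + 1) ^ 2 * 2 powr (- real m * (?n - s - t)) \<le> L"
    using bounded_poly_exp[of "?n - s - t" 2] t by auto
  have inv_kw: "1 / kweight q \<le> L * 2 powr (- real q * t)" for q
  proof -
    have "1 / kweight q = ((real q + 1) ^ 2 * 2 powr (- real q * (?n - s - t))) * 2 powr (- real q * t)"
      by (simp add: kweight_def powr_minus_divide[symmetric] divide_inverse powr_minus[symmetric] mult.assoc algebra_simps flip: powr_add)
    also have "\<dots> \<le> L * 2 powr (- real q * t)" using L(2)[of q] by (intro mult_right_mono) auto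
    finally show ?thesis .
  qed
  \<comment> \<open>The lower bound that mass and energy force on the sum of
    \<open>2 powr (- real (q i) * t)\<close>. The choice of \<open>g0\<close> and
    \<open>\<tau>\<close> below allows at most \<open>c0 / 4 + c0 / 4\<close> for it.\<close>
  define c0 where "c0 = a\<^sup>2 / N / L"
  have c0: "c0 > 0" using a N L by (simp add: c0_def)
  define g0 where "g0 = c0 / (4 * 4 powr t)"
  have g0: "g0 > 0" using c0 by (simp add: g0_def)
  have "hausdorff_content t (1 / 4) ?Z \<le> hausdorff_measure t ?Z"
    unfolding hausdorff_measure_def by (rule SUP_upper) simp
  then have "hausdorff_content t (1 / 4) ?Z < ennreal g0" using z g0 by simp
  then obtain U where U: "?Z \<subseteq> (\<Union>i. U i)" "\<And>i::nat. bounded (U i)" "\<And>i. diameter (U i) \<le> 1 / 4"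
    and sumU: "(\<Sum>i. hausdorff_gauge t (U i)) < ennreal g0"
    unfolding hausdorff_content_def INF_less_iff by auto
  define \<tau> where "\<tau> i = c0 / 4 * (1 / 2) ^ Suc i" for i :: nat
  have \<tau>: "0 < \<tau> i" for i using c0 by (simp add: \<tau>_def)
  \<comment> \<open>Empty sets are treated apart: their gauge is 0 even for \<open>t = 0\<close>,
    where \<open>2 powr (- real q * t)\<close> is 1.\<close>
  have "\<exists>q V. open V \<and> U i \<subseteq> V \<and> (\<forall>x\<in>V. \<forall>x'\<in>V. dist x x' \<le> 1 / 2 ^ q)
     \<and> (if U i = {} then V = {} else
         ennreal (2 powr (- real q * t)) \<le> ennreal (4 powr t) * hausdorff_gauge t (U i) + ennreal (\<tau> i))" for i
  proof (cases "U i = {}")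
    case False
    then show ?thesis using open_thickening[OF U(2) False U(3) t(1) \<tau>] by simp
  qed auto
  then have "\<exists>q. \<forall>i. \<exists>V. open V \<and> U i \<subseteq> V \<and> (\<forall>x\<in>V. \<forall>x'\<in>V. dist x x' \<le> 1 / 2 ^ q i)
     \<and> (if U i = {} then V = {} else
         ennreal (2 powr (- real (q i) * t)) \<le> ennreal (4 powr t) * hausdorff_gauge t (U i) + ennreal (\<tau> i))"
    by (intro choice allI)
  then obtain q where "\<forall>i. \<exists>V. open V \<and> U i \<subseteq> V \<and> (\<forall>x\<in>V. \<forall>x'\<in>V. dist x x' \<le> 1 / 2 ^ q i)
     \<and> (if U i = {} then V = {} else
         ennreal (2 powr (- real (q i) * t)) \<le> ennreal (4 powr t) * hausdorff_gauge t (U i) + ennreal (\<tau> i))"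
    by (erule exE)
  from choice[OF this] obtain V where *: "\<forall>i. open (V i) \<and> U i \<subseteq> V i \<and> (\<forall>x\<in>V i. \<forall>x'\<in>V i. dist x x' \<le> 1 / 2 ^ q i)
     \<and> (if U i = {} then V i = {} else
         ennreal (2 powr (- real (q i) * t)) \<le> ennreal (4 powr t) * hausdorff_gauge t (U i) + ennreal (\<tau> i))"
    by (erule exE)
  then have V: "\<And>i. open (V i)" "\<And>i. U i \<subseteq> V i" "\<And>i x x'. x \<in> V i \<Longrightarrow> x' \<in> V i \<Longrightarrow> dist x x' \<le> 1 / 2 ^ q i"
    and qV: "\<And>i. if U i = {} then V i = {} else
         ennreal (2 powr (- real (q i) * t)) \<le> ennreal (4 powr t) * hausdorff_gauge t (U i) + ennreal (\<tau> i)"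
    by blast+
  have cov: "K A f \<inter> {x. Slim f x = y} \<subseteq> (\<Union>i. V i)"
    using K_lebesgue_point[OF f _ A] U(1) V(2) by blast
  have KV: "compact (K A f - (\<Union>i. V i))"
    using closed_Diff[OF closed_K open_UN, of UNIV V A f] V(1) compact_UNIV_torus
    by (metis closed_Int_compact inf_top_right)
  obtain \<eta> where \<eta>: "\<eta> > 0" "\<And>x. x \<in> K A f - (\<Union>i. V i) \<Longrightarrow> \<eta> \<le> \<bar>Slim f x - y\<bar>"
  proof (cases "K A f - (\<Union>i. V i) = {}")
    case True
    then show ?thesis using that[of 1] by auto
  next
    case False
    have "continuous_on (K A f - (\<Union>i. V i)) (\<lambda>x. \<bar>Slim f x - y\<bar>)"
      by (intro continuous_intros continuous_on_subset[OF continuous_on_Slim[OF A]]) auto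
    from continuous_attains_inf[OF KV False this] obtain x0 where x0: "x0 \<in> K A f - (\<Union>i. V i)"
      "\<And>x. x \<in> K A f - (\<Union>i. V i) \<Longrightarrow> \<bar>Slim f x0 - y\<bar> \<le> \<bar>Slim f x - y\<bar>" by blast
    then have "Slim f x0 \<noteq> y" using cov by auto
    then show ?thesis using x0(2) by (intro that[of "\<bar>Slim f x0 - y\<bar>"]) auto
  qed
  have "(\<lambda>j::nat. 1 / 2 ^ j :: real) \<longlonglongrightarrow> 0" by (rule LIMSEQ_divide_realpow_zero) simp
  from order_tendstoD(2)[OF this \<eta>(1)] obtain j0 where j0: "\<And>j. j \<ge> j0 \<Longrightarrow> 1 / 2 ^ j < \<eta>"
    by (auto simp: eventually_sequentially)
  obtain j where j: "j \<ge> j0" "ennreal a < slice_mass A (1 / 2 ^ j) f y" "slice_energy A (1 / 2 ^ j) f y \<le> ennreal N"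
    using io by blast
  let ?\<epsilon> = "1 / 2 ^ j :: real"
  have closedE: "compact (K A f \<inter> {x. \<bar>Slim f x - y\<bar> \<le> ?\<epsilon>})"
  proof -
    have "closedin (top_of_set (K A f)) (K A f \<inter> (\<lambda>x. \<bar>Slim f x - y\<bar>) -` {..?\<epsilon>})"
      by (rule continuous_closedin_preimage) (intro continuous_intros continuous_on_Slim[OF A], simp)
    then have "closed (K A f \<inter> (\<lambda>x. \<bar>Slim f x - y\<bar>) -` {..?\<epsilon>})"
      using closed_K closedin_closed_trans by blast
    then have "compact (K A f \<inter> (\<lambda>x. \<bar>Slim f x - y\<bar>) -` {..?\<epsilon>})"
      using compact_UNIV_torus closed_Int_compact by (metis inf_top_right)
    then show ?thesis by (simp add: vimage_def)
  qed
  have "K A f \<inter> {x. \<bar>Slim f x - y\<bar> \<le> ?\<epsilon>} \<subseteq> (\<Union>i\<in>UNIV. V i)"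
    using \<eta>(2) j0[OF j(1)] by force
  from compactE_image[OF closedE _ this] V(1) obtain D0 where D0: "finite D0" "K A f \<inter> {x. \<bar>Slim f x - y\<bar> \<le> ?\<epsilon>} \<subseteq> (\<Union>i\<in>D0. V i)"
    by auto
  define D where "D = {i \<in> {..Max (insert 0 D0)}. U i \<noteq> {}}"
  have D: "finite D" by (simp add: D_def)
  have DV: "x \<in> (\<Union>i\<in>D. V i)" if "x \<in> K A f" "\<bar>Slim f x - y\<bar> < ?\<epsilon>" for x
  proof -
    have "x \<in> (\<Union>i\<in>D0. V i)" using that by (intro subsetD[OF D0(2)]) simp
    then obtain i where i: "i \<in> D0" "x \<in> V i" by blast
    have "U i \<noteq> {}" using qV[of i] i by auto
    moreover have "i \<le> Max (insert 0 D0)" using i D0(1) by simp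
    ultimately show ?thesis using i by (auto simp: D_def)
  qed
  define V' where "V' i = V i - (\<Union>l\<in>D \<inter> {..<i}. V l)" for i
  have V'disj: "disjoint_family_on V' D"
    unfolding disjoint_family_on_def
  proof (intro ballI impI)
    fix i l assume "i \<in> D" "l \<in> D" "i \<noteq> l"
    then consider "i < l" | "l < i" by linarith
    then show "V' i \<inter> V' l = {}" by cases (use \<open>i \<in> D\<close> \<open>l \<in> D\<close> in \<open>auto simp: V'_def\<close>)
  qed
  have V'cov: "x \<in> (\<Union>i\<in>D. V' i)" if x: "x \<in> K A f" "\<bar>Slim f x - y\<bar> < ?\<epsilon>" for x
  proof -
    let ?P = "\<lambda>i. i \<in> D \<and> x \<in> V i"
    have ex: "\<exists>i. ?P i" using DV[OF x] by blast
    then obtain i where i: "?P i" "\<forall>l<i. \<not> ?P l" unfolding exists_least_iff[of ?P] by blast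
    then have "x \<in> V' i" unfolding V'_def by blast
    then show ?thesis using i by blast
  qed
  have "a\<^sup>2 / N \<le> (\<Sum>i\<in>D. 1 / kweight (q i))"
  proof (rule mass_le_energy[OF A _ D _ _ V'disj V'cov a j(2,3) N])
    show "V' i \<in> sets borel" for i using V(1) D by (auto simp: V'_def intro!: sets.Diff sets.finite_UN)
    show "dist x x' \<le> 1 / 2 ^ q i" if "x \<in> V' i" "x' \<in> V' i" for i x x'
      using that V(3) by (auto simp: V'_def)
  qed auto
  also have "\<dots> \<le> (\<Sum>i\<in>D. L * 2 powr (- real (q i) * t))" by (intro sum_mono inv_kw)
  also have "\<dots> = L * (\<Sum>i\<in>D. 2 powr (- real (q i) * t))" by (simp add: sum_distrib_left)
  finally have "c0 \<le> (\<Sum>i\<in>D. 2 powr (- real (q i) * t))"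
    unfolding c0_def by (subst pos_divide_le_eq[OF L(1)]) (simp only: mult.commute)
  then have "ennreal c0 \<le> (\<Sum>i\<in>D. ennreal (2 powr (- real (q i) * t)))" by (simp add: sum_ennreal ennreal_leI)
  also have "\<dots> \<le> (\<Sum>i\<in>D. ennreal (4 powr t) * hausdorff_gauge t (U i) + ennreal (\<tau> i))"
  proof (rule sum_mono)
    fix i assume "i \<in> D"
    then have "U i \<noteq> {}" by (auto simp: D_def)
    then show "ennreal (2 powr (- real (q i) * t)) \<le> ennreal (4 powr t) * hausdorff_gauge t (U i) + ennreal (\<tau> i)"
      using qV[of i] by simp
  qed
  also have "\<dots> = ennreal (4 powr t) * (\<Sum>i\<in>D. hausdorff_gauge t (U i)) + (\<Sum>i\<in>D. ennreal (\<tau> i))"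
    by (simp add: sum.distrib sum_distrib_left)
  also have "\<dots> \<le> ennreal (4 powr t) * ennreal g0 + ennreal (c0 / 4)"
  proof (intro add_mono mult_left_mono)
    have "(\<Sum>i\<in>D. hausdorff_gauge t (U i)) \<le> (\<Sum>i. hausdorff_gauge t (U i))"
      using D by (intro sum_le_suminf) auto
    then show "(\<Sum>i\<in>D. hausdorff_gauge t (U i)) \<le> ennreal g0" using sumU by (rule order.trans[OF _ less_imp_le])
    have "(\<Sum>i\<in>D. ennreal (\<tau> i)) = ennreal (\<Sum>i\<in>D. \<tau> i)" using \<tau> by (simp add: sum_ennreal less_imp_le)
    also have "(\<Sum>i\<in>D. \<tau> i) \<le> c0 / 4"
    proof -
      have sm: "(\<lambda>i. c0 / 4 * (1 / 2) ^ Suc i) sums (c0 / 4 * 1)" by (intro sums_mult power_half_series)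
      have "(\<Sum>i\<in>D. \<tau> i) \<le> (\<Sum>i. \<tau> i)"
        using D \<tau> sums_summable[OF sm] by (intro sum_le_suminf) (auto simp: \<tau>_def[abs_def] less_imp_le)
      then show ?thesis using sums_unique[OF sm] by (simp add: \<tau>_def[abs_def])
    qed
    then have "ennreal (\<Sum>i\<in>D. \<tau> i) \<le> ennreal (c0 / 4)" by (rule ennreal_leI)
    finally show "(\<Sum>i\<in>D. ennreal (\<tau> i)) \<le> ennreal (c0 / 4)" .
  qed simp
  also have "\<dots> = ennreal (c0 / 2)"
    using c0 by (simp add: g0_def ennreal_mult[symmetric] ennreal_plus[symmetric] del: ennreal_plus)
  finally show False using c0 by (simp add: ennreal_le_iff2)
qed

end

section \<open>Almost all levels\<close>

text \<open>An infinite radius is allowed because \<open>Theta\<close>, which takes its place, may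
  be infinite.\<close>

lemma emeasure_interval_le: "emeasure lborel {y::real. ennreal \<bar>y - a\<bar> \<le> \<theta>} \<le> 2 * \<theta>"
proof (cases \<theta>)
  case (real t)
  have "{y. ennreal \<bar>y - a\<bar> \<le> \<theta>} = {a - t..a + t}"
    using real by (auto simp: abs_le_iff)
  then have "emeasure lborel {y. ennreal \<bar>y - a\<bar> \<le> \<theta>} = ennreal (2 * t)"
    using real by simp
  then show ?thesis using real by (simp add: ennreal_mult)
qed (simp add: ennreal_mult_top)

lemma summable_inverse_Suc_square: "summable (\<lambda>m::nat. 1 / (real m + 1)\<^sup>2)"
  using inverse_squares_sums by (auto simp: sums_iff add.commute)

lemma emeasure_torus_singleton: "emeasure torus_measure {x :: 'n::finite torus} = 0"
proof -
  have le: "emeasure torus_measure {x} \<le> ennreal (10 ^ CARD('n) * (1 / 2 ^ k) ^ CARD('n))" for k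
    by (rule order_trans[OF emeasure_mono emeasure_torus_ball_le[of "1 / 2 ^ k" x]]) auto
  have "(\<lambda>k. ennreal (10 ^ CARD('n) * (1 / 2 ^ k) ^ CARD('n))) \<longlonglongrightarrow> ennreal (10 ^ CARD('n) * 0 ^ CARD('n))"
    by (intro tendsto_ennrealI tendsto_intros LIMSEQ_divide_realpow_zero) simp
  then have "(\<lambda>k. ennreal (10 ^ CARD('n) * (1 / 2 ^ k) ^ CARD('n))) \<longlonglongrightarrow> 0"
    by (simp add: zero_power)
  from LIMSEQ_le_const[OF this, of "emeasure torus_measure {x}"] le show ?thesis by auto
qed

section \<open>Mean estimates over pairs of a function and a level\<close>

context random_wavelet_series
begin

abbreviation T :: "'n torus measure" where "T \<equiv> torus_measure"

abbreviation P :: "('n l1 \<times> real) measure" where "P \<equiv> Q \<Otimes>\<^sub>M lborel"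

lemma sets_P: "sets P = sets (borel \<Otimes>\<^sub>M borel)"
  by (intro sets_pair_measure_cong) auto

lemma sigma_finite_P: "sigma_finite_measure P"
proof -
  interpret Q: prob_space Q by (rule prob_space_Q)
  interpret pair_sigma_finite Q lborel ..
  show ?thesis by (rule sigma_finite_measure_axioms)
qed

lemma slice_mass_measurable [measurable (raw)]:
  assumes [measurable]: "f \<in> measurable N borel" "h \<in> borel_measurable N"
  shows "(\<lambda>\<omega>. slice_mass A \<epsilon> (f \<omega>) (h \<omega>)) \<in> borel_measurable N"
proof -
  interpret T: prob_space T by (rule prob_space_torus_measure)
  show ?thesis unfolding slice_mass_def by measurable
qed

lemma slice_energy_measurable [measurable (raw)]:
  assumes [measurable]: "f \<in> measurable N borel" "h \<in> borel_measurable N"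
  shows "(\<lambda>\<omega>. slice_energy A \<epsilon> (f \<omega>) (h \<omega>)) \<in> borel_measurable N"
proof -
  interpret T: prob_space T by (rule prob_space_torus_measure)
  show ?thesis unfolding slice_energy_def by measurable
qed

lemma near_level_measurable [measurable (raw)]:
  assumes [measurable]: "f \<in> measurable N borel" "h \<in> borel_measurable N"
  shows "Measurable.pred N (\<lambda>\<omega>. near_level m (f \<omega>) (h \<omega>) q)"
  unfolding near_level_def by measurable

lemma cover_sum_measurable [measurable (raw)]:
  assumes [measurable]: "f \<in> measurable N borel" "h \<in> borel_measurable N"
  shows "(\<lambda>\<omega>. cover_sum (f \<omega>) (h \<omega>)) \<in> borel_measurable N"
  unfolding cover_sum_def by measurable

text \<open>For fixed \<open>f\<close> the levels near one dyadic value have measure of order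
  \<open>(m + 1)^2 * Theta\<close>, with mean of order \<open>(m + 1)^2 * 2^(-m*s)\<close>.
  Multiplied by the number \<open>2^(m*n)\<close> of dyadic points and by \<open>wt m\<close>, this
  leaves \<open>1/(m + 1)^2\<close>.\<close>

lemma AE_cover_sum: "AE z in P. cover_sum (fst z) (snd z) < \<infinity>"
proof -
  interpret Q: prob_space Q by (rule prob_space_Q)
  interpret QL: pair_sigma_finite Q lborel ..
  let ?N = "CARD('n)"
  define L where "L = 2 * Cup * CTheta"
  have L0: "L \<ge> 0" using CTheta_pos by (simp add: L_def Cup_def)
  have one: "(\<integral>\<^sup>+z. (if near_level m (fst z) (snd z) q then 1 else 0) \<partial>P)
      \<le> ennreal (L * (real m + 1)\<^sup>2 * 2 powr (- real m * s))" for m q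
  proof -
    let ?p = "dyadic_point m q"
    have "(\<integral>\<^sup>+z. (if near_level m (fst z) (snd z) q then 1 else 0) \<partial>P)
        = (\<integral>\<^sup>+f. (\<integral>\<^sup>+y. (if near_level m f y q then 1 else 0) \<partial>lborel) \<partial>Q)"
      by (subst lborel.nn_integral_fst[symmetric]) auto
    also have "\<dots> \<le> (\<integral>\<^sup>+f. ennreal (2 * (Cup * (real m + 1)\<^sup>2)) * Theta m f ?p \<partial>Q)"
    proof (rule nn_integral_mono)
      fix f
      have "(\<integral>\<^sup>+y. (if near_level m f y q then 1 else 0) \<partial>lborel) = (\<integral>\<^sup>+y. indicator {y. near_level m f y q} y \<partial>lborel)"
        by (rule nn_integral_cong) (simp add: indicator_def)
      also have "\<dots> = emeasure lborel {y. near_level m f y q}"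
        by (rule nn_integral_indicator) simp
      also have "\<dots> \<le> 2 * (ennreal (Cup * (real m + 1)\<^sup>2) * Theta m f ?p)"
        unfolding near_level_def by (rule emeasure_interval_le)
      also have "\<dots> = ennreal (2 * (Cup * (real m + 1)\<^sup>2)) * Theta m f ?p"
        by (simp add: ennreal_mult Cup_def mult.assoc)
      finally show "(\<integral>\<^sup>+y. (if near_level m f y q then 1 else 0) \<partial>lborel)
          \<le> ennreal (2 * (Cup * (real m + 1)\<^sup>2)) * Theta m f ?p" .
    qed
    also have "\<dots> = ennreal (2 * (Cup * (real m + 1)\<^sup>2)) * (\<integral>\<^sup>+f. Theta m f ?p \<partial>Q)"
      by (rule nn_integral_cmult) measurable
    also have "\<dots> \<le> ennreal (2 * (Cup * (real m + 1)\<^sup>2)) * ennreal (CTheta * 2 powr (- real m * s))"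
      by (intro mult_left_mono nn_integral_Theta_le) simp
    also have "\<dots> = ennreal (L * (real m + 1)\<^sup>2 * 2 powr (- real m * s))"
      using CTheta_pos by (subst ennreal_mult[symmetric]) (auto simp: L_def Cup_def ac_simps)
    finally show ?thesis .
  qed
  have "(\<integral>\<^sup>+z. cover_sum (fst z) (snd z) \<partial>P)
      = (\<Sum>m. \<integral>\<^sup>+z. (\<Sum>q\<in>dyadic_index m. ennreal (wt m) * (if near_level m (fst z) (snd z) q then 1 else 0)) \<partial>P)"
    unfolding cover_sum_def by (rule nn_integral_suminf) measurable
  also have "\<dots> = (\<Sum>m. \<Sum>q\<in>dyadic_index m. ennreal (wt m) * (\<integral>\<^sup>+z. (if near_level m (fst z) (snd z) q then 1 else 0) \<partial>P))"
    by (intro suminf_cong) (subst nn_integral_sum, simp, intro sum.cong refl nn_integral_cmult, measurable)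
  also have "\<dots> \<le> (\<Sum>m. ennreal (L * (1 / (real m + 1)\<^sup>2)))"
  proof (rule suminf_le)
    fix m
    have "(\<Sum>q\<in>dyadic_index m. ennreal (wt m) * (\<integral>\<^sup>+z. (if near_level m (fst z) (snd z) q then 1 else 0) \<partial>P))
      \<le> (\<Sum>q\<in>(dyadic_index m :: (int ^ 'n) set). ennreal (wt m) * ennreal (L * (real m + 1)\<^sup>2 * 2 powr (- real m * s)))"
      by (intro sum_mono mult_left_mono one) simp
    also have "\<dots> = ennreal (real (card (dyadic_index m :: (int ^ 'n) set)) * (wt m * (L * (real m + 1)\<^sup>2 * 2 powr (- real m * s))))"
    proof -
      have "ennreal (wt m) * ennreal (L * (real m + 1)\<^sup>2 * 2 powr (- real m * s)) = ennreal (wt m * (L * (real m + 1)\<^sup>2 * 2 powr (- real m * s)))"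
        using L0 by (intro ennreal_mult[symmetric]) (auto simp: wt_def)
      then show ?thesis by (simp only: sum_constant ennreal_of_nat_eq_real_of_nat ennreal_mult' of_nat_0_le_iff)
    qed
    also have "real (card (dyadic_index m :: (int ^ 'n) set)) * (wt m * (L * (real m + 1)\<^sup>2 * 2 powr (- real m * s)))
        = L * (1 / (real m + 1)\<^sup>2)"
    proof -
      have c: "real (card (dyadic_index m :: (int ^ 'n) set)) = 2 powr (real m * real ?N)"
        by (simp add: card_dyadic_index powr_realpow[symmetric])
      have "real (card (dyadic_index m :: (int ^ 'n) set)) * 2 powr (- real m * (real ?N - s)) * 2 powr (- real m * s) = 1"
        unfolding c by (simp add: algebra_simps flip: powr_add)
      then have "real (card (dyadic_index m :: (int ^ 'n) set)) * (wt m * (L * (real m + 1)\<^sup>2 * 2 powr (- real m * s)))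
          = L * ((real m + 1)\<^sup>2 / (real m + 1) ^ 4)"
        by (simp add: wt_def ac_simps)
      moreover have "(real m + 1)\<^sup>2 / (real m + 1) ^ 4 = 1 / (real m + 1)\<^sup>2"
        by (simp add: power_eq_if)
      ultimately show ?thesis by simp
    qed
    finally show "(\<Sum>q\<in>dyadic_index m. ennreal (wt m) * (\<integral>\<^sup>+z. (if near_level m (fst z) (snd z) q then 1 else 0) \<partial>P))
       \<le> ennreal (L * (1 / (real m + 1)\<^sup>2))" .
  qed auto
  also have "\<dots> = ennreal (\<Sum>m. L * (1 / (real m + 1)\<^sup>2))"
    using L0 by (intro suminf_ennreal2 summable_mult summable_inverse_Suc_square) auto
  also have "\<dots> < \<infinity>" by simp
  finally have "AE z in P. cover_sum (fst z) (snd z) \<noteq> \<infinity>"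
    by (intro nn_integral_PInf_AE) auto
  then show ?thesis by (simp add: less_top)
qed

text \<open>Over a ball of radius comparable to \<open>2^(-k)\<close> the integral of
  \<open>d^(-s)\<close> is of order \<open>2^(-k*(n-s))\<close>, as \<open>s < 1 \<le> n\<close>.
  This cancels the exponential part of \<open>kweight k\<close> and leaves the summable
  \<open>1/(k + 1)^2\<close>.\<close>

lemma nn_integral_kap_le:
  "\<exists>L\<ge>0. \<forall>x. (\<integral>\<^sup>+x'. kap x x' * ennreal (dist x x' powr (- s)) \<partial>T) \<le> ennreal L"
proof -
  let ?N = "CARD('n)" and ?\<rho> = "2 * real CARD('n)"
  define Kc where "Kc = ?\<rho> powr (- s) * 2 powr s * (20 * ?\<rho>) ^ ?N"
  have Kc0: "Kc \<ge> 0" by (simp add: Kc_def)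
  define geo where "geo = (\<Sum>i. 2 powr (- real i * (real ?N - s)))"
  have Ns: "real ?N - s > 0" using s by (simp add: less_le_trans[of s 1] Suc_leI)
  have sgeo: "summable (\<lambda>i. 2 powr (- real i * (real ?N - s)))" by (rule summable_powr_neg[OF Ns])
  have geo0: "geo \<ge> 0" unfolding geo_def by (rule suminf_nonneg[OF sgeo]) simp
  have layer: "(\<integral>\<^sup>+x'. indicator {z. dist x z \<le> ?\<rho> / 2 ^ k} x' * ennreal (dist x x' powr (- s)) \<partial>T)
      \<le> ennreal (Kc * geo * 2 powr (- real k * (real ?N - s)))" for x k
  proof -
    \<comment> \<open>Dyadic annuli around \<open>x\<close>: \<open>?a i\<close> bounds the
      singularity on the annulus of index \<open>i\<close>, and the doubled radius lets an open ball
      contain its closed outer edge.\<close>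
    let ?a = "\<lambda>i. (?\<rho> / 2 ^ k / 2 ^ Suc i) powr (- s)" and ?B = "\<lambda>i. ball x (2 * (?\<rho> / 2 ^ k / 2 ^ i))"
    have "(\<integral>\<^sup>+x'. indicator {z. dist x z \<le> ?\<rho> / 2 ^ k} x' * ennreal (dist x x' powr (- s)) \<partial>T)
        \<le> (\<integral>\<^sup>+x'. (\<Sum>i. ennreal (?a i) * indicator (?B i) x') \<partial>T)"
    proof (rule nn_integral_mono)
      fix x'
      show "indicator {z. dist x z \<le> ?\<rho> / 2 ^ k} x' * ennreal (dist x x' powr (- s)) \<le> (\<Sum>i. ennreal (?a i) * indicator (?B i) x')"
      proof (cases "0 < dist x x' \<and> dist x x' \<le> ?\<rho> / 2 ^ k")
        case True
        then obtain i where i: "?\<rho> / 2 ^ k / 2 ^ Suc i < dist x x'" "dist x x' \<le> ?\<rho> / 2 ^ k / 2 ^ i"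
          using dyadic_scale[of "dist x x'" "?\<rho> / 2 ^ k"] by blast
        have "dist x x' powr (- s) \<le> ?a i" using i(1) s by (intro powr_mono2') auto
        moreover have "x' \<in> ?B i"
        proof -
          have "0 < ?\<rho> / 2 ^ k / 2 ^ i" by simp
          then show ?thesis unfolding mem_ball using i(2) by linarith
        qed
        ultimately have "ennreal (dist x x' powr (- s)) \<le> (\<Sum>i\<in>{i}. ennreal (?a i) * indicator (?B i) x')"
          by (simp add: ennreal_leI)
        also have "\<dots> \<le> (\<Sum>i. ennreal (?a i) * indicator (?B i) x')" by (rule sum_le_suminf) auto
        finally show ?thesis using True by simp
      next
        case False
        \<comment> \<open>On the diagonal the integrand is 0, since
          \<open>0 powr (- s) = 0\<close>.\<close>
        then have "dist x x' = 0 \<or> x' \<notin> {z. dist x z \<le> ?\<rho> / 2 ^ k}" by auto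
        then have "indicator {z. dist x z \<le> ?\<rho> / 2 ^ k} x' * ennreal (dist x x' powr (- s)) = 0" by auto
        then show ?thesis by (simp only: zero_le)
      qed
    qed
    also have "\<dots> = (\<Sum>i. ennreal (?a i) * emeasure T (?B i))"
    proof -
      have "(\<integral>\<^sup>+x'. (\<Sum>i. ennreal (?a i) * indicator (?B i) x') \<partial>T) = (\<Sum>i. \<integral>\<^sup>+x'. ennreal (?a i) * indicator (?B i) x' \<partial>T)"
        unfolding indicator_def mem_ball by (rule nn_integral_suminf) measurable
      also have "\<dots> = (\<Sum>i. ennreal (?a i) * emeasure T (?B i))"
        by (intro suminf_cong nn_integral_cmult_indicator) simp
      finally show ?thesis .
    qed
    also have "\<dots> \<le> (\<Sum>i. ennreal (Kc * 2 powr (- real k * (real ?N - s)) * 2 powr (- real i * (real ?N - s))))"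
    proof (rule suminf_le)
      fix i
      have "ennreal (?a i) * emeasure T (?B i) \<le> ennreal (?a i) * ennreal (10 ^ ?N * (2 * (?\<rho> / 2 ^ k / 2 ^ i)) ^ ?N)"
        by (intro mult_left_mono emeasure_torus_ball_le) auto
      also have "\<dots> = ennreal (?a i * (10 ^ ?N * (2 * (?\<rho> / 2 ^ k / 2 ^ i)) ^ ?N))"
        by (rule ennreal_mult[symmetric]) auto
      also have "?a i * (10 ^ ?N * (2 * (?\<rho> / 2 ^ k / 2 ^ i)) ^ ?N)
          = Kc * 2 powr (- real k * (real ?N - s)) * 2 powr (- real i * (real ?N - s))"
      proof -
        have "?a i = ?\<rho> powr (- s) * 2 powr s * 2 powr (real k * s) * 2 powr (real i * s)"
        proof -
          have "?\<rho> / 2 ^ k / 2 ^ Suc i = ?\<rho> * 2 powr (- (real k + real i + 1))"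
          proof -
            have "2 powr (real k + real i + 1) = 2 ^ k * 2 ^ Suc i" by (simp add: powr_add powr_realpow)
            then have "2 powr (- (real k + real i + 1)) = 1 / (2 ^ k * 2 ^ Suc i)" by (simp only: powr_minus_divide)
            then show ?thesis by (simp only:) simp
          qed
          then have "?a i = ?\<rho> powr (- s) * (2 powr (- (real k + real i + 1))) powr (- s)"
            by (simp only: powr_mult)
          also have "(2 powr (- (real k + real i + 1))) powr (- s) = 2 powr (s + real k * s + real i * s)"
            by (simp add: powr_powr algebra_simps)
          finally show ?thesis by (simp add: powr_add mult.assoc)
        qed
        moreover have "10 ^ ?N * (2 * (?\<rho> / 2 ^ k / 2 ^ i)) ^ ?N
            = (20 * ?\<rho>) ^ ?N * 2 powr (- real k * real ?N) * 2 powr (- real i * real ?N)"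
        proof -
          have e: "2 powr (- real k * real ?N) = (1 / 2 ^ k) ^ ?N" for k :: nat
          proof -
            have "1 / 2 ^ k = 2 powr (- real k)" by (simp add: powr_minus_divide powr_realpow)
            then show ?thesis by (simp add: powr_power mult.commute)
          qed
          have "10 ^ ?N * (2 * (?\<rho> / 2 ^ k / 2 ^ i)) ^ ?N = (10 * (2 * (?\<rho> / 2 ^ k / 2 ^ i))) ^ ?N"
            by (rule power_mult_distrib[symmetric])
          also have "10 * (2 * (?\<rho> / 2 ^ k / 2 ^ i)) = 20 * ?\<rho> * (1 / 2 ^ k) * (1 / 2 ^ i)" by simp
          finally show ?thesis unfolding e by (simp only: power_mult_distrib)
        qed
        ultimately show ?thesis
          by (simp add: Kc_def ac_simps algebra_simps flip: powr_add)
      qed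
      finally show "ennreal (?a i) * emeasure T (?B i)
        \<le> ennreal (Kc * 2 powr (- real k * (real ?N - s)) * 2 powr (- real i * (real ?N - s)))" .
    qed auto
    also have "\<dots> = ennreal (\<Sum>i. Kc * 2 powr (- real k * (real ?N - s)) * 2 powr (- real i * (real ?N - s)))"
      using Kc0 by (intro suminf_ennreal2 summable_mult sgeo) auto
    also have "(\<Sum>i. Kc * 2 powr (- real k * (real ?N - s)) * 2 powr (- real i * (real ?N - s)))
        = Kc * geo * 2 powr (- real k * (real ?N - s))"
      unfolding geo_def by (subst suminf_mult[OF sgeo]) simp
    finally show ?thesis .
  qed
  define L where "L = Kc * geo * (\<Sum>k. 1 / (real k + 1)\<^sup>2)"
  have "(\<integral>\<^sup>+x'. kap x x' * ennreal (dist x x' powr (- s)) \<partial>T) \<le> ennreal L" for x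
  proof -
    have "(\<integral>\<^sup>+x'. kap x x' * ennreal (dist x x' powr (- s)) \<partial>T)
        = (\<integral>\<^sup>+x'. (\<Sum>k. ennreal (kweight k) * (indicator {z. dist x z \<le> ?\<rho> / 2 ^ k} x' * ennreal (dist x x' powr (- s)))) \<partial>T)"
      unfolding kap_def by (simp add: mult.assoc flip: ennreal_suminf_multc)
    also have "\<dots> = (\<Sum>k. \<integral>\<^sup>+x'. ennreal (kweight k) * (indicator {z. dist x z \<le> ?\<rho> / 2 ^ k} x' * ennreal (dist x x' powr (- s))) \<partial>T)"
      unfolding indicator_def mem_Collect_eq by (rule nn_integral_suminf) measurable
    also have "\<dots> = (\<Sum>k. ennreal (kweight k) * (\<integral>\<^sup>+x'. indicator {z. dist x z \<le> ?\<rho> / 2 ^ k} x' * ennreal (dist x x' powr (- s)) \<partial>T))"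
      unfolding indicator_def mem_Collect_eq by (intro suminf_cong nn_integral_cmult) measurable
    also have "\<dots> \<le> (\<Sum>k. ennreal (Kc * geo * (1 / (real k + 1)\<^sup>2)))"
    proof (rule suminf_le)
      fix k
      have "ennreal (kweight k) * (\<integral>\<^sup>+x'. indicator {z. dist x z \<le> ?\<rho> / 2 ^ k} x' * ennreal (dist x x' powr (- s)) \<partial>T)
        \<le> ennreal (kweight k) * ennreal (Kc * geo * 2 powr (- real k * (real ?N - s)))"
        by (intro mult_left_mono layer) simp
      also have "\<dots> = ennreal (kweight k * (Kc * geo * 2 powr (- real k * (real ?N - s))))"
        using Kc0 geo0 kweight_nonneg by (intro ennreal_mult[symmetric]) auto
      also have "kweight k * (Kc * geo * 2 powr (- real k * (real ?N - s))) = Kc * geo * (1 / (real k + 1)\<^sup>2)"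
      proof -
        have "2 powr (real k * (real ?N - s)) * 2 powr (- real k * (real ?N - s)) = 1" by (simp flip: powr_add)
        then show ?thesis by (simp add: kweight_def ac_simps)
      qed
      finally show "ennreal (kweight k) * (\<integral>\<^sup>+x'. indicator {z. dist x z \<le> ?\<rho> / 2 ^ k} x' * ennreal (dist x x' powr (- s)) \<partial>T)
        \<le> ennreal (Kc * geo * (1 / (real k + 1)\<^sup>2))" .
    qed auto
    also have "\<dots> = ennreal (\<Sum>k. Kc * geo * (1 / (real k + 1)\<^sup>2))"
      using Kc0 geo0 by (intro suminf_ennreal2 summable_mult summable_inverse_Suc_square) auto
    also have "(\<Sum>k. Kc * geo * (1 / (real k + 1)\<^sup>2)) = L"
      unfolding L_def by (rule suminf_mult[OF summable_inverse_Suc_square])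
    finally show ?thesis .
  qed
  moreover have "L \<ge> 0"
    unfolding L_def using Kc0 geo0 by (intro mult_nonneg_nonneg suminf_nonneg summable_inverse_Suc_square) auto
  ultimately show ?thesis by blast
qed

text \<open>After Fubini's theorem the normalization \<open>1 / (2 * \<epsilon>)^2\<close> cancels
  the bound for a pair of points, uniformly in \<open>\<epsilon>\<close>, and what remains is the
  integral of \<open>kap\<close> against \<open>d^(-s)\<close>. The diagonal, where
  anticoncentration fails, is null.\<close>

lemma nn_integral_energy_le:
  assumes A: "0 \<le> A"
  shows "\<exists>L\<ge>0. \<forall>\<epsilon>>0. (\<integral>\<^sup>+z. slice_energy A \<epsilon> (fst z) (snd z) \<partial>P) \<le> ennreal L"
proof -
  interpret Q: prob_space Q by (rule prob_space_Q)
  interpret P: sigma_finite_measure P by (rule sigma_finite_P)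
  interpret T: prob_space T by (rule prob_space_torus_measure)
  interpret PT: pair_sigma_finite P T ..
  obtain L where L: "L \<ge> 0" "\<And>x. (\<integral>\<^sup>+x'. kap x x' * ennreal (dist x x' powr (- s)) \<partial>T) \<le> ennreal L"
    using nn_integral_kap_le by blast
  have "(\<integral>\<^sup>+z. slice_energy A \<epsilon> (fst z) (snd z) \<partial>P) \<le> ennreal (Canti * L)" if \<epsilon>: "\<epsilon> > 0" for \<epsilon>
  proof -
    let ?s = "\<lambda>z x. slice A \<epsilon> (fst z) (snd z) x"
    \<comment> \<open>If both slices are nonzero, the two values differ by less than
      \<open>2 * \<epsilon>\<close>, which gives one factor through anticoncentration; the range of
      \<open>y\<close> gives the other.\<close>
    have inner: "(\<integral>\<^sup>+z. ?s z x * ?s z x' \<partial>P) \<le> ennreal ((2 * \<epsilon>)\<^sup>2 * Canti * dist x x' powr (- s))" if x: "x \<noteq> x'" for x x'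
    proof -
      let ?F = "{f. x \<in> K A f \<and> x' \<in> K A f \<and> \<bar>Slim f x - Slim f x'\<bar> < 2 * \<epsilon>}"
      have "(\<integral>\<^sup>+z. ?s z x * ?s z x' \<partial>P) = (\<integral>\<^sup>+f. (\<integral>\<^sup>+y. slice A \<epsilon> f y x * slice A \<epsilon> f y x' \<partial>lborel) \<partial>Q)"
        by (subst lborel.nn_integral_fst[symmetric]) auto
      also have "\<dots> \<le> (\<integral>\<^sup>+f. ennreal (2 * \<epsilon>) * indicator ?F f \<partial>Q)"
      proof (rule nn_integral_mono)
        fix f
        have "(\<integral>\<^sup>+y. slice A \<epsilon> f y x * slice A \<epsilon> f y x' \<partial>lborel)
            \<le> (\<integral>\<^sup>+y. indicator ?F f * indicator {y. ennreal \<bar>y - Slim f x\<bar> \<le> ennreal \<epsilon>} y \<partial>lborel)"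
          using \<epsilon> by (intro nn_integral_mono) (auto simp: slice_def indicator_def)
        also have "\<dots> = indicator ?F f * emeasure lborel {y. ennreal \<bar>y - Slim f x\<bar> \<le> ennreal \<epsilon>}"
          by (rule nn_integral_cmult_indicator) measurable
        also have "\<dots> \<le> indicator ?F f * (2 * ennreal \<epsilon>)"
          by (intro mult_left_mono emeasure_interval_le) simp
        finally show "(\<integral>\<^sup>+y. slice A \<epsilon> f y x * slice A \<epsilon> f y x' \<partial>lborel) \<le> ennreal (2 * \<epsilon>) * indicator ?F f"
          using \<epsilon> by (simp add: ennreal_mult mult.commute)
      qed
      also have "\<dots> = ennreal (2 * \<epsilon>) * emeasure Q ?F" by (rule nn_integral_cmult_indicator) measurable
      also have "\<dots> \<le> ennreal (2 * \<epsilon>) * ennreal (Canti * (2 * \<epsilon>) * dist x x' powr (- s))"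
        using \<epsilon> by (intro mult_left_mono Slim_anticoncentration[OF x A]) auto
      also have "\<dots> = ennreal ((2 * \<epsilon>)\<^sup>2 * Canti * dist x x' powr (- s))"
        using \<epsilon> Canti_pos by (subst ennreal_mult[symmetric]) (auto simp: power2_eq_square ac_simps)
      finally show ?thesis .
    qed
    have "(\<integral>\<^sup>+z. slice_energy A \<epsilon> (fst z) (snd z) \<partial>P)
        = ennreal (1 / (2 * \<epsilon>)\<^sup>2) * (\<integral>\<^sup>+z. (\<integral>\<^sup>+x. (\<integral>\<^sup>+x'. kap x x' * (?s z x * ?s z x') \<partial>T) \<partial>T) \<partial>P)"
      unfolding slice_energy_def by (rule nn_integral_cmult) measurable
    moreover have "(\<integral>\<^sup>+z. (\<integral>\<^sup>+x. (\<integral>\<^sup>+x'. kap x x' * (?s z x * ?s z x') \<partial>T) \<partial>T) \<partial>P)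
        = (\<integral>\<^sup>+x. (\<integral>\<^sup>+z. (\<integral>\<^sup>+x'. kap x x' * (?s z x * ?s z x') \<partial>T) \<partial>P) \<partial>T)"
      by (rule PT.Fubini'[symmetric]) measurable
    moreover have "\<dots> = (\<integral>\<^sup>+x. (\<integral>\<^sup>+x'. (\<integral>\<^sup>+z. kap x x' * (?s z x * ?s z x') \<partial>P) \<partial>T) \<partial>T)"
      by (intro nn_integral_cong PT.Fubini'[symmetric]) measurable
    moreover have "\<dots> \<le> (\<integral>\<^sup>+x. ennreal ((2 * \<epsilon>)\<^sup>2 * Canti) * ennreal L \<partial>T)"
    proof (rule nn_integral_mono)
      fix x
      have "(\<integral>\<^sup>+x'. (\<integral>\<^sup>+z. kap x x' * (?s z x * ?s z x') \<partial>P) \<partial>T)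
          \<le> (\<integral>\<^sup>+x'. ennreal ((2 * \<epsilon>)\<^sup>2 * Canti) * (kap x x' * ennreal (dist x x' powr (- s))) \<partial>T)"
      proof (rule nn_integral_mono_AE)
        have "AE x' in T. x' \<notin> {x}"
          by (rule AE_not_in) (simp add: null_sets_def emeasure_torus_singleton)
        then show "AE x' in T. (\<integral>\<^sup>+z. kap x x' * (?s z x * ?s z x') \<partial>P)
            \<le> ennreal ((2 * \<epsilon>)\<^sup>2 * Canti) * (kap x x' * ennreal (dist x x' powr (- s)))"
        proof eventually_elim
          case (elim x')
          have "(\<integral>\<^sup>+z. kap x x' * (?s z x * ?s z x') \<partial>P) = kap x x' * (\<integral>\<^sup>+z. ?s z x * ?s z x' \<partial>P)"
            by (rule nn_integral_cmult) measurable
          also have "\<dots> \<le> kap x x' * ennreal ((2 * \<epsilon>)\<^sup>2 * Canti * dist x x' powr (- s))"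
            using elim by (intro mult_left_mono inner) auto
          also have "\<dots> = ennreal ((2 * \<epsilon>)\<^sup>2 * Canti) * (kap x x' * ennreal (dist x x' powr (- s)))"
            using Canti_pos by (subst ennreal_mult) (auto simp: ac_simps)
          finally show ?case .
        qed
      qed
      also have "\<dots> = ennreal ((2 * \<epsilon>)\<^sup>2 * Canti) * (\<integral>\<^sup>+x'. kap x x' * ennreal (dist x x' powr (- s)) \<partial>T)"
        by (rule nn_integral_cmult) measurable
      also have "\<dots> \<le> ennreal ((2 * \<epsilon>)\<^sup>2 * Canti) * ennreal L" by (intro mult_left_mono L) simp
      finally show "(\<integral>\<^sup>+x'. (\<integral>\<^sup>+z. kap x x' * (?s z x * ?s z x') \<partial>P) \<partial>T) \<le> ennreal ((2 * \<epsilon>)\<^sup>2 * Canti) * ennreal L" .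
    qed
    ultimately have "(\<integral>\<^sup>+z. slice_energy A \<epsilon> (fst z) (snd z) \<partial>P)
        \<le> ennreal (1 / (2 * \<epsilon>)\<^sup>2) * (\<integral>\<^sup>+x. ennreal ((2 * \<epsilon>)\<^sup>2 * Canti) * ennreal L \<partial>T)"
      by (simp only: mult_left_mono zero_le)
    also have "\<dots> = ennreal (1 / (2 * \<epsilon>)\<^sup>2 * ((2 * \<epsilon>)\<^sup>2 * Canti * L))"
    proof -
      have "ennreal ((2 * \<epsilon>)\<^sup>2 * Canti) * ennreal L = ennreal ((2 * \<epsilon>)\<^sup>2 * Canti * L)"
        using L(1) Canti_pos by (intro ennreal_mult[symmetric]) auto
      moreover have "ennreal (1 / (2 * \<epsilon>)\<^sup>2) * ennreal ((2 * \<epsilon>)\<^sup>2 * Canti * L) = ennreal (1 / (2 * \<epsilon>)\<^sup>2 * ((2 * \<epsilon>)\<^sup>2 * Canti * L))"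
        using L(1) Canti_pos by (intro ennreal_mult[symmetric]) auto
      ultimately show ?thesis by (simp only: nn_integral_torus_const)
    qed
    also have "1 / (2 * \<epsilon>)\<^sup>2 * ((2 * \<epsilon>)\<^sup>2 * Canti * L) = Canti * L" using \<epsilon> by simp
    finally show ?thesis .
  qed
  then show ?thesis using L Canti_pos by (intro exI[of _ "Canti * L"]) auto
qed

lemma mass_square_le_energy: "slice_mass A \<epsilon> f y * slice_mass A \<epsilon> f y \<le> slice_energy A \<epsilon> f y"
proof -
  let ?s = "\<lambda>x. slice A \<epsilon> f y x" and ?e = "ennreal (1 / (2 * \<epsilon>))"
  have [measurable]: "?s \<in> borel_measurable T" by measurable
  have "(\<integral>\<^sup>+x. ?s x \<partial>T) * (\<integral>\<^sup>+x. ?s x \<partial>T) = (\<integral>\<^sup>+x. (\<integral>\<^sup>+x'. 1 * (?s x * ?s x') \<partial>T) \<partial>T)"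
    by (simp add: nn_integral_cmult nn_integral_multc)
  also have "\<dots> \<le> (\<integral>\<^sup>+x. (\<integral>\<^sup>+x'. kap x x' * (?s x * ?s x') \<partial>T) \<partial>T)"
    by (intro nn_integral_mono mult_right_mono kap_ge_1) simp
  finally have 1: "(\<integral>\<^sup>+x. ?s x \<partial>T) * (\<integral>\<^sup>+x. ?s x \<partial>T) \<le> (\<integral>\<^sup>+x. (\<integral>\<^sup>+x'. kap x x' * (?s x * ?s x') \<partial>T) \<partial>T)" .
  have 2: "?e * ?e \<le> ennreal (1 / (2 * \<epsilon>)\<^sup>2)"
    by (cases "\<epsilon> \<ge> 0") (auto simp: ennreal_mult[symmetric] power2_eq_square ennreal_neg)
  have "slice_mass A \<epsilon> f y * slice_mass A \<epsilon> f y = (?e * ?e) * ((\<integral>\<^sup>+x. ?s x \<partial>T) * (\<integral>\<^sup>+x. ?s x \<partial>T))"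
    unfolding slice_mass_def by (simp only: ac_simps)
  also have "\<dots> \<le> slice_energy A \<epsilon> f y"
    unfolding slice_energy_def by (rule mult_mono[OF 2 1]) auto
  finally show ?thesis .
qed

end

section \<open>From positive mean mass to the dimension of level sets\<close>

context random_wavelet_series
begin

text \<open>A jointly measurable condition that implies the dimension claim: the second conjunct
  serves the upper bound, the third the lower one. All parameters are natural numbers, so that the
  quantifiers are countable.\<close>

definition full_level :: "'n l1 \<Rightarrow> real \<Rightarrow> bool" where
  "full_level f y \<longleftrightarrow> f \<in> good \<and> cover_sum f y < \<infinity> \<and>
    (\<exists>A N. 0 < N \<and> (\<forall>j0. \<exists>j\<ge>j0. ennreal (1 / real N) < slice_mass (real A) (1 / 2 ^ j) f y \<and> slice_energy (real A) (1 / 2 ^ j) f y \<le> ennreal (real N)))"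

lemma full_level_measurable [measurable (raw)]:
  assumes [measurable]: "f \<in> measurable N borel" "h \<in> borel_measurable N"
  shows "Measurable.pred N (\<lambda>\<omega>. full_level (f \<omega>) (h \<omega>))"
  unfolding full_level_def by measurable

lemma hausdorff_dim_full_level:
  assumes "full_level f y"
  shows "hausdorff_dim (lebesgue_points f \<inter> level_set f y) = ereal (real CARD('n) - s)"
proof (rule antisym)
  have f: "f \<in> good" and c: "cover_sum f y < \<infinity>" using assms by (auto simp: full_level_def)
  obtain A N where N: "0 < N"
    "\<And>j0. \<exists>j\<ge>j0. ennreal (1 / real N) < slice_mass (real A) (1 / 2 ^ j) f y \<and> slice_energy (real A) (1 / 2 ^ j) f y \<le> ennreal (real N)"
    using assms by (auto simp: full_level_def)
  show "hausdorff_dim (lebesgue_points f \<inter> level_set f y) \<le> ereal (real CARD('n) - s)"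
    by (rule hausdorff_dim_level_le[OF f c])
  show "ereal (real CARD('n) - s) \<le> hausdorff_dim (lebesgue_points f \<inter> level_set f y)"
    by (rule hausdorff_dim_ge, rule hausdorff_measure_level_pos[where A = "real A" and a = "1 / real N" and N = "real N"])
       (use f N in auto)
qed

text \<open>Since the energy dominates the square of the mass, a lower bound for the mean mass bounds from below
  the measure of the set where the mass is not small and the energy not large.\<close>

lemma full_level_positive:
  fixes A :: nat
  assumes D: "D \<in> sets (borel \<Otimes>\<^sub>M borel)" "D \<subseteq> UNIV \<times> {-R..R}"
    and h: "0 < h" "\<And>j. ennreal h \<le> (\<integral>\<^sup>+z. slice_mass (real A) (1 / 2 ^ j) (fst z) (snd z) * indicator D z \<partial>P)"
  shows "0 < emeasure P {z \<in> D. full_level (fst z) (snd z)}"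
proof -
  interpret Q: prob_space Q by (rule prob_space_Q)
  interpret QL: pair_sigma_finite Q lborel ..
  note [measurable, simp] = D(1)
  have "emeasure P D \<le> emeasure P (UNIV \<times> {-R..R})"
    using D(2) by (intro emeasure_mono) (auto simp: sets_P space_pair_measure)
  also have "\<dots> = emeasure Q UNIV * emeasure lborel {-R..R}"
    by (intro lborel.emeasure_pair_measure_Times) auto
  also have "\<dots> \<le> ennreal (2 * \<bar>R\<bar>)"
    using Q.emeasure_space_1 by (cases "R \<ge> 0") (auto intro!: ennreal_leI)
  finally have PD: "emeasure P D \<le> ennreal (2 * \<bar>R\<bar>)" .
  obtain L where L: "L \<ge> 0" "\<And>\<epsilon>. \<epsilon> > 0 \<Longrightarrow> (\<integral>\<^sup>+z. slice_energy (real A) \<epsilon> (fst z) (snd z) \<partial>P) \<le> ennreal L"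
    using nn_integral_energy_le[of "real A"] by auto
  \<comment> \<open>Chosen so that the contributions of small mass and of large energy together use
    at most half of \<open>h\<close>.\<close>
  obtain K0 :: nat where K0: "(4 * (2 * \<bar>R\<bar> + L) + 1) / h < real K0" using reals_Archimedean2 by blast
  define k where "k = max 1 K0"
  define N where "N = k * k"
  have k1: "1 \<le> real k" by (simp add: k_def)
  have kh: "4 * (2 * \<bar>R\<bar> + L) \<le> h * real k"
  proof -
    have "(4 * (2 * \<bar>R\<bar> + L) + 1) / h < real k" using K0 by (simp add: k_def)
    then show ?thesis using h(1) by (simp add: field_simps)
  qed
  define E where "E j = {z \<in> D. ennreal (1 / real N) < slice_mass (real A) (1 / 2 ^ j) (fst z) (snd z)
      \<and> slice_energy (real A) (1 / 2 ^ j) (fst z) (snd z) \<le> ennreal (real N)}" for j :: nat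
  have Em [measurable, simp]: "E j \<in> sets (borel \<Otimes>\<^sub>M borel)" for j
  proof -
    have "E j = D \<inter> {z \<in> space (borel \<Otimes>\<^sub>M borel). ennreal (1 / real N) < slice_mass (real A) (1 / 2 ^ j) (fst z) (snd z)
      \<and> slice_energy (real A) (1 / 2 ^ j) (fst z) (snd z) \<le> ennreal (real N)}"
      by (auto simp: E_def space_pair_measure)
    also have "\<dots> \<in> sets (borel \<Otimes>\<^sub>M borel)" by measurable
    finally show ?thesis .
  qed
  have t: "x \<le> x + y + w" "y \<le> x + y + w" "w \<le> x + y + w" for x y w :: ennreal
    by (simp_all add: add_increasing add_increasing2)
  have low: "ennreal (h / (2 * real k)) \<le> emeasure P (E j)" for j
  proof -
    let ?u = "\<lambda>z. slice_mass (real A) (1 / 2 ^ j) (fst z) (snd z)" and ?v = "\<lambda>z. slice_energy (real A) (1 / 2 ^ j) (fst z) (snd z)"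
    \<comment> \<open>Three cases with \<open>N = k * k\<close>: the mass is small; or
      \<open>z \<in> E j\<close>, where energy at most \<open>k * k\<close> forces mass at most
      \<open>k\<close>; or the energy exceeds \<open>k * k\<close>, and then \<open>k\<close> times
      the mass is at most the energy.\<close>
    have pw: "?u z * indicator D z \<le> ennreal (1 / real N) * indicator D z + ennreal (real k) * indicator (E j) z + ennreal (1 / real k) * ?v z" for z
    proof (cases "z \<in> D")
      case True
      have uv: "?u z * ?u z \<le> ?v z" by (rule mass_square_le_energy)
      have "?u z \<le> ennreal (1 / real N) \<or> (z \<in> E j \<and> ?v z \<le> ennreal (real N)) \<or> ennreal (real N) < ?v z"
        using True by (auto simp: E_def not_le)
      then consider "?u z \<le> ennreal (1 / real N)" | "z \<in> E j" "?v z \<le> ennreal (real N)" | "ennreal (real N) < ?v z"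
        by blast
      then show ?thesis
      proof cases
        case 1
        then show ?thesis using True by (intro order_trans[OF _ t(1)]) simp
      next
        case 2
        have "?u z \<le> ennreal (real k)"
        proof (rule ccontr)
          assume gt: "\<not> ?u z \<le> ennreal (real k)"
          then have "ennreal (real k) * ?u z \<le> ?u z * ?u z" by (intro mult_right_mono) auto
          also have "\<dots> \<le> ennreal (real N)" using uv 2(2) by (rule order_trans)
          also have "\<dots> = ennreal (real k) * ennreal (real k)" by (simp add: N_def ennreal_mult)
          finally show False using gt k1 by (subst (asm) ennreal_mult_le_mult_iff) auto
        qed
        then show ?thesis using True 2(1) by (intro order_trans[OF _ t(2)]) simp
      next
        case 3
        have "ennreal (real k) * ?u z \<le> ?v z"
        proof (cases "?u z \<le> ennreal (real k)")
          case True
          then have "ennreal (real k) * ?u z \<le> ennreal (real k) * ennreal (real k)" by (rule mult_left_mono) simp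
          then show ?thesis using 3 by (simp add: N_def ennreal_mult order.trans[OF _ less_imp_le])
        next
          case False
          then have "ennreal (real k) * ?u z \<le> ?u z * ?u z" by (intro mult_right_mono) auto
          then show ?thesis using uv by (rule order_trans)
        qed
        then have "ennreal (1 / real k) * (ennreal (real k) * ?u z) \<le> ennreal (1 / real k) * ?v z"
          by (rule mult_left_mono) simp
        moreover have "ennreal (1 / real k) * (ennreal (real k) * ?u z) = ?u z"
          using k1 by (simp add: mult.assoc[symmetric] ennreal_mult[symmetric])
        ultimately show ?thesis using True by (intro order_trans[OF _ t(3)]) simp
      qed
    qed simp
    have "ennreal h \<le> (\<integral>\<^sup>+z. ?u z * indicator D z \<partial>P)" by (rule h)
    also have "\<dots> \<le> (\<integral>\<^sup>+z. ennreal (1 / real N) * indicator D z + ennreal (real k) * indicator (E j) z + ennreal (1 / real k) * ?v z \<partial>P)"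
      by (rule nn_integral_mono) (rule pw)
    also have "\<dots> = ennreal (1 / real N) * emeasure P D + ennreal (real k) * emeasure P (E j) + ennreal (1 / real k) * (\<integral>\<^sup>+z. ?v z \<partial>P)"
      by (simp add: nn_integral_add nn_integral_cmult nn_integral_cmult_indicator)
    also have "\<dots> \<le> ennreal (1 / real k) * ennreal (2 * \<bar>R\<bar>) + ennreal (real k) * emeasure P (E j) + ennreal (1 / real k) * ennreal L"
    proof (intro add_mono mult_mono PD L order_refl)
      show "ennreal (1 / real N) \<le> ennreal (1 / real k)"
        using k1 by (intro ennreal_leI divide_left_mono) (auto simp: N_def)
    qed auto
    also have "\<dots> = ennreal ((2 * \<bar>R\<bar> + L) / real k) + ennreal (real k) * emeasure P (E j)"
      using L(1) k1 by (simp add: ennreal_mult[symmetric] add_divide_distrib ac_simps)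
    also have "\<dots> \<le> ennreal (h / 2) + ennreal (real k) * emeasure P (E j)"
    proof (intro add_right_mono ennreal_leI)
      show "(2 * \<bar>R\<bar> + L) / real k \<le> h / 2" using kh k1 h(1) L(1) by (simp add: divide_le_eq)
    qed
    finally have "ennreal (h / 2) + ennreal (h / 2) \<le> ennreal (h / 2) + ennreal (real k) * emeasure P (E j)"
      using h(1) by (simp add: ennreal_plus[symmetric] del: ennreal_plus)
    then have "ennreal (h / 2) \<le> ennreal (real k) * emeasure P (E j)"
      by (simp add: ennreal_add_left_cancel_le)
    then have "ennreal (1 / real k) * ennreal (h / 2) \<le> ennreal (1 / real k) * (ennreal (real k) * emeasure P (E j))"
      by (rule mult_left_mono) simp
    moreover have "ennreal (1 / real k) * (ennreal (real k) * emeasure P (E j)) = emeasure P (E j)"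
      using k1 by (simp add: mult.assoc[symmetric] ennreal_mult[symmetric])
    moreover have "ennreal (1 / real k) * ennreal (h / 2) = ennreal (h / (2 * real k))"
      using k1 h(1) by (simp add: ennreal_mult[symmetric] mult.commute)
    ultimately show ?thesis by simp
  qed
  \<comment> \<open>The limsup of the events \<open>E j\<close> keeps the lower bound by continuity
    from above, which applies because \<open>D\<close> lies in a strip of finite measure.\<close>
  let ?F = "\<lambda>J. \<Union>j\<in>{J..}. E j"
  have "ennreal (h / (2 * real k)) \<le> (INF J. emeasure P (?F J))"
  proof (rule INF_greatest)
    fix J
    have "emeasure P (E J) \<le> emeasure P (?F J)" by (rule emeasure_mono) auto
    with low[of J] show "ennreal (h / (2 * real k)) \<le> emeasure P (?F J)" by (rule order_trans)
  qed
  also have "\<dots> = emeasure P (\<Inter>J. ?F J)"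
  proof (rule INF_emeasure_decseq)
    show "range ?F \<subseteq> sets P" by auto
    show "decseq ?F" unfolding decseq_def by (intro allI impI UN_mono) auto
    show "emeasure P (?F J) \<noteq> \<infinity>" for J
    proof -
      have "emeasure P (?F J) \<le> emeasure P D" by (rule emeasure_mono) (auto simp: E_def)
      then show ?thesis using PD by (auto simp: top_unique)
    qed
  qed
  also have "\<dots> \<le> emeasure P {z \<in> D. full_level (fst z) (snd z)}"
  proof (rule emeasure_mono_AE)
    have "AE z in P. fst z \<in> good"
    proof (rule QL.AE_pair_measure)
      have "{z \<in> space (borel \<Otimes>\<^sub>M borel :: ('n l1 \<times> real) measure). fst z \<in> good} \<in> sets (borel \<Otimes>\<^sub>M borel)"
        by measurable
      then show "{z \<in> space P. fst z \<in> good} \<in> sets P" by (simp add: space_pair_measure)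
      show "AE f in Q. AE y in lborel. fst (f, y) \<in> good" using AE_good by eventually_elim simp
    qed
    with AE_cover_sum show "AE z in P. z \<in> (\<Inter>J. ?F J) \<longrightarrow> z \<in> {z \<in> D. full_level (fst z) (snd z)}"
    proof eventually_elim
      case (elim z)
      show ?case
      proof
        assume z: "z \<in> (\<Inter>J. ?F J)"
        then have "z \<in> D" by (auto simp: E_def)
        moreover have "\<exists>j\<ge>J. ennreal (1 / real N) < slice_mass (real A) (1 / 2 ^ j) (fst z) (snd z)
            \<and> slice_energy (real A) (1 / 2 ^ j) (fst z) (snd z) \<le> ennreal (real N)" for J
        proof -
          have "z \<in> ?F J" using z by blast
          then obtain j where "j \<ge> J" "z \<in> E j" by auto
          then show ?thesis by (auto simp: E_def)
        qed
        moreover have "0 < N" using k1 by (simp add: N_def)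
        ultimately show "z \<in> {z \<in> D. full_level (fst z) (snd z)}"
          using elim unfolding full_level_def by blast
      qed
    qed
    have "{z \<in> D. full_level (fst z) (snd z)} = D \<inter> {z \<in> space P. full_level (fst z) (snd z)}"
      by (auto simp: space_pair_measure)
    also have "\<dots> \<in> sets P" by measurable
    finally show "{z \<in> D. full_level (fst z) (snd z)} \<in> sets P" .
  qed
  finally have "ennreal (h / (2 * real k)) \<le> emeasure P {z \<in> D. full_level (fst z) (snd z)}" .
  moreover have "0 < ennreal (h / (2 * real k))" using h(1) k1 by simp
  ultimately show ?thesis by (rule less_le_trans[rotated])
qed

text \<open>Bringing the torus variable outermost leaves, for each fixed \<open>x\<close>, an
  integral over \<open>f\<close> and \<open>y\<close> that can be bounded below uniformly in
  \<open>x\<close>.\<close>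

lemma nn_integral_mass_rectangle:
  assumes [measurable]: "F \<in> sets borel" "Y \<in> sets borel"
  shows "(\<integral>\<^sup>+z. slice_mass A \<epsilon> (fst z) (snd z) * indicator (F \<times> Y) z \<partial>P)
    = ennreal (1 / (2 * \<epsilon>)) * (\<integral>\<^sup>+x. (\<integral>\<^sup>+f. (\<integral>\<^sup>+y. slice A \<epsilon> f y x * (indicator F f * indicator Y y) \<partial>lborel) \<partial>Q) \<partial>T)"
proof -
  interpret Q: prob_space Q by (rule prob_space_Q)
  interpret P: sigma_finite_measure P by (rule sigma_finite_P)
  interpret T: prob_space T by (rule prob_space_torus_measure)
  interpret PT: pair_sigma_finite P T ..
  let ?i = "\<lambda>z. indicator F (fst z) * indicator Y (snd z) :: ennreal"
  have "(\<integral>\<^sup>+z. slice_mass A \<epsilon> (fst z) (snd z) * indicator (F \<times> Y) z \<partial>P)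
      = (\<integral>\<^sup>+z. ennreal (1 / (2 * \<epsilon>)) * (\<integral>\<^sup>+x. slice A \<epsilon> (fst z) (snd z) x * ?i z \<partial>T) \<partial>P)"
  proof (rule nn_integral_cong)
    fix z
    have "(\<integral>\<^sup>+x. slice A \<epsilon> (fst z) (snd z) x * ?i z \<partial>T) = (\<integral>\<^sup>+x. slice A \<epsilon> (fst z) (snd z) x \<partial>T) * ?i z"
      by (rule nn_integral_multc) measurable
    moreover have "indicator (F \<times> Y) z = ?i z" by (cases z) (simp add: indicator_times)
    ultimately show "slice_mass A \<epsilon> (fst z) (snd z) * indicator (F \<times> Y) z
        = ennreal (1 / (2 * \<epsilon>)) * (\<integral>\<^sup>+x. slice A \<epsilon> (fst z) (snd z) x * ?i z \<partial>T)"
      by (simp only: slice_mass_def mult.assoc)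
  qed
  also have "\<dots> = ennreal (1 / (2 * \<epsilon>)) * (\<integral>\<^sup>+z. (\<integral>\<^sup>+x. slice A \<epsilon> (fst z) (snd z) x * ?i z \<partial>T) \<partial>P)"
    by (rule nn_integral_cmult) measurable
  finally have 1: "(\<integral>\<^sup>+z. slice_mass A \<epsilon> (fst z) (snd z) * indicator (F \<times> Y) z \<partial>P)
    = ennreal (1 / (2 * \<epsilon>)) * (\<integral>\<^sup>+z. (\<integral>\<^sup>+x. slice A \<epsilon> (fst z) (snd z) x * ?i z \<partial>T) \<partial>P)" .
  have 2: "(\<integral>\<^sup>+z. (\<integral>\<^sup>+x. slice A \<epsilon> (fst z) (snd z) x * ?i z \<partial>T) \<partial>P) = (\<integral>\<^sup>+x. (\<integral>\<^sup>+z. slice A \<epsilon> (fst z) (snd z) x * ?i z \<partial>P) \<partial>T)"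
    by (rule PT.Fubini'[symmetric]) measurable
  have 3: "(\<integral>\<^sup>+z. slice A \<epsilon> (fst z) (snd z) x * ?i z \<partial>P)
      = (\<integral>\<^sup>+f. (\<integral>\<^sup>+y. slice A \<epsilon> f y x * (indicator F f * indicator Y y) \<partial>lborel) \<partial>Q)" for x
    by (subst lborel.nn_integral_fst[symmetric]) auto
  show ?thesis unfolding 1 2 3 ..
qed

lemma emeasure_open_interval: "0 \<le> \<epsilon> \<Longrightarrow> emeasure lborel {y::real. \<bar>a - y\<bar> < \<epsilon>} = ennreal (2 * \<epsilon>)"
proof -
  assume \<epsilon>: "0 \<le> \<epsilon>"
  have "{y. \<bar>a - y\<bar> < \<epsilon>} = {a - \<epsilon><..<a + \<epsilon>}" by (auto simp: abs_less_iff)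
  then show ?thesis using \<epsilon> by simp
qed

text \<open>If the functions with a null set of full levels had positive probability,
  \<open>A\<close> could be taken so large that at each \<open>x\<close> at least half of them have
  \<open>x\<close> in \<open>K A f\<close>. The mean mass over this set is then bounded below, and
  \<open>full_level_positive\<close> contradicts Fubini's theorem.\<close>

lemma AE_full_level_measure:
  "AE f in Q. 0 < emeasure lborel {y. full_level f y}"
proof -
  interpret Q: prob_space Q by (rule prob_space_Q)
  interpret T: prob_space T by (rule prob_space_torus_measure)
  interpret QT: pair_sigma_finite Q T ..
  define g where "g f = emeasure lborel {y. full_level f y}" for f
  have g_eq: "g f = (\<integral>\<^sup>+y. indicator {z. full_level (fst z) (snd z)} (f, y) \<partial>lborel)" for f
  proof -
    have "g f = (\<integral>\<^sup>+y. indicator {y. full_level f y} y \<partial>lborel)"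
      unfolding g_def by (rule nn_integral_indicator[symmetric]) simp
    then show ?thesis by (simp add: indicator_def)
  qed
  have gm[measurable]: "g \<in> borel_measurable borel"
    unfolding g_eq indicator_def mem_Collect_eq fst_conv snd_conv by measurable
  define F where "F = {f. g f = 0}"
  have F[measurable]: "F \<in> sets borel" unfolding F_def by measurable
  have "emeasure Q F = 0"
  proof (rule ccontr)
    assume "emeasure Q F \<noteq> 0"
    then have q: "0 < Q.prob F" by (simp add: Q.emeasure_eq_measure zero_less_measure_iff)
    obtain A0 :: nat where A0: "2 * CK / Q.prob F < real A0" using reals_Archimedean2 by blast
    define A where "A = max 1 A0"
    have A1: "0 < real A" by (simp add: A_def)
    have "2 * CK / Q.prob F < real A" using A0 by (simp add: A_def)
    then have CKA: "CK / real A \<le> Q.prob F / 2" using A1 q by (simp add: field_simps)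
    \<comment> \<open>On \<open>K A f\<close> the values are at most \<open>A * Cgeo\<close> in
      modulus, and \<open>\<epsilon> \<le> 1\<close>; the strip thus contains every relevant
      \<open>y\<close>, and the inner integral is exactly \<open>2 * \<epsilon>\<close>.\<close>
    define R where "R = real A * Cgeo + 1"
    have "0 < emeasure P {z \<in> F \<times> {-R..R}. full_level (fst z) (snd z)}"
    proof (rule full_level_positive)
      show "F \<times> {-R..R} \<in> sets (borel \<Otimes>\<^sub>M borel)" by measurable
      show "F \<times> {-R..R} \<subseteq> UNIV \<times> {-R..R}" by auto
      show "0 < Q.prob F / 2" using q by simp
      fix j :: nat
      let ?\<epsilon> = "1 / 2 ^ j :: real"
      have \<epsilon>: "0 < ?\<epsilon>" "?\<epsilon> \<le> 1" by auto
      have inner: "(\<integral>\<^sup>+y. slice (real A) ?\<epsilon> f y x * (indicator F f * indicator {-R..R} y) \<partial>lborel)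
          = ennreal (2 * ?\<epsilon>) * indicator {f \<in> F. x \<in> K (real A) f} f" for x f
      proof (cases "f \<in> F \<and> x \<in> K (real A) f")
        case True
        have "\<bar>Slim f x\<bar> \<le> R - 1" using K_Slim_le[of x "real A" f] True by (simp add: R_def)
        then have "y \<in> {-R..R}" if "\<bar>Slim f x - y\<bar> < ?\<epsilon>" for y
          using \<epsilon>(2) that unfolding atLeastAtMost_iff by linarith
        then have "slice (real A) ?\<epsilon> f y x * (indicator F f * indicator {-R..R} y) = indicator {y. \<bar>Slim f x - y\<bar> < ?\<epsilon>} y" for y
          using True by (auto simp: slice_def indicator_def)
        then have "(\<integral>\<^sup>+y. slice (real A) ?\<epsilon> f y x * (indicator F f * indicator {-R..R} y) \<partial>lborel)
            = emeasure lborel {y. \<bar>Slim f x - y\<bar> < ?\<epsilon>}" by simp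
        then show ?thesis using True \<epsilon> emeasure_open_interval[of ?\<epsilon> "Slim f x"] by simp
      next
        case False
        then have z: "slice (real A) ?\<epsilon> f y x * (indicator F f * indicator {-R..R} y) = 0" for y
          by (auto simp: slice_def indicator_def)
        show ?thesis using False by (simp only: z) simp
      qed
      have prob: "ennreal (Q.prob F / 2) \<le> emeasure Q {f \<in> F. x \<in> K (real A) f}" for x
      proof -
        have "emeasure Q F \<le> emeasure Q ({f \<in> F. x \<in> K (real A) f} \<union> {f. x \<notin> K (real A) f})"
          by (rule emeasure_mono) auto
        also have "\<dots> \<le> emeasure Q {f \<in> F. x \<in> K (real A) f} + emeasure Q {f. x \<notin> K (real A) f}"
          by (rule emeasure_subadditive) auto
        also have "\<dots> \<le> emeasure Q {f \<in> F. x \<in> K (real A) f} + ennreal (Q.prob F / 2)"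
          using prob_not_K_le[OF A1, of x] CKA by (intro add_left_mono order_trans[OF prob_not_K_le[OF A1]] ennreal_leI)
        finally have "Q.prob F \<le> Q.prob {f \<in> F. x \<in> K (real A) f} + Q.prob F / 2"
          unfolding Q.emeasure_eq_measure using q
          by (subst (asm) ennreal_plus[symmetric]) (auto simp del: ennreal_plus)
        then show ?thesis unfolding Q.emeasure_eq_measure by (intro ennreal_leI) simp
      qed
      have "(\<integral>\<^sup>+z. slice_mass (real A) ?\<epsilon> (fst z) (snd z) * indicator (F \<times> {-R..R}) z \<partial>P)
          = ennreal (1 / (2 * ?\<epsilon>)) * (\<integral>\<^sup>+x. (\<integral>\<^sup>+f. ennreal (2 * ?\<epsilon>) * indicator {f \<in> F. x \<in> K (real A) f} f \<partial>Q) \<partial>T)"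
        by (subst nn_integral_mass_rectangle) (simp_all only: inner F, simp)
      also have "\<dots> = ennreal (1 / (2 * ?\<epsilon>)) * (\<integral>\<^sup>+x. ennreal (2 * ?\<epsilon>) * emeasure Q {f \<in> F. x \<in> K (real A) f} \<partial>T)"
        by (intro arg_cong2[where f = times] refl nn_integral_cong nn_integral_cmult_indicator) simp
      also have "\<dots> \<ge> ennreal (1 / (2 * ?\<epsilon>)) * (\<integral>\<^sup>+x. ennreal (2 * ?\<epsilon>) * ennreal (Q.prob F / 2) \<partial>T)"
        by (intro mult_left_mono nn_integral_mono prob) auto
      also have "ennreal (1 / (2 * ?\<epsilon>)) * (\<integral>\<^sup>+x. ennreal (2 * ?\<epsilon>) * ennreal (Q.prob F / 2) \<partial>T) = ennreal (Q.prob F / 2)"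
        unfolding nn_integral_torus_const using \<epsilon>(1)
        by (simp only: mult.assoc[symmetric]) (subst ennreal_mult[symmetric], auto)
      finally show "ennreal (Q.prob F / 2) \<le> (\<integral>\<^sup>+z. slice_mass (real A) ?\<epsilon> (fst z) (snd z) * indicator (F \<times> {-R..R}) z \<partial>P)" .
    qed
    moreover have "emeasure P {z \<in> F \<times> {-R..R}. full_level (fst z) (snd z)} = 0"
    proof -
      let ?D = "{z \<in> F \<times> UNIV. full_level (fst z) (snd z)}"
      have Dm: "?D \<in> sets P"
      proof -
        have "?D = {z \<in> space P. fst z \<in> F \<and> full_level (fst z) (snd z)}" by (auto simp: space_pair_measure)
        also have "\<dots> \<in> sets P" by measurable
        finally show ?thesis .
      qed
      have "emeasure P ?D = (\<integral>\<^sup>+f. emeasure lborel (Pair f -` ?D) \<partial>Q)"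
        by (rule lborel.emeasure_pair_measure_alt[OF Dm])
      also have "\<dots> = (\<integral>\<^sup>+f. 0 \<partial>Q)"
      proof (rule nn_integral_cong)
        fix f
        show "emeasure lborel (Pair f -` ?D) = 0"
          by (cases "f \<in> F") (auto simp: F_def g_def vimage_def)
      qed
      finally have "emeasure P ?D = 0" by simp
      moreover have "emeasure P {z \<in> F \<times> {-R..R}. full_level (fst z) (snd z)} \<le> emeasure P ?D"
        by (rule emeasure_mono[OF _ Dm]) auto
      ultimately show ?thesis by simp
    qed
    ultimately show False by simp
  qed
  then have "AE f in Q. f \<notin> F" by (intro AE_not_in) (simp add: null_sets_def)
  then show ?thesis by eventually_elim (auto simp: F_def g_def zero_less_iff_neq_zero)
qed

text \<open>Here the levels are restricted to a hypothetical bounded exceptional set of length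
  \<open>l\<close>. The lower density bound for single values gives mean mass of order
  \<open>h * l\<close>, and \<open>A\<close> is taken so large that the restriction to
  \<open>K A f\<close> removes at most half of it.\<close>

lemma AE_full_level_prob:
  "AE y in lborel. 0 < emeasure Q {f. full_level f y}"
proof -
  interpret Q: prob_space Q by (rule prob_space_Q)
  interpret T: prob_space T by (rule prob_space_torus_measure)
  interpret QL: pair_sigma_finite Q lborel ..
  define g where "g y = emeasure Q {f. full_level f y}" for y
  have g_eq: "g y = (\<integral>\<^sup>+f. indicator {z. full_level (fst z) (snd z)} (f, y) \<partial>Q)" for y
  proof -
    have "g y = (\<integral>\<^sup>+f. indicator {f. full_level f y} f \<partial>Q)"
      unfolding g_def by (rule nn_integral_indicator[symmetric]) simp
    then show ?thesis by (simp add: indicator_def)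
  qed
  have gm[measurable]: "g \<in> borel_measurable borel"
    unfolding g_eq indicator_def mem_Collect_eq fst_conv snd_conv by measurable
  define Y0 where "Y0 R = {y. g y = 0} \<inter> {- real R..real R}" for R :: nat
  have Y0[measurable]: "Y0 R \<in> sets borel" for R unfolding Y0_def by measurable
  have null: "emeasure lborel (Y0 R) = 0" for R
  proof (rule ccontr)
    let ?R = "real R" and ?Y = "Y0 R"
    assume neq: "emeasure lborel ?Y \<noteq> 0"
    have fin: "emeasure lborel ?Y < \<infinity>"
      by (rule le_less_trans[OF emeasure_mono[of _ "{- ?R..?R}"]]) (auto simp: Y0_def)
    define l where "l = measure lborel ?Y"
    have l: "emeasure lborel ?Y = ennreal l" "0 < l"
      using neq fin by (auto simp: l_def emeasure_eq_ennreal_measure less_top zero_less_measure_iff)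
    obtain h where h: "h > 0" "\<And>x y \<epsilon>. \<bar>y\<bar> \<le> ?R \<Longrightarrow> 0 < \<epsilon> \<Longrightarrow> \<epsilon> \<le> 1 \<Longrightarrow>
        ennreal (h * \<epsilon>) \<le> emeasure Q {f. \<bar>Slim f x - y\<bar> < \<epsilon>}"
      using Slim_concentration[of ?R] by auto
    have hl: "0 < h * l" using h l by simp
    obtain A0 :: nat where A0: "4 * CK / (h * l) < real A0" using reals_Archimedean2 by blast
    define A where "A = max 1 A0"
    have A1: "0 < real A" by (simp add: A_def)
    have "4 * CK / (h * l) < real A" using A0 by (simp add: A_def)
    \<comment> \<open>Points outside \<open>K A f\<close> cost at most
      \<open>2 * \<epsilon> * (h * l / 4)\<close>, half of the total
      \<open>\<epsilon> * h * l\<close>; the normalization \<open>1 / (2 * \<epsilon>)\<close> then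
      leaves \<open>h * l / 4\<close>.\<close>
    then have CKA: "CK / real A \<le> h * l / 4" using A1 hl by (simp add: field_simps)
    have "0 < emeasure P {z \<in> UNIV \<times> ?Y. full_level (fst z) (snd z)}"
    proof (rule full_level_positive)
      show "UNIV \<times> ?Y \<in> sets (borel \<Otimes>\<^sub>M borel)" by measurable
      show "UNIV \<times> ?Y \<subseteq> UNIV \<times> {-?R..?R}" by (auto simp: Y0_def)
      show "0 < h * l / 4" using hl by simp
      fix j :: nat
      let ?\<epsilon> = "1 / 2 ^ j :: real"
      have \<epsilon>: "0 < ?\<epsilon>" "?\<epsilon> \<le> 1" by auto
      let ?U = "\<lambda>x. \<integral>\<^sup>+f. (\<integral>\<^sup>+y. slice (real A) ?\<epsilon> f y x * (indicator UNIV f * indicator ?Y y) \<partial>lborel) \<partial>Q"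
      have main: "ennreal (?\<epsilon> * (h * l / 2)) \<le> ?U x" for x
      proof -
        let ?b = "\<lambda>f y. if \<bar>Slim f x - y\<bar> < ?\<epsilon> then 1 else 0 :: ennreal"
        let ?n = "\<lambda>f. if x \<notin> K (real A) f then 1 else 0 :: ennreal"
        have "ennreal (h * ?\<epsilon>) * ennreal l = (\<integral>\<^sup>+y. ennreal (h * ?\<epsilon>) * indicator ?Y y \<partial>lborel)"
          using l(1) by (simp add: nn_integral_cmult_indicator)
        also have "\<dots> \<le> (\<integral>\<^sup>+y. (\<integral>\<^sup>+f. ?b f y * indicator ?Y y \<partial>Q) \<partial>lborel)"
        proof (rule nn_integral_mono)
          fix y
          show "ennreal (h * ?\<epsilon>) * indicator ?Y y \<le> (\<integral>\<^sup>+f. ?b f y * indicator ?Y y \<partial>Q)"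
          proof (cases "y \<in> ?Y")
            case True
            have "(\<integral>\<^sup>+f. ?b f y * indicator ?Y y \<partial>Q) = (\<integral>\<^sup>+f. indicator {f. \<bar>Slim f x - y\<bar> < ?\<epsilon>} f \<partial>Q)"
              using True by (intro nn_integral_cong) (simp add: indicator_def)
            also have "\<dots> = emeasure Q {f. \<bar>Slim f x - y\<bar> < ?\<epsilon>}"
              by (rule nn_integral_indicator) simp
            finally show ?thesis using h(2)[of y ?\<epsilon> x] True \<epsilon> by (auto simp: Y0_def abs_le_iff)
          qed simp
        qed
        also have "\<dots> = (\<integral>\<^sup>+f. (\<integral>\<^sup>+y. ?b f y * indicator ?Y y \<partial>lborel) \<partial>Q)"
          by (rule QL.Fubini') measurable
        also have "\<dots> \<le> (\<integral>\<^sup>+f. (\<integral>\<^sup>+y. slice (real A) ?\<epsilon> f y x * (indicator UNIV f * indicator ?Y y) \<partial>lborel) + ennreal (2 * ?\<epsilon>) * ?n f \<partial>Q)"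
        proof (rule nn_integral_mono)
          fix f
          show "(\<integral>\<^sup>+y. ?b f y * indicator ?Y y \<partial>lborel)
            \<le> (\<integral>\<^sup>+y. slice (real A) ?\<epsilon> f y x * (indicator UNIV f * indicator ?Y y) \<partial>lborel) + ennreal (2 * ?\<epsilon>) * ?n f"
          proof (cases "x \<in> K (real A) f")
            case True
            then show ?thesis by (simp add: slice_def)
          next
            case False
            have "(\<integral>\<^sup>+y. ?b f y * indicator ?Y y \<partial>lborel) \<le> (\<integral>\<^sup>+y. indicator {y. \<bar>Slim f x - y\<bar> < ?\<epsilon>} y \<partial>lborel)"
              by (rule nn_integral_mono) (auto simp: indicator_def)
            also have "\<dots> = emeasure lborel {y. \<bar>Slim f x - y\<bar> < ?\<epsilon>}" by (rule nn_integral_indicator) simp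
            also have "\<dots> = ennreal (2 * ?\<epsilon>)" using \<epsilon> by (intro emeasure_open_interval) simp
            finally show ?thesis using False by (auto intro: add_increasing)
          qed
        qed
        also have "\<dots> = ?U x + ennreal (2 * ?\<epsilon>) * (\<integral>\<^sup>+f. ?n f \<partial>Q)"
          by (subst nn_integral_add) (auto simp: nn_integral_cmult)
        also have "(\<integral>\<^sup>+f. ?n f \<partial>Q) = emeasure Q {f. x \<notin> K (real A) f}"
        proof -
          have "(\<integral>\<^sup>+f. ?n f \<partial>Q) = (\<integral>\<^sup>+f. indicator {f. x \<notin> K (real A) f} f \<partial>Q)"
            by (rule nn_integral_cong) (simp add: indicator_def)
          also have "\<dots> = emeasure Q {f. x \<notin> K (real A) f}" by (rule nn_integral_indicator) simp
          finally show ?thesis .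
        qed
        also have "?U x + ennreal (2 * ?\<epsilon>) * emeasure Q {f. x \<notin> K (real A) f} \<le> ?U x + ennreal (2 * ?\<epsilon>) * ennreal (h * l / 4)"
          using CKA by (intro add_left_mono mult_left_mono order_trans[OF prob_not_K_le[OF A1]] ennreal_leI) auto
        finally have "ennreal (h * ?\<epsilon>) * ennreal l \<le> ?U x + ennreal (2 * ?\<epsilon>) * ennreal (h * l / 4)" .
        moreover have "ennreal (h * ?\<epsilon>) * ennreal l = ennreal (?\<epsilon> * (h * l / 2)) + ennreal (?\<epsilon> * (h * l / 2))"
        proof -
          have "ennreal (h * ?\<epsilon>) * ennreal l = ennreal (h * ?\<epsilon> * l)" using h l \<epsilon> by (intro ennreal_mult[symmetric]) auto
          also have "h * ?\<epsilon> * l = ?\<epsilon> * (h * l / 2) + ?\<epsilon> * (h * l / 2)" by (simp add: field_simps)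
          also have "ennreal \<dots> = ennreal (?\<epsilon> * (h * l / 2)) + ennreal (?\<epsilon> * (h * l / 2))"
            using hl \<epsilon> by (intro ennreal_plus) auto
          finally show ?thesis .
        qed
        moreover have "ennreal (2 * ?\<epsilon>) * ennreal (h * l / 4) = ennreal (?\<epsilon> * (h * l / 2))"
          using hl \<epsilon> by (subst ennreal_mult[symmetric]) auto
        ultimately show ?thesis by (simp add: add.commute ennreal_add_left_cancel_le)
      qed
      have "ennreal (h * l / 4) = ennreal (1 / (2 * ?\<epsilon>)) * (\<integral>\<^sup>+x. ennreal (?\<epsilon> * (h * l / 2)) \<partial>T)"
        unfolding nn_integral_torus_const using hl \<epsilon>(1) by (subst ennreal_mult[symmetric]) auto
      also have "\<dots> \<le> ennreal (1 / (2 * ?\<epsilon>)) * (\<integral>\<^sup>+x. ?U x \<partial>T)"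
        by (intro mult_left_mono nn_integral_mono main) auto
      also have "\<dots> = (\<integral>\<^sup>+z. slice_mass (real A) ?\<epsilon> (fst z) (snd z) * indicator (UNIV \<times> ?Y) z \<partial>P)"
        by (rule nn_integral_mass_rectangle[symmetric]) auto
      finally show "ennreal (h * l / 4) \<le> (\<integral>\<^sup>+z. slice_mass (real A) ?\<epsilon> (fst z) (snd z) * indicator (UNIV \<times> ?Y) z \<partial>P)" .
    qed
    moreover have "emeasure P {z \<in> UNIV \<times> ?Y. full_level (fst z) (snd z)} = 0"
    proof -
      let ?D = "{z \<in> UNIV \<times> ?Y. full_level (fst z) (snd z)}"
      have Dm: "?D \<in> sets P"
      proof -
        have "?D = {z \<in> space P. snd z \<in> ?Y \<and> full_level (fst z) (snd z)}" by (auto simp: space_pair_measure)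
        also have "\<dots> \<in> sets P" by measurable
        finally show ?thesis .
      qed
      have "emeasure P ?D = (\<integral>\<^sup>+y. emeasure Q ((\<lambda>f. (f, y)) -` ?D) \<partial>lborel)"
        by (rule QL.emeasure_pair_measure_alt2[OF Dm])
      also have "\<dots> = (\<integral>\<^sup>+(y::real). 0 \<partial>lborel)"
      proof (rule nn_integral_cong)
        fix y
        show "emeasure Q ((\<lambda>f. (f, y)) -` ?D) = 0"
          by (cases "y \<in> ?Y") (auto simp: Y0_def g_def vimage_def)
      qed
      finally show ?thesis by simp
    qed
    ultimately show False by simp
  qed
  have "AE y in lborel. \<forall>R. y \<notin> Y0 R"
    unfolding AE_all_countable using null by (intro allI AE_not_in) (simp add: null_sets_def)
  then show ?thesis
  proof eventually_elim
    case (elim y)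
    obtain R :: nat where "\<bar>y\<bar> \<le> real R" using real_arch_simple by blast
    then have "g y \<noteq> 0" using elim by (auto simp: Y0_def abs_le_iff)
    then show ?case by (simp add: g_def zero_less_iff_neq_zero)
  qed
qed

lemma level_set_dimension:
  shows "(AE f in series_law M s \<beta> \<Psi> W B.
            \<exists>Y \<in> sets (lebesgue :: real measure). emeasure lebesgue Y > 0 \<and>
              (\<forall>y\<in>Y. hausdorff_dim (lebesgue_points f \<inter> level_set f y)
                        = ereal (real CARD('n) - s)))
       \<and> (AE y in (lebesgue :: real measure).
            \<exists>F \<in> sets (series_law M s \<beta> \<Psi> W B). emeasure (series_law M s \<beta> \<Psi> W B) F > 0 \<and>
              (\<forall>f\<in>F. hausdorff_dim (lebesgue_points f \<inter> level_set f y)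
                        = ereal (real CARD('n) - s)))"
  unfolding Q_def[symmetric]
proof
  show "AE f in Q. \<exists>Y \<in> sets (lebesgue :: real measure). emeasure lebesgue Y > 0 \<and>
      (\<forall>y\<in>Y. hausdorff_dim (lebesgue_points f \<inter> level_set f y) = ereal (real CARD('n) - s))"
    using AE_full_level_measure
  proof eventually_elim
    case (elim f)
    have Y: "{y. full_level f y} \<in> sets lborel" by simp
    then have "emeasure lebesgue {y. full_level f y} = emeasure lborel {y. full_level f y}"
      by simp
    then show ?case using elim Y hausdorff_dim_full_level
      by (intro bexI[of _ "{y. full_level f y}"]) (auto intro: sets_completionI_sets)
  qed
  have "AE y in lborel. \<exists>F \<in> sets Q. emeasure Q F > 0 \<and>
      (\<forall>f\<in>F. hausdorff_dim (lebesgue_points f \<inter> level_set f y) = ereal (real CARD('n) - s))"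
    using AE_full_level_prob
  proof eventually_elim
    case (elim y)
    then show ?case using hausdorff_dim_full_level
      by (intro bexI[of _ "{f. full_level f y}"]) auto
  qed
  then show "AE y in lebesgue. \<exists>F \<in> sets Q. emeasure Q F > 0 \<and>
      (\<forall>f\<in>F. hausdorff_dim (lebesgue_points f \<inter> level_set f y) = ereal (real CARD('n) - s))"
    by (rule AE_completion)
qed

end

theorem theorem5p3:
  fixes \<Psi> :: "nat \<Rightarrow> real ^ 'n::finite \<Rightarrow> real"
    and M :: "'w measure"
    and W B :: "nat \<times> nat \<times> (int ^ 'n) \<Rightarrow> 'w \<Rightarrow> real"
    and s p \<beta> \<delta> C :: real
  assumes "0 < s" "s < 1" "1 < p" "\<beta> > - s"
    and "\<delta> = p * (s + \<beta>)" "\<delta> < real CARD('n)"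
    and "wavelet_basis \<Psi>"
    and "C > 0" "separation_property \<Psi> C"
    and "random_weights M \<delta> W B"
  shows "(AE f in series_law M s \<beta> \<Psi> W B.
            \<exists>Y \<in> sets (lebesgue :: real measure). emeasure lebesgue Y > 0 \<and>
              (\<forall>y\<in>Y. hausdorff_dim (lebesgue_points f \<inter> level_set f y)
                        = ereal (real CARD('n) - s)))
       \<and> (AE y in (lebesgue :: real measure).
            \<exists>F \<in> sets (series_law M s \<beta> \<Psi> W B). emeasure (series_law M s \<beta> \<Psi> W B) F > 0 \<and>
              (\<forall>f\<in>F. hausdorff_dim (lebesgue_points f \<inter> level_set f y)
                        = ereal (real CARD('n) - s)))"
proof -
  obtain b where b: "b \<ge> 1" "\<And>k j x. j \<in> wavelet_index k \<Longrightarrow> \<bar>wavelet \<Psi> k j x\<bar> \<le> b"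
    "\<And>k j x y. j \<in> wavelet_index k \<Longrightarrow> \<bar>wavelet \<Psi> k j x - wavelet \<Psi> k j y\<bar> \<le> b * 2 ^ k * dist x y"
    "\<And>k x. real (card {j \<in> wavelet_index k. wavelet \<Psi> k j x \<noteq> 0}) \<le> b"
  proof -
    have "mother_wavelets \<Psi>" using assms(7) by (simp add: wavelet_basis_def)
    then show ?thesis by (rule wavelet_bounds) (rule that)
  qed
  have "random_wavelet_series \<Psi> M W B s p \<beta> \<delta> C b"
    by (rule random_wavelet_series.intro) (fact assms b)+
  then show ?thesis
    by (rule random_wavelet_series.level_set_dimension)
qed

end
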